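(* Let $k$ be a field of characteristic zero and let $A$ be a (graded connected) noncommutative complete intersection (NCCI) $k$-algebra. Assume that $\mathrm{H}_1(A,k^n)=0$ for some $n\ge 1$. Then $\mathrm{Rep}_n(A)$ is a complete intersection.
   Context: Representation schemes and representation homology: $\mathtt{DGA}_k^+$ is the category of non-negatively graded unital associative DG $k$-algebras (differential of degree $-1$), with the model structure in which weak equivalences are quasi-isomorphisms and fibrations are the maps surjective in all positive degrees; $\mathtt{CDGA}_k^+$ is its full subcategory of graded commutative DG algebras. For $R\in\mathtt{DGA}_k^+$ and $n\ge1$, $R_n\in\mathtt{CDGA}_k^+$ is the commutative DG algebra representing the functor $C\mapsto \mathrm{Hom}_{\mathtt{DGA}_k^+}(R,\mathbb{M}_n(C))$ on $\mathtt{CDGA}_k^+$. For an ordinary algebra $A$, $\mathrm{Rep}_n(A)$ is the affine scheme representing $B\mapsto\mathrm{Hom}_{\mathrm{Alg}_k}(A,\mathbb{M}_n(B))$ on ordinary commutative $k$-algebras. Representation homology is $\mathrm{H}_p(A,k^n):=\mathrm{H}_p(R_n)$, where $R\to A$ is any cofibrant resolution in $\mathtt{DGA}_k^+$ (the result does not depend on the choice). NCCI: an algebra $A=F/J$, with $F$ a smooth algebra (finitely generated and formally smooth, i.e. $\Omega^1_kF=\mathrm{Ker}(F\otimes F\to F)$ is a projective bimodule) and $J$ a finitely generated two-sided ideal, is a noncommutative complete intersection if $J/J^2$ is a projective $A$-bimodule. Throughout, algebras are graded connected with a non-negative polynomial grading, presented as $A=T_kV/\langle j(L)\rangle$, where $V$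 and $L$ are positively graded $k$-vector spaces of finite total dimension and $j:L\to T_kV$ is a homomorphism of graded vector spaces. The triple $(V,L,j)$ is called presentation data for $A$. $\mathrm{Rep}_n(A)$ is naturally a closed subscheme of the affine space $\mathrm{Rep}_n(T_kV)$ of dimension $n^2\dim_kV$; it is a complete intersection if its defining ideal is generated by a regular sequence. *)

theory Defs
  imports
    "HOL-Library.FuncSet"
    "HOL-Library.Poly_Mapping"
    "HOL-Algebra.Module"
    "HOL-Algebra.QuotRing"
    "HOL-Algebra.Ideal_Product"
    "HOL-Algebra.Elementary_Groups"
begin

section \<open>Algebras over a field\<close>

text \<open>
  The ground field is a type \<open>'k\<close> of class \<open>field\<close>; the library record \<open>module\<close> (a ring together
  with a scalar multiplication) carries the data of a unital associative \<open>k\<close>-algebra.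
\<close>

locale k_algebra = ring A for A :: "('k::field, 'a, 'z) module_scheme" (structure) +
  assumes smult_closed: "x \<in> carrier A \<Longrightarrow> c \<odot> x \<in> carrier A"
    and smult_l_distr: "x \<in> carrier A \<Longrightarrow> (b + c) \<odot> x = b \<odot> x \<oplus> c \<odot> x"
    and smult_r_distr: "x \<in> carrier A \<Longrightarrow> y \<in> carrier A \<Longrightarrow> c \<odot> (x \<oplus> y) = c \<odot> x \<oplus> c \<odot> y"
    and smult_assoc: "x \<in> carrier A \<Longrightarrow> (b * c) \<odot> x = b \<odot> (c \<odot> x)"
    and smult_one: "x \<in> carrier A \<Longrightarrow> 1 \<odot> x = x"
    and smult_mult_l: "x \<in> carrier A \<Longrightarrow> y \<in> carrier A \<Longrightarrow> (c \<odot> x) \<otimes> y = c \<odot> (x \<otimes> y)"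
    and smult_mult_r: "x \<in> carrier A \<Longrightarrow> y \<in> carrier A \<Longrightarrow> x \<otimes> (c \<odot> y) = c \<odot> (x \<otimes> y)"

locale comm_k_algebra = k_algebra A for A :: "('k::field, 'a, 'z) module_scheme" (structure) +
  assumes mult_comm: "x \<in> carrier A \<Longrightarrow> y \<in> carrier A \<Longrightarrow> x \<otimes> y = y \<otimes> x"

text \<open>
  Homomorphisms are extensional functions, so that hom-sets are honest sets of maps and
  bijections between them may be stated with \<^const>\<open>bij_betw\<close>.
\<close>

definition alg_hom ::
  "('k, 'a, 'y) module_scheme \<Rightarrow> ('k, 'b, 'z) module_scheme \<Rightarrow> ('a \<Rightarrow> 'b) set" where
  "alg_hom A B = {f \<in> ring_hom A B \<inter> extensional (carrier A).
     \<forall>c. \<forall>x\<in>carrier A. f (c \<odot>\<^bsub>A\<^esub> x) = c \<odot>\<^bsub>B\<^esub> f x}"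

definition quotient_algebra ::
  "('k, 'a, 'z) module_scheme \<Rightarrow> 'a set \<Rightarrow> ('k, 'a set) module" where
  "quotient_algebra A I = ring.extend (A Quot I)
     (module.fields (\<lambda>c U. \<Union>x\<in>U. I +>\<^bsub>A\<^esub> (c \<odot>\<^bsub>A\<^esub> x)))"

definition matrix_indices :: "nat \<Rightarrow> (nat \<times> nat) set" where
  "matrix_indices n = {..<n} \<times> {..<n}"

definition matrix_algebra ::
  "nat \<Rightarrow> ('k, 'a, 'z) module_scheme \<Rightarrow> ('k, nat \<times> nat \<Rightarrow> 'a) module" where
  "matrix_algebra n C = \<lparr>
     carrier = matrix_indices n \<rightarrow>\<^sub>E carrier C,
     mult = (\<lambda>M N. \<lambda>(i, j)\<in>matrix_indices n. \<Oplus>\<^bsub>C\<^esub>l\<in>{..<n}. M (i, l) \<otimes>\<^bsub>C\<^esub> N (l, j)),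
     one = (\<lambda>(i, j)\<in>matrix_indices n. if i = j then \<one>\<^bsub>C\<^esub> else \<zero>\<^bsub>C\<^esub>),
     zero = (\<lambda>e\<in>matrix_indices n. \<zero>\<^bsub>C\<^esub>),
     add = (\<lambda>M N. \<lambda>e\<in>matrix_indices n. M e \<oplus>\<^bsub>C\<^esub> N e),
     smult = (\<lambda>c M. \<lambda>e\<in>matrix_indices n. c \<odot>\<^bsub>C\<^esub> M e)\<rparr>"

definition map_matrix :: "nat \<Rightarrow> ('a \<Rightarrow> 'b) \<Rightarrow> (nat \<times> nat \<Rightarrow> 'a) \<Rightarrow> nat \<times> nat \<Rightarrow> 'b" where
  "map_matrix n f M = (\<lambda>e\<in>matrix_indices n. f (M e))"


section \<open>Bimodules\<close>

text \<open>
  The left action is the inherited field \<open>smult\<close>. As for library modules, the inherited fields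
  \<open>mult\<close> and \<open>one\<close> have no meaning for a bimodule.
\<close>

record ('a, 'm) bimodule = "('a, 'm) module" +
  rsmult :: "'m \<Rightarrow> 'a \<Rightarrow> 'm"

locale bimodule = A: k_algebra A + abelian_group M
  for A :: "('k::field, 'a, 'y) module_scheme" and M :: "('a, 'm, 'z) bimodule_scheme" (structure) +
  assumes left_closed: "a \<in> carrier A \<Longrightarrow> x \<in> carrier M \<Longrightarrow> a \<odot> x \<in> carrier M"
    and left_add: "a \<in> carrier A \<Longrightarrow> x \<in> carrier M \<Longrightarrow> y \<in> carrier M \<Longrightarrow>
      a \<odot> (x \<oplus> y) = a \<odot> x \<oplus> a \<odot> y"
    and add_left: "a \<in> carrier A \<Longrightarrow> b \<in> carrier A \<Longrightarrow> x \<in> carrier M \<Longrightarrow>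
      (a \<oplus>\<^bsub>A\<^esub> b) \<odot> x = a \<odot> x \<oplus> b \<odot> x"
    and left_assoc: "a \<in> carrier A \<Longrightarrow> b \<in> carrier A \<Longrightarrow> x \<in> carrier M \<Longrightarrow>
      (a \<otimes>\<^bsub>A\<^esub> b) \<odot> x = a \<odot> (b \<odot> x)"
    and left_one: "x \<in> carrier M \<Longrightarrow> \<one>\<^bsub>A\<^esub> \<odot> x = x"
    and right_closed: "a \<in> carrier A \<Longrightarrow> x \<in> carrier M \<Longrightarrow> rsmult M x a \<in> carrier M"
    and right_add: "a \<in> carrier A \<Longrightarrow> x \<in> carrier M \<Longrightarrow> y \<in> carrier M \<Longrightarrow>
      rsmult M (x \<oplus> y) a = rsmult M x a \<oplus> rsmult M y a"
    and add_right: "a \<in> carrier A \<Longrightarrow> b \<in> carrier A \<Longrightarrow> x \<in> carrier M \<Longrightarrow>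
      rsmult M x (a \<oplus>\<^bsub>A\<^esub> b) = rsmult M x a \<oplus> rsmult M x b"
    and right_assoc: "a \<in> carrier A \<Longrightarrow> b \<in> carrier A \<Longrightarrow> x \<in> carrier M \<Longrightarrow>
      rsmult M x (a \<otimes>\<^bsub>A\<^esub> b) = rsmult M (rsmult M x a) b"
    and right_one: "x \<in> carrier M \<Longrightarrow> rsmult M x \<one>\<^bsub>A\<^esub> = x"
    and left_right: "a \<in> carrier A \<Longrightarrow> b \<in> carrier A \<Longrightarrow> x \<in> carrier M \<Longrightarrow>
      rsmult M (a \<odot> x) b = a \<odot> rsmult M x b"
    and scalars_central: "x \<in> carrier M \<Longrightarrow>
      (c \<odot>\<^bsub>A\<^esub> \<one>\<^bsub>A\<^esub>) \<odot> x = rsmult M x (c \<odot>\<^bsub>A\<^esub> \<one>\<^bsub>A\<^esub>)"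

definition bimodule_hom ::
  "('k, 'a, 'w) module_scheme \<Rightarrow> ('a, 'm, 'y) bimodule_scheme \<Rightarrow> ('a, 'n, 'z) bimodule_scheme
    \<Rightarrow> ('m \<Rightarrow> 'n) set" where
  "bimodule_hom A M N = {f \<in> carrier M \<rightarrow>\<^sub>E carrier N.
     (\<forall>x\<in>carrier M. \<forall>y\<in>carrier M. f (x \<oplus>\<^bsub>M\<^esub> y) = f x \<oplus>\<^bsub>N\<^esub> f y) \<and>
     (\<forall>a\<in>carrier A. \<forall>x\<in>carrier M.
        f (a \<odot>\<^bsub>M\<^esub> x) = a \<odot>\<^bsub>N\<^esub> f x \<and> f (rsmult M x a) = rsmult N (f x) a)}"

text \<open>
  The test bimodules have their elements in the type of the elements of \<open>A\<close> and \<open>P\<close>. As soon as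
  this type is infinite, it has room for the free bimodule on the set \<open>P\<close>, and the lifting
  property against the surjection from that bimodule onto \<open>P\<close> already gives projectivity.
\<close>

definition projective_bimodule ::
  "('k::field, 'u) module \<Rightarrow> ('u, 'u) bimodule \<Rightarrow> bool" where
  "projective_bimodule A P \<longleftrightarrow> bimodule A P \<and>
     (\<forall>(M :: ('u, 'u) bimodule) (N :: ('u, 'u) bimodule).
        bimodule A M \<longrightarrow> bimodule A N \<longrightarrow>
        (\<forall>p\<in>bimodule_hom A M N. p ` carrier M = carrier N \<longrightarrow>
          (\<forall>g\<in>bimodule_hom A P N. \<exists>h\<in>bimodule_hom A P M. \<forall>x\<in>carrier P. p (h x) = g x)))"

text \<open>The bimodule \<open>J/J\<^sup>2\<close> over \<open>F/J\<close>; its elements are cosets of \<open>J\<^sup>2\<close>.\<close>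

definition conormal_bimodule ::
  "('k, 'a, 'z) module_scheme \<Rightarrow> 'a set \<Rightarrow> ('a set, 'a set) bimodule" where
  "conormal_bimodule F J = (let J2 = J \<cdot>\<^bsub>F\<^esub> J in \<lparr>
     carrier = (\<lambda>x. J2 +>\<^bsub>F\<^esub> x) ` J,
     mult = undefined,
     one = undefined,
     zero = J2,
     add = set_add F,
     smult = (\<lambda>U W. \<Union>a\<in>U. \<Union>x\<in>W. J2 +>\<^bsub>F\<^esub> (a \<otimes>\<^bsub>F\<^esub> x)),
     rsmult = (\<lambda>W U. \<Union>x\<in>W. \<Union>a\<in>U. J2 +>\<^bsub>F\<^esub> (x \<otimes>\<^bsub>F\<^esub> a))\<rparr>)"


section \<open>Free algebras and presentation data\<close>

text \<open>
  Words form a monoid, written additively so that convolution of finitely supported functions on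
  words, i.e. the multiplication of \<open>'x word \<Rightarrow>\<^sub>0 'k\<close>, is concatenation extended bilinearly.
\<close>

datatype 'x word = Word (letters: "'x list")

instantiation word :: (type) monoid_add
begin

definition zero_word :: "'a word" where "0 = Word []"

definition plus_word :: "'a word \<Rightarrow> 'a word \<Rightarrow> 'a word" where
  "u + v = Word (letters u @ letters v)"

instance
  by standard (simp_all add: zero_word_def plus_word_def)

end

text \<open>The tensor algebra of the vector space with basis \<open>X\<close>.\<close>

definition free_algebra :: "'x set \<Rightarrow> ('k::field, 'x word \<Rightarrow>\<^sub>0 'k) module" where
  "free_algebra X = \<lparr>
     carrier = {p. \<forall>w\<in>Poly_Mapping.keys p. set (letters w) \<subseteq> X},
     mult = (*), one = 1, zero = 0, add = (+),
     smult = (\<lambda>c. Poly_Mapping.map ((*) c))\<rparr>"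

definition gen :: "'x \<Rightarrow> 'x word \<Rightarrow>\<^sub>0 'k::field" where
  "gen x = Poly_Mapping.single (Word [x]) 1"

definition word_degree :: "('x \<Rightarrow> nat) \<Rightarrow> 'x word \<Rightarrow> nat" where
  "word_degree dx w = sum_list (map dx (letters w))"

text \<open>
  Presentation data \<open>(V, L, j)\<close>. The positively graded finite-dimensional spaces \<open>V\<close> and \<open>L\<close> are
  given by finite homogeneous bases \<open>X\<close>, \<open>Y\<close> with degree functions \<open>dx\<close>, \<open>dy\<close>, and the degree
  preserving linear map \<open>L \<rightarrow> T\<^sub>kV\<close> by its values on the basis \<open>Y\<close>.
\<close>

definition presentation_data ::
  "'x set \<Rightarrow> ('x \<Rightarrow> nat) \<Rightarrow> 'y set \<Rightarrow> ('y \<Rightarrow> nat) \<Rightarrow> ('y \<Rightarrow> 'x word \<Rightarrow>\<^sub>0 'k::field) \<Rightarrow> bool" where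
  "presentation_data X dx Y dy j \<longleftrightarrow>
     finite X \<and> (\<forall>x\<in>X. 0 < dx x) \<and>
     finite Y \<and> (\<forall>y\<in>Y. 0 < dy y) \<and>
     (\<forall>y\<in>Y. j y \<in> carrier (free_algebra X) \<and>
       (\<forall>w\<in>Poly_Mapping.keys (j y). word_degree dx w = dy y))"

definition relation_ideal ::
  "'x set \<Rightarrow> 'y set \<Rightarrow> ('y \<Rightarrow> 'x word \<Rightarrow>\<^sub>0 'k::field) \<Rightarrow> ('x word \<Rightarrow>\<^sub>0 'k) set" where
  "relation_ideal X Y j = Idl\<^bsub>free_algebra X\<^esub> (j ` Y)"

definition presented_algebra ::
  "'x set \<Rightarrow> 'y set \<Rightarrow> ('y \<Rightarrow> 'x word \<Rightarrow>\<^sub>0 'k::field) \<Rightarrow> ('k, ('x word \<Rightarrow>\<^sub>0 'k) set) module" where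
  "presented_algebra X Y j = quotient_algebra (free_algebra X) (relation_ideal X Y j)"

text \<open>
  Noncommutative complete intersections \<open>A = F/J\<close> with \<open>F = T\<^sub>kV\<close> and \<open>J = \<langle>j(L)\<rangle>\<close>. Here \<open>F\<close> is
  automatically smooth (it is finitely generated, and \<open>\<Omega>\<^sup>1F\<close> is the free bimodule
  \<open>F \<otimes> V \<otimes> F\<close>) and \<open>J\<close> is finitely generated, so that what remains of the definition is that
  \<open>J/J\<^sup>2\<close> is a projective \<open>A\<close>-bimodule.
\<close>

definition ncci ::
  "'x set \<Rightarrow> 'y set \<Rightarrow> ('y \<Rightarrow> 'x word \<Rightarrow>\<^sub>0 'k::field) \<Rightarrow> bool" where
  "ncci X Y j \<longleftrightarrow> projective_bimodule (presented_algebra X Y j)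
     (conormal_bimodule (free_algebra X) (relation_ideal X Y j))"


section \<open>Differential graded algebras\<close>

text \<open>
  Non-negatively graded unital associative DG algebras; \<open>comp D i\<close> is the component of degree \<open>i\<close>
  and the differential lowers the degree by one.
\<close>

record ('k, 'a) dga = "('k, 'a) module" +
  comp :: "nat \<Rightarrow> 'a set"
  diff :: "'a \<Rightarrow> 'a"

locale dg_algebra = k_algebra D for D :: "('k::field, 'a, 'z) dga_scheme" (structure) +
  assumes comp_carrier: "comp D i \<subseteq> carrier D"
    and comp_zero: "\<zero> \<in> comp D i"
    and comp_add: "x \<in> comp D i \<Longrightarrow> y \<in> comp D i \<Longrightarrow> x \<oplus> y \<in> comp D i"
    and comp_smult: "x \<in> comp D i \<Longrightarrow> c \<odot> x \<in> comp D i"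
    and direct_sum: "x \<in> carrier D \<Longrightarrow>
      \<exists>!f. (\<forall>i. f i \<in> comp D i) \<and> finite {i. f i \<noteq> \<zero>} \<and> x = (\<Oplus>i\<in>{i. f i \<noteq> \<zero>}. f i)"
    and comp_one: "\<one> \<in> comp D 0"
    and comp_mult: "x \<in> comp D i \<Longrightarrow> y \<in> comp D j \<Longrightarrow> x \<otimes> y \<in> comp D (i + j)"
    and diff_add: "x \<in> carrier D \<Longrightarrow> y \<in> carrier D \<Longrightarrow> diff D (x \<oplus> y) = diff D x \<oplus> diff D y"
    and diff_smult: "x \<in> carrier D \<Longrightarrow> diff D (c \<odot> x) = c \<odot> diff D x"
    and diff_comp: "x \<in> comp D (Suc i) \<Longrightarrow> diff D x \<in> comp D i"
    and diff_comp_0: "x \<in> comp D 0 \<Longrightarrow> diff D x = \<zero>"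
    and diff_diff: "x \<in> carrier D \<Longrightarrow> diff D (diff D x) = \<zero>"
    and leibniz: "x \<in> comp D i \<Longrightarrow> y \<in> carrier D \<Longrightarrow>
      diff D (x \<otimes> y) = diff D x \<otimes> y \<oplus> ((-1) ^ i) \<odot> (x \<otimes> diff D y)"

locale comm_dg_algebra = dg_algebra D for D :: "('k::field, 'a, 'z) dga_scheme" (structure) +
  assumes graded_comm: "x \<in> comp D i \<Longrightarrow> y \<in> comp D j \<Longrightarrow>
    x \<otimes> y = ((-1) ^ (i * j)) \<odot> (y \<otimes> x)"

definition dga_hom ::
  "('k, 'a, 'y) dga_scheme \<Rightarrow> ('k, 'b, 'z) dga_scheme \<Rightarrow> ('a \<Rightarrow> 'b) set" where
  "dga_hom D E = {f \<in> alg_hom D E.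
     (\<forall>i. f ` comp D i \<subseteq> comp E i) \<and> (\<forall>x\<in>carrier D. f (diff D x) = diff E (f x))}"

text \<open>An ordinary algebra as a DG algebra concentrated in degree \<open>0\<close>.\<close>

definition concentrated :: "('k, 'a) module \<Rightarrow> ('k, 'a) dga" where
  "concentrated A = module.extend A
     (dga.fields (\<lambda>i. if i = 0 then carrier A else {\<zero>\<^bsub>A\<^esub>}) (\<lambda>x. \<zero>\<^bsub>A\<^esub>))"

definition matrix_dga ::
  "nat \<Rightarrow> ('k, 'a, 'z) dga_scheme \<Rightarrow> ('k, nat \<times> nat \<Rightarrow> 'a) dga" where
  "matrix_dga n C = module.extend (matrix_algebra n C)
     (dga.fields (\<lambda>i. matrix_indices n \<rightarrow>\<^sub>E comp C i) (map_matrix n (diff C)))"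

definition cycles :: "('k, 'a, 'z) dga_scheme \<Rightarrow> nat \<Rightarrow> 'a set" where
  "cycles D p = {x \<in> comp D p. diff D x = \<zero>\<^bsub>D\<^esub>}"

definition boundaries :: "('k, 'a, 'z) dga_scheme \<Rightarrow> nat \<Rightarrow> 'a set" where
  "boundaries D p = diff D ` comp D (Suc p)"

definition homology :: "('k, 'a, 'z) dga_scheme \<Rightarrow> nat \<Rightarrow> 'a set monoid" where
  "homology D p =
     \<lparr>carrier = cycles D p, mult = (\<oplus>\<^bsub>D\<^esub>), one = \<zero>\<^bsub>D\<^esub>\<rparr> Mod boundaries D p"

definition homology_map ::
  "('k, 'b, 'z) dga_scheme \<Rightarrow> ('a \<Rightarrow> 'b) \<Rightarrow> nat \<Rightarrow> 'a set \<Rightarrow> 'b set" where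
  "homology_map E f p U = (\<Union>x\<in>U. boundaries E p +>\<^bsub>E\<^esub> f x)"

definition quasi_iso ::
  "('k, 'a, 'y) dga_scheme \<Rightarrow> ('k, 'b, 'z) dga_scheme \<Rightarrow> ('a \<Rightarrow> 'b) \<Rightarrow> bool" where
  "quasi_iso D E f \<longleftrightarrow> f \<in> dga_hom D E \<and>
     (\<forall>p. bij_betw (homology_map E f p) (carrier (homology D p)) (carrier (homology E p)))"

definition fibration ::
  "('k, 'a, 'y) dga_scheme \<Rightarrow> ('k, 'b, 'z) dga_scheme \<Rightarrow> ('a \<Rightarrow> 'b) \<Rightarrow> bool" where
  "fibration D E f \<longleftrightarrow> f \<in> dga_hom D E \<and> (\<forall>i>0. f ` comp D i = comp E i)"

text \<open>
  Left lifting property of the initial map \<open>k \<rightarrow> R\<close> against the acyclic fibrations. (The square has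
  no further data, \<open>k\<close> being initial.) The test objects have their elements in the same type \<open>'u\<close>
  as \<open>R\<close>. For \<open>R \<noteq> 0\<close> over an infinite field this is no restriction: \<open>R\<close> admits an acyclic
  fibration from a semi-free DG algebra of the cardinality of \<open>R\<close>, and if that fibration splits then
  \<open>R\<close> is a retract of a semi-free DG algebra.
\<close>

definition cofibrant :: "('k::field, 'u) dga \<Rightarrow> bool" where
  "cofibrant R \<longleftrightarrow> dg_algebra R \<and>
     (\<forall>(D :: ('k, 'u) dga) (E :: ('k, 'u) dga) p g.
        dg_algebra D \<longrightarrow> dg_algebra E \<longrightarrow> fibration D E p \<longrightarrow> quasi_iso D E p \<longrightarrow>
        g \<in> dga_hom R E \<longrightarrow>
        (\<exists>h\<in>dga_hom R D. \<forall>x\<in>carrier R. p (h x) = g x))"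

definition cofibrant_resolution ::
  "('k::field, 'a) module \<Rightarrow> ('k, 'u) dga \<Rightarrow> ('u \<Rightarrow> 'a) \<Rightarrow> bool" where
  "cofibrant_resolution A R q \<longleftrightarrow> cofibrant R \<and> quasi_iso R (concentrated A) q"


section \<open>Representation functors\<close>

text \<open>
  \<open>S\<close> with the universal representation \<open>\<pi> : R \<rightarrow> M\<^sub>n(S)\<close> represents the functor
  \<open>C \<mapsto> Hom(R, M\<^sub>n(C))\<close> on commutative DG algebras. \<open>C\<close> ranges over the commutative DG algebras
  with elements in the type \<open>'u\<close> of \<open>R\<close> and \<open>S\<close>, which has room for the representing object: the
  latter is generated by \<open>n\<^sup>2\<close> copies of \<open>R\<close>.
\<close>

definition represents_dg_rep ::
  "('k::field, 'u) dga \<Rightarrow> nat \<Rightarrow> ('k, 'u) dga \<Rightarrow> ('u \<Rightarrow> nat \<times> nat \<Rightarrow> 'u) \<Rightarrow> bool" where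
  "represents_dg_rep R n S \<pi> \<longleftrightarrow>
     comm_dg_algebra S \<and> \<pi> \<in> dga_hom R (matrix_dga n S) \<and>
     (\<forall>C :: ('k, 'u) dga. comm_dg_algebra C \<longrightarrow>
        bij_betw (\<lambda>\<psi>. \<lambda>x\<in>carrier R. map_matrix n \<psi> (\<pi> x))
          (dga_hom S C) (dga_hom R (matrix_dga n C)))"

text \<open>
  \<open>B\<close> with the universal representation \<open>\<rho> : A \<rightarrow> M\<^sub>n(B)\<close> represents \<open>C \<mapsto> Hom(A, M\<^sub>n(C))\<close> on
  ordinary commutative algebras; that is, \<open>B\<close> is the coordinate ring of the affine scheme
  \<open>Rep\<^sub>n(A)\<close>.
\<close>

definition represents_rep ::
  "('k::field, 'a) module \<Rightarrow> nat \<Rightarrow> ('k, 'u) module \<Rightarrow> ('a \<Rightarrow> nat \<times> nat \<Rightarrow> 'u) \<Rightarrow> bool" where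
  "represents_rep A n B \<rho> \<longleftrightarrow>
     comm_k_algebra B \<and> \<rho> \<in> alg_hom A (matrix_algebra n B) \<and>
     (\<forall>C :: ('k, 'u) module. comm_k_algebra C \<longrightarrow>
        bij_betw (\<lambda>\<psi>. \<lambda>x\<in>carrier A. map_matrix n \<psi> (\<rho> x))
          (alg_hom B C) (alg_hom A (matrix_algebra n C)))"


section \<open>Representation schemes as closed subschemes of affine space\<close>

definition poly_algebra :: "'v set \<Rightarrow> ('k::field, ('v \<Rightarrow>\<^sub>0 nat) \<Rightarrow>\<^sub>0 'k) module" where
  "poly_algebra W = \<lparr>
     carrier = {f. \<forall>m\<in>Poly_Mapping.keys f. Poly_Mapping.keys m \<subseteq> W},
     mult = (*), one = 1, zero = 0, add = (+),
     smult = (\<lambda>c. Poly_Mapping.map ((*) c))\<rparr>"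

definition poly_eval ::
  "('k::field, 'b, 'z) module_scheme \<Rightarrow> ('v \<Rightarrow> 'b) \<Rightarrow> (('v \<Rightarrow>\<^sub>0 nat) \<Rightarrow>\<^sub>0 'k) \<Rightarrow> 'b" where
  "poly_eval B s f = (\<Oplus>\<^bsub>B\<^esub>m\<in>Poly_Mapping.keys f. Poly_Mapping.lookup f m \<odot>\<^bsub>B\<^esub>
     (\<Otimes>\<^bsub>B\<^esub>v\<in>Poly_Mapping.keys m. s v [^]\<^bsub>B\<^esub> Poly_Mapping.lookup m v))"

text \<open>
  The coordinate ring of the affine space \<open>Rep\<^sub>n(T\<^sub>kV)\<close> of dimension \<open>n\<^sup>2 dim V\<close>: the variable
  \<open>(x, i, l)\<close> is the \<open>(i, l)\<close> entry of the matrix representing the basis element \<open>x\<close>.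
\<close>

definition rep_coordinates :: "'x set \<Rightarrow> nat \<Rightarrow> ('x \<times> nat \<times> nat) set" where
  "rep_coordinates X n = X \<times> matrix_indices n"

text \<open>
  The ideal of the closed subscheme \<open>Rep\<^sub>n(A) \<subseteq> Rep\<^sub>n(T\<^sub>kV)\<close>: the kernel of the restriction map of
  coordinate rings, which sends the variable \<open>(x, i, l)\<close> to the \<open>(i, l)\<close> entry of the image of \<open>x\<close>
  under the universal representation of \<open>A = T\<^sub>kV/J\<close>.
\<close>

definition rep_defining_ideal ::
  "'x set \<Rightarrow> ('x word \<Rightarrow>\<^sub>0 'k) set \<Rightarrow> nat \<Rightarrow> ('k::field, 'b) module
    \<Rightarrow> (('x word \<Rightarrow>\<^sub>0 'k) set \<Rightarrow> nat \<times> nat \<Rightarrow> 'b) \<Rightarrow> ((('x \<times> nat \<times> nat) \<Rightarrow>\<^sub>0 nat) \<Rightarrow>\<^sub>0 'k) set" where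
  "rep_defining_ideal X J n B \<rho> =
     {f \<in> carrier (poly_algebra (rep_coordinates X n)).
        poly_eval B (\<lambda>(x, e). \<rho> (J +>\<^bsub>free_algebra X\<^esub> gen x) e) f = \<zero>\<^bsub>B\<^esub>}"

definition regular_sequence :: "('a, 'z) ring_scheme \<Rightarrow> 'a list \<Rightarrow> bool" where
  "regular_sequence P fs \<longleftrightarrow> set fs \<subseteq> carrier P \<and>
     (\<forall>i<length fs. \<forall>g\<in>carrier P.
        fs ! i \<otimes>\<^bsub>P\<^esub> g \<in> Idl\<^bsub>P\<^esub> (set (take i fs)) \<longrightarrow> g \<in> Idl\<^bsub>P\<^esub> (set (take i fs))) \<and>
     Idl\<^bsub>P\<^esub> (set fs) \<noteq> carrier P"

definition generated_by_regular_sequence :: "('a, 'z) ring_scheme \<Rightarrow> 'a set \<Rightarrow> bool" where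
  "generated_by_regular_sequence P I \<longleftrightarrow> (\<exists>fs. regular_sequence P fs \<and> I = Idl\<^bsub>P\<^esub> (set fs))"

end

theory Submission
  imports Defs "HOL-Library.Equipollence" "HOL-Algebra.Free_Abelian_Groups"
begin

text \<open>
  After discarding superfluous relations, the presentation of \<open>A = F/J\<close> is minimal, and
  then \<open>J/J\<^sup>2\<close> is free on \<open>L\<close>. Consequently every syzygy of the relations is trivial, i.e. \<open>J\<close> is
  the quotient of \<open>F \<otimes> L \<otimes> F\<close> by the elements \<open>d(u) v - u d(v)\<close>. The DG algebra \<open>J \<rightarrow> F\<close> resolves \<open>A\<close>, and
  by the description of \<open>J\<close> the generic matrices define a representation of it over \<open>C\<close>, the truncation
  of the Koszul complex of the entries of the generic relations in \<open>Q = k[Rep\<^sub>n(F)]\<close> to degrees \<open>\<le> 1\<close>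
  (so that \<open>C\<^sub>1\<close> is the free module modulo the Koszul syzygies). Lifting \<open>R \<rightarrow> A\<close> to \<open>R \<rightarrow> (J \<rightarrow> F)\<close>
  gives a map \<open>R\<^sub>n \<rightarrow> C\<close>. In the other direction choose images in \<open>R\<^sub>n\<close> of the coordinates and of the
  basis of the Koszul complex. The composite \<open>Q \<rightarrow> R\<^sub>n \<rightarrow> C\<close> is homotopic to the inclusion, by a
  homotopy through the path object of \<open>C\<close>. A syzygy in \<open>Q\<close> becomes a \<open>1\<close>-cycle of \<open>R\<^sub>n\<close>, hence a
  boundary, hence vanishes in \<open>C\<^sub>1\<close>; up to the homotopy this says that it is a Koszul syzygy. So
  the Koszul complex has no first homology, and since the entries are homogeneous of positive degree
  they form a regular sequence.
\<close>


section \<open>Monoid algebras\<close>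

text \<open>\<open>R\<close> and its representing object are accessible only through lifting and
  representability, and only against test objects whose elements lie in one fixed type
  \<open>'u\<close>. So no explicit model of \<open>R\<close> is compared with it: two maps have to
  suffice, and the objects that they pass through (A, J -> F, C) are recoded in \<open>'u\<close>,
  which is where cardinalities enter. The lift cannot be made the identity on generators; it sends a
  chosen preimage of x to an element of F congruent to x modulo J. This defines an endomorphism
  theta of F over A, and theta - 1, with values in J, is the datum from which the homotopy is built.
  Truncating at degree 1 is what makes the vanishing of first homology usable: C is zero in degree
  2, so the image in C of a boundary from degree 2 vanishes. The quotient by Koszul syzygies is then
  forced, since a product of two elements of degree 1 is 0 and its Leibniz rule reads d(u) v = u
  d(v). In matrices over C the same identity kills exactly the trivial syzygies of the relations,
  which is why all syzygies must first be known to be trivial.\<close>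

definition algebra_map ::
  "('k, 'a, 'y) module_scheme \<Rightarrow> ('k, 'b, 'z) module_scheme \<Rightarrow> ('a \<Rightarrow> 'b) \<Rightarrow> bool" where
  "algebra_map A B f \<longleftrightarrow> f \<in> ring_hom A B \<and>
     (\<forall>c. \<forall>x\<in>carrier A. f (c \<odot>\<^bsub>A\<^esub> x) = c \<odot>\<^bsub>B\<^esub> f x)"

lemma algebra_mapI:
  assumes "\<And>x. x \<in> carrier A \<Longrightarrow> f x \<in> carrier B"
    and "\<And>x y. x \<in> carrier A \<Longrightarrow> y \<in> carrier A \<Longrightarrow> f (x \<otimes>\<^bsub>A\<^esub> y) = f x \<otimes>\<^bsub>B\<^esub> f y"
    and "\<And>x y. x \<in> carrier A \<Longrightarrow> y \<in> carrier A \<Longrightarrow> f (x \<oplus>\<^bsub>A\<^esub> y) = f x \<oplus>\<^bsub>B\<^esub> f y"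
    and "f \<one>\<^bsub>A\<^esub> = \<one>\<^bsub>B\<^esub>"
    and "\<And>c x. x \<in> carrier A \<Longrightarrow> f (c \<odot>\<^bsub>A\<^esub> x) = c \<odot>\<^bsub>B\<^esub> f x"
  shows "algebra_map A B f"
  using assms by (auto simp: algebra_map_def intro!: ring_hom_memI)

lemma algebra_mapD:
  assumes "algebra_map A B f"
  shows algebra_map_closed: "x \<in> carrier A \<Longrightarrow> f x \<in> carrier B"
    and algebra_map_mult: "x \<in> carrier A \<Longrightarrow> y \<in> carrier A \<Longrightarrow> f (x \<otimes>\<^bsub>A\<^esub> y) = f x \<otimes>\<^bsub>B\<^esub> f y"
    and algebra_map_add: "x \<in> carrier A \<Longrightarrow> y \<in> carrier A \<Longrightarrow> f (x \<oplus>\<^bsub>A\<^esub> y) = f x \<oplus>\<^bsub>B\<^esub> f y"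
    and algebra_map_one: "f \<one>\<^bsub>A\<^esub> = \<one>\<^bsub>B\<^esub>"
    and algebra_map_smult: "x \<in> carrier A \<Longrightarrow> f (c \<odot>\<^bsub>A\<^esub> x) = c \<odot>\<^bsub>B\<^esub> f x"
  using assms by (auto simp: algebra_map_def ring_hom_def)

lemma algebra_map_comp:
  assumes "algebra_map A B f" "algebra_map B C g"
  shows "algebra_map A C (\<lambda>x. g (f x))"
  by (rule algebra_mapI) (simp_all add: algebra_mapD[OF assms(1)] algebra_mapD[OF assms(2)])

text \<open>\<open>algebra_map\<close> drops extensionality, so that composites written as lambda
  terms are algebra maps as they stand; extensionality is restored only where a hom-set of the
  definitions is met.\<close>

lemma alg_hom_iff: "f \<in> alg_hom A B \<longleftrightarrow> algebra_map A B f \<and> f \<in> extensional (carrier A)"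
  by (auto simp: alg_hom_def algebra_map_def)

lemma algebra_map_cong:
  assumes "algebra_map A B f" "\<And>x. x \<in> carrier A \<Longrightarrow> g x = f x" "ring A" "k_algebra A"
  shows "algebra_map A B g"
proof -
  interpret k_algebra A by fact
  show ?thesis
    using assms(1) by (intro algebra_mapI) (simp_all add: assms(2) smult_closed algebra_mapD[OF assms(1)])
qed

context k_algebra
begin

lemma smult_zero_left: "x \<in> carrier A \<Longrightarrow> 0 \<odot> x = \<zero>"
  using smult_l_distr[of x 0 0] smult_closed[of x 0] by (simp add: add.l_cancel_one')

lemma smult_zero_right: "c \<odot> \<zero> = \<zero>"
  using smult_r_distr[of \<zero> \<zero> c] smult_closed[of \<zero> c] by (simp add: add.l_cancel_one')

lemma smult_minus_one: "x \<in> carrier A \<Longrightarrow> (-1) \<odot> x = \<ominus> x"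
  using smult_l_distr[of x "-1" 1] smult_closed[of x "-1"]
  by (simp add: smult_one smult_zero_left minus_equality)

lemma smult_finsum:
  assumes "f \<in> S \<rightarrow> carrier A"
  shows "c \<odot> (\<Oplus>i\<in>S. f i) = (\<Oplus>i\<in>S. c \<odot> f i)"
  using assms
proof (induction S rule: infinite_finite_induct)
  case (insert x F)
  have "(\<lambda>i. c \<odot> f i) \<in> F \<rightarrow> carrier A" using insert.prems by (auto intro: smult_closed)
  then show ?case using insert by (auto simp: smult_closed smult_r_distr)
qed (auto simp: smult_zero_right finsum_infinite)

end

lemma (in abelian_monoid) finsum_swap:
  assumes "finite S" "finite K" "\<And>i l. i \<in> S \<Longrightarrow> l \<in> K \<Longrightarrow> f i l \<in> carrier G"
  shows "(\<Oplus>i\<in>S. \<Oplus>l\<in>K. f i l) = (\<Oplus>l\<in>K. \<Oplus>i\<in>S. f i l)"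
  using assms(1,3)
proof (induction S rule: finite_induct)
  case empty
  then show ?case by simp
next
  case (insert x F)
  have c: "(\<lambda>l. f x l) \<in> K \<rightarrow> carrier G" "(\<lambda>l. \<Oplus>i\<in>F. f i l) \<in> K \<rightarrow> carrier G"
    "(\<lambda>i. \<Oplus>l\<in>K. f i l) \<in> F \<rightarrow> carrier G" "(\<Oplus>l\<in>K. f x l) \<in> carrier G"
    using insert.prems by (auto intro!: finsum_closed)
  have "(\<Oplus>l\<in>K. \<Oplus>i\<in>insert x F. f i l) = (\<Oplus>l\<in>K. f x l \<oplus> (\<Oplus>i\<in>F. f i l))"
    using insert c by (intro finsum_cong' refl) (auto intro!: finsum_insert)
  then show ?case using insert c by (simp add: finsum_addf)
qed

lemma finsum_hom:
  assumes "abelian_monoid A" "abelian_monoid B"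
    and "\<And>x. x \<in> carrier A \<Longrightarrow> h x \<in> carrier B"
    and "\<And>x y. x \<in> carrier A \<Longrightarrow> y \<in> carrier A \<Longrightarrow> h (x \<oplus>\<^bsub>A\<^esub> y) = h x \<oplus>\<^bsub>B\<^esub> h y"
    and "h \<zero>\<^bsub>A\<^esub> = \<zero>\<^bsub>B\<^esub>" and "f \<in> S \<rightarrow> carrier A"
  shows "h (finsum A f S) = finsum B (\<lambda>i. h (f i)) S"
proof -
  interpret A: abelian_monoid A by fact
  interpret B: abelian_monoid B by fact
  show ?thesis using assms(6)
  proof (induction S rule: infinite_finite_induct)
    case (insert x F)
    have "(\<lambda>i. h (f i)) \<in> F \<rightarrow> carrier B" using insert.prems assms(3) by auto
    then show ?case using insert assms(3,4) by auto
  qed (auto simp: assms(5))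
qed

lemma algebra_map_zero:
  assumes "algebra_map A B f" "ring A" "ring B"
  shows "f \<zero>\<^bsub>A\<^esub> = \<zero>\<^bsub>B\<^esub>"
  using assms ring_hom_zero unfolding algebra_map_def by blast

lemma algebra_map_finsum:
  assumes "algebra_map A B f" "ring A" "ring B" "g \<in> S \<rightarrow> carrier A"
  shows "f (finsum A g S) = finsum B (\<lambda>i. f (g i)) S"
  using assms by (intro finsum_hom)
    (auto intro: algebra_mapD algebra_map_zero ring.is_abelian_group abelian_group.axioms simp: algebra_map_zero algebra_mapD)

definition additive_submonoid :: "'w::monoid_add set \<Rightarrow> bool" where
  "additive_submonoid Ws \<longleftrightarrow> 0 \<in> Ws \<and> (\<forall>u\<in>Ws. \<forall>v\<in>Ws. u + v \<in> Ws)"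

text \<open>\<open>free_algebra\<close> and \<open>poly_algebra\<close> are the cases of words over
  X and of monomials over W, so the algebra axioms, linear extension and the cardinality bound are
  proved once, for a submonoid \<open>Ws\<close>.\<close>

definition monoid_algebra :: "'w::monoid_add set \<Rightarrow> ('k::field, 'w \<Rightarrow>\<^sub>0 'k) module" where
  "monoid_algebra Ws = \<lparr>
     carrier = {p. Poly_Mapping.keys p \<subseteq> Ws},
     mult = (*), one = 1, ring.zero = 0, add = (+),
     smult = (\<lambda>c. Poly_Mapping.map ((*) c))\<rparr>"

lemma monoid_algebra_simps [simp]:
  "carrier (monoid_algebra Ws) = {p. Poly_Mapping.keys p \<subseteq> Ws}"
  "mult (monoid_algebra Ws) = (*)" "one (monoid_algebra Ws) = 1"
  "ring.zero (monoid_algebra Ws) = 0" "add (monoid_algebra Ws) = (+)"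
  "smult (monoid_algebra Ws) c p = Poly_Mapping.single 0 c * p"
  by (simp_all add: monoid_algebra_def mult_map_scale_conv_mult)

definition words_over :: "'x set \<Rightarrow> 'x word set" where
  "words_over X = {w. set (letters w) \<subseteq> X}"

definition monomials_over :: "'v set \<Rightarrow> ('v \<Rightarrow>\<^sub>0 nat) set" where
  "monomials_over W = {m. Poly_Mapping.keys m \<subseteq> W}"

lemma free_algebra_eq: "free_algebra X = monoid_algebra (words_over X)"
  by (auto simp: free_algebra_def monoid_algebra_def words_over_def)

lemma poly_algebra_eq: "poly_algebra W = monoid_algebra (monomials_over W)"
  by (auto simp: poly_algebra_def monoid_algebra_def monomials_over_def)

lemma additive_submonoid_words: "additive_submonoid (words_over X)"
  by (auto simp: additive_submonoid_def words_over_def zero_word_def plus_word_def)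

lemma additive_submonoid_monomials: "additive_submonoid (monomials_over W)"
  unfolding additive_submonoid_def monomials_over_def using keys_add by fastforce

section \<open>Supports of finitely supported functions\<close>

lemma keys_single_subset: "w \<in> Ws \<Longrightarrow> Poly_Mapping.keys (Poly_Mapping.single w c) \<subseteq> Ws"
  by (simp split: if_splits)

lemma keys_add_subset:
  "Poly_Mapping.keys p \<subseteq> Ws \<Longrightarrow> Poly_Mapping.keys q \<subseteq> Ws \<Longrightarrow> Poly_Mapping.keys (p + q) \<subseteq> Ws"
  by (meson Un_least keys_add subset_trans)

lemma keys_mult_subset:
  assumes "additive_submonoid Ws" "Poly_Mapping.keys p \<subseteq> Ws" "Poly_Mapping.keys q \<subseteq> Ws"
  shows "Poly_Mapping.keys (p * q) \<subseteq> Ws"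
  using keys_mult[of p q] assms unfolding additive_submonoid_def by blast

lemma poly_mapping_sum_single:
  fixes p :: "'w \<Rightarrow>\<^sub>0 'v::comm_monoid_add"
  shows "p = (\<Sum>w\<in>Poly_Mapping.keys p. Poly_Mapping.single w (Poly_Mapping.lookup p w))"
proof (rule poly_mapping_eqI)
  fix k
  show "Poly_Mapping.lookup p k =
    Poly_Mapping.lookup (\<Sum>w\<in>Poly_Mapping.keys p. Poly_Mapping.single w (Poly_Mapping.lookup p w)) k"
    by (auto simp: lookup_sum lookup_single when_def in_keys_iff if_distrib cong: if_cong)
qed

lemma poly_mapping_induct_single [consumes 1, case_names zero single add]:
  fixes p :: "'w \<Rightarrow>\<^sub>0 'v::comm_monoid_add"
  assumes "Poly_Mapping.keys p \<subseteq> Ws" and "Q 0"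
    and "\<And>w c. w \<in> Ws \<Longrightarrow> Q (Poly_Mapping.single w c)"
    and "\<And>p q. Poly_Mapping.keys p \<subseteq> Ws \<Longrightarrow> Poly_Mapping.keys q \<subseteq> Ws \<Longrightarrow> Q p \<Longrightarrow> Q q \<Longrightarrow> Q (p + q)"
  shows "Q p"
proof -
  have "finite S \<Longrightarrow> S \<subseteq> Ws \<Longrightarrow>
      Poly_Mapping.keys (\<Sum>w\<in>S. Poly_Mapping.single w (Poly_Mapping.lookup p w)) \<subseteq> Ws \<and>
      Q (\<Sum>w\<in>S. Poly_Mapping.single w (Poly_Mapping.lookup p w))" for S
  proof (induction S rule: finite_induct)
    case (insert x F)
    let ?q = "\<Sum>w\<in>F. Poly_Mapping.single w (Poly_Mapping.lookup p w)"
    have "Poly_Mapping.keys (Poly_Mapping.single x (Poly_Mapping.lookup p x)) \<subseteq> Ws"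
      "Poly_Mapping.keys ?q \<subseteq> Ws" "Q ?q" "Q (Poly_Mapping.single x (Poly_Mapping.lookup p x))"
      using insert assms(3) keys_single_subset[of x Ws] by auto
    then show ?case
      using assms(4) keys_add_subset insert.hyps by (metis sum.insert)
  qed (simp add: assms(2))
  then show ?thesis using assms(1) poly_mapping_sum_single[of p] by (metis finite_keys)
qed

lemma finsum_monoid_algebra:
  assumes "additive_submonoid Ws" "\<And>i. i \<in> S \<Longrightarrow> Poly_Mapping.keys (f i) \<subseteq> Ws"
    "abelian_monoid (monoid_algebra Ws :: ('k::field, 'w::monoid_add \<Rightarrow>\<^sub>0 'k) module)"
  shows "finsum (monoid_algebra Ws :: ('k::field, 'w::monoid_add \<Rightarrow>\<^sub>0 'k) module) f S = sum f S"
proof -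
  interpret abelian_monoid "monoid_algebra Ws :: ('k::field, 'w::monoid_add \<Rightarrow>\<^sub>0 'k) module" by fact
  show ?thesis using assms(2)
  proof (induction S rule: infinite_finite_induct)
    case (insert x F)
    then have "finsum (monoid_algebra Ws) f (insert x F)
        = f x \<oplus>\<^bsub>monoid_algebra Ws\<^esub> finsum (monoid_algebra Ws) f F"
      by (intro finsum_insert) auto
    then show ?case using insert by auto
  qed (simp_all add: finsum_infinite)
qed

text \<open>Scalars are supported at the unit of the monoid, which commutes with every word; this
  makes them central in the free algebra too.\<close>

lemma single_zero_central:
  "Poly_Mapping.single 0 (c::'k::comm_semiring_1) * p = p * Poly_Mapping.single (0::'w::monoid_add) c"
proof -
  have "Poly_Mapping.keys p \<subseteq> UNIV" by simp
  then show ?thesis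
    by (induction p rule: poly_mapping_induct_single)
      (auto simp: mult_single mult.commute algebra_simps)
qed

lemma k_algebra_monoid_algebra:
  assumes "additive_submonoid Ws"
  shows "k_algebra (monoid_algebra Ws :: ('k::field, 'w::monoid_add \<Rightarrow>\<^sub>0 'k) module)"
proof -
  let ?A = "monoid_algebra Ws :: ('k::field, 'w::monoid_add \<Rightarrow>\<^sub>0 'k) module"
  note cl = keys_add_subset keys_mult_subset[OF assms]
  have "0 \<in> Ws" using assms by (simp add: additive_submonoid_def)
  have "abelian_group ?A"
  proof (rule abelian_groupI)
    fix x assume "x \<in> carrier ?A"
    then show "\<exists>y\<in>carrier ?A. y \<oplus>\<^bsub>?A\<^esub> x = \<zero>\<^bsub>?A\<^esub>"
      by (intro bexI[of _ "- x"]) (auto simp: in_keys_iff)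
  qed (auto simp: cl algebra_simps)
  moreover have "monoid ?A"
    using \<open>0 \<in> Ws\<close> by unfold_locales (auto simp: cl algebra_simps simp del: single_one)
  ultimately have "ring ?A"
    by (rule ringI) (auto simp: algebra_simps)
  then show ?thesis
  proof (rule k_algebra.intro, unfold_locales)
    fix x y and b c :: 'k
    show "(b + c) \<odot>\<^bsub>?A\<^esub> x = b \<odot>\<^bsub>?A\<^esub> x \<oplus>\<^bsub>?A\<^esub> c \<odot>\<^bsub>?A\<^esub> x"
      by (simp add: single_add algebra_simps)
    show "(b * c) \<odot>\<^bsub>?A\<^esub> x = b \<odot>\<^bsub>?A\<^esub> (c \<odot>\<^bsub>?A\<^esub> x)"
      by (simp add: mult.assoc[symmetric] mult_single)
    show "x \<otimes>\<^bsub>?A\<^esub> (c \<odot>\<^bsub>?A\<^esub> y) = c \<odot>\<^bsub>?A\<^esub> (x \<otimes>\<^bsub>?A\<^esub> y)"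
      by (simp add: mult.assoc[symmetric] single_zero_central[symmetric])
    show "x \<in> carrier ?A \<Longrightarrow> c \<odot>\<^bsub>?A\<^esub> x \<in> carrier ?A"
      using cl(2)[OF keys_single_subset[OF \<open>0 \<in> Ws\<close>]] by simp
  qed (auto simp: algebra_simps)
qed

lemma comm_k_algebra_monoid_algebra:
  assumes "additive_submonoid Ws"
  shows "comm_k_algebra (monoid_algebra Ws :: ('k::field, 'w::comm_monoid_add \<Rightarrow>\<^sub>0 'k) module)"
  using k_algebra_monoid_algebra[OF assms]
  by (intro comm_k_algebra.intro) (auto simp: comm_k_algebra_axioms_def mult.commute)

lemmas k_algebra_free_algebra = k_algebra_monoid_algebra[OF additive_submonoid_words, folded free_algebra_eq]
lemmas comm_k_algebra_poly_algebra =
  comm_k_algebra_monoid_algebra[OF additive_submonoid_monomials, folded poly_algebra_eq]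

section \<open>Linear extension of monoid homomorphisms\<close>

text \<open>Both \<open>free_eval\<close> and \<open>poly_eval\<close> have this form, for products
  of letters and for monomials. The sum runs over the support, which
  \<open>linear_extension_superset\<close> enlarges to a common index set when two arguments are
  added.\<close>

definition linear_extension ::
  "('k::field, 'a, 'z) module_scheme \<Rightarrow> ('w \<Rightarrow> 'a) \<Rightarrow> ('w \<Rightarrow>\<^sub>0 'k) \<Rightarrow> 'a" where
  "linear_extension A m p =
     (\<Oplus>\<^bsub>A\<^esub>w\<in>Poly_Mapping.keys p. Poly_Mapping.lookup p w \<odot>\<^bsub>A\<^esub> m w)"

context k_algebra
begin

lemma linear_extension_superset:
  assumes m: "m \<in> Ws \<rightarrow> carrier A" and "finite S" "Poly_Mapping.keys p \<subseteq> S" "S \<subseteq> Ws"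
  shows "linear_extension A m p = (\<Oplus>w\<in>S. Poly_Mapping.lookup p w \<odot> m w)"
proof -
  have "m w \<in> carrier A" if "w \<in> S" for w using assms that by auto
  then show ?thesis
    unfolding linear_extension_def using assms
    by (intro add.finprod_mono_neutral_cong_left)
      (auto simp: in_keys_iff smult_zero_left intro!: smult_closed)
qed

lemma linear_extension_closed:
  assumes "m \<in> Ws \<rightarrow> carrier A" "Poly_Mapping.keys p \<subseteq> Ws"
  shows "linear_extension A m p \<in> carrier A"
  unfolding linear_extension_def using assms by (intro finsum_closed) (auto intro!: smult_closed)

lemma linear_extension_add:
  assumes m: "m \<in> Ws \<rightarrow> carrier A" and p: "Poly_Mapping.keys p \<subseteq> Ws" and q: "Poly_Mapping.keys q \<subseteq> Ws"
  shows "linear_extension A m (p + q) = linear_extension A m p \<oplus> linear_extension A m q"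
proof -
  let ?S = "Poly_Mapping.keys p \<union> Poly_Mapping.keys q"
  have *: "(\<lambda>w. Poly_Mapping.lookup r w \<odot> m w) \<in> ?S \<rightarrow> carrier A" for r :: "_ \<Rightarrow>\<^sub>0 'k"
    using assms by (auto intro!: smult_closed)
  have "linear_extension A m (p + q) = (\<Oplus>w\<in>?S. Poly_Mapping.lookup (p + q) w \<odot> m w)"
    using assms keys_add[of p q] by (intro linear_extension_superset[OF m]) auto
  also have "\<dots> = (\<Oplus>w\<in>?S. Poly_Mapping.lookup p w \<odot> m w \<oplus> Poly_Mapping.lookup q w \<odot> m w)"
    using m p q by (intro finsum_cong' refl) (auto simp: lookup_add subset_iff Pi_iff smult_l_distr intro!: smult_closed)
  also have "\<dots> = linear_extension A m p \<oplus> linear_extension A m q"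
    using assms * by (simp add: finsum_addf linear_extension_superset[OF m, of ?S])
  finally show ?thesis .
qed

lemma linear_extension_single:
  assumes "m w \<in> carrier A"
  shows "linear_extension A m (Poly_Mapping.single w c) = c \<odot> m w"
  using assms by (auto simp: linear_extension_def smult_zero_left smult_closed)

lemma linear_extension_zero: "linear_extension A m 0 = \<zero>"
  by (simp add: linear_extension_def)

lemma linear_extension_smult:
  assumes m: "m \<in> Ws \<rightarrow> carrier A" and p: "Poly_Mapping.keys p \<subseteq> Ws"
  shows "linear_extension A m (Poly_Mapping.single (0::'w::monoid_add) c * p) = c \<odot> linear_extension A m p"
  using p
proof (induction p rule: poly_mapping_induct_single)
  case zero
  then show ?case by (simp add: linear_extension_zero smult_zero_right)
next
  case (single w d)
  then have "m w \<in> carrier A" using m by auto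
  then show ?case by (simp add: mult_single linear_extension_single smult_assoc)
next
  case (add p q)
  have "Poly_Mapping.keys (Poly_Mapping.single (0::'w) c * r) \<subseteq> Ws" if "Poly_Mapping.keys r \<subseteq> Ws"
    for r :: "'w \<Rightarrow>\<^sub>0 'k"
    using keys_mult[of "Poly_Mapping.single (0::'w) c" r] that by (auto split: if_splits)
  then show ?case
    using add m by (simp add: distrib_left linear_extension_add[OF m] smult_r_distr
      linear_extension_closed[OF m])
qed

lemma linear_extension_mult:
  assumes m: "m \<in> Ws \<rightarrow> carrier A" and Ws: "additive_submonoid Ws"
    and mm: "\<And>u v. u \<in> Ws \<Longrightarrow> v \<in> Ws \<Longrightarrow> m (u + v) = m u \<otimes> m v"
    and p: "Poly_Mapping.keys p \<subseteq> Ws" and q: "Poly_Mapping.keys q \<subseteq> Ws"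
  shows "linear_extension A m (p * q) = linear_extension A m p \<otimes> linear_extension A m q"
  using p
proof (induction p rule: poly_mapping_induct_single)
  case zero
  then show ?case using linear_extension_closed[OF m q] by (simp add: linear_extension_zero)
next
  case (single u c)
  note u = single
  show ?case using q
  proof (induction q rule: poly_mapping_induct_single)
    case zero
    then show ?case using linear_extension_closed[OF m, of "Poly_Mapping.single u c"] u
      by (simp add: linear_extension_zero keys_single_subset)
  next
    case (single v d)
    then have "m u \<in> carrier A" "m v \<in> carrier A" "m (u + v) \<in> carrier A" "u + v \<in> Ws"
      using u m Ws by (auto simp: additive_submonoid_def)
    then show ?case using u single
      by (simp add: mult_single linear_extension_single smult_mult_l smult_mult_r
        smult_assoc[symmetric] mm smult_closed mult.commute)
  next
    case (add p q)
    then show ?case using u m Ws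
      by (simp add: distrib_left linear_extension_add[OF m] keys_mult_subset keys_single_subset
        linear_extension_closed[OF m] r_distr del: keys_single)
  qed
next
  case (add p q')
  then show ?case using m q Ws
    by (simp add: distrib_right linear_extension_add[OF m] keys_mult_subset linear_extension_closed[OF m] l_distr)
qed

lemma linear_extension_algebra_map:
  assumes m: "m \<in> Ws \<rightarrow> carrier A" and Ws: "additive_submonoid (Ws :: 'w::monoid_add set)"
    and mm: "\<And>u v. u \<in> Ws \<Longrightarrow> v \<in> Ws \<Longrightarrow> m (u + v) = m u \<otimes> m v" and m0: "m 0 = \<one>"
  shows "algebra_map (monoid_algebra Ws) A (linear_extension A m)"
proof (rule algebra_mapI)
  have "linear_extension A m (Poly_Mapping.single 0 1) = 1 \<odot> m 0"
    by (rule linear_extension_single) (simp add: m0)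
  then show "linear_extension A m \<one>\<^bsub>monoid_algebra Ws\<^esub> = \<one>"
    by (simp add: m0 smult_one)
qed (use assms in \<open>auto simp: linear_extension_closed[OF m] linear_extension_mult[OF m Ws mm]
  linear_extension_add[OF m] linear_extension_smult[OF m]\<close>)

end

section \<open>Matrix algebras\<close>

lemma matrix_algebra_simps [simp]:
  "carrier (matrix_algebra n C) = matrix_indices n \<rightarrow>\<^sub>E carrier C"
  "mult (matrix_algebra n C) M N =
    (\<lambda>(i, j)\<in>matrix_indices n. \<Oplus>\<^bsub>C\<^esub>l\<in>{..<n}. M (i, l) \<otimes>\<^bsub>C\<^esub> N (l, j))"
  "one (matrix_algebra n C) = (\<lambda>(i, j)\<in>matrix_indices n. if i = j then \<one>\<^bsub>C\<^esub> else \<zero>\<^bsub>C\<^esub>)"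
  "ring.zero (matrix_algebra n C) = (\<lambda>e\<in>matrix_indices n. \<zero>\<^bsub>C\<^esub>)"
  "add (matrix_algebra n C) M N = (\<lambda>e\<in>matrix_indices n. M e \<oplus>\<^bsub>C\<^esub> N e)"
  "smult (matrix_algebra n C) c M = (\<lambda>e\<in>matrix_indices n. c \<odot>\<^bsub>C\<^esub> M e)"
  by (simp_all add: matrix_algebra_def)

lemma mem_matrix_indices [simp]: "(i, l) \<in> matrix_indices n \<longleftrightarrow> i < n \<and> l < n"
  by (auto simp: matrix_indices_def)

lemma finite_matrix_indices [simp]: "finite (matrix_indices n)"
  by (simp add: matrix_indices_def)

lemma matrix_eqI:
  assumes "M \<in> extensional (matrix_indices n)" "N \<in> extensional (matrix_indices n)"
    and "\<And>i l. i < n \<Longrightarrow> l < n \<Longrightarrow> M (i, l) = N (i, l)"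
  shows "M = N"
  using assms by (intro extensionalityI[of M "matrix_indices n" N]) (auto simp: matrix_indices_def)

lemma matrix_entry_closed:
  "M \<in> matrix_indices n \<rightarrow>\<^sub>E S \<Longrightarrow> i < n \<Longrightarrow> l < n \<Longrightarrow> M (i, l) \<in> S"
  by (auto simp: PiE_iff)

context k_algebra
begin

lemma matrix_mult_closed:
  assumes "M \<in> matrix_indices n \<rightarrow>\<^sub>E carrier A" "N \<in> matrix_indices n \<rightarrow>\<^sub>E carrier A" "i < n" "l < n"
  shows "(\<Oplus>k\<in>{..<n}. M (i, k) \<otimes> N (k, l)) \<in> carrier A"
  using assms by (intro finsum_closed) (auto simp: matrix_entry_closed)

text \<open>The entries may fail to commute, as they do in DG algebras, to which this is applied;
  associativity is an interchange of two finite sums.\<close>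

lemma k_algebra_matrix_algebra: "k_algebra (matrix_algebra n A)"
proof -
  let ?M = "matrix_algebra n A"
  note ec = matrix_entry_closed[where S = "carrier A" and n = n]
  have "abelian_group ?M"
  proof (rule abelian_groupI)
    fix x assume x: "x \<in> carrier ?M"
    show "\<exists>y\<in>carrier ?M. y \<oplus>\<^bsub>?M\<^esub> x = \<zero>\<^bsub>?M\<^esub>"
      using x by (intro bexI[of _ "\<lambda>e\<in>matrix_indices n. \<ominus> x e"])
        (auto intro!: restrict_ext simp: l_neg PiE_iff)
  qed (auto intro!: restrict_ext matrix_eqI[of _ n] simp: PiE_iff a_ac)
  moreover have "monoid ?M"
  proof (rule monoidI)
    fix x y z assume x: "x \<in> carrier ?M" and y: "y \<in> carrier ?M" and z: "z \<in> carrier ?M"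
    show "x \<otimes>\<^bsub>?M\<^esub> y \<in> carrier ?M"
      using x y by (auto intro!: matrix_mult_closed)
    show "x \<otimes>\<^bsub>?M\<^esub> y \<otimes>\<^bsub>?M\<^esub> z = x \<otimes>\<^bsub>?M\<^esub> (y \<otimes>\<^bsub>?M\<^esub> z)"
    proof (rule matrix_eqI)
      fix i l assume il: "i < n" "l < n"
      have "(x \<otimes>\<^bsub>?M\<^esub> y \<otimes>\<^bsub>?M\<^esub> z) (i, l) = (\<Oplus>k\<in>{..<n}. (\<Oplus>m\<in>{..<n}. x (i, m) \<otimes> y (m, k)) \<otimes> z (k, l))"
        using x y z il by (auto intro!: finsum_cong' matrix_mult_closed simp: ec)
      also have "\<dots> = (\<Oplus>k\<in>{..<n}. \<Oplus>m\<in>{..<n}. x (i, m) \<otimes> y (m, k) \<otimes> z (k, l))"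
        using x y z il by (intro finsum_cong' refl) (auto intro!: finsum_ldistr finsum_closed simp: ec)
      also have "\<dots> = (\<Oplus>m\<in>{..<n}. \<Oplus>k\<in>{..<n}. x (i, m) \<otimes> y (m, k) \<otimes> z (k, l))"
        using x y z il by (intro finsum_swap) (auto simp: ec)
      also have "\<dots> = (\<Oplus>m\<in>{..<n}. \<Oplus>k\<in>{..<n}. x (i, m) \<otimes> (y (m, k) \<otimes> z (k, l)))"
        using x y z il by (intro finsum_cong' refl) (auto intro!: finsum_closed simp: ec m_assoc)
      also have "\<dots> = (\<Oplus>m\<in>{..<n}. x (i, m) \<otimes> (\<Oplus>k\<in>{..<n}. y (m, k) \<otimes> z (k, l)))"
        using x y z il
        by (intro finsum_cong' refl finsum_rdistr[symmetric]) (auto intro!: finsum_closed simp: ec)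
      also have "\<dots> = (x \<otimes>\<^bsub>?M\<^esub> (y \<otimes>\<^bsub>?M\<^esub> z)) (i, l)"
        using x y z il by (auto intro!: finsum_cong' matrix_mult_closed simp: ec)
      finally show "(x \<otimes>\<^bsub>?M\<^esub> y \<otimes>\<^bsub>?M\<^esub> z) (i, l) = (x \<otimes>\<^bsub>?M\<^esub> (y \<otimes>\<^bsub>?M\<^esub> z)) (i, l)" .
    qed auto
    show "\<one>\<^bsub>?M\<^esub> \<otimes>\<^bsub>?M\<^esub> x = x"
    proof (rule matrix_eqI)
      fix i l assume il: "i < n" "l < n"
      have "(\<one>\<^bsub>?M\<^esub> \<otimes>\<^bsub>?M\<^esub> x) (i, l) = (\<Oplus>k\<in>{..<n}. if k = i then x (k, l) else \<zero>)"
        using x il by (auto intro!: finsum_cong' simp: ec)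
      also have "\<dots> = x (i, l)"
        using il ec x by (intro add.finprod_singleton_swap) auto
      finally show "(\<one>\<^bsub>?M\<^esub> \<otimes>\<^bsub>?M\<^esub> x) (i, l) = x (i, l)" .
    qed (use x in \<open>auto simp: PiE_iff\<close>)
    show "x \<otimes>\<^bsub>?M\<^esub> \<one>\<^bsub>?M\<^esub> = x"
    proof (rule matrix_eqI)
      fix i l assume il: "i < n" "l < n"
      have "(x \<otimes>\<^bsub>?M\<^esub> \<one>\<^bsub>?M\<^esub>) (i, l) = (\<Oplus>k\<in>{..<n}. if k = l then x (i, k) else \<zero>)"
        using x il by (auto intro!: finsum_cong' simp: ec)
      also have "\<dots> = x (i, l)"
        using il ec x by (intro add.finprod_singleton_swap) auto
      finally show "(x \<otimes>\<^bsub>?M\<^esub> \<one>\<^bsub>?M\<^esub>) (i, l) = x (i, l)" .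
    qed (use x in \<open>auto simp: PiE_iff\<close>)
  qed auto
  ultimately have "ring ?M"
  proof (rule ringI)
    fix x y z assume x: "x \<in> carrier ?M" and y: "y \<in> carrier ?M" and z: "z \<in> carrier ?M"
    show "(x \<oplus>\<^bsub>?M\<^esub> y) \<otimes>\<^bsub>?M\<^esub> z = x \<otimes>\<^bsub>?M\<^esub> z \<oplus>\<^bsub>?M\<^esub> y \<otimes>\<^bsub>?M\<^esub> z"
    proof (rule matrix_eqI)
      fix i l assume il: "i < n" "l < n"
      have "((x \<oplus>\<^bsub>?M\<^esub> y) \<otimes>\<^bsub>?M\<^esub> z) (i, l) = (\<Oplus>k\<in>{..<n}. x (i, k) \<otimes> z (k, l) \<oplus> y (i, k) \<otimes> z (k, l))"
        using x y z il by (auto intro!: finsum_cong' simp: ec l_distr simp del: finsum_addf)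
      also have "\<dots> = (x \<otimes>\<^bsub>?M\<^esub> z \<oplus>\<^bsub>?M\<^esub> y \<otimes>\<^bsub>?M\<^esub> z) (i, l)"
        using x y z il by (simp add: finsum_addf ec Pi_iff)
      finally show "((x \<oplus>\<^bsub>?M\<^esub> y) \<otimes>\<^bsub>?M\<^esub> z) (i, l) = (x \<otimes>\<^bsub>?M\<^esub> z \<oplus>\<^bsub>?M\<^esub> y \<otimes>\<^bsub>?M\<^esub> z) (i, l)" .
    qed auto
    show "z \<otimes>\<^bsub>?M\<^esub> (x \<oplus>\<^bsub>?M\<^esub> y) = z \<otimes>\<^bsub>?M\<^esub> x \<oplus>\<^bsub>?M\<^esub> z \<otimes>\<^bsub>?M\<^esub> y"
    proof (rule matrix_eqI)
      fix i l assume il: "i < n" "l < n"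
      have "(z \<otimes>\<^bsub>?M\<^esub> (x \<oplus>\<^bsub>?M\<^esub> y)) (i, l) = (\<Oplus>k\<in>{..<n}. z (i, k) \<otimes> x (k, l) \<oplus> z (i, k) \<otimes> y (k, l))"
        using x y z il by (auto intro!: finsum_cong' simp: ec r_distr simp del: finsum_addf)
      also have "\<dots> = (z \<otimes>\<^bsub>?M\<^esub> x \<oplus>\<^bsub>?M\<^esub> z \<otimes>\<^bsub>?M\<^esub> y) (i, l)"
        using x y z il by (simp add: finsum_addf ec Pi_iff)
      finally show "(z \<otimes>\<^bsub>?M\<^esub> (x \<oplus>\<^bsub>?M\<^esub> y)) (i, l) = (z \<otimes>\<^bsub>?M\<^esub> x \<oplus>\<^bsub>?M\<^esub> z \<otimes>\<^bsub>?M\<^esub> y) (i, l)" .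
    qed auto
  qed
  then show ?thesis
  proof (rule k_algebra.intro, unfold_locales)
    fix x y and c :: 'k assume x: "x \<in> carrier ?M" and y: "y \<in> carrier ?M"
    show "(c \<odot>\<^bsub>?M\<^esub> x) \<otimes>\<^bsub>?M\<^esub> y = c \<odot>\<^bsub>?M\<^esub> (x \<otimes>\<^bsub>?M\<^esub> y)"
    proof (rule matrix_eqI)
      fix i l assume il: "i < n" "l < n"
      have "((c \<odot>\<^bsub>?M\<^esub> x) \<otimes>\<^bsub>?M\<^esub> y) (i, l) = (\<Oplus>k\<in>{..<n}. c \<odot> (x (i, k) \<otimes> y (k, l)))"
        using x y il by (auto intro!: finsum_cong' smult_closed simp: ec smult_mult_l)
      then show "((c \<odot>\<^bsub>?M\<^esub> x) \<otimes>\<^bsub>?M\<^esub> y) (i, l) = (c \<odot>\<^bsub>?M\<^esub> (x \<otimes>\<^bsub>?M\<^esub> y)) (i, l)"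
        using x y il by (simp add: smult_finsum ec Pi_iff)
    qed auto
    show "x \<otimes>\<^bsub>?M\<^esub> (c \<odot>\<^bsub>?M\<^esub> y) = c \<odot>\<^bsub>?M\<^esub> (x \<otimes>\<^bsub>?M\<^esub> y)"
    proof (rule matrix_eqI)
      fix i l assume il: "i < n" "l < n"
      have "(x \<otimes>\<^bsub>?M\<^esub> (c \<odot>\<^bsub>?M\<^esub> y)) (i, l) = (\<Oplus>k\<in>{..<n}. c \<odot> (x (i, k) \<otimes> y (k, l)))"
        using x y il by (auto intro!: finsum_cong' smult_closed simp: ec smult_mult_r)
      then show "(x \<otimes>\<^bsub>?M\<^esub> (c \<odot>\<^bsub>?M\<^esub> y)) (i, l) = (c \<odot>\<^bsub>?M\<^esub> (x \<otimes>\<^bsub>?M\<^esub> y)) (i, l)"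
        using x y il by (simp add: smult_finsum ec Pi_iff)
    qed auto
  qed (auto intro!: restrict_ext matrix_eqI[of _ n]
      simp: PiE_iff smult_closed smult_l_distr smult_r_distr smult_assoc smult_one)
qed

end

lemma map_matrix_apply [simp]: "i < n \<Longrightarrow> l < n \<Longrightarrow> map_matrix n f M (i, l) = f (M (i, l))"
  by (simp add: map_matrix_def)

lemma map_matrix_extensional [simp]: "map_matrix n f M \<in> extensional (matrix_indices n)"
  by (simp add: map_matrix_def)

lemma algebra_map_map_matrix:
  assumes f: "algebra_map A B f" and A: "k_algebra A" and B: "k_algebra B"
  shows "algebra_map (matrix_algebra n A) (matrix_algebra n B) (map_matrix n f)"
proof -
  interpret A: k_algebra A by fact
  interpret B: k_algebra B by fact
  note ec = matrix_entry_closed[where S = "carrier A" and n = n]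
  show ?thesis
  proof (rule algebra_mapI)
    fix x y assume x: "x \<in> carrier (matrix_algebra n A)" and y: "y \<in> carrier (matrix_algebra n A)"
    show "map_matrix n f (x \<otimes>\<^bsub>matrix_algebra n A\<^esub> y)
        = map_matrix n f x \<otimes>\<^bsub>matrix_algebra n B\<^esub> map_matrix n f y"
      using x y
      by (intro matrix_eqI) (auto simp: algebra_map_finsum[OF f A.ring_axioms B.ring_axioms] ec Pi_iff
        algebra_mapD[OF f] intro!: B.finsum_cong')
  qed (auto intro!: matrix_eqI[of _ n] simp: map_matrix_def PiE_iff algebra_mapD[OF f]
      algebra_map_zero[OF f A.ring_axioms B.ring_axioms])
qed

section \<open>Evaluation of noncommutative polynomials\<close>

definition word_prod :: "('k, 'a, 'z) module_scheme \<Rightarrow> ('x \<Rightarrow> 'a) \<Rightarrow> 'x word \<Rightarrow> 'a" where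
  "word_prod A s w = foldr (\<lambda>x p. s x \<otimes>\<^bsub>A\<^esub> p) (letters w) \<one>\<^bsub>A\<^esub>"

definition free_eval ::
  "('k::field, 'a, 'z) module_scheme \<Rightarrow> ('x \<Rightarrow> 'a) \<Rightarrow> ('x word \<Rightarrow>\<^sub>0 'k) \<Rightarrow> 'a" where
  "free_eval A s = linear_extension A (word_prod A s)"

lemma words_over_simps [simp]:
  "0 \<in> words_over X" "Word [] \<in> words_over X"
  "u + v \<in> words_over X \<longleftrightarrow> u \<in> words_over X \<and> v \<in> words_over X"
  "Word (x # xs) \<in> words_over X \<longleftrightarrow> x \<in> X \<and> Word xs \<in> words_over X"
  by (auto simp: words_over_def zero_word_def plus_word_def)

context k_algebra
begin

lemma word_prod_closed:
  assumes "s \<in> X \<rightarrow> carrier A" "w \<in> words_over X"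
  shows "word_prod A s w \<in> carrier A"
proof -
  have "set xs \<subseteq> X \<Longrightarrow> foldr (\<lambda>x p. s x \<otimes> p) xs \<one> \<in> carrier A" for xs
    using assms(1) by (induction xs) auto
  then show ?thesis using assms(2) by (simp add: word_prod_def words_over_def)
qed

lemma word_prod_0: "word_prod A s 0 = \<one>"
  by (simp add: word_prod_def zero_word_def)

lemma word_prod_add:
  assumes "s \<in> X \<rightarrow> carrier A" "u \<in> words_over X" "v \<in> words_over X"
  shows "word_prod A s (u + v) = word_prod A s u \<otimes> word_prod A s v"
proof -
  have c: "set xs \<subseteq> X \<Longrightarrow> foldr (\<lambda>x p. s x \<otimes> p) xs \<one> \<in> carrier A" for xs
    using assms(1) by (induction xs) auto
  have "set xs \<subseteq> X \<Longrightarrow> set ys \<subseteq> X \<Longrightarrow> foldr (\<lambda>x p. s x \<otimes> p) (xs @ ys) \<one>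
      = foldr (\<lambda>x p. s x \<otimes> p) xs \<one> \<otimes> foldr (\<lambda>x p. s x \<otimes> p) ys \<one>" for xs ys
  proof (induction xs)
    case (Cons x xs)
    have "s x \<in> carrier A" using Cons.prems assms(1) by auto
    then show ?case using Cons c[of xs] c[of ys] by (simp add: m_assoc)
  qed (use c in simp)
  then show ?thesis using assms(2,3) by (simp add: word_prod_def words_over_def plus_word_def)
qed

lemma word_prod_single: "s x \<in> carrier A \<Longrightarrow> word_prod A s (Word [x]) = s x"
  by (simp add: word_prod_def)

lemma free_eval_algebra_map:
  assumes "s \<in> X \<rightarrow> carrier A"
  shows "algebra_map (free_algebra X) A (free_eval A s)"
  unfolding free_algebra_eq free_eval_def using assms
  by (intro linear_extension_algebra_map additive_submonoid_words)
    (auto simp: word_prod_closed word_prod_0 word_prod_add)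

lemma free_eval_word:
  assumes "s \<in> X \<rightarrow> carrier A" "w \<in> words_over X"
  shows "free_eval A s (Poly_Mapping.single w c) = c \<odot> word_prod A s w"
  unfolding free_eval_def using assms by (simp add: linear_extension_single word_prod_closed)

lemma free_eval_gen:
  assumes "s x \<in> carrier A"
  shows "free_eval A s (gen x) = s x"
  unfolding free_eval_def gen_def using assms
  by (simp add: linear_extension_single word_prod_single smult_one)

end

lemma carrier_free_algebra: "carrier (free_algebra X) = {p. Poly_Mapping.keys p \<subseteq> words_over X}"
  by (simp add: free_algebra_eq)

lemma free_algebra_simps [simp]:
  "mult (free_algebra X) = (*)" "one (free_algebra X) = 1"
  "ring.zero (free_algebra X) = 0" "add (free_algebra X) = (+)"
  "smult (free_algebra X) c p = Poly_Mapping.single 0 c * p"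
  by (simp_all add: free_algebra_eq)

lemma gen_closed [simp]: "x \<in> X \<Longrightarrow> gen x \<in> carrier (free_algebra X)"
  by (simp add: carrier_free_algebra gen_def)

lemma single_word_closed [simp]: "w \<in> words_over X \<Longrightarrow> Poly_Mapping.single w c \<in> carrier (free_algebra X)"
  by (simp add: carrier_free_algebra)

text \<open>Phrased with the operations of the type, because the simplifier unfolds the record
  operations of these algebras to \<open>+\<close> and \<open>*\<close>.\<close>

lemma monoid_algebra_closed:
  fixes p q :: "'w::monoid_add \<Rightarrow>\<^sub>0 'k::field"
  assumes Ws: "additive_submonoid Ws"
  defines "S \<equiv> carrier (monoid_algebra Ws)"
  shows "p \<in> S \<Longrightarrow> q \<in> S \<Longrightarrow> p + q \<in> S"
  "p \<in> S \<Longrightarrow> q \<in> S \<Longrightarrow> p * q \<in> S"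
  "p \<in> S \<Longrightarrow> q \<in> S \<Longrightarrow> p - q \<in> S"
  "p \<in> S \<Longrightarrow> - p \<in> S"
  "0 \<in> S" "1 \<in> S"
  "p \<in> S \<Longrightarrow> Poly_Mapping.single 0 c * p \<in> S"
proof -
  have m: "Poly_Mapping.keys (- r) = Poly_Mapping.keys r" for r :: "'w \<Rightarrow>\<^sub>0 'k"
    by (auto simp: in_keys_iff)
  have z: "0 \<in> Ws" using Ws by (simp add: additive_submonoid_def)
  show "p \<in> S \<Longrightarrow> q \<in> S \<Longrightarrow> p + q \<in> S" "p \<in> S \<Longrightarrow> - p \<in> S"
    "p \<in> S \<Longrightarrow> q \<in> S \<Longrightarrow> p * q \<in> S" "0 \<in> S" "1 \<in> S"
    using keys_mult_subset[OF Ws, of p q] keys_add_subset[of p Ws q] z by (simp_all add: S_def m)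
  show "p \<in> S \<Longrightarrow> q \<in> S \<Longrightarrow> p - q \<in> S"
    using keys_add_subset[of p Ws "- q"] by (simp add: S_def m)
  show "p \<in> S \<Longrightarrow> Poly_Mapping.single 0 c * p \<in> S"
    using keys_mult_subset[OF Ws, of "Poly_Mapping.single 0 c" p] z by (simp add: S_def)
qed

lemmas free_algebra_closed = monoid_algebra_closed[OF additive_submonoid_words, folded free_algebra_eq]
lemmas poly_algebra_closed = monoid_algebra_closed[OF additive_submonoid_monomials, folded poly_algebra_eq]

text \<open>The uniqueness half of the universal property. Identities between maps out of F are
  obtained from it below by comparing two composites on generators.\<close>

lemma algebra_map_free_algebra_eq:
  assumes f: "algebra_map (free_algebra X) A f" and g: "algebra_map (free_algebra X) A g"
    and eq: "\<And>x. x \<in> X \<Longrightarrow> f (gen x) = g (gen x)" and p: "p \<in> carrier (free_algebra X)"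
  shows "f p = g p"
proof -
  let ?F = "free_algebra X"
  have word: "w \<in> words_over X \<Longrightarrow> f (Poly_Mapping.single w 1) = g (Poly_Mapping.single w 1)" for w
  proof (cases w)
    case (Word xs)
    have "set xs \<subseteq> X \<Longrightarrow> f (Poly_Mapping.single (Word xs) 1) = g (Poly_Mapping.single (Word xs) 1)"
    proof (induction xs)
      case Nil
      then show ?case
        using algebra_map_one[OF f] algebra_map_one[OF g] by (simp add: zero_word_def[symmetric])
    next
      case (Cons x xs)
      have e: "Poly_Mapping.single (Word (x # xs)) 1 = gen x \<otimes>\<^bsub>?F\<^esub> Poly_Mapping.single (Word xs) 1"
        by (simp add: gen_def mult_single plus_word_def)
      have "gen x \<in> carrier ?F" "Poly_Mapping.single (Word xs) 1 \<in> carrier ?F"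
        using Cons.prems by (simp_all add: words_over_def)
      from algebra_map_mult[OF f this] algebra_map_mult[OF g this]
      show ?case unfolding e using Cons eq[of x] by simp
    qed
    then show "w \<in> words_over X \<Longrightarrow> ?thesis" using Word by (simp add: words_over_def)
  qed
  have "Poly_Mapping.keys p \<subseteq> words_over X" using p by (simp add: carrier_free_algebra)
  then show ?thesis
  proof (induction p rule: poly_mapping_induct_single)
    case zero
    \<comment> \<open>\<open>A\<close> is an arbitrary record here, so \<open>f 0\<close> is
      computed as \<open>0\<close> times \<open>f 1\<close>, that is \<open>0\<close> times the
      unit, for \<open>f\<close> and \<open>g\<close> alike.\<close>
    have "f (0 \<odot>\<^bsub>?F\<^esub> 0) = g (0 \<odot>\<^bsub>?F\<^esub> 0)"
      using algebra_map_smult[OF f, of "1" 0] algebra_map_smult[OF g, of "1" 0]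
        algebra_map_one[OF f] algebra_map_one[OF g]
      by (simp add: free_algebra_closed)
    then show ?case by simp
  next
    case (single w c)
    have e: "Poly_Mapping.single w c = c \<odot>\<^bsub>?F\<^esub> Poly_Mapping.single w 1"
      by (simp add: mult_single)
    show ?case unfolding e
      using single word[of w] algebra_map_smult[OF f, of "Poly_Mapping.single w 1" c]
       algebra_map_smult[OF g, of "Poly_Mapping.single w 1" c] by simp
  next
    case (add p q)
    then show ?case
      using algebra_map_add[OF f, of p q] algebra_map_add[OF g, of p q] by (simp add: carrier_free_algebra)
  qed
qed

section \<open>Evaluation of polynomials\<close>

definition pvar :: "'v \<Rightarrow> ('v \<Rightarrow>\<^sub>0 nat) \<Rightarrow>\<^sub>0 'k::field" where
  "pvar v = Poly_Mapping.single (Poly_Mapping.single v 1) 1"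

lemma carrier_poly_algebra: "carrier (poly_algebra W) = {p. Poly_Mapping.keys p \<subseteq> monomials_over W}"
  by (simp add: poly_algebra_eq)

lemma poly_algebra_simps [simp]:
  "mult (poly_algebra W) = (*)" "one (poly_algebra W) = 1"
  "ring.zero (poly_algebra W) = 0" "add (poly_algebra W) = (+)"
  "smult (poly_algebra W) c p = Poly_Mapping.single 0 c * p"
  by (simp_all add: poly_algebra_eq)

lemma pvar_closed [simp]: "v \<in> W \<Longrightarrow> pvar v \<in> carrier (poly_algebra W)"
  by (simp add: carrier_poly_algebra pvar_def monomials_over_def)

lemma poly_algebra_sum_closed:
  "(\<And>i. i \<in> S \<Longrightarrow> f i \<in> carrier (poly_algebra W)) \<Longrightarrow> sum f S \<in> carrier (poly_algebra W)"
  by (induction S rule: infinite_finite_induct) (auto simp: poly_algebra_closed)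

context comm_k_algebra
begin

sublocale comm: cring A
  by unfold_locales (rule mult_comm)

lemma monomial_prod_superset:
  assumes "s \<in> W \<rightarrow> carrier A" "finite S" "Poly_Mapping.keys m \<subseteq> S" "S \<subseteq> W"
  shows "(\<Otimes>v\<in>Poly_Mapping.keys m. s v [^] Poly_Mapping.lookup m v)
    = (\<Otimes>v\<in>S. s v [^] (Poly_Mapping.lookup m v :: nat))"
proof -
  have "s v \<in> carrier A" if "v \<in> S" for v using assms that by auto
  then show ?thesis using assms
    by (intro comm.finprod_mono_neutral_cong_left) (auto simp: in_keys_iff)
qed

text \<open>Multiplicativity on monomials: the two products and the product for the sum of exponents
  are compared over the union of the supports, where exponents simply add.\<close>

lemma poly_eval_algebra_map:
  assumes s: "s \<in> W \<rightarrow> carrier A"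
  shows "algebra_map (poly_algebra W) A (poly_eval A s)"
proof -
  let ?m = "\<lambda>m. \<Otimes>v\<in>Poly_Mapping.keys m. s v [^] (Poly_Mapping.lookup m v :: nat)"
  have c: "?m m \<in> carrier A" if "m \<in> monomials_over W" for m
    using s that by (intro comm.finprod_closed) (auto simp: monomials_over_def)
  have "?m (m + m') = ?m m \<otimes> ?m m'" if "m \<in> monomials_over W" "m' \<in> monomials_over W" for m m'
  proof -
    let ?S = "Poly_Mapping.keys m \<union> Poly_Mapping.keys m'"
    have S: "finite ?S" "?S \<subseteq> W" "\<And>v. v \<in> ?S \<Longrightarrow> s v \<in> carrier A"
      using that s by (auto simp: monomials_over_def)
    have "?m (m + m') = (\<Otimes>v\<in>?S. s v [^] (Poly_Mapping.lookup (m + m') v :: nat))"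
      using S keys_add[of m m'] by (intro monomial_prod_superset[OF s]) auto
    also have "\<dots> = (\<Otimes>v\<in>?S. s v [^] Poly_Mapping.lookup m v \<otimes> s v [^] Poly_Mapping.lookup m' v)"
      using S by (intro comm.finprod_cong' refl) (auto simp: lookup_add nat_pow_mult)
    also have "\<dots> = (\<Otimes>v\<in>?S. s v [^] Poly_Mapping.lookup m v) \<otimes> (\<Otimes>v\<in>?S. s v [^] Poly_Mapping.lookup m' v)"
      using S by (intro comm.finprod_multf) auto
    also have "\<dots> = ?m m \<otimes> ?m m'"
      using S by (simp add: monomial_prod_superset[OF s, of ?S])
    finally show ?thesis .
  qed
  moreover have "poly_eval A s = linear_extension A ?m"
    by (simp add: fun_eq_iff poly_eval_def linear_extension_def)
  ultimately show ?thesis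
    unfolding poly_algebra_eq using c
    by (auto intro!: linear_extension_algebra_map additive_submonoid_monomials)
qed

lemma poly_eval_pvar:
  assumes "s v \<in> carrier A"
  shows "poly_eval A s (pvar v) = s v"
  using assms by (simp add: poly_eval_def pvar_def smult_one)

end

lemma algebra_map_poly_algebra_eq:
  fixes f g :: "(('v \<Rightarrow>\<^sub>0 nat) \<Rightarrow>\<^sub>0 'k::field) \<Rightarrow> 'b"
  assumes f: "algebra_map (poly_algebra W) A f" and g: "algebra_map (poly_algebra W) A g"
    and eq: "\<And>v. v \<in> W \<Longrightarrow> f (pvar v) = g (pvar v)" and p: "p \<in> carrier (poly_algebra W)"
  shows "f p = g p"
proof -
  let ?F = "poly_algebra W"
  let ?s = "\<lambda>m. Poly_Mapping.single m (1::'k)"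
  have cl: "?s m \<in> carrier ?F" if "m \<in> monomials_over W" for m
    using that by (simp add: carrier_poly_algebra)
  have mult: "f (?s (m + m')) = g (?s (m + m'))"
    if "m \<in> monomials_over W" "m' \<in> monomials_over W" "f (?s m) = g (?s m)" "f (?s m') = g (?s m')" for m m'
    using algebra_map_mult[OF f cl[OF that(1)] cl[OF that(2)]] algebra_map_mult[OF g cl[OF that(1)] cl[OF that(2)]] that(3,4)
    by (simp add: mult_single)
  have mon: "m \<in> monomials_over W \<Longrightarrow> f (?s m) = g (?s m)" for m
  proof -
    assume "m \<in> monomials_over W"
    then have "Poly_Mapping.keys m \<subseteq> W" by (simp add: monomials_over_def)
    then show ?thesis
    proof (induction m rule: poly_mapping_induct_single)
      case zero
      then show ?case using algebra_map_one[OF f] algebra_map_one[OF g] by simp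
    next
      case (single v c)
      show ?case
      proof (induction c)
        case 0
        then show ?case using algebra_map_one[OF f] algebra_map_one[OF g] by simp
      next
        case (Suc c)
        have "f (?s (Poly_Mapping.single v 1 + Poly_Mapping.single v c))
            = g (?s (Poly_Mapping.single v 1 + Poly_Mapping.single v c))"
          using single Suc eq[OF single] by (intro mult) (auto simp: monomials_over_def pvar_def)
        then show ?case by (simp add: single_add[symmetric])
      qed
    next
      case (add m m')
      then show ?case by (intro mult) (auto simp: monomials_over_def)
    qed
  qed
  have "Poly_Mapping.keys p \<subseteq> monomials_over W" using p by (simp add: carrier_poly_algebra)
  then show ?thesis
  proof (induction p rule: poly_mapping_induct_single)
    case zero
    show ?case
      using algebra_map_smult[OF f, of "1" 0] algebra_map_smult[OF g, of "1" 0]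
        algebra_map_one[OF f] algebra_map_one[OF g]
      by (simp add: poly_algebra_closed)
  next
    case (single w c)
    have e: "Poly_Mapping.single w c = c \<odot>\<^bsub>?F\<^esub> ?s w"
      by (simp add: mult_single)
    show ?case unfolding e
      using single mon[of w] algebra_map_smult[OF f cl, of w c]
       algebra_map_smult[OF g cl, of w c] by simp
  next
    case (add p q)
    then show ?case
      using algebra_map_add[OF f, of p q] algebra_map_add[OF g, of p q] by (simp add: carrier_poly_algebra)
  qed
qed

section \<open>Homogeneous components\<close>

definition restrict_keys :: "('w \<Rightarrow> bool) \<Rightarrow> ('w \<Rightarrow>\<^sub>0 'v::zero) \<Rightarrow> 'w \<Rightarrow>\<^sub>0 'v" where
  "restrict_keys Q p = Poly_Mapping.mapp (\<lambda>w c. c when Q w) p"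

lemma lookup_restrict_keys [simp]:
  "Poly_Mapping.lookup (restrict_keys Q p) w = (Poly_Mapping.lookup p w when Q w)"
  by (auto simp: restrict_keys_def lookup_mapp when_def in_keys_iff)

lemma keys_restrict_keys [simp]:
  "Poly_Mapping.keys (restrict_keys Q p) = {w \<in> Poly_Mapping.keys p. Q w}"
  by (auto simp: in_keys_iff when_def split: if_splits)

lemma restrict_keys_zero [simp]: "restrict_keys Q 0 = 0"
  by (rule poly_mapping_eqI) simp

lemma restrict_keys_add: "restrict_keys Q (p + q) = restrict_keys Q p + restrict_keys Q (q :: _ \<Rightarrow>\<^sub>0 'v::comm_monoid_add)"
  by (rule poly_mapping_eqI) (simp add: lookup_add when_def)

lemma restrict_keys_uminus: "restrict_keys Q (- p) = - restrict_keys Q (p :: _ \<Rightarrow>\<^sub>0 'v::ab_group_add)"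
  by (rule poly_mapping_eqI) (simp add: when_def)

lemma restrict_keys_diff: "restrict_keys Q (p - q) = restrict_keys Q p - restrict_keys Q (q :: _ \<Rightarrow>\<^sub>0 'v::ab_group_add)"
  by (rule poly_mapping_eqI) (simp add: lookup_minus when_def)

lemma restrict_keys_sum:
  "restrict_keys Q (sum f S) = (\<Sum>i\<in>S. restrict_keys Q (f i :: _ \<Rightarrow>\<^sub>0 'v::comm_monoid_add))"
  by (induction S rule: infinite_finite_induct) (simp_all add: restrict_keys_add)

lemma restrict_keys_id: "(\<And>w. w \<in> Poly_Mapping.keys p \<Longrightarrow> Q w) \<Longrightarrow> restrict_keys Q p = p"
  by (rule poly_mapping_eqI) (auto simp: when_def in_keys_iff)

lemma restrict_keys_eq_0: "(\<And>w. w \<in> Poly_Mapping.keys p \<Longrightarrow> \<not> Q w) \<Longrightarrow> restrict_keys Q p = 0"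
  by (rule poly_mapping_eqI) (auto simp: when_def in_keys_iff)

lemma restrict_keys_single:
  "restrict_keys Q (Poly_Mapping.single w c) = (if Q w then Poly_Mapping.single w c else 0)"
  by (rule poly_mapping_eqI) (auto simp: when_def lookup_single)

text \<open>Meant for \<open>f\<close> homogeneous of degree e: if \<open>Q w\<close> is
  \<open>wt w = D\<close>, then \<open>Q' u\<close> is \<open>wt u + e = D\<close>, a form of
  "degree D - e" without truncated subtraction.\<close>

lemma restrict_keys_mult_right:
  fixes p f :: "'w::monoid_add \<Rightarrow>\<^sub>0 'k::semiring_0"
  assumes "\<And>u v. v \<in> Poly_Mapping.keys f \<Longrightarrow> Q (u + v) = Q' u"
  shows "restrict_keys Q (p * f) = restrict_keys Q' p * f"
proof -
  have "Poly_Mapping.keys p \<subseteq> UNIV" by simp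
  then show ?thesis
  proof (induction p rule: poly_mapping_induct_single)
    case (single u c)
    have "Poly_Mapping.keys f \<subseteq> {v. \<forall>u. Q (u + v) = Q' u}" using assms by auto
    then show ?case
      by (induction f rule: poly_mapping_induct_single)
        (auto simp: mult_single restrict_keys_single distrib_left restrict_keys_add)
  qed (simp_all add: distrib_right restrict_keys_add)
qed

lemma sum_restrict_keys:
  fixes p :: "'w \<Rightarrow>\<^sub>0 'v::comm_monoid_add"
  assumes "finite Ds" "\<And>w. w \<in> Poly_Mapping.keys p \<Longrightarrow> g w \<in> Ds"
  shows "p = (\<Sum>d\<in>Ds. restrict_keys (\<lambda>w. g w = d) p)"
proof (rule poly_mapping_eqI)
  fix w
  have "Poly_Mapping.lookup p w = (\<Sum>d\<in>Ds. if d = g w then Poly_Mapping.lookup p w else 0)"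
    using assms by (cases "w \<in> Poly_Mapping.keys p") (auto simp: in_keys_iff)
  also have "\<dots> = Poly_Mapping.lookup (\<Sum>d\<in>Ds. restrict_keys (\<lambda>w. g w = d) p) w"
    by (auto simp: lookup_sum when_def intro!: sum.cong)
  finally show "Poly_Mapping.lookup p w = Poly_Mapping.lookup (\<Sum>d\<in>Ds. restrict_keys (\<lambda>w. g w = d) p) w" .
qed

lemma sum_mem_closed:
  assumes "0 \<in> S" "\<And>x y. x \<in> S \<Longrightarrow> y \<in> S \<Longrightarrow> x + y \<in> S" "\<And>i. i \<in> I \<Longrightarrow> f i \<in> S"
  shows "sum f I \<in> (S :: 'r::comm_monoid_add set)"
  using assms(3) by (induction I rule: infinite_finite_induct) (auto simp: assms(1,2))

section \<open>Koszul syzygies and regular sequences\<close>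

text \<open>A skew matrix \<open>s\<close> with zero diagonal is an element of the second exterior
  power, and \<open>a\<close> is its image under the Koszul differential;
  \<open>koszul_exact\<close> thus says that the first Koszul homology of the family vanishes. The
  ring is a subset \<open>S\<close> of a type, as polynomial algebras in a set of variables
  are.\<close>

definition koszul_trivial ::
  "'r::comm_ring_1 set \<Rightarrow> ('i \<Rightarrow> 'r) \<Rightarrow> 'i set \<Rightarrow> ('i \<Rightarrow> 'r) \<Rightarrow> bool" where
  "koszul_trivial S f I a \<longleftrightarrow> (\<exists>s. (\<forall>i\<in>I. \<forall>l\<in>I. s i l \<in> S \<and> s i l = - s l i) \<and>
     (\<forall>i\<in>I. s i i = 0) \<and> (\<forall>i\<in>I. a i = (\<Sum>l\<in>I. s i l * f l)))"

definition koszul_exact :: "'r::comm_ring_1 set \<Rightarrow> ('i \<Rightarrow> 'r) \<Rightarrow> 'i set \<Rightarrow> bool" where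
  "koszul_exact S f I \<longleftrightarrow>
     (\<forall>a. (\<forall>i\<in>I. a i \<in> S) \<longrightarrow> (\<Sum>i\<in>I. a i * f i) = 0 \<longrightarrow> koszul_trivial S f I a)"

lemma koszul_exactD:
  assumes "koszul_exact S f I" "\<And>i. i \<in> I \<Longrightarrow> a i \<in> S" "(\<Sum>i\<in>I. a i * f i) = 0"
  shows "koszul_trivial S f I a"
  using assms unfolding koszul_exact_def by simp

lemma koszul_trivial_sum:
  assumes "\<And>d. d \<in> Ds \<Longrightarrow> koszul_trivial S f I (a d)"
    and S: "0 \<in> S" "\<And>x y. x \<in> S \<Longrightarrow> y \<in> S \<Longrightarrow> x + y \<in> S"
  shows "koszul_trivial S f I (\<lambda>i. \<Sum>d\<in>Ds. a d i)"
proof -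
  have "\<forall>d\<in>Ds. \<exists>s. (\<forall>i\<in>I. \<forall>l\<in>I. s i l \<in> S \<and> s i l = - s l i) \<and>
     (\<forall>i\<in>I. s i i = 0) \<and> (\<forall>i\<in>I. a d i = (\<Sum>l\<in>I. s i l * f l))"
    using assms(1) unfolding koszul_trivial_def by blast
  from bchoice[OF this] obtain s where
    s: "\<forall>d\<in>Ds. (\<forall>i\<in>I. \<forall>l\<in>I. s d i l \<in> S \<and> s d i l = - s d l i) \<and>
     (\<forall>i\<in>I. s d i i = 0) \<and> (\<forall>i\<in>I. a d i = (\<Sum>l\<in>I. s d i l * f l))"
    by blast
  have "(\<Sum>d\<in>Ds. s d i l) \<in> S" if "i \<in> I" "l \<in> I" for i l
  proof (rule sum_mem_closed)
    show "s d i l \<in> S" if "d \<in> Ds" for d using s that \<open>i \<in> I\<close> \<open>l \<in> I\<close> by blast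
  qed (rule S; assumption)+
  moreover have "(\<Sum>d\<in>Ds. s d i l) = - (\<Sum>d\<in>Ds. s d l i)" if "i \<in> I" "l \<in> I" for i l
    unfolding sum_negf[symmetric] by (rule sum.cong) (use s that in blast)+
  moreover have "(\<Sum>d\<in>Ds. a d i) = (\<Sum>l\<in>I. (\<Sum>d\<in>Ds. s d i l) * f l)" if "i \<in> I" for i
  proof -
    have "(\<Sum>d\<in>Ds. a d i) = (\<Sum>d\<in>Ds. \<Sum>l\<in>I. s d i l * f l)"
      by (rule sum.cong) (use s that in blast)+
    also have "\<dots> = (\<Sum>l\<in>I. (\<Sum>d\<in>Ds. s d i l) * f l)"
      by (subst sum.swap) (simp add: sum_distrib_right)
    finally show ?thesis .
  qed
  moreover have "(\<Sum>d\<in>Ds. s d i i) = 0" if "i \<in> I" for i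
    by (rule sum.neutral) (use s that in blast)
  ultimately show ?thesis
    unfolding koszul_trivial_def by (intro exI[of _ "\<lambda>i l. \<Sum>d\<in>Ds. s d i l"] conjI ballI) assumption+
qed

section \<open>Homogeneous syzygies\<close>

context
  fixes Ws :: "'w::comm_monoid_add set" and wt :: "'w \<Rightarrow> nat"
    and S :: "('w \<Rightarrow>\<^sub>0 'k::field) set" and f :: "'i \<Rightarrow> 'w \<Rightarrow>\<^sub>0 'k" and e :: "'i \<Rightarrow> nat"
  assumes Ws: "additive_submonoid Ws" and S_def: "S = carrier (monoid_algebra Ws)"
    and wt_add: "\<And>u v. wt (u + v) = wt u + wt v"
begin

lemma S_closed:
  "p \<in> S \<Longrightarrow> q \<in> S \<Longrightarrow> p + q \<in> S" "p \<in> S \<Longrightarrow> q \<in> S \<Longrightarrow> p * q \<in> S"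
  "p \<in> S \<Longrightarrow> q \<in> S \<Longrightarrow> p - q \<in> S" "p \<in> S \<Longrightarrow> - p \<in> S" "0 \<in> S" "1 \<in> S"
  unfolding S_def by (fact monoid_algebra_closed[OF Ws])+

lemma S_restrict_keys: "p \<in> S \<Longrightarrow> restrict_keys Q p \<in> S"
  unfolding S_def by auto

text \<open>The i-th coefficient is cut in degree D - e i, so that every summand is cut in degree D;
  the result is the degree D part of a zero sum.\<close>

lemma restrict_syzygy:
  assumes f: "\<And>i w. i \<in> I \<Longrightarrow> w \<in> Poly_Mapping.keys (f i) \<Longrightarrow> wt w = e i"
    and a: "(\<Sum>i\<in>I. a i * f i) = 0"
  shows "(\<Sum>i\<in>I. restrict_keys (\<lambda>w. wt w + e i = D) (a i) * f i) = 0"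
proof -
  have "(\<Sum>i\<in>I. restrict_keys (\<lambda>w. wt w + e i = D) (a i) * f i)
      = restrict_keys (\<lambda>w. wt w = D) (\<Sum>i\<in>I. a i * f i)"
    unfolding restrict_keys_sum using f
    by (intro sum.cong refl restrict_keys_mult_right[symmetric]) (simp add: wt_add)
  then show ?thesis by (simp add: a)
qed

text \<open>
  Graded Nakayama: the syzygies of \<open>(f\<^sub>i)\<^sub>i\<^sub>\<in>\<^sub>I\<close> are Koszul up to \<open>f\<^sub>i\<^sub>0\<close> times further syzygies, which
  have smaller degree.
\<close>

lemma koszul_exact_remove:
  assumes fin: "finite I" and i0: "i0 \<notin> I" and ex: "koszul_exact S f (insert i0 I)"
    and f: "\<And>i w. i \<in> insert i0 I \<Longrightarrow> w \<in> Poly_Mapping.keys (f i) \<Longrightarrow> wt w = e i"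
    and e: "e i0 > 0" and fS: "f i0 \<in> S"
  shows "koszul_exact S f I"
proof -
  have hom: "koszul_trivial S f I a"
    if "\<And>i. i \<in> I \<Longrightarrow> a i \<in> S" "(\<Sum>i\<in>I. a i * f i) = 0"
      "\<And>i w. i \<in> I \<Longrightarrow> w \<in> Poly_Mapping.keys (a i) \<Longrightarrow> wt w + e i = D" for D a
    using that
  proof (induction D arbitrary: a rule: less_induct)
    case (less D)
    \<comment> \<open>With coefficient 0 at \<open>i0\<close> the syzygy belongs to the larger
      family, where exactness is known.\<close>
    let ?a = "\<lambda>i. if i = i0 then 0 else a i"
    have "(\<Sum>i\<in>insert i0 I. ?a i * f i) = (\<Sum>i\<in>I. a i * f i)"
      using fin i0 by (auto intro!: sum.cong)
    then have "koszul_trivial S f (insert i0 I) ?a"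
      using less.prems(1,2) S_closed(5) by (intro koszul_exactD[OF ex]) auto
    then obtain s where s0: "\<forall>i\<in>insert i0 I. \<forall>l\<in>insert i0 I. s i l \<in> S \<and> s i l = - s l i"
      "\<forall>i\<in>insert i0 I. s i i = 0" "\<forall>i\<in>insert i0 I. ?a i = (\<Sum>l\<in>insert i0 I. s i l * f l)"
      unfolding koszul_trivial_def by blast
    have s: "\<And>i l. i \<in> insert i0 I \<Longrightarrow> l \<in> insert i0 I \<Longrightarrow> s i l \<in> S"
      "\<And>i l. i \<in> insert i0 I \<Longrightarrow> l \<in> insert i0 I \<Longrightarrow> s i l = - s l i"
      "\<And>i. i \<in> insert i0 I \<Longrightarrow> s i i = 0"
      "\<And>i. i \<in> insert i0 I \<Longrightarrow> ?a i = (\<Sum>l\<in>insert i0 I. s i l * f l)"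
      using s0 by blast+
    \<comment> \<open>The entry (i, l) is cut in degree D - e i - e l, the degree that fits the i-th
      equation. The condition is symmetric in i and l, so skewness survives.\<close>
    define s' where "s' i l = restrict_keys (\<lambda>w. wt w + e l + e i = D) (s i l)" for i l
    have s'S: "s' i l \<in> S" if "i \<in> insert i0 I" "l \<in> insert i0 I" for i l
      unfolding s'_def using s(1)[OF that] by (rule S_restrict_keys)
    have s'_anti: "s' i l = - s' l i" if "i \<in> insert i0 I" "l \<in> insert i0 I" for i l
      unfolding s'_def by (subst s(2)[OF that]) (simp add: restrict_keys_uminus ac_simps)
    have s'_diag: "s' i i = 0" if "i \<in> insert i0 I" for i
      unfolding s'_def by (simp add: s(3)[OF that])
    have proj: "restrict_keys (\<lambda>w. wt w + e i = D) (\<Sum>l\<in>insert i0 I. s i l * f l)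
        = (\<Sum>l\<in>insert i0 I. s' i l * f l)" for i
      unfolding restrict_keys_sum s'_def using f
      by (intro sum.cong refl restrict_keys_mult_right) (simp add: wt_add ac_simps)
    have a_eq: "a i = s' i i0 * f i0 + (\<Sum>l\<in>I. s' i l * f l)" if "i \<in> I" for i
    proof -
      have r: "restrict_keys (\<lambda>w. wt w + e i = D) (a i) = a i"
        using less.prems(3)[OF that] by (simp add: restrict_keys_id)
      have "a i = (\<Sum>l\<in>insert i0 I. s i l * f l)" using s(4)[of i] that i0 by (metis insertI2)
      from arg_cong[OF this, of "restrict_keys (\<lambda>w. wt w + e i = D)"]
      have "a i = (\<Sum>l\<in>insert i0 I. s' i l * f l)" unfolding proj r .
      then show ?thesis using fin i0 by simp
    qed
    \<comment> \<open>The equation at \<open>i0\<close> has left side 0 and says that row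
      \<open>i0\<close> of \<open>s'\<close> is a syzygy of the smaller family. Its degree is D - e
      i0, so positivity of \<open>e i0\<close> makes the induction hypothesis applicable.\<close>
    have b: "(\<Sum>l\<in>I. s' i0 l * f l) = 0"
    proof -
      have "0 = (\<Sum>l\<in>insert i0 I. s i0 l * f l)" using s(4)[of i0] by simp
      from arg_cong[OF this, of "restrict_keys (\<lambda>w. wt w + e i0 = D)"]
      have "0 = (\<Sum>l\<in>insert i0 I. s' i0 l * f l)" unfolding proj restrict_keys_zero .
      then show ?thesis using fin i0 s'_diag[of i0] by simp
    qed
    have "koszul_trivial S f I (s' i0)"
    proof (cases "e i0 \<le> D")
      case True
      show ?thesis
      proof (rule less.IH[of "D - e i0"])
        show "D - e i0 < D" using e True by simp
      qed (use b s'S in \<open>auto simp: s'_def\<close>)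
    next
      case False
      \<comment> \<open>No exponent satisfies \<open>wt w + e l + e i0 = D\<close> when
        \<open>D < e i0\<close>.\<close>
      then have "s' i0 l = 0" for l unfolding s'_def by (intro restrict_keys_eq_0) auto
      then show ?thesis
        unfolding koszul_trivial_def using S_closed(5) by (intro exI[of _ "\<lambda>_ _. 0"]) auto
    qed
    then obtain t where t0: "\<forall>i\<in>I. \<forall>l\<in>I. t i l \<in> S \<and> t i l = - t l i"
      "\<forall>i\<in>I. t i i = 0" "\<forall>i\<in>I. s' i0 i = (\<Sum>l\<in>I. t i l * f l)"
      unfolding koszul_trivial_def by blast
    have t: "\<And>i l. i \<in> I \<Longrightarrow> l \<in> I \<Longrightarrow> t i l \<in> S"
      "\<And>i l. i \<in> I \<Longrightarrow> l \<in> I \<Longrightarrow> t i l = - t l i" "\<And>i. i \<in> I \<Longrightarrow> t i i = 0"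
      "\<And>i. i \<in> I \<Longrightarrow> s' i0 i = (\<Sum>l\<in>I. t i l * f l)"
      using t0 by blast+
    show ?case
      unfolding koszul_trivial_def
    \<comment> \<open>By skewness column \<open>i0\<close> is minus row \<open>i0\<close>, hence
      minus \<open>t\<close> applied to \<open>f\<close>; substituting this in \<open>a_eq\<close>
      turns the term with \<open>f i0\<close> into a multiple of \<open>t\<close>.\<close>
    proof (intro exI[of _ "\<lambda>i l. s' i l - f i0 * t i l"] conjI ballI)
      fix i l assume il: "i \<in> I" "l \<in> I"
      show "s' i l - f i0 * t i l \<in> S" using il t(1) s'S fS by (intro S_closed) auto
      have "s' i l = - s' l i" using s'_anti il by blast
      moreover have "t i l = - t l i" using t(2) il by blast
      ultimately show "s' i l - f i0 * t i l = - (s' l i - f i0 * t l i)" by simp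
    next
      fix i assume i: "i \<in> I"
      show "s' i i - f i0 * t i i = 0" using s'_diag t(3) i by simp
      have "s' i i0 = - s' i0 i" using s'_anti i by blast
      then have "a i = - (\<Sum>l\<in>I. t i l * f l) * f i0 + (\<Sum>l\<in>I. s' i l * f l)"
        using a_eq[OF i] t(4)[OF i] by simp
      also have "\<dots> = (\<Sum>l\<in>I. (s' i l - f i0 * t i l) * f l)"
        by (simp add: sum_distrib_right sum_distrib_left sum_subtractf algebra_simps)
      finally show "a i = (\<Sum>l\<in>I. (s' i l - f i0 * t i l) * f l)" .
    qed
  qed
  show ?thesis unfolding koszul_exact_def
  proof (intro allI impI)
    fix a assume a: "\<forall>i\<in>I. a i \<in> S" "(\<Sum>i\<in>I. a i * f i) = 0"
    define Ds where "Ds = (\<Union>i\<in>I. (\<lambda>w. wt w + e i) ` Poly_Mapping.keys (a i))"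
    have "koszul_trivial S f I (\<lambda>i. \<Sum>D\<in>Ds. restrict_keys (\<lambda>w. wt w + e i = D) (a i))"
    proof (rule koszul_trivial_sum)
      fix D
      have "(\<Sum>i\<in>I. restrict_keys (\<lambda>w. wt w + e i = D) (a i) * f i) = 0"
        using f a(2) by (intro restrict_syzygy) auto
      then show "koszul_trivial S f I (\<lambda>i. restrict_keys (\<lambda>w. wt w + e i = D) (a i))"
        using a by (intro hom[of _ D]) (auto intro: S_restrict_keys)
    qed (auto intro: S_closed)
    moreover have "(\<Sum>D\<in>Ds. restrict_keys (\<lambda>w. wt w + e i = D) (a i)) = a i" if "i \<in> I" for i
      using fin that by (intro sum_restrict_keys[symmetric]) (auto simp: Ds_def)
    ultimately show "koszul_trivial S f I a" unfolding koszul_trivial_def by auto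
  qed
qed

end

text \<open>The hypothesis \<open>eq\<close> is a syzygy with coefficient \<open>g\<close> at
  \<open>i0\<close>. If it is Koszul, \<open>g\<close> is row \<open>i0\<close> of a skew matrix
  applied to \<open>f\<close>, and the zero diagonal removes \<open>f i0\<close> from that
  combination.\<close>

lemma koszul_exact_nonzerodivisor:
  assumes fin: "finite I" and i0: "i0 \<notin> I" and ex: "koszul_exact S f (insert i0 I)"
    and S: "\<And>x. x \<in> S \<Longrightarrow> - x \<in> S" and g: "g \<in> S" and c: "\<And>i. i \<in> I \<Longrightarrow> c i \<in> S"
    and eq: "f i0 * g = (\<Sum>i\<in>I. c i * f i)"
  shows "\<exists>c. (\<forall>i\<in>I. c i \<in> S) \<and> g = (\<Sum>i\<in>I. c i * f i)"
proof -
  let ?a = "\<lambda>i. if i = i0 then g else - c i"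
  have "(\<Sum>i\<in>I. ?a i * f i) = (\<Sum>i\<in>I. - c i * f i)"
    using i0 by (intro sum.cong) auto
  then have "(\<Sum>i\<in>insert i0 I. ?a i * f i) = g * f i0 - (\<Sum>i\<in>I. c i * f i)"
    using fin i0 by (simp add: sum_negf)
  then have "(\<Sum>i\<in>insert i0 I. ?a i * f i) = 0" using eq by (simp add: mult.commute)
  moreover have "?a i \<in> S" if "i \<in> insert i0 I" for i using that c g S by auto
  ultimately have "koszul_trivial S f (insert i0 I) ?a"
    by (intro koszul_exactD[OF ex])
  then obtain s where "\<forall>i\<in>insert i0 I. \<forall>l\<in>insert i0 I. s i l \<in> S \<and> s i l = - s l i"
      "\<forall>i\<in>insert i0 I. s i i = 0" "\<forall>i\<in>insert i0 I. ?a i = (\<Sum>l\<in>insert i0 I. s i l * f l)"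
    unfolding koszul_trivial_def by blast
  then have "\<forall>l\<in>I. s i0 l \<in> S" "s i0 i0 = 0" "?a i0 = (\<Sum>l\<in>insert i0 I. s i0 l * f l)"
    by blast+
  then show ?thesis using fin i0 by (intro exI[of _ "s i0"]) simp
qed

lemma genideal_image_poly_algebra:
  fixes f :: "'i \<Rightarrow> ('v \<Rightarrow>\<^sub>0 nat) \<Rightarrow>\<^sub>0 'k::field"
  assumes fin: "finite I" and f: "\<And>i. i \<in> I \<Longrightarrow> f i \<in> carrier (poly_algebra W)"
  shows "Idl\<^bsub>poly_algebra W\<^esub> (f ` I) =
    {(\<Sum>i\<in>I. c i * f i) | c. \<forall>i\<in>I. c i \<in> carrier (poly_algebra W)}" (is "_ = ?T")
proof -
  let ?P = "poly_algebra W :: ('k, ('v \<Rightarrow>\<^sub>0 nat) \<Rightarrow>\<^sub>0 'k) module"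
  interpret P: comm_k_algebra ?P by (rule comm_k_algebra_poly_algebra)
  have sub: "f ` I \<subseteq> carrier ?P" using f by auto
  have "ideal ?T ?P"
  proof (rule idealI)
    show "ring ?P" by (rule P.ring_axioms)
    show "subgroup ?T (add_monoid ?P)"
    proof (rule P.add.subgroupI)
      show "?T \<subseteq> carrier ?P" using f by (auto intro!: poly_algebra_sum_closed poly_algebra_closed)
      have "(\<Sum>i\<in>I. 0 * f i) \<in> ?T"
        by (intro CollectI exI[of _ "\<lambda>_. 0"]) (simp add: poly_algebra_closed)
      then show "?T \<noteq> {}" by blast
    next
      fix a b assume "a \<in> ?T" "b \<in> ?T"
      then obtain c d where c: "a = (\<Sum>i\<in>I. c i * f i)" "\<forall>i\<in>I. c i \<in> carrier ?P"
        and d: "b = (\<Sum>i\<in>I. d i * f i)" "\<forall>i\<in>I. d i \<in> carrier ?P" by blast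
      have "a + b = (\<Sum>i\<in>I. (c i + d i) * f i)" by (simp add: c d sum.distrib distrib_right)
      then show "a \<oplus>\<^bsub>?P\<^esub> b \<in> ?T" using c d by (auto intro!: exI[of _ "\<lambda>i. c i + d i"] poly_algebra_closed)
    next
      fix a assume "a \<in> ?T"
      then obtain c where c: "a = (\<Sum>i\<in>I. c i * f i)" "\<forall>i\<in>I. c i \<in> carrier ?P" by blast
      then have "a \<in> carrier ?P" using f by (auto intro!: poly_algebra_sum_closed poly_algebra_closed)
      then have "\<ominus>\<^bsub>?P\<^esub> a = - a"
        by (intro P.minus_equality) (auto intro: poly_algebra_closed)
      moreover have "- a = (\<Sum>i\<in>I. (- c i) * f i)" by (simp add: c sum_negf)
      ultimately show "\<ominus>\<^bsub>?P\<^esub> a \<in> ?T"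
        using c by (auto intro!: exI[of _ "\<lambda>i. - c i"] poly_algebra_closed)
    qed
    fix a x assume "a \<in> ?T" and x: "x \<in> carrier ?P"
    then obtain c where c: "a = (\<Sum>i\<in>I. c i * f i)" "\<forall>i\<in>I. c i \<in> carrier ?P" by blast
    then have "x * a = (\<Sum>i\<in>I. (x * c i) * f i)" by (simp add: sum_distrib_left mult.assoc)
    then show "x \<otimes>\<^bsub>?P\<^esub> a \<in> ?T" using c x by (auto intro!: exI[of _ "\<lambda>i. x * c i"] poly_algebra_closed)
    then show "a \<otimes>\<^bsub>?P\<^esub> x \<in> ?T" by (simp add: mult.commute)
  qed
  moreover have "f ` I \<subseteq> ?T"
  proof
    fix y assume "y \<in> f ` I"
    then obtain i where i: "i \<in> I" "y = f i" by blast
    have "f i = (\<Sum>l\<in>I. (if l = i then 1 else 0) * f l)"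
      using i fin by (simp add: if_distrib[of "\<lambda>x. x * _"] cong: if_cong)
    then show "y \<in> ?T" using i by (auto intro!: exI[of _ "\<lambda>l. if l = i then 1 else 0"] poly_algebra_closed)
  qed
  ultimately have "Idl\<^bsub>?P\<^esub> (f ` I) \<subseteq> ?T" by (rule P.genideal_minimal)
  moreover have "?T \<subseteq> Idl\<^bsub>?P\<^esub> (f ` I)"
  proof
    fix y assume "y \<in> ?T"
    then obtain c where c: "y = (\<Sum>i\<in>I. c i * f i)" "\<forall>i\<in>I. c i \<in> carrier ?P" by blast
    interpret id: ideal "Idl\<^bsub>?P\<^esub> (f ` I)" ?P using sub by (rule P.genideal_ideal)
    have "c i * f i \<in> Idl\<^bsub>?P\<^esub> (f ` I)" if "i \<in> I" for i
      using id.I_l_closed[of "f i" "c i"] c that P.genideal_self[OF sub] by auto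
    then show "y \<in> Idl\<^bsub>?P\<^esub> (f ` I)" unfolding c(1) using id.zero_closed id.a_closed
      by (intro sum_mem_closed) auto
  qed
  ultimately show ?thesis by blast
qed

text \<open>Removing one element at a time by \<open>koszul_exact_remove\<close>, every initial
  segment is Koszul exact, which makes each element a nonzerodivisor modulo its predecessors. The
  ideal is proper because the generators have positive degree while 1 has degree 0.\<close>

lemma regular_sequence_if_koszul_exact:
  fixes f :: "'i \<Rightarrow> ('v \<Rightarrow>\<^sub>0 nat) \<Rightarrow>\<^sub>0 'k::field"
  assumes xs: "distinct xs" and ex: "koszul_exact (carrier (poly_algebra W)) f (set xs)"
    and fS: "\<And>i. i \<in> set xs \<Longrightarrow> f i \<in> carrier (poly_algebra W)"
    and wt: "wt 0 = 0" "\<And>u v. wt (u + v) = wt u + wt v"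
    and f: "\<And>i w. i \<in> set xs \<Longrightarrow> w \<in> Poly_Mapping.keys (f i) \<Longrightarrow> wt w = e i"
    and e: "\<And>i. i \<in> set xs \<Longrightarrow> (0::nat) < e i"
  shows "regular_sequence (poly_algebra W) (map f xs)"
proof -
  let ?P = "poly_algebra W :: ('k, ('v \<Rightarrow>\<^sub>0 nat) \<Rightarrow>\<^sub>0 'k) module"
  have Ws: "additive_submonoid (monomials_over W)" by (rule additive_submonoid_monomials)
  \<comment> \<open>Induction on the number of elements cut off at the end.\<close>
  have prefix: "koszul_exact (carrier ?P) f (set (take m xs))" for m
  proof (induction "length xs - m" arbitrary: m)
    case 0
    then show ?case using ex by simp
  next
    case (Suc d)
    then have m: "m < length xs" by simp
    have *: "set (take (Suc m) xs) = insert (xs ! m) (set (take m xs))"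
      using m by (simp add: take_Suc_conv_app_nth)
    have ex': "koszul_exact (carrier ?P) f (insert (xs ! m) (set (take m xs)))"
      using Suc.hyps(1)[of "Suc m"] Suc.hyps(2) * by simp
    have sub: "i \<in> set xs" if "i \<in> insert (xs ! m) (set (take m xs))" for i
      using set_take_subset[of "Suc m" xs] * that by auto
    have mem: "xs ! m \<in> set xs" using m by simp
    have "xs ! m \<notin> set (take m xs)" using xs m by (auto simp: in_set_conv_nth nth_eq_iff_index_eq)
    with finite_set show ?case
      by (rule koszul_exact_remove[OF Ws arg_cong[where f = carrier, OF poly_algebra_eq] wt(2)])
        (rule ex' f[OF sub] e[OF mem] fS[OF mem]; assumption)+
  qed
  have idl: "Idl\<^bsub>?P\<^esub> (set (take m (map f xs))) =
      {(\<Sum>i\<in>set (take m xs). c i * f i) | c. \<forall>i\<in>set (take m xs). c i \<in> carrier ?P}" for m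
    using genideal_image_poly_algebra[of "set (take m xs)" f W] fS set_take_subset[of m xs]
    by (simp add: take_map subset_iff)
  show ?thesis unfolding regular_sequence_def
  proof (intro conjI allI ballI impI)
    show "set (map f xs) \<subseteq> carrier ?P" using fS by auto
  next
    fix m g assume m: "m < length (map f xs)" and g: "g \<in> carrier ?P"
      and eq: "map f xs ! m \<otimes>\<^bsub>?P\<^esub> g \<in> Idl\<^bsub>?P\<^esub> (set (take m (map f xs)))"
    from eq obtain c where c: "f (xs ! m) * g = (\<Sum>i\<in>set (take m xs). c i * f i)"
      "\<forall>i\<in>set (take m xs). c i \<in> carrier ?P" unfolding idl using m by auto
    have "set (take (Suc m) xs) = insert (xs ! m) (set (take m xs))"
      using m by (simp add: take_Suc_conv_app_nth)
    then have "koszul_exact (carrier ?P) f (insert (xs ! m) (set (take m xs)))"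
      using prefix[of "Suc m"] by simp
    moreover have "xs ! m \<notin> set (take m xs)" using xs m by (auto simp: in_set_conv_nth nth_eq_iff_index_eq)
    ultimately have "\<exists>c. (\<forall>i\<in>set (take m xs). c i \<in> carrier ?P) \<and> g = (\<Sum>i\<in>set (take m xs). c i * f i)"
      using c g by (intro koszul_exact_nonzerodivisor[where ?i0.0 = "xs ! m" and c = c])
        (auto intro: poly_algebra_closed)
    then show "g \<in> Idl\<^bsub>?P\<^esub> (set (take m (map f xs)))" unfolding idl by blast
  next
    show "Idl\<^bsub>?P\<^esub> (set (map f xs)) \<noteq> carrier ?P"
    proof
      assume "Idl\<^bsub>?P\<^esub> (set (map f xs)) = carrier ?P"
      then have "1 \<in> Idl\<^bsub>?P\<^esub> (set (take (length xs) (map f xs)))" by (simp add: poly_algebra_closed)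
      then obtain c where c: "1 = (\<Sum>i\<in>set xs. c i * f i)" unfolding idl by auto
      have "restrict_keys (\<lambda>w. wt w = 0) (c i * f i) = 0" if "i \<in> set xs" for i
        using keys_mult[of "c i" "f i"] f[OF that] e[OF that] by (intro restrict_keys_eq_0) (auto simp: wt)
      then have "restrict_keys (\<lambda>w. wt w = 0) (\<Sum>i\<in>set xs. c i * f i) = 0"
        by (simp add: restrict_keys_sum)
      moreover have "restrict_keys (\<lambda>w. wt w = 0) (1 :: ('v \<Rightarrow>\<^sub>0 nat) \<Rightarrow>\<^sub>0 'k) = 1"
        by (rule restrict_keys_id) (auto simp: wt)
      ultimately show False using c by simp
    qed
  qed
qed

section \<open>Cardinality of monoid algebras\<close>

lemma lepoll_square:
  assumes "infinite K" "A \<lesssim> K" "B \<lesssim> K"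
  shows "A \<times> B \<lesssim> K"
proof -
  have "A \<times> B \<lesssim> K \<times> K" using assms(2,3) by (rule times_lepoll_mono)
  also have "K \<times> K \<lesssim> K"
    using assms(1) card_of_Times_same_infinite[of K] ordIso_imp_ordLeq
    unfolding lepoll_def card_of_ordLeq[symmetric] by (metis card_of_ordLeq)
  finally show ?thesis .
qed

lemma lepoll_Fpow:
  assumes "infinite K" "A \<lesssim> K"
  shows "Fpow A \<lesssim> K"
proof -
  obtain f where f: "inj_on f A" "f ` A \<subseteq> K" using assms(2) by (auto simp: lepoll_def)
  have "inj_on (image f) (Fpow A)" using f(1) by (rule inj_on_image_Fpow)
  moreover have "image f ` Fpow A \<subseteq> Fpow K" using f(2) by (rule image_Fpow_mono)
  ultimately have "Fpow A \<lesssim> Fpow K" by (auto simp: lepoll_def)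
  then show ?thesis using eqpoll_Fpow[OF assms(1)] lepoll_trans1 lepoll_trans2 by blast
qed

text \<open>A finitely supported function is determined by the graph of its nonzero part, a finite
  subset of \<open>Ws \<times> V\<close>; passing to finite subsets does not raise an infinite
  cardinality.\<close>

lemma lepoll_poly_mappings:
  assumes "infinite K" "countable Ws" "V \<lesssim> K"
  shows "{p :: 'w \<Rightarrow>\<^sub>0 'v::zero. Poly_Mapping.keys p \<subseteq> Ws \<and> Poly_Mapping.lookup p ` Ws \<subseteq> V} \<lesssim> K"
proof -
  have "Ws \<lesssim> K"
    using assms(1,2) infinite_le_lepoll[of K] lepoll_trans
    by (metis countable_lepoll countable_def lepoll_def subset_UNIV)
  then have "Fpow (Ws \<times> V) \<lesssim> K" using assms by (intro lepoll_Fpow lepoll_square)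
  have "{p :: 'w \<Rightarrow>\<^sub>0 'v. Poly_Mapping.keys p \<subseteq> Ws \<and> Poly_Mapping.lookup p ` Ws \<subseteq> V}
      \<lesssim> {f. f ` Ws \<subseteq> V \<and> {x. f x \<noteq> 0} \<subseteq> Ws \<and> finite {x. f x \<noteq> (0::'v)}}"
    unfolding lepoll_def
    by (rule exI[of _ Poly_Mapping.lookup])
      (auto simp: poly_mapping_eqI in_keys_iff subset_iff intro!: inj_onI)
  also have "\<dots> \<lesssim> Fpow (Ws \<times> V)"
    using lepoll_restricted_funspace[of Ws V "\<lambda>_. 0"] by simp
  also have "\<dots> \<lesssim> K" by fact
  finally show ?thesis .
qed

lemma lepoll_monoid_algebra:
  assumes "infinite K" "countable Ws" "(UNIV :: 'k set) \<lesssim> K"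
  shows "carrier (monoid_algebra Ws :: ('k::field, 'w::monoid_add \<Rightarrow>\<^sub>0 'k) module) \<lesssim> K"
  using lepoll_poly_mappings[OF assms] by simp

lemma countable_words_over:
  assumes "finite X"
  shows "countable (words_over X)"
proof -
  have "words_over X \<subseteq> Word ` lists X"
  proof
    fix w assume "w \<in> words_over X"
    then show "w \<in> Word ` lists X" by (cases w) (auto simp: words_over_def)
  qed
  moreover have "countable (Word ` lists X)"
    using assms by (intro countable_image countable_lists countable_finite)
  ultimately show ?thesis using countable_subset by blast
qed

text \<open>Exponents are themselves finitely supported functions, with values in the natural
  numbers, so the same count applies.\<close>

lemma countable_monomials_over:
  assumes "finite W"
  shows "countable (monomials_over W)"
proof -
  have "monomials_over W \<lesssim> (UNIV :: nat set)"
    using lepoll_poly_mappings[of "UNIV :: nat set" W "UNIV :: nat set"] assms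
    by (simp add: monomials_over_def countable_finite)
  then show ?thesis using countable_lepoll by (metis countableI_type)
qed

text \<open>Realises a quotient of \<open>S\<close> on elements of a prescribed type: pick one
  representative per class and embed it. The test objects of \<open>projective_bimodule\<close>,
  \<open>cofibrant\<close>, \<open>represents_dg_rep\<close> and \<open>represents_rep\<close> have
  their elements in a fixed type, and the quotients below must be moved there.\<close>

lemma quotient_encoding:
  assumes "S \<lesssim> (UNIV :: 'u set)"
    and refl: "\<And>p. p \<in> S \<Longrightarrow> rel p p"
    and sym: "\<And>p q. p \<in> S \<Longrightarrow> q \<in> S \<Longrightarrow> rel p q \<Longrightarrow> rel q p"
    and trans: "\<And>p q r. p \<in> S \<Longrightarrow> q \<in> S \<Longrightarrow> r \<in> S \<Longrightarrow> rel p q \<Longrightarrow> rel q r \<Longrightarrow> rel p r"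
  shows "\<exists>enc :: 'a \<Rightarrow> 'u. \<forall>p\<in>S. \<forall>q\<in>S. enc p = enc q \<longleftrightarrow> rel p q"
proof -
  obtain g :: "'a \<Rightarrow> 'u" where g: "inj_on g S" using assms(1) by (auto simp: lepoll_def)
  define rep where "rep p = (SOME q. q \<in> S \<and> rel p q)" for p
  have rep: "rep p \<in> S \<and> rel p (rep p)" if "p \<in> S" for p
    unfolding rep_def by (rule someI[of _ p]) (use refl that in auto)
  have "g (rep p) = g (rep q) \<longleftrightarrow> rel p q" if p: "p \<in> S" and q: "q \<in> S" for p q
  proof
    assume "g (rep p) = g (rep q)"
    then have "rep p = rep q" using rep p q inj_onD[OF g] by blast
    then show "rel p q" using rep[OF p] rep[OF q] sym trans p q by metis
  next
    assume "rel p q"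
    then have "(r \<in> S \<and> rel p r) = (r \<in> S \<and> rel q r)" for r using sym trans p q by blast
    then show "g (rep p) = g (rep q)" by (simp add: rep_def)
  qed
  then show ?thesis by (intro exI[of _ "\<lambda>p. g (rep p)"] ballI)
qed

section \<open>Two-term algebras\<close>

text \<open>Carries the axioms between records that differ only in extension fields, as
  \<open>alg\<close> and \<open>dga\<close> below do.\<close>

lemma k_algebra_cong:
  fixes A :: "('k::field, 'a, 'y) module_scheme" and B :: "('k, 'a, 'z) module_scheme"
  assumes "k_algebra A" "carrier B = carrier A" "mult B = mult A" "one B = one A"
    "ring.zero B = ring.zero A" "add B = add A" "smult B = smult A"
  shows "k_algebra B"
proof -
  interpret k_algebra A by fact
  have "abelian_group B"
    by (rule abelian_groupI) (auto simp: assms(2-) a_ac intro: l_neg)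
  moreover have "monoid B"
    by (rule monoidI) (auto simp: assms(2-) m_assoc)
  ultimately have "ring B"
    by (rule ringI) (auto simp: assms(2-) l_distr r_distr)
  moreover have "k_algebra_axioms B"
    using k_algebra_axioms assms(2-) unfolding k_algebra_def k_algebra_axioms_def by simp
  ultimately show ?thesis by (rule k_algebra.intro)
qed

text \<open>
  The algebra \<open>(F/I) \<oplus> (M/N)\<close> with \<open>(p, u) (q, v) = (p q, p v + u q + eps u d(v))\<close>, coded in the type
  \<open>'u\<close>. For \<open>eps = 0\<close> and with \<open>M\<close> in degree \<open>1\<close> it is a DG algebra with differential \<open>d\<close>; for
  \<open>eps = 1\<close> it is the path object along which homotopies between maps into \<open>F/I\<close> are defined, its
  second end point being \<open>(p, u) \<mapsto> p + d(u)\<close>.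
\<close>

locale two_term =
  fixes Ws :: "'w::monoid_add set" and M :: "'m::ab_group_add set"
    and lact :: "('w \<Rightarrow>\<^sub>0 'k::field) \<Rightarrow> 'm \<Rightarrow> 'm" and ract :: "'m \<Rightarrow> ('w \<Rightarrow>\<^sub>0 'k) \<Rightarrow> 'm"
    and d :: "'m \<Rightarrow> 'w \<Rightarrow>\<^sub>0 'k" and I :: "('w \<Rightarrow>\<^sub>0 'k) set" and N :: "'m set"
    and eps :: 'k and enc :: "('w \<Rightarrow>\<^sub>0 'k) \<times> 'm \<Rightarrow> 'u" and Fs :: "('w \<Rightarrow>\<^sub>0 'k) set"
  assumes Ws: "additive_submonoid Ws" and Fs_def: "Fs = carrier (monoid_algebra Ws)"
    and M_zero: "0 \<in> M" and M_add: "u \<in> M \<Longrightarrow> v \<in> M \<Longrightarrow> u + v \<in> M" and M_uminus: "u \<in> M \<Longrightarrow> - u \<in> M"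
    and lact_closed: "p \<in> Fs \<Longrightarrow> u \<in> M \<Longrightarrow> lact p u \<in> M"
    and ract_closed: "p \<in> Fs \<Longrightarrow> u \<in> M \<Longrightarrow> ract u p \<in> M"
    and lact_add: "p \<in> Fs \<Longrightarrow> u \<in> M \<Longrightarrow> v \<in> M \<Longrightarrow> lact p (u + v) = lact p u + lact p v"
    and add_lact: "p \<in> Fs \<Longrightarrow> q \<in> Fs \<Longrightarrow> u \<in> M \<Longrightarrow> lact (p + q) u = lact p u + lact q u"
    and ract_add: "p \<in> Fs \<Longrightarrow> u \<in> M \<Longrightarrow> v \<in> M \<Longrightarrow> ract (u + v) p = ract u p + ract v p"
    and add_ract: "p \<in> Fs \<Longrightarrow> q \<in> Fs \<Longrightarrow> u \<in> M \<Longrightarrow> ract u (p + q) = ract u p + ract u q"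
    and lact_assoc: "p \<in> Fs \<Longrightarrow> q \<in> Fs \<Longrightarrow> u \<in> M \<Longrightarrow> lact (p * q) u = lact p (lact q u)"
    and ract_assoc: "p \<in> Fs \<Longrightarrow> q \<in> Fs \<Longrightarrow> u \<in> M \<Longrightarrow> ract u (p * q) = ract (ract u p) q"
    and lact_ract: "p \<in> Fs \<Longrightarrow> q \<in> Fs \<Longrightarrow> u \<in> M \<Longrightarrow> ract (lact p u) q = lact p (ract u q)"
    and lact_one: "u \<in> M \<Longrightarrow> lact 1 u = u" and ract_one: "u \<in> M \<Longrightarrow> ract u 1 = u"
    and central: "u \<in> M \<Longrightarrow> lact (Poly_Mapping.single 0 c) u = ract u (Poly_Mapping.single 0 c)"
    and d_closed: "u \<in> M \<Longrightarrow> d u \<in> Fs"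
    and d_add: "u \<in> M \<Longrightarrow> v \<in> M \<Longrightarrow> d (u + v) = d u + d v"
    and d_lact: "p \<in> Fs \<Longrightarrow> u \<in> M \<Longrightarrow> d (lact p u) = p * d u"
    and d_ract: "p \<in> Fs \<Longrightarrow> u \<in> M \<Longrightarrow> d (ract u p) = d u * p"
    and I_zero: "0 \<in> I" and I_add: "p \<in> I \<Longrightarrow> q \<in> I \<Longrightarrow> p + q \<in> I"
    and I_mult_l: "p \<in> I \<Longrightarrow> q \<in> Fs \<Longrightarrow> q * p \<in> I" and I_mult_r: "p \<in> I \<Longrightarrow> q \<in> Fs \<Longrightarrow> p * q \<in> I"
    and N_sub: "N \<subseteq> M" and N_zero: "0 \<in> N" and N_add: "u \<in> N \<Longrightarrow> v \<in> N \<Longrightarrow> u + v \<in> N"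
    and N_lact: "p \<in> Fs \<Longrightarrow> u \<in> N \<Longrightarrow> lact p u \<in> N" and N_ract: "p \<in> Fs \<Longrightarrow> u \<in> N \<Longrightarrow> ract u p \<in> N"
    and I_lact: "p \<in> I \<Longrightarrow> u \<in> M \<Longrightarrow> lact p u \<in> N" and I_ract: "p \<in> I \<Longrightarrow> u \<in> M \<Longrightarrow> ract u p \<in> N"
    and d_N: "u \<in> N \<Longrightarrow> d u \<in> I"
    and crossing: "u \<in> M \<Longrightarrow> v \<in> M \<Longrightarrow> ract u (d v) - lact (d u) v \<in> N"
    and enc: "p \<in> Fs \<Longrightarrow> q \<in> Fs \<Longrightarrow> u \<in> M \<Longrightarrow> v \<in> M \<Longrightarrow>
      enc (p, u) = enc (q, v) \<longleftrightarrow> p - q \<in> I \<and> u - v \<in> N"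
begin

abbreviation \<sigma> :: "'k \<Rightarrow> 'w \<Rightarrow>\<^sub>0 'k" where "\<sigma> c \<equiv> Poly_Mapping.single 0 c"

lemma Fs_closed:
  "p \<in> Fs \<Longrightarrow> q \<in> Fs \<Longrightarrow> p + q \<in> Fs" "p \<in> Fs \<Longrightarrow> q \<in> Fs \<Longrightarrow> p * q \<in> Fs"
  "p \<in> Fs \<Longrightarrow> q \<in> Fs \<Longrightarrow> p - q \<in> Fs" "p \<in> Fs \<Longrightarrow> - p \<in> Fs" "0 \<in> Fs" "1 \<in> Fs"
  unfolding Fs_def by (fact monoid_algebra_closed[OF Ws])+

lemma sigma_closed: "\<sigma> c \<in> Fs"
  using monoid_algebra_closed(7)[OF Ws monoid_algebra_closed(6)[OF Ws], of c] by (simp add: Fs_def)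

lemma M_diff: "u \<in> M \<Longrightarrow> v \<in> M \<Longrightarrow> u - v \<in> M"
  using M_add[of u "- v"] M_uminus by simp

lemma zero_lact: "u \<in> M \<Longrightarrow> lact 0 u = 0"
  using add_lact[of 0 0 u] Fs_closed(5) by simp

lemma lact_zero: "p \<in> Fs \<Longrightarrow> lact p 0 = 0"
  using lact_add[of p 0 0] M_zero by simp

lemma zero_ract: "u \<in> M \<Longrightarrow> ract u 0 = 0"
  using add_ract[of 0 0 u] Fs_closed(5) by simp

lemma ract_zero: "p \<in> Fs \<Longrightarrow> ract 0 p = 0"
  using ract_add[of p 0 0] M_zero by simp

lemma d_zero: "d 0 = 0"
  using d_add[of 0 0] M_zero by simp

lemma lact_diff: "p \<in> Fs \<Longrightarrow> u \<in> M \<Longrightarrow> v \<in> M \<Longrightarrow> lact p (u - v) = lact p u - lact p v"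
  using lact_add[of p "u - v" v] M_diff by simp

lemma ract_diff: "p \<in> Fs \<Longrightarrow> u \<in> M \<Longrightarrow> v \<in> M \<Longrightarrow> ract (u - v) p = ract u p - ract v p"
  using ract_add[of p "u - v" v] M_diff by simp

lemma diff_lact: "p \<in> Fs \<Longrightarrow> q \<in> Fs \<Longrightarrow> u \<in> M \<Longrightarrow> lact (p - q) u = lact p u - lact q u"
  using add_lact[of "p - q" q u] Fs_closed by simp

lemma diff_ract: "p \<in> Fs \<Longrightarrow> q \<in> Fs \<Longrightarrow> u \<in> M \<Longrightarrow> ract u (p - q) = ract u p - ract u q"
  using add_ract[of "p - q" q u] Fs_closed by simp

lemma d_diff: "u \<in> M \<Longrightarrow> v \<in> M \<Longrightarrow> d (u - v) = d u - d v"
  using d_add[of "u - v" v] M_diff by simp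

lemma uminus_lact: "p \<in> Fs \<Longrightarrow> u \<in> M \<Longrightarrow> lact (- p) u = - lact p u"
  using diff_lact[of 0 p u] Fs_closed(5) zero_lact by simp

lemma N_uminus: "u \<in> N \<Longrightarrow> - u \<in> N"
  using N_lact[of "- 1" u] Fs_closed uminus_lact[of 1 u] lact_one[of u] N_sub by auto

lemma I_uminus: "p \<in> I \<Longrightarrow> - p \<in> I"
  using I_mult_l[of p "- 1"] Fs_closed by simp

text \<open>Operations on codes go through a chosen preimage; \<open>add_enc\<close>,
  \<open>smult_enc\<close> and \<open>mult_enc\<close> show that the choice is immaterial modulo I
  and N.\<close>

definition dec :: "'u \<Rightarrow> ('w \<Rightarrow>\<^sub>0 'k) \<times> 'm" where
  "dec x = (SOME pu. pu \<in> Fs \<times> M \<and> enc pu = x)"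

definition mulp :: "('w \<Rightarrow>\<^sub>0 'k) \<times> 'm \<Rightarrow> ('w \<Rightarrow>\<^sub>0 'k) \<times> 'm \<Rightarrow> ('w \<Rightarrow>\<^sub>0 'k) \<times> 'm" where
  "mulp = (\<lambda>(p, u) (q, v). (p * q, lact p v + ract u q + lact (\<sigma> eps) (ract u (d v))))"

definition alg :: "('k, 'u) module" where
  "alg = \<lparr>carrier = enc ` (Fs \<times> M),
     mult = (\<lambda>x y. enc (mulp (dec x) (dec y))), one = enc (1, 0), ring.zero = enc (0, 0),
     add = (\<lambda>x y. enc (fst (dec x) + fst (dec y), snd (dec x) + snd (dec y))),
     smult = (\<lambda>c x. enc (\<sigma> c * fst (dec x), lact (\<sigma> c) (snd (dec x))))\<rparr>"

lemma dec_enc: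
  assumes "p \<in> Fs" "u \<in> M"
  obtains p' u' where "dec (enc (p, u)) = (p', u')" "p' \<in> Fs" "u' \<in> M" "p' - p \<in> I" "u' - u \<in> N"
proof -
  have "dec (enc (p, u)) \<in> Fs \<times> M \<and> enc (dec (enc (p, u))) = enc (p, u)"
    unfolding dec_def by (rule someI[of _ "(p, u)"]) (use assms in auto)
  then show ?thesis using that assms enc by (cases "dec (enc (p, u))") auto
qed

lemma mulp_closed:
  assumes "p \<in> Fs" "u \<in> M" "q \<in> Fs" "v \<in> M"
  shows "lact p v + ract u q + lact (\<sigma> eps) (ract u (d v)) \<in> M"
  using assms sigma_closed by (intro M_add lact_closed ract_closed d_closed)

lemma carrier_alg: "carrier alg = enc ` (Fs \<times> M)"
  and zero_alg: "\<zero>\<^bsub>alg\<^esub> = enc (0, 0)" and one_alg: "\<one>\<^bsub>alg\<^esub> = enc (1, 0)"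
  by (simp_all add: alg_def)

lemma enc_closed: "p \<in> Fs \<Longrightarrow> u \<in> M \<Longrightarrow> enc (p, u) \<in> carrier alg"
  by (simp add: carrier_alg)

lemma carrier_algE:
  assumes "x \<in> carrier alg"
  obtains p u where "x = enc (p, u)" "p \<in> Fs" "u \<in> M"
  using assms by (auto simp: carrier_alg)

lemma add_enc:
  assumes "p \<in> Fs" "u \<in> M" "q \<in> Fs" "v \<in> M"
  shows "enc (p, u) \<oplus>\<^bsub>alg\<^esub> enc (q, v) = enc (p + q, u + v)"
proof -
  obtain p' u' where p': "dec (enc (p, u)) = (p', u')" "p' \<in> Fs" "u' \<in> M" "p' - p \<in> I" "u' - u \<in> N"
    using dec_enc assms by metis
  obtain q' v' where q': "dec (enc (q, v)) = (q', v')" "q' \<in> Fs" "v' \<in> M" "q' - q \<in> I" "v' - v \<in> N"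
    using dec_enc assms by metis
  have "p' + q' - (p + q) \<in> I" "u' + v' - (u + v) \<in> N"
    using I_add[OF p'(4) q'(4)] N_add[OF p'(5) q'(5)] by (simp_all add: algebra_simps)
  then show ?thesis using assms p' q'
    by (simp add: alg_def enc Fs_closed M_add)
qed

lemma smult_enc:
  assumes "p \<in> Fs" "u \<in> M"
  shows "c \<odot>\<^bsub>alg\<^esub> enc (p, u) = enc (\<sigma> c * p, lact (\<sigma> c) u)"
proof -
  obtain p' u' where p': "dec (enc (p, u)) = (p', u')" "p' \<in> Fs" "u' \<in> M" "p' - p \<in> I" "u' - u \<in> N"
    using dec_enc assms by metis
  have "\<sigma> c * p' - \<sigma> c * p = \<sigma> c * (p' - p)" by (simp add: algebra_simps)
  moreover have "lact (\<sigma> c) u' - lact (\<sigma> c) u = lact (\<sigma> c) (u' - u)"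
    using assms p' sigma_closed by (simp add: lact_diff)
  ultimately show ?thesis using assms p' sigma_closed
    by (simp add: alg_def enc Fs_closed lact_closed I_mult_l N_lact)
qed

text \<open>Changing both factors by elements of I and N, each difference telescopes; the term with
  \<open>eps\<close> uses that \<open>d\<close> maps N into I and that I sends M into N.\<close>

lemma mult_enc:
  assumes "p \<in> Fs" "u \<in> M" "q \<in> Fs" "v \<in> M"
  shows "enc (p, u) \<otimes>\<^bsub>alg\<^esub> enc (q, v) =
    enc (p * q, lact p v + ract u q + lact (\<sigma> eps) (ract u (d v)))"
proof -
  obtain p' u' where p': "dec (enc (p, u)) = (p', u')" "p' \<in> Fs" "u' \<in> M" "p' - p \<in> I" "u' - u \<in> N"
    using dec_enc assms by metis
  obtain q' v' where q': "dec (enc (q, v)) = (q', v')" "q' \<in> Fs" "v' \<in> M" "q' - q \<in> I" "v' - v \<in> N"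
    using dec_enc assms by metis
  have "p' * q' - p * q = (p' - p) * q' + p * (q' - q)" by (simp add: algebra_simps)
  then have 1: "p' * q' - p * q \<in> I" using assms p' q' by (simp add: I_add I_mult_l I_mult_r)
  have "lact p' v' - lact p v = lact (p' - p) v' + lact p (v' - v)"
    using assms p' q' by (simp add: lact_diff diff_lact)
  then have 2: "lact p' v' - lact p v \<in> N" using assms p' q' by (simp add: N_add I_lact N_lact)
  have "ract u' q' - ract u q = ract (u' - u) q' + ract u (q' - q)"
    using assms p' q' by (simp add: ract_diff diff_ract)
  then have 3: "ract u' q' - ract u q \<in> N" using assms p' q' by (simp add: N_add I_ract N_ract)
  have "ract u' (d v') - ract u (d v) = ract (u' - u) (d v') + ract u (d v' - d v)"
    using assms p' q' by (simp add: ract_diff diff_ract d_closed)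
  then have "ract u' (d v') - ract u (d v) = ract (u' - u) (d v') + ract u (d (v' - v))"
    using assms p' q' by (simp add: d_diff)
  then have "ract u' (d v') - ract u (d v) \<in> N" using assms p' q'
    by (simp add: N_add I_ract N_ract d_N d_closed)
  then have "lact (\<sigma> eps) (ract u' (d v') - ract u (d v)) \<in> N" by (intro N_lact sigma_closed)
  then have 4: "lact (\<sigma> eps) (ract u' (d v')) - lact (\<sigma> eps) (ract u (d v)) \<in> N"
    using assms p' q' sigma_closed by (simp add: lact_diff ract_closed d_closed)
  have "lact p' v' + ract u' q' + lact (\<sigma> eps) (ract u' (d v'))
      - (lact p v + ract u q + lact (\<sigma> eps) (ract u (d v))) \<in> N"
    using N_add[OF N_add[OF 2 3] 4] by (simp add: algebra_simps)
  then show ?thesis using assms p' q' 1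
    by (simp add: alg_def mulp_def enc Fs_closed mulp_closed)
qed

lemma sigma_lact: "u \<in> M \<Longrightarrow> p \<in> Fs \<Longrightarrow> lact (\<sigma> c) (lact p u) = lact p (lact (\<sigma> c) u)"
  using lact_assoc[of "\<sigma> c" p u] lact_assoc[of p "\<sigma> c" u] sigma_closed single_zero_central[of c p] by simp

lemma sigma_ract: "u \<in> M \<Longrightarrow> p \<in> Fs \<Longrightarrow> ract (lact (\<sigma> c) u) p = lact (\<sigma> c) (ract u p)"
  using lact_ract sigma_closed by simp

lemma ract_sigma: "u \<in> M \<Longrightarrow> p \<in> Fs \<Longrightarrow> ract u (\<sigma> c * p) = lact (\<sigma> c) (ract u p)"
  using ract_assoc[of "\<sigma> c" p u] sigma_closed lact_ract central[of u c] by metis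

lemma lact_sigma: "u \<in> M \<Longrightarrow> p \<in> Fs \<Longrightarrow> lact (\<sigma> c * p) u = lact (\<sigma> c) (lact p u)"
  using lact_assoc sigma_closed by simp

lemmas closed = Fs_closed M_zero M_add lact_closed ract_closed sigma_closed d_closed

lemma k_algebra_alg: "k_algebra alg"
proof -
  have "abelian_group alg"
  proof (rule abelian_groupI)
    fix x assume "x \<in> carrier alg"
    then obtain p u where x: "x = enc (p, u)" "p \<in> Fs" "u \<in> M" by (rule carrier_algE)
    then show "\<exists>y\<in>carrier alg. y \<oplus>\<^bsub>alg\<^esub> x = \<zero>\<^bsub>alg\<^esub>"
      by (intro bexI[of _ "enc (- p, - u)"]) (simp_all add: add_enc zero_alg closed M_uminus enc_closed)
    show "\<zero>\<^bsub>alg\<^esub> \<oplus>\<^bsub>alg\<^esub> x = x" using x by (simp add: zero_alg add_enc closed)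
    fix y assume "y \<in> carrier alg"
    then obtain q v where y: "y = enc (q, v)" "q \<in> Fs" "v \<in> M" by (rule carrier_algE)
    show "x \<oplus>\<^bsub>alg\<^esub> y \<in> carrier alg" using x y by (simp add: add_enc closed enc_closed)
    show "x \<oplus>\<^bsub>alg\<^esub> y = y \<oplus>\<^bsub>alg\<^esub> x" using x y by (simp add: add_enc add.commute)
    fix z assume "z \<in> carrier alg"
    then obtain r w where z: "z = enc (r, w)" "r \<in> Fs" "w \<in> M" by (rule carrier_algE)
    show "x \<oplus>\<^bsub>alg\<^esub> y \<oplus>\<^bsub>alg\<^esub> z = x \<oplus>\<^bsub>alg\<^esub> (y \<oplus>\<^bsub>alg\<^esub> z)"
      using x y z by (simp add: add_enc closed add.assoc)
  qed (simp add: zero_alg enc_closed closed)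
  moreover have "monoid alg"
  proof (rule monoidI)
    show "\<one>\<^bsub>alg\<^esub> \<in> carrier alg" by (simp add: one_alg enc_closed closed)
    fix x assume "x \<in> carrier alg"
    then obtain p u where x: "x = enc (p, u)" "p \<in> Fs" "u \<in> M" by (rule carrier_algE)
    show "\<one>\<^bsub>alg\<^esub> \<otimes>\<^bsub>alg\<^esub> x = x"
      using x by (simp add: one_alg mult_enc closed lact_one ract_zero lact_zero)
    show "x \<otimes>\<^bsub>alg\<^esub> \<one>\<^bsub>alg\<^esub> = x"
      using x by (simp add: one_alg mult_enc closed ract_one lact_zero d_zero zero_ract)
    fix y assume "y \<in> carrier alg"
    then obtain q v where y: "y = enc (q, v)" "q \<in> Fs" "v \<in> M" by (rule carrier_algE)
    show "x \<otimes>\<^bsub>alg\<^esub> y \<in> carrier alg" using x y by (simp add: mult_enc closed enc_closed)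
    fix z assume "z \<in> carrier alg"
    then obtain r w where z: "z = enc (r, w)" "r \<in> Fs" "w \<in> M" by (rule carrier_algE)
    have "lact (p * q) w + ract (lact p v + ract u q + lact (\<sigma> eps) (ract u (d v))) r
        + lact (\<sigma> eps) (ract (lact p v + ract u q + lact (\<sigma> eps) (ract u (d v))) (d w))
      = lact p (lact q w + ract v r + lact (\<sigma> eps) (ract v (d w))) + ract u (q * r)
        + lact (\<sigma> eps) (ract u (d (lact q w + ract v r + lact (\<sigma> eps) (ract v (d w)))))"
      using x y z sigma_lact[of "ract v (d w)" p eps]
      by (simp add: closed lact_add ract_add lact_assoc ract_assoc lact_ract d_add d_lact d_ract
        add_ract central[symmetric] ac_simps)
    then show "x \<otimes>\<^bsub>alg\<^esub> y \<otimes>\<^bsub>alg\<^esub> z = x \<otimes>\<^bsub>alg\<^esub> (y \<otimes>\<^bsub>alg\<^esub> z)"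
      using x y z by (simp add: mult_enc closed mult.assoc)
  qed
  ultimately have "ring alg"
  proof (rule ringI)
    fix x y z assume "x \<in> carrier alg" "y \<in> carrier alg" "z \<in> carrier alg"
    then obtain p u q v r w where x: "x = enc (p, u)" "p \<in> Fs" "u \<in> M"
      and y: "y = enc (q, v)" "q \<in> Fs" "v \<in> M" and z: "z = enc (r, w)" "r \<in> Fs" "w \<in> M"
      by (metis carrier_algE)
    show "(x \<oplus>\<^bsub>alg\<^esub> y) \<otimes>\<^bsub>alg\<^esub> z = x \<otimes>\<^bsub>alg\<^esub> z \<oplus>\<^bsub>alg\<^esub> y \<otimes>\<^bsub>alg\<^esub> z"
      using x y z by (simp add: mult_enc add_enc closed distrib_right add_lact ract_add lact_add add_ac)
    show "z \<otimes>\<^bsub>alg\<^esub> (x \<oplus>\<^bsub>alg\<^esub> y) = z \<otimes>\<^bsub>alg\<^esub> x \<oplus>\<^bsub>alg\<^esub> z \<otimes>\<^bsub>alg\<^esub> y"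
      using x y z by (simp add: mult_enc add_enc closed distrib_left add_ract lact_add d_add add_ac)
  qed
  then show ?thesis
  proof (rule k_algebra.intro, unfold_locales)
    fix x b c assume "x \<in> carrier alg"
    then obtain p u where x: "x = enc (p, u)" "p \<in> Fs" "u \<in> M" by (rule carrier_algE)
    show "c \<odot>\<^bsub>alg\<^esub> x \<in> carrier alg" using x by (simp add: smult_enc closed enc_closed)
    show "(b + c) \<odot>\<^bsub>alg\<^esub> x = b \<odot>\<^bsub>alg\<^esub> x \<oplus>\<^bsub>alg\<^esub> c \<odot>\<^bsub>alg\<^esub> x"
      using x by (simp add: smult_enc add_enc closed single_add distrib_right add_lact)
    have "lact (\<sigma> (b * c)) u = lact (\<sigma> b) (lact (\<sigma> c) u)"
      using x lact_assoc[of "\<sigma> b" "\<sigma> c" u] by (simp add: closed mult_single)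
    then show "(b * c) \<odot>\<^bsub>alg\<^esub> x = b \<odot>\<^bsub>alg\<^esub> (c \<odot>\<^bsub>alg\<^esub> x)"
      using x by (simp add: smult_enc closed mult.assoc[symmetric] mult_single)
    show "1 \<odot>\<^bsub>alg\<^esub> x = x" using x by (simp add: smult_enc lact_one)
    fix y assume "y \<in> carrier alg"
    then obtain q v where y: "y = enc (q, v)" "q \<in> Fs" "v \<in> M" by (rule carrier_algE)
    show "c \<odot>\<^bsub>alg\<^esub> (x \<oplus>\<^bsub>alg\<^esub> y) = c \<odot>\<^bsub>alg\<^esub> x \<oplus>\<^bsub>alg\<^esub> c \<odot>\<^bsub>alg\<^esub> y"
      using x y by (simp add: smult_enc add_enc closed distrib_left lact_add)
    have s: "lact (\<sigma> c) (lact p v) = lact p (lact (\<sigma> c) v)"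
      "lact (\<sigma> c) (lact (\<sigma> eps) (ract u (d v))) = lact (\<sigma> eps) (lact (\<sigma> c) (ract u (d v)))"
      using x y by (auto intro!: sigma_lact closed)
    show "(c \<odot>\<^bsub>alg\<^esub> x) \<otimes>\<^bsub>alg\<^esub> y = c \<odot>\<^bsub>alg\<^esub> (x \<otimes>\<^bsub>alg\<^esub> y)"
      using x y by (simp add: smult_enc mult_enc closed mult.assoc lact_sigma sigma_ract lact_add s)
    have "p * (\<sigma> c * q) = \<sigma> c * (p * q)" by (simp add: mult.assoc[symmetric] single_zero_central[symmetric])
    then show "x \<otimes>\<^bsub>alg\<^esub> (c \<odot>\<^bsub>alg\<^esub> y) = c \<odot>\<^bsub>alg\<^esub> (x \<otimes>\<^bsub>alg\<^esub> y)"
      using x y by (simp add: smult_enc mult_enc closed ract_sigma d_lact lact_add s)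
  qed
qed

text \<open>With equal left and right actions the commutator of (p, u) and (q, v) is
  \<open>eps\<close> times u d(v) - d(u) v, which \<open>crossing\<close> puts into N.\<close>

lemma comm_k_algebra_alg:
  assumes "\<And>p q. p \<in> Fs \<Longrightarrow> q \<in> Fs \<Longrightarrow> p * q = q * p"
    and "\<And>p u. p \<in> Fs \<Longrightarrow> u \<in> M \<Longrightarrow> ract u p = lact p u"
  shows "comm_k_algebra alg"
proof (intro comm_k_algebra.intro k_algebra_alg comm_k_algebra_axioms.intro)
  fix x y assume "x \<in> carrier alg" "y \<in> carrier alg"
  then obtain p u q v where x: "x = enc (p, u)" "p \<in> Fs" "u \<in> M"
    and y: "y = enc (q, v)" "q \<in> Fs" "v \<in> M" by (metis carrier_algE)
  have "lact p v + ract u q + lact (\<sigma> eps) (ract u (d v))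
      - (lact q u + ract v p + lact (\<sigma> eps) (ract v (d u)))
      = lact (\<sigma> eps) (ract u (d v) - lact (d u) v)"
    using x y assms(2) by (simp add: lact_diff closed)
  moreover have "\<dots> \<in> N" using x y by (intro N_lact crossing closed)
  ultimately show "x \<otimes>\<^bsub>alg\<^esub> y = y \<otimes>\<^bsub>alg\<^esub> x"
    using x y assms(1)[of p q] by (simp add: mult_enc enc closed I_zero)
qed

definition dga :: "('k, 'u) dga" where
  "dga = module.extend alg (dga.fields
     (\<lambda>i. if i = 0 then (\<lambda>p. enc (p, 0)) ` Fs else if i = 1 then (\<lambda>u. enc (0, u)) ` M else {enc (0, 0)})
     (\<lambda>x. enc (d (snd (dec x)), 0)))"

lemma dga_simps [simp]:
  "carrier dga = carrier alg" "mult dga = mult alg" "one dga = one alg" "ring.zero dga = ring.zero alg"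
  "add dga = add alg" "smult dga = smult alg"
  by (simp_all add: dga_def module.defs)

lemma comp_dga:
  "comp dga 0 = (\<lambda>p. enc (p, 0)) ` Fs" "comp dga (Suc 0) = (\<lambda>u. enc (0, u)) ` M"
  "comp dga (Suc (Suc i)) = {enc (0, 0)}"
  by (simp_all add: dga_def module.defs dga.defs)

lemma diff_enc:
  assumes "p \<in> Fs" "u \<in> M"
  shows "diff dga (enc (p, u)) = enc (d u, 0)"
proof -
  obtain p' u' where p': "dec (enc (p, u)) = (p', u')" "p' \<in> Fs" "u' \<in> M" "p' - p \<in> I" "u' - u \<in> N"
    using dec_enc assms by metis
  then have "d u' - d u \<in> I" using d_N[of "u' - u"] assms by (simp add: d_diff)
  then show ?thesis using assms p' by (simp add: dga_def module.defs dga.defs enc closed N_zero)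
qed

lemma dga_degree_cases:
  assumes "x \<in> comp dga i"
  obtains p where "i = 0" "x = enc (p, 0)" "p \<in> Fs" | u where "i = 1" "x = enc (0, u)" "u \<in> M"
    | "i \<ge> 2" "x = enc (0, 0)"
  using assms
proof (cases i)
  case (Suc i')
  then show ?thesis using assms that by (cases i') (auto simp: comp_dga)
qed (use that in \<open>auto simp: comp_dga\<close>)

lemma enc_comp_0: "p \<in> Fs \<Longrightarrow> enc (p, 0) \<in> comp dga 0"
  and enc_comp_1: "u \<in> M \<Longrightarrow> enc (0, u) \<in> comp dga 1"
  and enc_comp_2: "i \<ge> 2 \<Longrightarrow> comp dga i = {enc (0, 0)}"
  and zero_comp: "enc (0, 0) \<in> comp dga i"
proof -
  show "i \<ge> 2 \<Longrightarrow> comp dga i = {enc (0, 0)}" by (cases i; cases "i - 1") (auto simp: comp_dga)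
  show "enc (0, 0) \<in> comp dga i"
    by (cases i; cases "i - 1") (auto simp: comp_dga Fs_closed M_zero)
qed (auto simp: comp_dga)

text \<open>Components of degree at least 2 are zero, so a decomposition is determined by its parts
  of degrees 0 and 1, which the coding recovers modulo I and N.\<close>

lemma dga_direct_sum:
  assumes "p \<in> Fs" "u \<in> M"
  shows "\<exists>!f. (\<forall>i. f i \<in> comp dga i) \<and> finite {i. f i \<noteq> \<zero>\<^bsub>dga\<^esub>} \<and>
      enc (p, u) = (\<Oplus>\<^bsub>dga\<^esub>i\<in>{i. f i \<noteq> \<zero>\<^bsub>dga\<^esub>}. f i)"
proof -
  interpret k_algebra alg by (rule k_algebra_alg)
  have fs: "finsum dga = finsum alg" by (simp add: finsum_def finprod_def fun_eq_iff)
  have supp: "f i = enc (0, 0)" if "\<forall>i. f i \<in> comp dga i" "i \<ge> 2" for f i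
    using that enc_comp_2 by blast
  have fin: "{i. f i \<noteq> \<zero>\<^bsub>dga\<^esub>} \<subseteq> {0, 1}" if "\<forall>i. f i \<in> comp dga i" for f :: "nat \<Rightarrow> 'u"
  proof
    fix i assume "i \<in> {i. f i \<noteq> \<zero>\<^bsub>dga\<^esub>}"
    then have "\<not> i \<ge> 2" using supp[OF that] by (auto simp: zero_alg)
    then show "i \<in> {0, 1}" by auto
  qed
  have sum: "(\<Oplus>\<^bsub>dga\<^esub>i\<in>{i. f i \<noteq> \<zero>\<^bsub>dga\<^esub>}. f i) = f 0 \<oplus>\<^bsub>alg\<^esub> f 1"
    if f: "\<forall>i. f i \<in> comp dga i" for f :: "nat \<Rightarrow> 'u"
  proof -
    have c: "f 0 \<in> carrier alg" "f 1 \<in> carrier alg"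
      using f[rule_format, of 0] f[rule_format, of 1] by (auto simp: comp_dga enc_closed closed)
    have "(\<Oplus>\<^bsub>dga\<^esub>i\<in>{i. f i \<noteq> \<zero>\<^bsub>dga\<^esub>}. f i) = (\<Oplus>\<^bsub>alg\<^esub>i\<in>{0, 1}. f i)"
      unfolding fs using fin[OF f] c by (intro add.finprod_mono_neutral_cong_left) auto
    then show ?thesis using c by simp
  qed
  show ?thesis
  proof (rule ex1I[of _ "\<lambda>i. if i = 0 then enc (p, 0) else if i = 1 then enc (0, u) else enc (0, 0)"])
    let ?f = "\<lambda>i::nat. if i = 0 then enc (p, 0) else if i = 1 then enc (0, u) else enc (0, 0)"
    have f: "\<forall>i. ?f i \<in> comp dga i"
      using assms zero_comp by (auto simp: comp_dga)
    show "(\<forall>i. ?f i \<in> comp dga i) \<and> finite {i. ?f i \<noteq> \<zero>\<^bsub>dga\<^esub>} \<and>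
      enc (p, u) = (\<Oplus>\<^bsub>dga\<^esub>i\<in>{i. ?f i \<noteq> \<zero>\<^bsub>dga\<^esub>}. ?f i)"
      unfolding sum[OF f] using f finite_subset[OF fin[OF f]] assms by (simp add: add_enc closed)
  next
    fix f assume "(\<forall>i. f i \<in> comp dga i) \<and> finite {i. f i \<noteq> \<zero>\<^bsub>dga\<^esub>} \<and>
      enc (p, u) = (\<Oplus>\<^bsub>dga\<^esub>i\<in>{i. f i \<noteq> \<zero>\<^bsub>dga\<^esub>}. f i)"
    then have f: "\<forall>i. f i \<in> comp dga i" and eq: "enc (p, u) = f 0 \<oplus>\<^bsub>alg\<^esub> f 1"
      using sum[of f] by auto
    obtain p' where p': "f 0 = enc (p', 0)" "p' \<in> Fs" using f[rule_format, of 0] by (auto simp: comp_dga)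
    obtain u' where u': "f 1 = enc (0, u')" "u' \<in> M" using f[rule_format, of 1] by (auto simp: comp_dga)
    have "enc (p, u) = enc (p', u')" using eq p' u' by (simp add: add_enc closed)
    then have "p - p' \<in> I" "u - u' \<in> N" using enc assms p' u' by auto
    then have "f 0 = enc (p, 0)" "f 1 = enc (0, u)"
      using p' u' assms I_uminus[of "p - p'"] N_uminus[of "u - u'"]
      by (auto simp: enc closed N_zero I_zero)
    then show "f = (\<lambda>i. if i = 0 then enc (p, 0) else if i = 1 then enc (0, u) else enc (0, 0))"
      using supp[OF f] by (auto simp: fun_eq_iff)
  qed
qed

text \<open>For eps = 0 two elements of degree 1 multiply to zero, and the Leibniz rule for their
  product is exactly \<open>crossing\<close>; against degree 0 it is \<open>d_lact\<close> and
  \<open>d_ract\<close>.\<close>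

lemma dg_algebra_dga:
  assumes eps: "eps = 0"
  shows "dg_algebra dga"
proof -
  have e: "lact (\<sigma> eps) u = 0" if "u \<in> M" for u using zero_lact[OF that] by (simp add: eps)
  have m: "enc (p, u) \<otimes>\<^bsub>alg\<^esub> enc (q, v) = enc (p * q, lact p v + ract u q)"
    if "p \<in> Fs" "u \<in> M" "q \<in> Fs" "v \<in> M" for p u q v
    using that by (simp add: mult_enc e closed)
  interpret A: k_algebra alg by (rule k_algebra_alg)
  have "k_algebra dga" by (rule k_algebra_cong[OF k_algebra_alg]) simp_all
  then show ?thesis
  proof (rule dg_algebra.intro, unfold_locales)
    fix i j :: nat and x y :: 'u and c :: 'k
    show "comp dga i \<subseteq> carrier dga"
    proof
      fix x assume "x \<in> comp dga i"
      then show "x \<in> carrier dga" by (cases rule: dga_degree_cases) (auto simp: enc_closed closed)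
    qed
    show "\<zero>\<^bsub>dga\<^esub> \<in> comp dga i" using zero_comp by (simp add: zero_alg)
    show "\<one>\<^bsub>dga\<^esub> \<in> comp dga 0" by (simp add: one_alg comp_dga closed)
    show "x \<oplus>\<^bsub>dga\<^esub> y \<in> comp dga i" if x: "x \<in> comp dga i" and y: "y \<in> comp dga i"
      using x by (cases rule: dga_degree_cases; use y in \<open>cases rule: dga_degree_cases\<close>)
        (auto simp: add_enc closed intro: zero_comp enc_comp_0 enc_comp_1[simplified])
    show "c \<odot>\<^bsub>dga\<^esub> x \<in> comp dga i" if x: "x \<in> comp dga i"
      using x by (cases rule: dga_degree_cases)
        (auto simp: smult_enc closed lact_zero intro: zero_comp enc_comp_0 enc_comp_1[simplified])
    show "\<exists>!f. (\<forall>i. f i \<in> comp dga i) \<and> finite {i. f i \<noteq> \<zero>\<^bsub>dga\<^esub>} \<and>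
        x = (\<Oplus>\<^bsub>dga\<^esub>i\<in>{i. f i \<noteq> \<zero>\<^bsub>dga\<^esub>}. f i)" if xc: "x \<in> carrier dga"
    proof -
      obtain p u where "x = enc (p, u)" "p \<in> Fs" "u \<in> M" using xc unfolding dga_simps by (rule carrier_algE)
      from dga_direct_sum[OF this(2,3)] this(1) show ?thesis by simp
    qed
    show "x \<otimes>\<^bsub>dga\<^esub> y \<in> comp dga (i + j)" if x: "x \<in> comp dga i" and y: "y \<in> comp dga j"
      using x by (cases rule: dga_degree_cases; use y in \<open>cases rule: dga_degree_cases\<close>)
        (auto simp: m closed lact_zero ract_zero zero_lact zero_ract
          intro: zero_comp enc_comp_0 enc_comp_1[simplified])
    show "diff dga (c \<odot>\<^bsub>dga\<^esub> x) = c \<odot>\<^bsub>dga\<^esub> diff dga x" if x: "x \<in> carrier dga"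
    proof -
      obtain p u where "x = enc (p, u)" "p \<in> Fs" "u \<in> M" using x unfolding dga_simps by (rule carrier_algE)
      then show ?thesis by (simp add: smult_enc diff_enc closed d_lact lact_zero)
    qed
    show "diff dga (x \<oplus>\<^bsub>dga\<^esub> y) = diff dga x \<oplus>\<^bsub>dga\<^esub> diff dga y"
      if x: "x \<in> carrier dga" and y: "y \<in> carrier dga"
    proof -
      obtain p u q v where "x = enc (p, u)" "p \<in> Fs" "u \<in> M" "y = enc (q, v)" "q \<in> Fs" "v \<in> M"
        using x y by (metis carrier_algE dga_simps(1))
      then show ?thesis by (simp add: add_enc diff_enc closed d_add)
    qed
    show "diff dga x \<in> comp dga i" if "x \<in> comp dga (Suc i)"
      using that by (cases rule: dga_degree_cases) (auto simp: diff_enc closed comp_dga d_zero intro: zero_comp)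
    show "diff dga x = \<zero>\<^bsub>dga\<^esub>" if "x \<in> comp dga 0"
      using that by (cases rule: dga_degree_cases) (auto simp: diff_enc closed d_zero zero_alg)
    show "diff dga (diff dga x) = \<zero>\<^bsub>dga\<^esub>" if xc: "x \<in> carrier dga"
    proof -
      obtain p u where "x = enc (p, u)" "p \<in> Fs" "u \<in> M" using xc unfolding dga_simps by (rule carrier_algE)
      then show ?thesis by (simp add: diff_enc closed d_zero zero_alg)
    qed
    show "diff dga (x \<otimes>\<^bsub>dga\<^esub> y) = diff dga x \<otimes>\<^bsub>dga\<^esub> y \<oplus>\<^bsub>dga\<^esub> ((-1) ^ i) \<odot>\<^bsub>dga\<^esub> (x \<otimes>\<^bsub>dga\<^esub> diff dga y)"
      if x: "x \<in> comp dga i" and yc: "y \<in> carrier dga"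
    proof -
      obtain q v where y: "y = enc (q, v)" "q \<in> Fs" "v \<in> M" using yc unfolding dga_simps by (rule carrier_algE)
      from x show ?thesis
      proof (cases rule: dga_degree_cases)
        case (1 p)
        then show ?thesis using y
          by (simp add: m diff_enc closed add_enc smult_enc d_lact lact_zero ract_zero zero_lact zero_ract d_zero lact_one d_add)
      next
        case (2 u)
        have "lact (- 1) (ract u (d v)) = - ract u (d v)"
          using 2 y uminus_lact[of 1 "ract u (d v)"] by (simp add: closed lact_one)
        then have "lact (\<sigma> (- 1)) (ract u (d v)) = - ract u (d v)" by (simp add: single_uminus)
        moreover have "lact (d u) v - ract u (d v) \<in> N"
          using crossing[of u v] 2 y N_uminus by fastforce
        ultimately show ?thesis using 2 y N_uminus[of "lact (d u) v - ract u (d v)"]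
          by (simp add: m diff_enc closed add_enc smult_enc d_ract lact_zero ract_zero zero_lact zero_ract
            d_zero M_uminus M_diff enc I_zero)
      next
        case 3
        then show ?thesis using y
          by (simp add: m diff_enc closed add_enc smult_enc lact_zero ract_zero zero_lact zero_ract d_zero)
      qed
    qed
  qed
qed

lemma comm_dg_algebra_dga:
  assumes eps: "eps = 0"
    and c: "\<And>p q. p \<in> Fs \<Longrightarrow> q \<in> Fs \<Longrightarrow> p * q = q * p"
    and a: "\<And>p u. p \<in> Fs \<Longrightarrow> u \<in> M \<Longrightarrow> ract u p = lact p u"
  shows "comm_dg_algebra dga"
proof (intro comm_dg_algebra.intro dg_algebra_dga comm_dg_algebra_axioms.intro eps)
  interpret A: comm_k_algebra alg using c a by (rule comm_k_algebra_alg)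
  have e: "lact (\<sigma> eps) u = 0" if "u \<in> M" for u using zero_lact[OF that] by (simp add: eps)
  fix x y i j assume x: "x \<in> comp dga i" and y: "y \<in> comp dga j"
  interpret D: dg_algebra dga using eps by (rule dg_algebra_dga)
  have xy: "x \<in> carrier alg" "y \<in> carrier alg" using x y D.comp_carrier by auto
  show "x \<otimes>\<^bsub>dga\<^esub> y = ((-1) ^ (i * j)) \<odot>\<^bsub>dga\<^esub> (y \<otimes>\<^bsub>dga\<^esub> x)"
  proof (cases "i = 0 \<or> j = 0")
    case True
    then have "(- 1 :: 'k) ^ (i * j) = 1" by auto
    then show ?thesis using A.mult_comm[OF xy] xy A.m_closed by (simp add: A.smult_one)
  next
    case False
    obtain u v where "x = enc (0, u)" "u \<in> M" "y = enc (0, v)" "v \<in> M"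
      using x y False by (auto elim!: dga_degree_cases intro: M_zero)
    then show ?thesis
      by (simp add: mult_enc smult_enc closed zero_lact zero_ract e lact_zero)
  qed
qed

end

section \<open>Syzygies of a presentation\<close>

text \<open>Neither scalars nor negatives are built in: the generating sets used below contain all
  scalar multiples of their elements.\<close>

inductive_set add_span :: "'a::comm_monoid_add set \<Rightarrow> 'a set" for G where
  zero: "0 \<in> add_span G"
| base: "g \<in> G \<Longrightarrow> g \<in> add_span G"
| add: "p \<in> add_span G \<Longrightarrow> q \<in> add_span G \<Longrightarrow> p + q \<in> add_span G"

lemma add_span_restrict_keys:
  fixes G :: "('w \<Rightarrow>\<^sub>0 'v::comm_monoid_add) set"
  assumes "\<And>g. g \<in> G \<Longrightarrow> restrict_keys Q g \<in> {g, 0}" "p \<in> add_span G"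
  shows "restrict_keys Q p \<in> add_span G"
  using assms(2)
proof (induction rule: add_span.induct)
  case (base g)
  then show ?case using assms(1)[of g] by (auto intro: add_span.intros)
qed (auto intro: add_span.intros simp: restrict_keys_add)

lemma add_span_image:
  assumes "p \<in> add_span G" "0 \<in> S" "\<And>x y. x \<in> S \<Longrightarrow> y \<in> S \<Longrightarrow> x + y \<in> S"
    "\<And>g. g \<in> G \<Longrightarrow> h g \<in> S" "h 0 = 0"
    "\<And>p q. p \<in> add_span G \<Longrightarrow> q \<in> add_span G \<Longrightarrow> h (p + q) = h p + h q"
  shows "h p \<in> S"
  using assms(1) by (induction rule: add_span.induct) (auto simp: assms)

lemma keys_multE:
  assumes "w \<in> Poly_Mapping.keys (p * q)"
  obtains u v where "w = u + v" "u \<in> Poly_Mapping.keys p" "v \<in> Poly_Mapping.keys q"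
  using assms keys_mult[of p q] by blast

lemma word_degree_simps [simp]:
  "word_degree f 0 = 0" "word_degree f (u + v) = word_degree f u + word_degree f v"
  "word_degree f (Word []) = 0" "word_degree f (Word (x # xs)) = f x + word_degree f (Word xs)"
  by (simp_all add: word_degree_def zero_word_def plus_word_def)

definition map_word :: "('a \<Rightarrow> 'b) \<Rightarrow> 'a word \<Rightarrow> 'b word" where
  "map_word f w = Word (map f (letters w))"

lemma map_word_simps [simp]:
  "map_word f (u + v) = map_word f u + map_word f v" "map_word f 0 = 0"
  "map_word f (Word (x # xs)) = Word [f x] + map_word f (Word xs)"
  by (simp_all add: map_word_def zero_word_def plus_word_def)

lemma single_word_eq_word_prod:
  "Poly_Mapping.single w (1::'k::field) = word_prod (free_algebra X) gen w"
proof (cases w)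
  case (Word xs)
  have "Poly_Mapping.single (Word xs) (1::'k) = word_prod (free_algebra X) gen (Word xs)"
  proof (induction xs)
    case Nil
    have "Poly_Mapping.single (Word []) 1 = (1 :: 'a word \<Rightarrow>\<^sub>0 'k)"
      unfolding zero_word_def[symmetric] by simp
    then show ?case by (simp add: word_prod_def)
  next
    case (Cons x xs)
    have "Poly_Mapping.single (Word (x # xs)) (1::'k) = gen x * Poly_Mapping.single (Word xs) 1"
      by (simp add: gen_def mult_single plus_word_def)
    then show ?case by (simp add: Cons word_prod_def)
  qed
  then show ?thesis by (simp add: Word)
qed

locale graded_presentation =
  fixes X :: "'x set" and dx :: "'x \<Rightarrow> nat" and Y :: "'y set" and dy :: "'y \<Rightarrow> nat"
    and j :: "'y \<Rightarrow> 'x word \<Rightarrow>\<^sub>0 'k::field_char_0"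
  assumes presentation: "presentation_data X dx Y dy j"
begin

lemma finite_X: "finite X" and dx_pos: "x \<in> X \<Longrightarrow> 0 < dx x"
  and finite_Y: "finite Y" and dy_pos: "y \<in> Y \<Longrightarrow> 0 < dy y"
  and j_closed: "y \<in> Y \<Longrightarrow> j y \<in> carrier (free_algebra X)"
  and j_degree: "y \<in> Y \<Longrightarrow> w \<in> Poly_Mapping.keys (j y) \<Longrightarrow> word_degree dx w = dy y"
  using presentation unfolding presentation_data_def by blast+

abbreviation F :: "('k, 'x word \<Rightarrow>\<^sub>0 'k) module" where "F \<equiv> free_algebra X"
abbreviation Z :: "('x + 'y) set" where "Z \<equiv> Inl ` X \<union> Inr ` Y"
abbreviation T :: "('k, ('x + 'y) word \<Rightarrow>\<^sub>0 'k) module" where "T \<equiv> free_algebra Z"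
abbreviation J :: "('x word \<Rightarrow>\<^sub>0 'k) set" where "J \<equiv> relation_ideal X Y j"
abbreviation iw :: "'x word \<Rightarrow> ('x + 'y) word" where "iw \<equiv> map_word Inl"

sublocale F: k_algebra F by (rule k_algebra_free_algebra)
sublocale T: k_algebra T by (rule k_algebra_free_algebra)

text \<open>F (x) L (x) F is realised inside the free algebra T on ordinary and relation letters
  together: f acts by multiplication with \<open>iota f\<close>, and \<open>ev\<close>, which
  replaces each relation letter by its relation, restricts to the map onto J. This spares a
  construction of tensor products.\<close>

definition iota :: "('x word \<Rightarrow>\<^sub>0 'k) \<Rightarrow> ('x + 'y) word \<Rightarrow>\<^sub>0 'k" where
  "iota = free_eval T (\<lambda>x. gen (Inl x))"

definition ev :: "(('x + 'y) word \<Rightarrow>\<^sub>0 'k) \<Rightarrow> 'x word \<Rightarrow>\<^sub>0 'k" where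
  "ev = free_eval F (case_sum gen j)"

text \<open>The words with exactly one relation letter span the free bimodule \<open>F \<otimes> L \<otimes> F\<close>.\<close>

definition W1 :: "('x + 'y) word set" where
  "W1 = {iw a + Word [Inr y] + iw b | a y b. a \<in> words_over X \<and> y \<in> Y \<and> b \<in> words_over X}"

definition T1 :: "(('x + 'y) word \<Rightarrow>\<^sub>0 'k) set" where
  "T1 = {p. Poly_Mapping.keys p \<subseteq> W1}"

lemma iota_map: "algebra_map F T iota"
  unfolding iota_def by (rule T.free_eval_algebra_map) auto

lemma ev_map: "algebra_map T F ev"
  unfolding ev_def by (rule F.free_eval_algebra_map) (auto simp: j_closed)

lemmas iota_closed = algebra_map_closed[OF iota_map]
lemmas iota_mult = algebra_map_mult[OF iota_map, simplified]
lemmas iota_add = algebra_map_add[OF iota_map, simplified]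
lemmas iota_one = algebra_map_one[OF iota_map, simplified]
lemmas ev_closed = algebra_map_closed[OF ev_map]
lemmas ev_mult = algebra_map_mult[OF ev_map, simplified]
lemmas ev_add = algebra_map_add[OF ev_map, simplified]
lemmas ev_one = algebra_map_one[OF ev_map, simplified]
lemmas ev_smult = algebra_map_smult[OF ev_map, simplified]
lemmas F_closed = free_algebra_closed[where X = X and ?'k = 'k]
lemmas T_closed = free_algebra_closed[where X = Z and ?'k = 'k]

lemma iota_zero: "iota 0 = 0" and ev_zero: "ev 0 = 0"
  using algebra_map_zero[OF iota_map F.ring_axioms T.ring_axioms]
    algebra_map_zero[OF ev_map T.ring_axioms F.ring_axioms] by simp_all

lemma iota_uminus: "p \<in> carrier F \<Longrightarrow> iota (- p) = - iota p"
  using iota_add[of p "- p"] F_closed(4)[of p] iota_zero by (simp add: eq_neg_iff_add_eq_0 add.commute)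

lemma ev_uminus: "p \<in> carrier T \<Longrightarrow> ev (- p) = - ev p"
  using ev_add[of p "- p"] T_closed(4)[of p] ev_zero by (simp add: eq_neg_iff_add_eq_0 add.commute)

lemma iota_diff: "p \<in> carrier F \<Longrightarrow> q \<in> carrier F \<Longrightarrow> iota (p - q) = iota p - iota q"
  using iota_add[of p "- q"] F_closed(4)[of q] iota_uminus by simp

lemma ev_diff: "p \<in> carrier T \<Longrightarrow> q \<in> carrier T \<Longrightarrow> ev (p - q) = ev p - ev q"
  using ev_add[of p "- q"] T_closed(4)[of q] ev_uminus by simp

lemma ev_gen: "x \<in> X \<Longrightarrow> ev (gen (Inl x)) = gen x" "y \<in> Y \<Longrightarrow> ev (gen (Inr y)) = j y"
  unfolding ev_def by (auto simp: F.free_eval_gen j_closed)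

lemma iota_gen: "x \<in> X \<Longrightarrow> iota (gen x) = gen (Inl x)"
  unfolding iota_def by (rule T.free_eval_gen) simp

lemma ev_iota: "p \<in> carrier F \<Longrightarrow> ev (iota p) = p"
proof (rule algebra_map_free_algebra_eq[of X F "\<lambda>p. ev (iota p)" "\<lambda>p. p"])
  show "algebra_map F F (\<lambda>p. ev (iota p))" by (rule algebra_map_comp[OF iota_map ev_map])
  show "algebra_map F F (\<lambda>p. p)" by (rule algebra_mapI) auto
qed (auto simp: iota_gen ev_gen)

lemma iw_closed: "a \<in> words_over X \<Longrightarrow> iw a \<in> words_over Z"
  by (auto simp: words_over_def map_word_def)

lemma W1_closed: "W1 \<subseteq> words_over Z"
  by (auto simp: W1_def iw_closed)

lemma T1_closed: "p \<in> T1 \<Longrightarrow> p \<in> carrier T"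
  using W1_closed by (auto simp: T1_def carrier_free_algebra)

lemma iota_single:
  assumes "a \<in> words_over X"
  shows "iota (Poly_Mapping.single a c) = Poly_Mapping.single (iw a) c"
proof -
  have "word_prod T (\<lambda>x. gen (Inl x)) w = word_prod T gen (iw w)" for w
    by (simp add: word_prod_def map_word_def foldr_map o_def)
  then have "word_prod T (\<lambda>x. gen (Inl x)) a = Poly_Mapping.single (iw a) (1::'k)"
    by (simp add: single_word_eq_word_prod[symmetric])
  then show ?thesis
    unfolding iota_def using assms by (subst T.free_eval_word[where X = X]) (auto simp: mult_single)
qed

lemma T1_add: "p \<in> T1 \<Longrightarrow> q \<in> T1 \<Longrightarrow> p + q \<in> T1"
  and T1_zero: "0 \<in> T1"
  and T1_uminus: "p \<in> T1 \<Longrightarrow> - p \<in> T1"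
  and T1_restrict: "p \<in> T1 \<Longrightarrow> restrict_keys Q p \<in> T1"
  using keys_add_subset[of p W1 q] by (auto simp: T1_def in_keys_iff)

lemma T1_diff: "p \<in> T1 \<Longrightarrow> q \<in> T1 \<Longrightarrow> p - q \<in> T1"
  using T1_add[of p "- q"] T1_uminus[of q] by simp

lemma T1_single: "w \<in> W1 \<Longrightarrow> Poly_Mapping.single w c \<in> T1"
  by (simp add: T1_def)

lemma T1_gen: "y \<in> Y \<Longrightarrow> gen (Inr y) \<in> T1"
  unfolding gen_def by (rule T1_single) (force simp: W1_def zero_word_def[symmetric] intro: exI[of _ 0])

lemma keys_iota:
  assumes "Poly_Mapping.keys p \<subseteq> K" "K \<subseteq> words_over X"
  shows "Poly_Mapping.keys (iota p) \<subseteq> iw ` K"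
  using assms(1)
proof (induction p rule: poly_mapping_induct_single)
  case (add p q)
  then have "p \<in> carrier F" "q \<in> carrier F" using assms(2) by (auto simp: carrier_free_algebra)
  then show ?case using add keys_add[of "iota p" "iota q"] by (auto simp: iota_add)
next
  case (single w c)
  then show ?case using assms(2) by (auto simp: iota_single split: if_splits)
qed (simp add: iota_zero)

lemma iota_T1: "p \<in> carrier F \<Longrightarrow> t \<in> T1 \<Longrightarrow> iota p * t \<in> T1"
  and T1_iota: "p \<in> carrier F \<Longrightarrow> t \<in> T1 \<Longrightarrow> t * iota p \<in> T1"
proof -
  assume p: "p \<in> carrier F" and t: "t \<in> T1"
  have i: "\<exists>a'\<in>words_over X. w = iw a'" if "w \<in> Poly_Mapping.keys (iota p)" for w
    using keys_iota[of p "words_over X"] that p by (auto simp: carrier_free_algebra)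
  have "u + v \<in> W1" if "u \<in> Poly_Mapping.keys (iota p)" "v \<in> Poly_Mapping.keys t" for u v
  proof -
    from i[OF that(1)] obtain a' where a': "a' \<in> words_over X" "u = iw a'" by blast
    from that(2) t obtain a y b where v: "v = iw a + Word [Inr y] + iw b"
      "a \<in> words_over X" "y \<in> Y" "b \<in> words_over X"
      by (auto simp: T1_def W1_def)
    have "u + v = iw (a' + a) + Word [Inr y] + iw b" by (simp add: a' v add.assoc)
    then show ?thesis unfolding W1_def using a' v
      by (intro CollectI exI[of _ "a' + a"] exI[of _ y] exI[of _ b]) simp
  qed
  then show "iota p * t \<in> T1" unfolding T1_def using keys_mult[of "iota p" t] by blast
  have "v + u \<in> W1" if "u \<in> Poly_Mapping.keys (iota p)" "v \<in> Poly_Mapping.keys t" for u v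
  proof -
    from i[OF that(1)] obtain a' where a': "a' \<in> words_over X" "u = iw a'" by blast
    from that(2) t obtain a y b where v: "v = iw a + Word [Inr y] + iw b"
      "a \<in> words_over X" "y \<in> Y" "b \<in> words_over X"
      by (auto simp: T1_def W1_def)
    have "v + u = iw a + Word [Inr y] + iw (b + a')" by (simp add: a' v add.assoc)
    then show ?thesis unfolding W1_def using a' v
      by (intro CollectI exI[of _ a] exI[of _ y] exI[of _ "b + a'"]) simp
  qed
  then show "t * iota p \<in> T1" unfolding T1_def using keys_mult[of t "iota p"] by blast
qed

lemma T1_induct [consumes 1, case_names zero single add]:
  assumes "t \<in> T1" "Q 0"
    and "\<And>a y b c. a \<in> words_over X \<Longrightarrow> y \<in> Y \<Longrightarrow> b \<in> words_over X \<Longrightarrow>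
      Q (iota (Poly_Mapping.single a c) * gen (Inr y) * iota (Poly_Mapping.single b 1))"
    and "\<And>p q. p \<in> T1 \<Longrightarrow> q \<in> T1 \<Longrightarrow> Q p \<Longrightarrow> Q q \<Longrightarrow> Q (p + q)"
  shows "Q t"
proof -
  have "Poly_Mapping.keys t \<subseteq> W1" using assms(1) by (simp add: T1_def)
  then show ?thesis
  proof (induction t rule: poly_mapping_induct_single)
    case (single w c)
    then obtain a y b where w: "w = iw a + Word [Inr y] + iw b"
      "a \<in> words_over X" "y \<in> Y" "b \<in> words_over X"
      by (auto simp: W1_def)
    have "Poly_Mapping.single w c = iota (Poly_Mapping.single a c) * gen (Inr y) * iota (Poly_Mapping.single b 1)"
      using w by (simp add: iota_single gen_def mult_single)
    then show ?case using assms(3) w by simp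
  qed (auto simp: assms(2) T1_def intro: assms(4))
qed

lemma relation_ideal_ideal: "ideal J F"
  unfolding relation_ideal_def by (rule F.genideal_ideal) (auto simp: j_closed)

sublocale J: ideal J F by (rule relation_ideal_ideal)

lemma J_sub: "v \<in> J \<Longrightarrow> v \<in> carrier F" by (rule J.Icarr)

lemma j_in_J: "y \<in> Y \<Longrightarrow> j y \<in> J"
  unfolding relation_ideal_def using F.genideal_self[of "j ` Y"] j_closed by auto

lemma J_mult: "v \<in> J \<Longrightarrow> p \<in> carrier F \<Longrightarrow> p * v \<in> J" "v \<in> J \<Longrightarrow> p \<in> carrier F \<Longrightarrow> v * p \<in> J"
  using J.I_l_closed[of v p] J.I_r_closed[of v p] by simp_all

lemma J_add: "v \<in> J \<Longrightarrow> v' \<in> J \<Longrightarrow> v + v' \<in> J" and J_zero: "0 \<in> J"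
  using J.a_closed[of v v'] J.zero_closed by simp_all

lemma J_uminus: "v \<in> J \<Longrightarrow> - v \<in> J"
  using J_mult(1)[of v "- 1"] F_closed by simp

lemma ev_T1: "t \<in> T1 \<Longrightarrow> ev t \<in> J"
proof (induction rule: T1_induct)
  case (single a y b c)
  then have "gen (Inr y) \<in> carrier T" "iota (Poly_Mapping.single a c) \<in> carrier T"
    "iota (Poly_Mapping.single b 1) \<in> carrier T" by (auto intro: iota_closed)
  moreover have "Poly_Mapping.single a c * j y \<in> J"
    using single by (intro J_mult(1) j_in_J) auto
  then have "Poly_Mapping.single a c * j y * Poly_Mapping.single b 1 \<in> J"
    using single by (intro J_mult(2)[where v = "Poly_Mapping.single a c * j y"]) auto
  ultimately show ?case using single
    by (simp add: ev_mult T_closed ev_iota ev_gen)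
qed (auto simp: ev_zero J_zero ev_add T1_closed J_add)

text \<open>The evaluations of combinations of words with one relation letter form an ideal, as
  \<open>f\<close> acts through \<open>iota f\<close>, and this ideal contains the
  relations.\<close>

lemma J_eq: "J = ev ` T1"
proof
  show "ev ` T1 \<subseteq> J" using ev_T1 by auto
  have "ideal (ev ` T1) F"
  proof (rule idealI)
    show "ring F" by (rule F.ring_axioms)
    show "subgroup (ev ` T1) (add_monoid F)"
    proof (rule F.add.subgroupI)
      show "ev ` T1 \<subseteq> carrier F" using ev_T1 J_sub by auto
      show "ev ` T1 \<noteq> {}" using T1_zero by auto
    next
      fix a b assume "a \<in> ev ` T1" "b \<in> ev ` T1"
      then obtain s t where "a = ev s" "s \<in> T1" "b = ev t" "t \<in> T1" by auto
      then show "a \<oplus>\<^bsub>F\<^esub> b \<in> ev ` T1" by (auto simp: ev_add[symmetric] T1_closed intro: T1_add)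
    next
      fix a assume "a \<in> ev ` T1"
      then obtain s where s: "a = ev s" "s \<in> T1" by auto
      have "\<ominus>\<^bsub>F\<^esub> a = ev (- s)"
        using s ev_uminus[OF T1_closed[OF s(2)]] ev_closed[OF T1_closed[OF s(2)]]
        by (intro F.minus_equality) (auto simp: F_closed)
      then show "\<ominus>\<^bsub>F\<^esub> a \<in> ev ` T1" using T1_uminus[OF s(2)] by auto
    qed
    fix a p assume "a \<in> ev ` T1" and p: "p \<in> carrier F"
    then obtain s where s: "a = ev s" "s \<in> T1" by auto
    have "p * a = ev (iota p * s)" "a * p = ev (s * iota p)"
      using s p by (auto simp: ev_mult T1_closed iota_closed ev_iota)
    then show "p \<otimes>\<^bsub>F\<^esub> a \<in> ev ` T1" "a \<otimes>\<^bsub>F\<^esub> p \<in> ev ` T1"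
      using iota_T1[OF p s(2)] T1_iota[OF p s(2)] by auto
  qed
  moreover have "j ` Y \<subseteq> ev ` T1" using T1_gen ev_gen(2) by force
  ultimately show "J \<subseteq> ev ` T1" unfolding relation_ideal_def by (rule F.genideal_minimal)
qed

text \<open>\<open>wt\<close> gives a relation letter the degree of its relation, which makes
  \<open>ev\<close> homogeneous. \<open>wt0\<close> counts ordinary letters only; on words with one
  relation letter it measures the distance from the bare letter and drives the Nakayama argument for
  the conormal bimodule.\<close>

abbreviation wt :: "('x + 'y) word \<Rightarrow> nat" where "wt \<equiv> word_degree (case_sum dx dy)"
abbreviation wt0 :: "('x + 'y) word \<Rightarrow> nat" where "wt0 \<equiv> word_degree (case_sum dx (\<lambda>_. 0))"

lemma wt_iw [simp]: "wt (iw a) = word_degree dx a" "wt0 (iw a) = word_degree dx a"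
  by (simp_all add: word_degree_def map_word_def o_def)

section \<open>Homogeneity of the evaluation map\<close>

lemma keys_ev_single:
  assumes "w \<in> words_over Z" "v \<in> Poly_Mapping.keys (ev (Poly_Mapping.single w c))"
  shows "word_degree dx v = wt w"
proof -
  have "Word xs \<in> words_over Z \<Longrightarrow> v \<in> Poly_Mapping.keys (ev (Poly_Mapping.single (Word xs) 1)) \<Longrightarrow>
      word_degree dx v = wt (Word xs)" for xs v
  proof (induction xs arbitrary: v)
    case Nil
    then show ?case by (simp add: zero_word_def[symmetric] ev_one)
  next
    case (Cons z zs)
    have z: "gen z \<in> carrier T" "Poly_Mapping.single (Word zs) 1 \<in> carrier T" "z \<in> Z" "Word zs \<in> words_over Z"
      using Cons.prems by auto
    have "Poly_Mapping.single (Word (z # zs)) 1 = gen z * Poly_Mapping.single (Word zs) (1::'k)"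
      by (simp add: gen_def mult_single plus_word_def)
    then have "ev (Poly_Mapping.single (Word (z # zs)) 1) = ev (gen z) * ev (Poly_Mapping.single (Word zs) 1)"
      using z by (simp add: ev_mult)
    then obtain u u' where v: "v = u + u'" "u \<in> Poly_Mapping.keys (ev (gen z))"
      "u' \<in> Poly_Mapping.keys (ev (Poly_Mapping.single (Word zs) 1))"
      using Cons.prems(2) keys_mult by fastforce
    have "word_degree dx u = case_sum dx dy z"
    proof (cases z)
      case (Inl x)
      then have "ev (gen z) = gen x" using z(3) ev_gen(1) by auto
      then show ?thesis using v(2) Inl by (simp add: gen_def)
    next
      case (Inr y)
      then show ?thesis using v(2) z(3) by (auto simp: ev_gen j_degree)
    qed
    then show ?case using Cons.IH[OF z(4) v(3)] v(1) by simp
  qed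
  moreover have "Poly_Mapping.single w c = Poly_Mapping.single 0 c * Poly_Mapping.single w 1"
    by (simp add: mult_single)
  then have "ev (Poly_Mapping.single w c) = Poly_Mapping.single 0 c * ev (Poly_Mapping.single w 1)"
    using assms(1) ev_smult[of "Poly_Mapping.single w 1" c] by simp
  then have "v \<in> Poly_Mapping.keys (ev (Poly_Mapping.single w 1))"
    using assms(2) keys_mult[of "Poly_Mapping.single 0 c" "ev (Poly_Mapping.single w 1)"]
    by (auto split: if_splits)
  ultimately show ?thesis using assms(1) by (metis word.exhaust)
qed

lemma restrict_keys_ev:
  assumes "p \<in> carrier T"
  shows "restrict_keys (\<lambda>v. word_degree dx v = D) (ev p) = ev (restrict_keys (\<lambda>w. wt w = D) p)"
proof -
  have "Poly_Mapping.keys p \<subseteq> words_over Z" using assms by (simp add: carrier_free_algebra)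
  then show ?thesis
  proof (induction p rule: poly_mapping_induct_single)
    case zero
    then show ?case by (simp add: ev_zero)
  next
    case (single w c)
    show ?case
    proof (cases "wt w = D")
      case True
      then show ?thesis using keys_ev_single[OF single]
        by (simp add: restrict_keys_single restrict_keys_id)
    next
      case False
      then show ?thesis using keys_ev_single[OF single]
        by (simp add: restrict_keys_single restrict_keys_eq_0 ev_zero)
    qed
  next
    case (add p q)
    have "restrict_keys Q p \<in> carrier T" "restrict_keys Q q \<in> carrier T" "p \<in> carrier T" "q \<in> carrier T" for Q
      using add(1,2) by (auto simp: carrier_free_algebra)
    then show ?case using add(3,4) by (simp add: ev_add restrict_keys_add)
  qed
qed

lemma W1_weight_pos: "w \<in> W1 \<Longrightarrow> 0 < wt w"
  by (auto simp: W1_def dy_pos)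

text \<open>A word with a relation letter has positive weight and \<open>ev\<close> preserves
  degrees. So J lies in the augmentation ideal; later this shows that a left factor from J begins
  with an ordinary letter.\<close>

lemma J_degree_pos:
  assumes "v \<in> J" "w \<in> Poly_Mapping.keys v"
  shows "0 < word_degree dx w"
proof (rule ccontr)
  assume "\<not> 0 < word_degree dx w"
  obtain t where t: "t \<in> T1" "v = ev t" using assms(1) J_eq by auto
  have "restrict_keys (\<lambda>w. wt w = 0) t = 0"
    using t(1) W1_weight_pos by (intro restrict_keys_eq_0) (auto simp: T1_def subset_iff)
  then have "restrict_keys (\<lambda>v. word_degree dx v = 0) v = 0"
    using restrict_keys_ev[OF T1_closed[OF t(1)], of 0] t(2) by (simp add: ev_zero)
  moreover have "w \<in> Poly_Mapping.keys (restrict_keys (\<lambda>v. word_degree dx v = 0) v)"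
    using assms(2) \<open>\<not> 0 < word_degree dx w\<close> by simp
  ultimately show False by simp
qed

text \<open>U is J T1 + T1 J, the kernel of F (x) L (x) F -> A (x) L (x) A. N consists, up to sign,
  of the boundaries of words with two relation letters, for the differential on T that sends each
  relation letter to its relation. Generators are formed from monomials, so that a projection to
  suitable degrees keeps or kills each of them.\<close>

definition U :: "(('x + 'y) word \<Rightarrow>\<^sub>0 'k) set" where
  "U = add_span ({iota (ev (Poly_Mapping.single w c)) * Poly_Mapping.single w' d | w c w' d. w \<in> W1 \<and> w' \<in> W1} \<union>
     {Poly_Mapping.single w' d * iota (ev (Poly_Mapping.single w c)) | w c w' d. w \<in> W1 \<and> w' \<in> W1})"

definition N :: "(('x + 'y) word \<Rightarrow>\<^sub>0 'k) set" where
  "N = add_span {Poly_Mapping.single w c * iota (ev (Poly_Mapping.single w' d)) -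
     iota (ev (Poly_Mapping.single w c)) * Poly_Mapping.single w' d | w c w' d. w \<in> W1 \<and> w' \<in> W1}"

lemma U_zero: "0 \<in> U" and N_zero: "0 \<in> N"
  and U_add: "p \<in> U \<Longrightarrow> q \<in> U \<Longrightarrow> p + q \<in> U" and N_add: "p \<in> N \<Longrightarrow> q \<in> N \<Longrightarrow> p + q \<in> N"
  by (auto simp: U_def N_def intro: add_span.intros)

lemma ev_iota_T1: "t \<in> T1 \<Longrightarrow> iota (ev t) \<in> carrier T"
  by (simp add: iota_closed ev_closed T1_closed)

lemma W1_subset_induct [consumes 1, case_names zero single add]:
  assumes "t \<in> T1" "Q 0" "\<And>w c. w \<in> W1 \<Longrightarrow> Q (Poly_Mapping.single w c)"
    and "\<And>p q. p \<in> T1 \<Longrightarrow> q \<in> T1 \<Longrightarrow> Q p \<Longrightarrow> Q q \<Longrightarrow> Q (p + q)"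
  shows "Q t"
  using assms(1) poly_mapping_induct_single[of t W1 Q] assms(2-) unfolding T1_def by auto

lemma iota_ev_add:
  "s \<in> T1 \<Longrightarrow> t \<in> T1 \<Longrightarrow> iota (ev (s + t)) = iota (ev s) + iota (ev t)"
  by (simp add: ev_add iota_add T1_closed ev_closed)

lemma U_ev:
  assumes "s \<in> T1" "t \<in> T1"
  shows "iota (ev s) * t \<in> U" "t * iota (ev s) \<in> U"
proof -
  have "iota (ev s) * t \<in> U \<and> t * iota (ev s) \<in> U"
    using assms(1)
  proof (induction s rule: W1_subset_induct)
    case (single w c)
    note w = single
    show ?case using assms(2)
    proof (induction t rule: W1_subset_induct)
      case (single w' d)
      then show ?case using w unfolding U_def by (intro conjI; intro add_span.base; blast)
    qed (auto simp: U_zero distrib_left distrib_right intro: U_add)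
  qed (auto simp: U_zero ev_zero iota_zero iota_ev_add distrib_left distrib_right intro: U_add)
  then show "iota (ev s) * t \<in> U" "t * iota (ev s) \<in> U" by auto
qed

lemma U_J:
  assumes "v \<in> J" "t \<in> T1"
  shows "iota v * t \<in> U" "t * iota v \<in> U"
  using U_ev assms J_eq by auto

lemma N_ev:
  assumes "s \<in> T1" "t \<in> T1"
  shows "s * iota (ev t) - iota (ev s) * t \<in> N"
  using assms(1)
proof (induction s rule: W1_subset_induct)
  case (single w c)
  note w = single
  show ?case using assms(2)
  proof (induction t rule: W1_subset_induct)
    case (single w' d)
    then show ?case using w unfolding N_def by (auto intro!: add_span.base)
  next
    case (add p q)
    have "Poly_Mapping.single w c * iota (ev (p + q)) - iota (ev (Poly_Mapping.single w c)) * (p + q)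
      = (Poly_Mapping.single w c * iota (ev p) - iota (ev (Poly_Mapping.single w c)) * p)
      + (Poly_Mapping.single w c * iota (ev q) - iota (ev (Poly_Mapping.single w c)) * q)"
      using add by (simp add: iota_ev_add distrib_left)
    then show ?case using add N_add by simp
  qed (auto simp: N_zero ev_zero iota_zero)
next
  case (add p q)
  have "(p + q) * iota (ev t) - iota (ev (p + q)) * t
      = (p * iota (ev t) - iota (ev p) * t) + (q * iota (ev t) - iota (ev q) * t)"
    using add by (simp add: iota_ev_add distrib_right)
  then show ?case using add N_add by simp
qed (auto simp: N_zero ev_zero iota_zero)

lemma N_T1: "p \<in> N \<Longrightarrow> p \<in> T1"
  unfolding N_def
proof (induction rule: add_span.induct)
  case (base g)
  then show ?case by (auto intro!: T1_diff iota_T1 T1_iota T1_single ev_closed T1_closed)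
qed (auto intro: T1_zero T1_add)

text \<open>Both terms of a generator evaluate to the product of the two evaluations.\<close>

lemma ev_N: "p \<in> N \<Longrightarrow> ev p = 0"
proof -
  assume "p \<in> N"
  then have "p \<in> T1 \<and> ev p = 0" unfolding N_def
  proof (induction rule: add_span.induct)
    case (base g)
    then obtain w c w' d where g: "g = Poly_Mapping.single w c * iota (ev (Poly_Mapping.single w' d)) -
       iota (ev (Poly_Mapping.single w c)) * Poly_Mapping.single w' d" "w \<in> W1" "w' \<in> W1" by blast
    have t: "Poly_Mapping.single w c \<in> T1" "Poly_Mapping.single w' d \<in> T1" using g T1_single by auto
    then have c: "Poly_Mapping.single w c \<in> carrier T" "Poly_Mapping.single w' d \<in> carrier T"
      "iota (ev (Poly_Mapping.single w c)) \<in> carrier T" "iota (ev (Poly_Mapping.single w' d)) \<in> carrier T"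
      "ev (Poly_Mapping.single w c) \<in> carrier F" "ev (Poly_Mapping.single w' d) \<in> carrier F"
      using T1_closed ev_iota_T1 ev_closed by blast+
    have "g \<in> T1" using g t c by (auto intro!: T1_diff iota_T1 T1_iota)
    moreover have "ev g = 0" unfolding g(1) using c by (simp add: ev_diff ev_mult T_closed ev_iota)
    ultimately show ?case by simp
  qed (auto simp: ev_zero T1_zero ev_add T1_closed intro: T1_add)
  then show ?thesis by simp
qed

text \<open>A left factor is absorbed by the first entry of a generator: a (s d(t) - d(s) t) = (a s)
  d(t) - d(a s) t.\<close>

lemma N_iota:
  assumes "p \<in> N" "a \<in> words_over X"
  shows "iota (Poly_Mapping.single a 1) * p \<in> N"
proof -
  let ?a = "iota (Poly_Mapping.single a 1)"
  have a: "?a \<in> carrier T" "Poly_Mapping.single a 1 \<in> carrier F" using assms(2) by (auto intro: iota_closed)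
  show ?thesis using assms(1)
    unfolding N_def
  proof (rule add_span_image)
    fix g assume "g \<in> {Poly_Mapping.single w c * iota (ev (Poly_Mapping.single w' d)) -
       iota (ev (Poly_Mapping.single w c)) * Poly_Mapping.single w' d | w c w' d. w \<in> W1 \<and> w' \<in> W1}"
    then obtain w c w' d where g: "g = Poly_Mapping.single w c * iota (ev (Poly_Mapping.single w' d)) -
       iota (ev (Poly_Mapping.single w c)) * Poly_Mapping.single w' d" "w \<in> W1" "w' \<in> W1" by blast
    let ?s = "Poly_Mapping.single w c" and ?t = "Poly_Mapping.single w' d"
    have t: "?s \<in> T1" "?t \<in> T1" using g T1_single by auto
    have "iota (ev (?a * ?s)) = ?a * iota (ev ?s)"
      using a T1_closed[OF t(1)] ev_closed[OF T1_closed[OF t(1)]] by (simp add: ev_mult ev_iota iota_mult)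
    then have "?a * g = (?a * ?s) * iota (ev ?t) - iota (ev (?a * ?s)) * ?t"
      by (simp add: g right_diff_distrib mult.assoc)
    then show "?a * g \<in> add_span {Poly_Mapping.single w c * iota (ev (Poly_Mapping.single w' d)) -
       iota (ev (Poly_Mapping.single w c)) * Poly_Mapping.single w' d | w c w' d. w \<in> W1 \<and> w' \<in> W1}"
      using N_ev[OF iota_T1[OF a(2) t(1)] t(2)] by (simp add: N_def)
  qed (auto simp: distrib_left intro: add_span.intros)
qed

lemma restrict_N: "p \<in> N \<Longrightarrow> restrict_keys (\<lambda>w. wt w = D) p \<in> N"
  unfolding N_def
proof (rule add_span_restrict_keys)
  fix g assume "g \<in> {Poly_Mapping.single w c * iota (ev (Poly_Mapping.single w' d)) -
     iota (ev (Poly_Mapping.single w c)) * Poly_Mapping.single w' d | w c w' d. w \<in> W1 \<and> w' \<in> W1}"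
  then obtain w c w' d where g: "g = Poly_Mapping.single w c * iota (ev (Poly_Mapping.single w' d)) -
     iota (ev (Poly_Mapping.single w c)) * Poly_Mapping.single w' d" "w \<in> W1" "w' \<in> W1" by blast
  have k: "wt v = wt u" if "u \<in> W1" "v \<in> Poly_Mapping.keys (iota (ev (Poly_Mapping.single u c)))" for u v c
  proof -
    have u: "u \<in> words_over Z" using W1_closed that(1) by auto
    have "Poly_Mapping.keys (ev (Poly_Mapping.single u c)) \<subseteq> words_over X"
      using ev_closed[of "Poly_Mapping.single u c"] u by (simp add: carrier_free_algebra)
    with that(2) keys_iota[of "ev (Poly_Mapping.single u c)", OF subset_refl]
    show ?thesis using keys_ev_single[OF u] by auto
  qed
  have "wt v = wt w + wt w'" if "v \<in> Poly_Mapping.keys g" for v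
  proof -
    have "v \<in> Poly_Mapping.keys (Poly_Mapping.single w c * iota (ev (Poly_Mapping.single w' d))) \<union>
      Poly_Mapping.keys (iota (ev (Poly_Mapping.single w c)) * Poly_Mapping.single w' d)"
      using that unfolding g(1) by (rule subsetD[OF keys_diff])
    then show ?thesis
    proof
      assume "v \<in> Poly_Mapping.keys (Poly_Mapping.single w c * iota (ev (Poly_Mapping.single w' d)))"
      then obtain u u' where "v = u + u'" "u \<in> Poly_Mapping.keys (Poly_Mapping.single w c)"
        "u' \<in> Poly_Mapping.keys (iota (ev (Poly_Mapping.single w' d)))" by (rule keys_multE)
      then show ?thesis using k[OF g(3)] by (simp split: if_splits)
    next
      assume "v \<in> Poly_Mapping.keys (iota (ev (Poly_Mapping.single w c)) * Poly_Mapping.single w' d)"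
      then obtain u u' where "v = u + u'" "u \<in> Poly_Mapping.keys (iota (ev (Poly_Mapping.single w c)))"
        "u' \<in> Poly_Mapping.keys (Poly_Mapping.single w' d)" by (rule keys_multE)
      then show ?thesis using k[OF g(2)] by (simp split: if_splits)
    qed
  qed
  then show "restrict_keys (\<lambda>w. wt w = D) g \<in> {g, 0}"
    by (cases "D = wt w + wt w'") (auto intro: restrict_keys_id restrict_keys_eq_0)
qed

text \<open>Evaluating a relation letter turns its whole weight into weight of ordinary letters, so
  on either side all terms of a generator have \<open>wt0\<close> equal to
  \<open>wt w + wt0 w'\<close>. This lets \<open>conormal_kernel\<close> cut off high
  degrees.\<close>

lemma restrict_U: "p \<in> U \<Longrightarrow> restrict_keys (\<lambda>w. wt0 w < D) p \<in> U"
  unfolding U_def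
proof (rule add_span_restrict_keys)
  fix g assume "g \<in> {iota (ev (Poly_Mapping.single w c)) * Poly_Mapping.single w' d | w c w' d. w \<in> W1 \<and> w' \<in> W1} \<union>
     {Poly_Mapping.single w' d * iota (ev (Poly_Mapping.single w c)) | w c w' d. w \<in> W1 \<and> w' \<in> W1}"
  then obtain w c w' d where g: "g = iota (ev (Poly_Mapping.single w c)) * Poly_Mapping.single w' d \<or>
    g = Poly_Mapping.single w' d * iota (ev (Poly_Mapping.single w c))" "w \<in> W1" "w' \<in> W1" by blast
  have k: "wt0 v = wt w" if "v \<in> Poly_Mapping.keys (iota (ev (Poly_Mapping.single w c)))" for v
  proof -
    have w: "w \<in> words_over Z" using W1_closed g(2) by auto
    have "Poly_Mapping.keys (ev (Poly_Mapping.single w c)) \<subseteq> words_over X"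
      using ev_closed[of "Poly_Mapping.single w c"] w by (simp add: carrier_free_algebra)
    with that keys_iota[of "ev (Poly_Mapping.single w c)", OF subset_refl]
    show ?thesis using keys_ev_single[OF w] by auto
  qed
  have "wt0 v = wt w + wt0 w'" if "v \<in> Poly_Mapping.keys g" for v
  proof -
    have "v \<in> Poly_Mapping.keys (Poly_Mapping.single w' d * iota (ev (Poly_Mapping.single w c))) \<union>
      Poly_Mapping.keys (iota (ev (Poly_Mapping.single w c)) * Poly_Mapping.single w' d)"
      using that g(1) by auto
    then show ?thesis
    proof
      assume "v \<in> Poly_Mapping.keys (Poly_Mapping.single w' d * iota (ev (Poly_Mapping.single w c)))"
      then obtain u u' where "v = u + u'" "u \<in> Poly_Mapping.keys (Poly_Mapping.single w' d)"
        "u' \<in> Poly_Mapping.keys (iota (ev (Poly_Mapping.single w c)))" by (rule keys_multE)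
      then show ?thesis using k by (simp split: if_splits)
    next
      assume "v \<in> Poly_Mapping.keys (iota (ev (Poly_Mapping.single w c)) * Poly_Mapping.single w' d)"
      then obtain u u' where "v = u + u'" "u \<in> Poly_Mapping.keys (iota (ev (Poly_Mapping.single w c)))"
        "u' \<in> Poly_Mapping.keys (Poly_Mapping.single w' d)" by (rule keys_multE)
      then show ?thesis using k by (simp split: if_splits)
    qed
  qed
  then show "restrict_keys (\<lambda>w. wt0 w < D) g \<in> {g, 0}"
    by (cases "wt w + wt0 w' < D") (auto intro: restrict_keys_id restrict_keys_eq_0)
qed

end

subsection \<open>Left derivatives\<close>

lemma lookup_gen_mult:
  "Poly_Mapping.lookup (gen y * (q :: 'a word \<Rightarrow>\<^sub>0 'k::field)) (Word (x # xs)) =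
     (Poly_Mapping.lookup q (Word xs) when x = y)"
  "Poly_Mapping.lookup (gen y * (q :: 'a word \<Rightarrow>\<^sub>0 'k::field)) (Word []) = 0"
proof -
  have "Poly_Mapping.keys q \<subseteq> UNIV" by simp
  then have "Poly_Mapping.lookup (gen y * q) (Word (x # xs)) = (Poly_Mapping.lookup q (Word xs) when x = y) \<and>
     Poly_Mapping.lookup (gen y * q) (Word []) = 0"
  proof (induction q rule: poly_mapping_induct_single)
    case (single w c)
    then show ?case
      by (cases w) (auto simp: gen_def mult_single plus_word_def lookup_single when_def)
  qed (auto simp: distrib_left lookup_add when_def)
  then show "Poly_Mapping.lookup (gen y * q) (Word (x # xs)) = (Poly_Mapping.lookup q (Word xs) when x = y)"
    "Poly_Mapping.lookup (gen y * q) (Word []) = 0" by auto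
qed

text \<open>Coefficients are pulled back along prefixing \<open>x\<close>, so words not beginning
  with \<open>x\<close> are dropped and left multiplication by \<open>gen x\<close> is
  undone.\<close>

definition lderiv :: "'a \<Rightarrow> ('a word \<Rightarrow>\<^sub>0 'k::field) \<Rightarrow> 'a word \<Rightarrow>\<^sub>0 'k" where
  "lderiv x p = Poly_Mapping.map_key (\<lambda>w. Word (x # letters w)) p"

lemma lookup_lderiv [simp]: "Poly_Mapping.lookup (lderiv x p) (Word xs) = Poly_Mapping.lookup p (Word (x # xs))"
proof -
  have "inj (\<lambda>w. Word (x # letters w))" by (auto simp: inj_def word.expand)
  then show ?thesis by (simp add: lderiv_def map_key.rep_eq)
qed

lemma word_poly_eqI:
  "(\<And>xs. Poly_Mapping.lookup p (Word xs) = Poly_Mapping.lookup q (Word xs)) \<Longrightarrow> p = q"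
  by (rule poly_mapping_eqI) (metis word.exhaust)

lemma lderiv_add: "lderiv x (p + q) = lderiv x p + lderiv x q"
  by (rule word_poly_eqI) (simp add: lookup_add)

lemma lderiv_zero [simp]: "lderiv x 0 = 0"
  by (rule word_poly_eqI) simp

lemma lderiv_sum: "lderiv x (sum f S) = (\<Sum>i\<in>S. lderiv x (f i))"
  by (induction S rule: infinite_finite_induct) (simp_all add: lderiv_add)

lemma lderiv_gen_mult: "lderiv x (gen y * q) = (if x = y then q else 0)"
  by (rule word_poly_eqI) (simp add: lookup_gen_mult)

text \<open>Sorting the words by their first letter loses nothing, since each has a first letter and
  it lies in S.\<close>

lemma sum_gen_lderiv:
  assumes "finite S" "\<And>w. w \<in> Poly_Mapping.keys p \<Longrightarrow> \<exists>x\<in>S. \<exists>xs. w = Word (x # xs)"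
  shows "p = (\<Sum>x\<in>S. gen x * lderiv x p)"
proof (rule word_poly_eqI)
  fix xs
  show "Poly_Mapping.lookup p (Word xs) = Poly_Mapping.lookup (\<Sum>x\<in>S. gen x * lderiv x p) (Word xs)"
  proof (cases xs)
    case Nil
    then show ?thesis using assms(2)[of "Word []"] by (auto simp: lookup_sum lookup_gen_mult in_keys_iff)
  next
    case (Cons y ys)
    have "(\<Sum>x\<in>S. Poly_Mapping.lookup (gen x * lderiv x p) (Word xs))
        = (\<Sum>x\<in>S. if x = y then Poly_Mapping.lookup p (Word xs) else 0)"
      by (rule sum.cong) (auto simp: Cons lookup_gen_mult)
    also have "\<dots> = (if y \<in> S then Poly_Mapping.lookup p (Word xs) else 0)" using assms(1) by simp
    also have "\<dots> = Poly_Mapping.lookup p (Word xs)"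
      using assms(2)[of "Word xs"] by (auto simp: Cons in_keys_iff)
    finally show ?thesis by (simp add: lookup_sum)
  qed
qed

subsection \<open>The conormal bimodule\<close>

context graded_presentation
begin

abbreviation A :: "('k, ('x word \<Rightarrow>\<^sub>0 'k) set) module" where "A \<equiv> presented_algebra X Y j"
abbreviation J2 :: "('x word \<Rightarrow>\<^sub>0 'k) set" where "J2 \<equiv> J \<cdot>\<^bsub>F\<^esub> J"
abbreviation C :: "(('x word \<Rightarrow>\<^sub>0 'k) set, ('x word \<Rightarrow>\<^sub>0 'k) set) bimodule" where
  "C \<equiv> conormal_bimodule F J"

lemma J2_ideal: "ideal J2 F"
  by (rule F.ideal_prod_is_ideal[OF relation_ideal_ideal relation_ideal_ideal])

sublocale J2: ideal J2 F by (rule J2_ideal)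

lemma coset_eq: "K +>\<^bsub>F\<^esub> x = (\<lambda>k. k + x) ` K"
  by (auto simp: a_r_coset_def')

lemma coset_eq_iff:
  assumes "ideal K F" "x \<in> carrier F" "y \<in> carrier F"
  shows "K +>\<^bsub>F\<^esub> x = K +>\<^bsub>F\<^esub> y \<longleftrightarrow> x - y \<in> K"
proof -
  interpret K: ideal K F by fact
  have z: "0 \<in> K" using K.zero_closed by simp
  have a: "a + b \<in> K" if "a \<in> K" "b \<in> K" for a b using K.a_closed[OF that] by simp
  have m: "- a \<in> K" if "a \<in> K" for a
    using K.I_l_closed[of a "- 1"] that F_closed by simp
  show ?thesis unfolding coset_eq
  proof
    assume "(\<lambda>k. k + x) ` K = (\<lambda>k. k + y) ` K"
    then have "0 + x \<in> (\<lambda>k. k + y) ` K" using z by blast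
    then show "x - y \<in> K" by auto
  next
    assume xy: "x - y \<in> K"
    show "(\<lambda>k. k + x) ` K = (\<lambda>k. k + y) ` K"
    proof (intro Set.set_eqI iffI)
      fix u assume "u \<in> (\<lambda>k. k + x) ` K"
      then obtain k where "u = k + x" "k \<in> K" by auto
      then have "u = (k + (x - y)) + y" "k + (x - y) \<in> K" using a[OF _ xy] by auto
      then show "u \<in> (\<lambda>k. k + y) ` K" by blast
    next
      fix u assume "u \<in> (\<lambda>k. k + y) ` K"
      then obtain k where "u = k + y" "k \<in> K" by auto
      then have "u = (k + - (x - y)) + x" "k + - (x - y) \<in> K" using a[OF _ m[OF xy]] by auto
      then show "u \<in> (\<lambda>k. k + x) ` K" by blast
    qed
  qed
qed

lemma A_fields:
  "carrier A = a_rcosets\<^bsub>F\<^esub> J" "mult A = rcoset_mult F J" "one A = J +>\<^bsub>F\<^esub> 1"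
  "ring.zero A = J" "add A = set_add F"
  "smult A c V = (\<Union>x\<in>V. J +>\<^bsub>F\<^esub> (Poly_Mapping.single 0 c * x))"
  by (simp_all add: presented_algebra_def quotient_algebra_def FactRing_def ring.defs module.defs)

lemma carrier_A: "carrier A = (\<lambda>f. J +>\<^bsub>F\<^esub> f) ` carrier F"
  by (auto simp: A_fields A_RCOSETS_def')

lemma A_ops:
  assumes "f \<in> carrier F" "g \<in> carrier F"
  shows "(J +>\<^bsub>F\<^esub> f) \<oplus>\<^bsub>A\<^esub> (J +>\<^bsub>F\<^esub> g) = J +>\<^bsub>F\<^esub> (f + g)"
    and "(J +>\<^bsub>F\<^esub> f) \<otimes>\<^bsub>A\<^esub> (J +>\<^bsub>F\<^esub> g) = J +>\<^bsub>F\<^esub> (f * g)"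
    and "c \<odot>\<^bsub>A\<^esub> (J +>\<^bsub>F\<^esub> f) = J +>\<^bsub>F\<^esub> (Poly_Mapping.single 0 c * f)"
proof -
  show "(J +>\<^bsub>F\<^esub> f) \<oplus>\<^bsub>A\<^esub> (J +>\<^bsub>F\<^esub> g) = J +>\<^bsub>F\<^esub> (f + g)"
    using J.a_rcos_sum assms by (simp add: A_fields)
  show "(J +>\<^bsub>F\<^esub> f) \<otimes>\<^bsub>A\<^esub> (J +>\<^bsub>F\<^esub> g) = J +>\<^bsub>F\<^esub> (f * g)"
    using J.rcoset_mult_add assms by (simp add: A_fields)
  have "J +>\<^bsub>F\<^esub> (Poly_Mapping.single 0 c * x) = J +>\<^bsub>F\<^esub> (Poly_Mapping.single 0 c * f)"
    if "x \<in> J +>\<^bsub>F\<^esub> f" for x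
  proof -
    obtain k where k: "x = k + f" "k \<in> J" using \<open>x \<in> J +>\<^bsub>F\<^esub> f\<close> by (auto simp: coset_eq)
    have "Poly_Mapping.single 0 c * k \<in> J" using J_mult(1)[OF k(2), of "Poly_Mapping.single 0 c"] by simp
    then show ?thesis using k assms J_sub[OF k(2)]
      by (subst coset_eq_iff[OF relation_ideal_ideal]) (auto simp: F_closed distrib_left)
  qed
  moreover have "f \<in> J +>\<^bsub>F\<^esub> f" using J_zero by (force simp: coset_eq)
  ultimately show "c \<odot>\<^bsub>A\<^esub> (J +>\<^bsub>F\<^esub> f) = J +>\<^bsub>F\<^esub> (Poly_Mapping.single 0 c * f)"
    unfolding A_fields by blast
qed

lemma J2_sub_J: "v \<in> J2 \<Longrightarrow> v \<in> J"
  using F.ideal_prod_inter[OF relation_ideal_ideal relation_ideal_ideal] by auto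

lemma J2_zero: "0 \<in> J2" and J2_add: "u \<in> J2 \<Longrightarrow> v \<in> J2 \<Longrightarrow> u + v \<in> J2"
  and J2_mult: "v \<in> J2 \<Longrightarrow> p \<in> carrier F \<Longrightarrow> p * v \<in> J2" "v \<in> J2 \<Longrightarrow> p \<in> carrier F \<Longrightarrow> v * p \<in> J2"
  and J2_prod: "v \<in> J \<Longrightarrow> v' \<in> J \<Longrightarrow> v * v' \<in> J2"
  using J2.zero_closed J2.a_closed[of u v] J2.I_l_closed[of v p] J2.I_r_closed[of v p]
    ideal_prod.prod[of v J v' J F] by simp_all

lemma J2_uminus: "v \<in> J2 \<Longrightarrow> - v \<in> J2"
  using J2_mult(1)[of v "- 1"] F_closed by simp

lemma C_fields:
  "carrier C = (\<lambda>x. J2 +>\<^bsub>F\<^esub> x) ` J" "add C = set_add F"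
  "smult C V W = (\<Union>a\<in>V. \<Union>x\<in>W. J2 +>\<^bsub>F\<^esub> (a * x))"
  "rsmult C W V = (\<Union>x\<in>W. \<Union>a\<in>V. J2 +>\<^bsub>F\<^esub> (x * a))"
  by (simp_all add: conormal_bimodule_def Let_def)

lemma carrier_C: "u \<in> J \<Longrightarrow> J2 +>\<^bsub>F\<^esub> u \<in> carrier C"
  and coset_A: "f \<in> carrier F \<Longrightarrow> J +>\<^bsub>F\<^esub> f \<in> carrier A"
  by (simp_all add: C_fields carrier_A)

text \<open>The unions in \<open>conormal_bimodule\<close> run over all representatives, but
  changing \<open>a\<close> by J alters a x only by a product of two elements of J, and changing
  \<open>x\<close> by J2 alters it within J2.\<close>

lemma C_ops:
  assumes "f \<in> carrier F" "u \<in> J" "v \<in> J"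
  shows "(J2 +>\<^bsub>F\<^esub> u) \<oplus>\<^bsub>C\<^esub> (J2 +>\<^bsub>F\<^esub> v) = J2 +>\<^bsub>F\<^esub> (u + v)"
    and "(J +>\<^bsub>F\<^esub> f) \<odot>\<^bsub>C\<^esub> (J2 +>\<^bsub>F\<^esub> u) = J2 +>\<^bsub>F\<^esub> (f * u)"
    and "rsmult C (J2 +>\<^bsub>F\<^esub> u) (J +>\<^bsub>F\<^esub> f) = J2 +>\<^bsub>F\<^esub> (u * f)"
proof -
  show "(J2 +>\<^bsub>F\<^esub> u) \<oplus>\<^bsub>C\<^esub> (J2 +>\<^bsub>F\<^esub> v) = J2 +>\<^bsub>F\<^esub> (u + v)"
    using J2.a_rcos_sum[of u v] assms J_sub by (simp add: C_fields)
  have *: "J2 +>\<^bsub>F\<^esub> (a * x) = J2 +>\<^bsub>F\<^esub> (f * u) \<and> J2 +>\<^bsub>F\<^esub> (x * a) = J2 +>\<^bsub>F\<^esub> (u * f)"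
    if "a \<in> J +>\<^bsub>F\<^esub> f" "x \<in> J2 +>\<^bsub>F\<^esub> u" for a x
  proof -
    from that(1) obtain k where k: "a = k + f" "k \<in> J" by (auto simp: coset_eq)
    from that(2) obtain l where l: "x = l + u" "l \<in> J2" by (auto simp: coset_eq)
    note c = J_sub[OF k(2)] J_sub[OF assms(2)] J_sub[OF J2_sub_J[OF l(2)]]
    have "a * x - f * u = k * x + f * l" "x * a - u * f = x * k + l * f"
      by (auto simp: k l algebra_simps)
    moreover have "x \<in> J" using J_add[OF J2_sub_J[OF l(2)] assms(2)] l(1) by simp
    then have "k * x + f * l \<in> J2" "x * k + l * f \<in> J2"
      using J2_add[OF J2_prod[OF k(2)] J2_mult(1)[OF l(2) assms(1)]]
        J2_add[OF J2_prod[OF _ k(2)] J2_mult(2)[OF l(2) assms(1)]] by auto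
    ultimately show ?thesis using assms c
      by (subst (1 2) coset_eq_iff[OF J2_ideal]) (auto simp: k l intro!: F_closed)
  qed
  have ne: "f \<in> J +>\<^bsub>F\<^esub> f" "u \<in> J2 +>\<^bsub>F\<^esub> u" using J_zero J2_zero by (force simp: coset_eq)+
  show "(J +>\<^bsub>F\<^esub> f) \<odot>\<^bsub>C\<^esub> (J2 +>\<^bsub>F\<^esub> u) = J2 +>\<^bsub>F\<^esub> (f * u)"
    unfolding C_fields using * ne by blast
  show "rsmult C (J2 +>\<^bsub>F\<^esub> u) (J +>\<^bsub>F\<^esub> f) = J2 +>\<^bsub>F\<^esub> (u * f)"
    unfolding C_fields using * ne by blast
qed

lemma ev_U: "p \<in> U \<Longrightarrow> ev p \<in> J2"
proof -
  assume "p \<in> U"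
  then have "p \<in> T1 \<and> ev p \<in> J2" unfolding U_def
  proof (induction rule: add_span.induct)
    case (base g)
    then obtain w c w' d where g: "g = iota (ev (Poly_Mapping.single w c)) * Poly_Mapping.single w' d \<or>
        g = Poly_Mapping.single w' d * iota (ev (Poly_Mapping.single w c))" "w \<in> W1" "w' \<in> W1" by blast
    have t: "Poly_Mapping.single w c \<in> T1" "Poly_Mapping.single w' d \<in> T1" using g T1_single by auto
    then have c: "Poly_Mapping.single w c \<in> carrier T" "Poly_Mapping.single w' d \<in> carrier T"
      "iota (ev (Poly_Mapping.single w c)) \<in> carrier T" "ev (Poly_Mapping.single w c) \<in> carrier F"
      using T1_closed ev_iota_T1 ev_closed by blast+
    have "g \<in> T1" using g(1) t c by (auto intro!: iota_T1 T1_iota)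
    moreover have "ev g \<in> J2" using g(1) c ev_T1[OF t(1)] ev_T1[OF t(2)]
      by (auto simp: ev_mult ev_iota intro: J2_prod)
    ultimately show ?case by simp
  qed (auto simp: ev_zero T1_zero ev_add T1_closed J2_zero intro: T1_add J2_add)
  then show ?thesis by simp
qed

lemma U_mult:
  assumes "p \<in> U" "f \<in> carrier F"
  shows "iota f * p \<in> U" "p * iota f \<in> U"
proof -
  let ?G = "{iota (ev (Poly_Mapping.single w c)) * Poly_Mapping.single w' d | w c w' d. w \<in> W1 \<and> w' \<in> W1} \<union>
     {Poly_Mapping.single w' d * iota (ev (Poly_Mapping.single w c)) | w c w' d. w \<in> W1 \<and> w' \<in> W1}"
  have *: "iota f * g \<in> U \<and> g * iota f \<in> U" if "g \<in> ?G" for g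
  proof -
    from that obtain w c w' d where g: "g = iota (ev (Poly_Mapping.single w c)) * Poly_Mapping.single w' d \<or>
        g = Poly_Mapping.single w' d * iota (ev (Poly_Mapping.single w c))" "w \<in> W1" "w' \<in> W1" by blast
    let ?s = "Poly_Mapping.single w c" and ?t = "Poly_Mapping.single w' d"
    have t: "?s \<in> T1" "?t \<in> T1" using g T1_single by auto
    have e: "ev ?s \<in> J" "ev ?s \<in> carrier F" using ev_T1[OF t(1)] J_sub by auto
    have "iota f * (iota (ev ?s) * ?t) = iota (f * ev ?s) * ?t"
      "iota f * (?t * iota (ev ?s)) = (iota f * ?t) * iota (ev ?s)"
      "(iota (ev ?s) * ?t) * iota f = iota (ev ?s) * (?t * iota f)"
      "(?t * iota (ev ?s)) * iota f = ?t * iota (ev ?s * f)"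
      using assms(2) e(2) by (simp_all add: iota_mult mult.assoc)
    then show ?thesis using g(1)
      U_J[OF J_mult(1)[OF e(1) assms(2)] t(2)] U_J[OF J_mult(2)[OF e(1) assms(2)] t(2)]
      U_J[OF e(1) iota_T1[OF assms(2) t(2)]] U_J[OF e(1) T1_iota[OF assms(2) t(2)]]
      by auto
  qed
  show "iota f * p \<in> U" by (rule add_span_image[OF assms(1)[unfolded U_def]])
    (use * in \<open>auto simp: distrib_left U_zero U_add\<close>)
  show "p * iota f \<in> U" by (rule add_span_image[OF assms(1)[unfolded U_def]])
    (use * in \<open>auto simp: distrib_right U_zero U_add\<close>)
qed

lemma U_uminus: "p \<in> U \<Longrightarrow> - p \<in> U"
  using U_mult(1)[of p "- 1"] F_closed iota_uminus[of 1] by (simp add: iota_one)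

lemma coset_rep:
  assumes "f \<in> carrier F"
  shows "(SOME g. g \<in> J +>\<^bsub>F\<^esub> f) \<in> carrier F" "(SOME g. g \<in> J +>\<^bsub>F\<^esub> f) - f \<in> J"
proof -
  have "(SOME g. g \<in> J +>\<^bsub>F\<^esub> f) \<in> J +>\<^bsub>F\<^esub> f"
    by (rule someI[of _ f]) (use J_zero in \<open>force simp: coset_eq\<close>)
  then obtain k where "(SOME g. g \<in> J +>\<^bsub>F\<^esub> f) = k + f" "k \<in> J" by (auto simp: coset_eq)
  then show "(SOME g. g \<in> J +>\<^bsub>F\<^esub> f) \<in> carrier F" "(SOME g. g \<in> J +>\<^bsub>F\<^esub> f) - f \<in> J"
    using assms J_sub F_closed by auto
qed

text \<open>The bimodule \<open>A \<otimes> L \<otimes> A\<close>, presented as the quotient of \<open>F \<otimes> L \<otimes> F\<close> by \<open>U\<close>.\<close>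

definition relator_bimodule ::
  "((('x + 'y) word \<Rightarrow>\<^sub>0 'k) \<Rightarrow> 'u) \<Rightarrow> (('x word \<Rightarrow>\<^sub>0 'k) set, 'u) bimodule" where
  "relator_bimodule enc = (let rep = \<lambda>x. SOME t. t \<in> T1 \<and> enc t = x in \<lparr>carrier = enc ` T1,
     mult = undefined, one = undefined, ring.zero = enc 0,
     add = (\<lambda>x y. enc (rep x + rep y)),
     smult = (\<lambda>a x. enc (iota (SOME f. f \<in> a) * rep x)),
     rsmult = (\<lambda>x a. enc (rep x * iota (SOME f. f \<in> a)))\<rparr>)"

context
  fixes enc :: "(('x + 'y) word \<Rightarrow>\<^sub>0 'k) \<Rightarrow> 'u"
  assumes enc: "\<And>s t. s \<in> T1 \<Longrightarrow> t \<in> T1 \<Longrightarrow> enc s = enc t \<longleftrightarrow> s - t \<in> U"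
begin

abbreviation (input) M where "M \<equiv> relator_bimodule enc"

lemma relator_rep:
  assumes "t \<in> T1"
  shows "(SOME s. s \<in> T1 \<and> enc s = enc t) \<in> T1" "(SOME s. s \<in> T1 \<and> enc s = enc t) - t \<in> U"
proof -
  have "(SOME s. s \<in> T1 \<and> enc s = enc t) \<in> T1 \<and> enc (SOME s. s \<in> T1 \<and> enc s = enc t) = enc t"
    by (rule someI[of _ t]) (simp add: assms)
  then show "(SOME s. s \<in> T1 \<and> enc s = enc t) \<in> T1" "(SOME s. s \<in> T1 \<and> enc s = enc t) - t \<in> U"
    using enc assms by blast+
qed

lemma carrier_relator: "carrier M = enc ` T1" and zero_relator: "\<zero>\<^bsub>M\<^esub> = enc 0"
  by (simp_all add: relator_bimodule_def Let_def)

lemma add_relator: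
  assumes "s \<in> T1" "t \<in> T1"
  shows "enc s \<oplus>\<^bsub>M\<^esub> enc t = enc (s + t)"
proof -
  let ?s = "SOME r. r \<in> T1 \<and> enc r = enc s" and ?t = "SOME r. r \<in> T1 \<and> enc r = enc t"
  have "?s + ?t - (s + t) \<in> U"
    using U_add[OF relator_rep(2)[OF assms(1)] relator_rep(2)[OF assms(2)]] by (simp add: algebra_simps)
  then show ?thesis using enc relator_rep(1)[OF assms(1)] relator_rep(1)[OF assms(2)] assms
    by (simp add: relator_bimodule_def Let_def T1_add)
qed

lemma smult_relator:
  assumes "f \<in> carrier F" "t \<in> T1"
  shows "(J +>\<^bsub>F\<^esub> f) \<odot>\<^bsub>M\<^esub> enc t = enc (iota f * t)"
    and "rsmult M (enc t) (J +>\<^bsub>F\<^esub> f) = enc (t * iota f)"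
proof -
  let ?t = "SOME r. r \<in> T1 \<and> enc r = enc t" and ?f = "SOME g. g \<in> J +>\<^bsub>F\<^esub> f"
  note t = relator_rep[OF assms(2)] and f = coset_rep[OF assms(1)]
  have "iota ?f * ?t - iota f * t = iota (?f - f) * ?t + iota f * (?t - t)"
    "?t * iota ?f - t * iota f = ?t * iota (?f - f) + (?t - t) * iota f"
    using assms f by (simp_all add: iota_diff algebra_simps)
  moreover have "iota (?f - f) * ?t + iota f * (?t - t) \<in> U" "?t * iota (?f - f) + (?t - t) * iota f \<in> U"
    using U_add[OF U_J(1)[OF f(2) t(1)] U_mult(1)[OF t(2) assms(1)]]
      U_add[OF U_J(2)[OF f(2) t(1)] U_mult(2)[OF t(2) assms(1)]] by auto
  ultimately show "(J +>\<^bsub>F\<^esub> f) \<odot>\<^bsub>M\<^esub> enc t = enc (iota f * t)" "rsmult M (enc t) (J +>\<^bsub>F\<^esub> f) = enc (t * iota f)"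
    using enc assms t f by (simp_all add: relator_bimodule_def Let_def iota_T1 T1_iota)
qed

lemma bimodule_relator:
  assumes "k_algebra A"
  shows "bimodule A M"
proof -
  have "abelian_group M"
  proof (rule abelian_groupI)
    fix x y assume "x \<in> carrier M" "y \<in> carrier M"
    then obtain s t where s: "x = enc s" "s \<in> T1" and t: "y = enc t" "t \<in> T1" by (auto simp: carrier_relator)
    show "x \<oplus>\<^bsub>M\<^esub> y \<in> carrier M" using s t by (simp add: add_relator carrier_relator T1_add)
    show "x \<oplus>\<^bsub>M\<^esub> y = y \<oplus>\<^bsub>M\<^esub> x" using s t by (simp add: add_relator add.commute)
    fix z assume "z \<in> carrier M"
    then obtain r where r: "z = enc r" "r \<in> T1" by (auto simp: carrier_relator)
    show "x \<oplus>\<^bsub>M\<^esub> y \<oplus>\<^bsub>M\<^esub> z = x \<oplus>\<^bsub>M\<^esub> (y \<oplus>\<^bsub>M\<^esub> z)"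
      using s t r by (simp add: add_relator T1_add add.assoc)
  next
    fix x assume "x \<in> carrier M"
    then obtain s where s: "x = enc s" "s \<in> T1" by (auto simp: carrier_relator)
    then show "\<zero>\<^bsub>M\<^esub> \<oplus>\<^bsub>M\<^esub> x = x" by (simp add: zero_relator add_relator T1_zero)
    show "\<exists>y\<in>carrier M. y \<oplus>\<^bsub>M\<^esub> x = \<zero>\<^bsub>M\<^esub>"
      using s by (intro bexI[of _ "enc (- s)"])
        (auto simp: zero_relator add_relator carrier_relator T1_uminus)
  qed (simp add: zero_relator carrier_relator T1_zero)
  moreover have "bimodule_axioms A M"
  proof
    fix a b x y and c :: 'k
    assume "a \<in> carrier A"
    then obtain f where f: "a = J +>\<^bsub>F\<^esub> f" "f \<in> carrier F" by (auto simp: carrier_A)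
    assume "x \<in> carrier M"
    then obtain s where s: "x = enc s" "s \<in> T1" by (auto simp: carrier_relator)
    show "a \<odot>\<^bsub>M\<^esub> x \<in> carrier M" "rsmult M x a \<in> carrier M"
      using f s by (simp_all add: smult_relator carrier_relator iota_T1 T1_iota)
    show "a \<odot>\<^bsub>M\<^esub> (x \<oplus>\<^bsub>M\<^esub> y) = a \<odot>\<^bsub>M\<^esub> x \<oplus>\<^bsub>M\<^esub> a \<odot>\<^bsub>M\<^esub> y"
      "rsmult M (x \<oplus>\<^bsub>M\<^esub> y) a = rsmult M x a \<oplus>\<^bsub>M\<^esub> rsmult M y a" if "y \<in> carrier M"
      using f s that by (auto simp: smult_relator carrier_relator iota_T1 T1_iota add_relator
          T1_add distrib_left distrib_right)
    assume "b \<in> carrier A"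
    then obtain g where g: "b = J +>\<^bsub>F\<^esub> g" "g \<in> carrier F" by (auto simp: carrier_A)
    show "(a \<oplus>\<^bsub>A\<^esub> b) \<odot>\<^bsub>M\<^esub> x = a \<odot>\<^bsub>M\<^esub> x \<oplus>\<^bsub>M\<^esub> b \<odot>\<^bsub>M\<^esub> x"
      "rsmult M x (a \<oplus>\<^bsub>A\<^esub> b) = rsmult M x a \<oplus>\<^bsub>M\<^esub> rsmult M x b"
      using f s g by (simp_all add: smult_relator A_ops iota_T1 T1_iota add_relator
          F_closed iota_add distrib_left distrib_right)
    show "(a \<otimes>\<^bsub>A\<^esub> b) \<odot>\<^bsub>M\<^esub> x = a \<odot>\<^bsub>M\<^esub> (b \<odot>\<^bsub>M\<^esub> x)"
      "rsmult M x (a \<otimes>\<^bsub>A\<^esub> b) = rsmult M (rsmult M x a) b"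
      "rsmult M (a \<odot>\<^bsub>M\<^esub> x) b = a \<odot>\<^bsub>M\<^esub> rsmult M x b"
      using f s g by (simp_all add: smult_relator A_ops iota_T1 T1_iota F_closed iota_mult mult.assoc)
  next
    fix x and c :: 'k assume "x \<in> carrier M"
    then obtain s where s: "x = enc s" "s \<in> T1" by (auto simp: carrier_relator)
    show "\<one>\<^bsub>A\<^esub> \<odot>\<^bsub>M\<^esub> x = x" "rsmult M x \<one>\<^bsub>A\<^esub> = x"
      using s F_closed(6) by (simp_all add: A_fields smult_relator iota_one)
    have "Poly_Mapping.single 0 c \<in> carrier F" by simp
    then show "(c \<odot>\<^bsub>A\<^esub> \<one>\<^bsub>A\<^esub>) \<odot>\<^bsub>M\<^esub> x = rsmult M x (c \<odot>\<^bsub>A\<^esub> \<one>\<^bsub>A\<^esub>)"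
      using s F_closed(6) A_ops(3)[of 1 1 c]
      by (simp add: A_fields(3) smult_relator iota_single single_zero_central)
  qed
  ultimately show ?thesis using assms by (intro bimodule.intro)
qed

end

end

subsection \<open>Minimal presentations of noncommutative complete intersections\<close>

lemma bimodule_homD:
  assumes "f \<in> bimodule_hom B M N"
  shows "x \<in> carrier M \<Longrightarrow> f x \<in> carrier N"
    and "x \<in> carrier M \<Longrightarrow> y \<in> carrier M \<Longrightarrow> f (x \<oplus>\<^bsub>M\<^esub> y) = f x \<oplus>\<^bsub>N\<^esub> f y"
    and "a \<in> carrier B \<Longrightarrow> x \<in> carrier M \<Longrightarrow> f (a \<odot>\<^bsub>M\<^esub> x) = a \<odot>\<^bsub>N\<^esub> f x"
    and "a \<in> carrier B \<Longrightarrow> x \<in> carrier M \<Longrightarrow> f (rsmult M x a) = rsmult N (f x) a"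
  using assms by (auto simp: bimodule_hom_def)

locale minimal_ncci = graded_presentation X dx Y dy j
  for X :: "'x set" and dx :: "'x \<Rightarrow> nat" and Y :: "'y set" and dy :: "'y \<Rightarrow> nat"
    and j :: "'y \<Rightarrow> 'x word \<Rightarrow>\<^sub>0 'k::field_char_0" +
  assumes ncci: "ncci X Y j"
    and minimal: "y \<in> Y \<Longrightarrow> j y \<notin> Idl\<^bsub>F\<^esub> (j ` (Y - {y}))"
begin

text \<open>For v and v' = ev u in J, the lift iota v * u of v v' has only words that begin with a
  nonempty word of v, as J has no constant terms; so no bare relation letter occurs in it.\<close>

lemma J2_decomposable:
  assumes "v \<in> J2"
  shows "\<exists>t\<in>T1. ev t = v \<and> (\<forall>y. Poly_Mapping.lookup t (Word [Inr y]) = 0)"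
  using assms
proof (induction rule: ideal_prod.induct)
  case (prod v v')
  then obtain u where u: "u \<in> T1" "v' = ev u" using J_eq by auto
  have v: "v \<in> carrier F" using prod J_sub by auto
  have "Poly_Mapping.lookup (iota v * u) (Word [Inr y]) = 0" for y
  proof (rule ccontr)
    assume "Poly_Mapping.lookup (iota v * u) (Word [Inr y]) \<noteq> 0"
    then have "Word [Inr y] \<in> Poly_Mapping.keys (iota v * u)" by (simp add: in_keys_iff)
    then obtain w w' where w: "Word [Inr y] = w + w'" "w \<in> Poly_Mapping.keys (iota v)" by (rule keys_multE)
    obtain a where a: "w = iw a" "a \<in> Poly_Mapping.keys v"
      using keys_iota[of v "Poly_Mapping.keys v"] v w(2) by (auto simp: carrier_free_algebra)
    have "0 < word_degree dx a" using J_degree_pos prod(1) a(2) by auto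
    then obtain x xs where "letters a = x # xs" by (cases "letters a") (auto simp: word_degree_def)
    then show False using w(1) a(1) by (simp add: map_word_def plus_word_def)
  qed
  moreover have "ev (iota v * u) = v * v'"
    using u v by (simp add: ev_mult iota_closed T1_closed ev_iota)
  ultimately show ?case using iota_T1[OF v u(1)] by (intro bexI[of _ "iota v * u"]) auto
next
  case (sum v v')
  then obtain t t' where "t \<in> T1" "ev t = v" "\<forall>y. Poly_Mapping.lookup t (Word [Inr y]) = 0"
    "t' \<in> T1" "ev t' = v'" "\<forall>y. Poly_Mapping.lookup t' (Word [Inr y]) = 0" by blast
  then show ?case
    by (intro bexI[of _ "t + t'"]) (auto simp: ev_add T1_closed lookup_add intro: T1_add)
qed

lemma word_degree_pos: "a \<in> words_over X \<Longrightarrow> word_degree dx a = 0 \<Longrightarrow> a = 0"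
  by (cases a; cases "letters a") (auto simp: word_degree_def words_over_def zero_word_def dest!: dx_pos)

text \<open>Nakayama in degree \<open>dy y0\<close>: subtract a lift of the same element without
  bare letters and pass to degree \<open>dy y0\<close>; a nonzero coefficient of the bare letter
  then expresses \<open>j y0\<close> through the other relations, against minimality.\<close>

lemma linear_part_zero:
  assumes t: "t \<in> T1" and ev: "ev t \<in> J2" and y0: "y0 \<in> Y"
  shows "Poly_Mapping.lookup t (Word [Inr y0]) = 0"
proof (rule ccontr)
  assume nz: "Poly_Mapping.lookup t (Word [Inr y0]) \<noteq> 0"
  obtain t' where t': "t' \<in> T1" "ev t' = ev t" "\<And>y. Poly_Mapping.lookup t' (Word [Inr y]) = 0"
    using J2_decomposable[OF ev] by auto
  let ?w = "Word [Inr y0] :: ('x + 'y) word"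
  define r where "r = restrict_keys (\<lambda>w. wt w = dy y0) (t - t')"
  define c where "c = Poly_Mapping.lookup r ?w"
  have r: "r \<in> T1" unfolding r_def using t t' by (intro T1_restrict T1_diff)
  have c: "c \<noteq> 0" unfolding c_def r_def using nz t'(3) by (simp add: lookup_minus)
  have ev_r: "ev r = 0"
    unfolding r_def using restrict_keys_ev[of "t - t'" "dy y0"] t t' T1_closed[OF T1_diff[OF t t'(1)]]
    by (simp add: ev_diff T1_closed)
  define s where "s = r - Poly_Mapping.single ?w c"
  \<comment> \<open>The remaining relations form a presentation of their own, so that
    \<open>ev_T1\<close> applies to their ideal.\<close>
  interpret G: graded_presentation X dx "Y - {y0}" dy j
    using presentation by unfold_locales (auto simp: presentation_data_def)
  have w0: "?w \<in> W1" using y0 T1_gen by (auto simp: T1_def gen_def)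
  have "w \<in> G.W1" if "w \<in> Poly_Mapping.keys s" for w
  proof -
    have "w \<noteq> ?w" using that by (auto simp: s_def c_def in_keys_iff lookup_minus)
    have "w \<in> Poly_Mapping.keys r"
      using that \<open>w \<noteq> ?w\<close> by (auto simp: s_def in_keys_iff lookup_minus lookup_single when_def)
    then have "w \<in> W1" "wt w = dy y0" using r by (auto simp: r_def T1_def)
    from this(1) obtain a y b where w: "w = iw a + Word [Inr y] + iw b"
      "a \<in> words_over X" "y \<in> Y" "b \<in> words_over X" by (auto simp: W1_def)
    \<comment> \<open>For degree reasons another word with the letter \<open>y0\<close> would have
      to be the bare letter, which has been subtracted.\<close>
    have "y \<noteq> y0"
    proof
      assume "y = y0"
      then have "a = 0" "b = 0" using \<open>wt w = dy y0\<close> w word_degree_pos by simp_all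
      then show False using w(1) \<open>y = y0\<close> \<open>w \<noteq> ?w\<close> by simp
    qed
    then show ?thesis unfolding G.W1_def using w by blast
  qed
  then have "s \<in> G.T1" by (auto simp: G.T1_def)
  then have "ev s \<in> Idl\<^bsub>F\<^esub> (j ` (Y - {y0}))"
    using G.ev_T1 by (simp add: relation_ideal_def)
  moreover have "ev s = - (Poly_Mapping.single 0 c * j y0)"
  proof -
    have "Poly_Mapping.single ?w c = Poly_Mapping.single 0 c * gen (Inr y0)"
      by (simp add: gen_def mult_single)
    then have "ev (Poly_Mapping.single ?w c) = Poly_Mapping.single 0 c * j y0"
      using y0 ev_smult[of "gen (Inr y0)" c] by (simp add: ev_gen)
    then show ?thesis unfolding s_def using ev_r r T1_single[OF w0]
      by (subst ev_diff) (auto simp: T1_closed)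
  qed
  ultimately have "- (Poly_Mapping.single 0 c * j y0) \<in> G.J" by (simp add: relation_ideal_def)
  then have "Poly_Mapping.single 0 (- inverse c) * - (Poly_Mapping.single 0 c * j y0) \<in> G.J"
    by (rule G.J_mult(1)) simp
  then have "j y0 \<in> G.J" using c by (simp add: mult.assoc[symmetric] mult_single single_uminus)
  then show False using minimal[OF y0] by (simp add: relation_ideal_def)
qed

lemma projective: "projective_bimodule A C"
  using ncci by (simp add: ncci_def)

lemma relator_hom_zero:
  assumes enc: "\<And>s t. s \<in> T1 \<Longrightarrow> t \<in> T1 \<Longrightarrow> enc s = enc t \<longleftrightarrow> s - t \<in> U"
    and s: "s \<in> bimodule_hom A C (relator_bimodule enc)"
  shows "s (J2 +>\<^bsub>F\<^esub> 0) = enc 0"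
proof -
  have "s (J2 +>\<^bsub>F\<^esub> 0) \<in> carrier (relator_bimodule enc)"
    using s J_zero by (auto simp: bimodule_hom_def C_fields)
  then obtain t where t: "s (J2 +>\<^bsub>F\<^esub> 0) = enc t" "t \<in> T1" by (auto simp: carrier_relator[OF enc])
  \<comment> \<open>Zero is written as 0 * 0, so that left linearity of \<open>s\<close> determines
    the value.\<close>
  have "s (J2 +>\<^bsub>F\<^esub> (0 * 0)) = (J +>\<^bsub>F\<^esub> 0) \<odot>\<^bsub>relator_bimodule enc\<^esub> s (J2 +>\<^bsub>F\<^esub> 0)"
    using bimodule_homD(3)[OF s coset_A carrier_C, OF F_closed(5) J_zero] C_ops(2)[OF F_closed(5) J_zero J_zero]
    by simp
  then show ?thesis using t smult_relator(1)[OF enc F_closed(5), of t] by (simp add: iota_zero)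
qed

text \<open>Projecting a word a y b and applying the section \<open>s\<close> changes it by a (y -
  tau y) b. The middle factor evaluates into J2, so by \<open>linear_part_zero\<close> each of its
  words contains an ordinary letter, and \<open>wt0\<close> grows by at least 1.\<close>

lemma conormal_kernel_step:
  assumes enc: "\<And>s t. s \<in> T1 \<Longrightarrow> t \<in> T1 \<Longrightarrow> enc s = enc t \<longleftrightarrow> s - t \<in> U"
    and s: "s \<in> bimodule_hom A C (relator_bimodule enc)"
    and tau: "\<And>y. y \<in> Y \<Longrightarrow> tau y \<in> T1 \<and> s (J2 +>\<^bsub>F\<^esub> j y) = enc (tau y) \<and> ev (tau y) - j y \<in> J2"
    and z: "Poly_Mapping.keys z \<subseteq> {w \<in> W1. k \<le> wt0 w}"
  shows "\<exists>e. Poly_Mapping.keys e \<subseteq> {w \<in> W1. Suc k \<le> wt0 w} \<and> s (J2 +>\<^bsub>F\<^esub> ev z) = enc (z - e)"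
proof -
  let ?M = "relator_bimodule enc"
  have s_add: "s (J2 +>\<^bsub>F\<^esub> (u + v)) = s (J2 +>\<^bsub>F\<^esub> u) \<oplus>\<^bsub>?M\<^esub> s (J2 +>\<^bsub>F\<^esub> v)" if "u \<in> J" "v \<in> J" for u v
    using bimodule_homD(2)[OF s carrier_C carrier_C, OF that] C_ops(1)[OF F_closed(5) that] by simp
  have s_mult: "s (J2 +>\<^bsub>F\<^esub> (f * u)) = (J +>\<^bsub>F\<^esub> f) \<odot>\<^bsub>?M\<^esub> s (J2 +>\<^bsub>F\<^esub> u)"
    "s (J2 +>\<^bsub>F\<^esub> (u * f)) = rsmult ?M (s (J2 +>\<^bsub>F\<^esub> u)) (J +>\<^bsub>F\<^esub> f)"
    if "f \<in> carrier F" "u \<in> J" for u f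
    using bimodule_homD(3,4)[OF s coset_A carrier_C, OF that] C_ops(2,3)[OF that that(2)] by simp_all
  show ?thesis using z
  proof (induction z rule: poly_mapping_induct_single)
    case zero
    show ?case using relator_hom_zero[OF enc s] by (intro exI[of _ 0]) (simp add: ev_zero)
  next
    case (single w c)
    then obtain a y b where w: "w = iw a + Word [Inr y] + iw b"
      "a \<in> words_over X" "y \<in> Y" "b \<in> words_over X" "k \<le> wt0 w" by (auto simp: W1_def)
    let ?a = "Poly_Mapping.single a c" and ?b = "Poly_Mapping.single b (1::'k)"
    define t where "t = gen (Inr y) - tau y"
    have ab: "?a \<in> carrier F" "?b \<in> carrier F" using w by auto
    have tT: "t \<in> T1" unfolding t_def using w tau T1_gen by (intro T1_diff) auto
    have "ev t = - (ev (tau y) - j y)"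
      unfolding t_def using w tau[OF w(3)] T1_closed[OF T1_gen[OF w(3)]] by (simp add: ev_diff T1_closed ev_gen)
    moreover have "ev (tau y) - j y \<in> J2" using tau[OF w(3)] by blast
    ultimately have evt: "ev t \<in> J2" by (simp only: J2_uminus)
    have tk: "1 \<le> wt0 v" if "v \<in> Poly_Mapping.keys t" for v
    proof -
      have "v \<in> W1" using that tT by (auto simp: T1_def)
      then obtain a' y' b' where v: "v = iw a' + Word [Inr y'] + iw b'"
        "a' \<in> words_over X" "y' \<in> Y" "b' \<in> words_over X" by (auto simp: W1_def)
      have "v \<noteq> Word [Inr y']" using linear_part_zero[OF tT evt v(3)] that by (auto simp: in_keys_iff)
      then have "a' \<noteq> 0 \<or> b' \<noteq> 0" using v by auto
      then show ?thesis using v word_degree_pos by fastforce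
    qed
    let ?e = "iota ?a * t * iota ?b"
    have eT: "?e \<in> T1" using ab tT by (intro iota_T1 T1_iota)
    have "Suc k \<le> wt0 v" if "v \<in> Poly_Mapping.keys ?e" for v
    proof -
      from that obtain v1 v2 where v: "v = v1 + v2" "v1 \<in> Poly_Mapping.keys (iota ?a * t)"
        "v2 \<in> Poly_Mapping.keys (iota ?b)" by (rule keys_multE)
      from v(2) obtain v3 v4 where v': "v1 = v3 + v4" "v3 \<in> Poly_Mapping.keys (iota ?a)"
        "v4 \<in> Poly_Mapping.keys t" by (rule keys_multE)
      have "v3 = iw a" "v2 = iw b" using v(3) v'(2) w by (auto simp: iota_single split: if_splits)
      then show ?thesis using v v' tk[OF v'(3)] w by simp
    qed
    then have keys: "Poly_Mapping.keys ?e \<subseteq> {w \<in> W1. Suc k \<le> wt0 w}" using eT by (auto simp: T1_def)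
    have z: "Poly_Mapping.single w c = iota ?a * gen (Inr y) * iota ?b"
      using w by (simp add: iota_single gen_def mult_single)
    have "ev (Poly_Mapping.single w c) = ?a * j y * ?b"
      unfolding z using ab w T1_closed[OF T1_gen[OF w(3)]]
      by (simp add: ev_mult T_closed iota_closed ev_iota ev_gen)
    then have "s (J2 +>\<^bsub>F\<^esub> ev (Poly_Mapping.single w c))
        = rsmult ?M ((J +>\<^bsub>F\<^esub> ?a) \<odot>\<^bsub>?M\<^esub> enc (tau y)) (J +>\<^bsub>F\<^esub> ?b)"
      using ab w(3) tau by (simp add: s_mult J_mult j_in_J)
    also have "\<dots> = enc (iota ?a * tau y * iota ?b)"
      using ab tau[OF w(3)] by (simp add: smult_relator[OF enc] iota_T1)
    also have "iota ?a * tau y * iota ?b = Poly_Mapping.single w c - ?e"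
      unfolding z t_def by (simp add: algebra_simps)
    finally show ?case using keys by blast
  next
    case (add p q)
    then obtain e e' where e: "Poly_Mapping.keys e \<subseteq> {w \<in> W1. Suc k \<le> wt0 w}" "s (J2 +>\<^bsub>F\<^esub> ev p) = enc (p - e)"
      "Poly_Mapping.keys e' \<subseteq> {w \<in> W1. Suc k \<le> wt0 w}" "s (J2 +>\<^bsub>F\<^esub> ev q) = enc (q - e')" by blast
    have T: "p \<in> T1" "q \<in> T1" "e \<in> T1" "e' \<in> T1" using add(1,2) e by (auto simp: T1_def)
    have "s (J2 +>\<^bsub>F\<^esub> ev (p + q)) = enc (p - e) \<oplus>\<^bsub>?M\<^esub> enc (q - e')"
      using T e by (simp add: ev_add T1_closed s_add ev_T1)
    also have "\<dots> = enc ((p - e) + (q - e'))" using T by (intro add_relator[OF enc] T1_diff)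
    also have "(p - e) + (q - e') = (p + q) - (e + e')" by simp
    finally show ?case using e keys_add_subset[of e _ e'] by blast
  qed
qed

text \<open>
  If \<open>s\<close> splits \<open>A \<otimes> L \<otimes> A \<rightarrow> J/J\<^sup>2\<close>, the complementary idempotent raises the degree by minimality of
  the presentation, hence vanishes: \<open>J/J\<^sup>2\<close> is free on \<open>L\<close>.
\<close>

lemma conormal_kernel:
  assumes z: "z \<in> T1" and evz: "ev z \<in> J2"
  shows "z \<in> U"
proof -
  \<comment> \<open>\<open>projective_bimodule\<close> tests only bimodules whose elements are sets
    of noncommutative polynomials, the type of the cosets in A. T1 has at most the cardinality of
    the field, which embeds there by singletons of constants.\<close>
  have "T1 \<subseteq> carrier T" using T1_closed by auto
  then have "T1 \<lesssim> carrier T" by (rule subset_imp_lepoll)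
  also have "carrier T \<lesssim> (UNIV :: 'k set)"
    unfolding free_algebra_eq
    by (rule lepoll_monoid_algebra) (auto simp: infinite_UNIV_char_0 finite_X finite_Y intro: countable_words_over)
  also have "(UNIV :: 'k set) \<lesssim> (UNIV :: ('x word \<Rightarrow>\<^sub>0 'k) set set)"
    unfolding lepoll_def by (rule exI[of _ "\<lambda>c. {Poly_Mapping.single 0 c}"]) (auto intro!: injI dest: injD[OF inj_single])
  finally have "\<exists>enc :: _ \<Rightarrow> ('x word \<Rightarrow>\<^sub>0 'k) set. \<forall>s\<in>T1. \<forall>t\<in>T1. enc s = enc t \<longleftrightarrow> s - t \<in> U"
  proof (rule quotient_encoding)
    show "p - p \<in> U" for p by (simp add: U_zero)
    show "q - p \<in> U" if "p - q \<in> U" for p q using U_uminus[OF that] by simp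
    show "p - r \<in> U" if "p - q \<in> U" "q - r \<in> U" for p q r using U_add[OF that] by simp
  qed
  then obtain enc :: "_ \<Rightarrow> ('x word \<Rightarrow>\<^sub>0 'k) set"
    where enc: "\<And>s t. s \<in> T1 \<Longrightarrow> t \<in> T1 \<Longrightarrow> enc s = enc t \<longleftrightarrow> s - t \<in> U" by blast
  let ?M = "relator_bimodule enc"
  have C: "bimodule A C" using projective by (simp add: projective_bimodule_def)
  then interpret C: bimodule A C .
  have M: "bimodule A ?M" by (rule bimodule_relator[OF enc C.A.k_algebra_axioms])
  define p where "p = (\<lambda>x\<in>carrier ?M. J2 +>\<^bsub>F\<^esub> ev (SOME t. t \<in> T1 \<and> enc t = x))"
  have p_enc: "p (enc t) = J2 +>\<^bsub>F\<^esub> ev t" if "t \<in> T1" for t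
  proof -
    let ?t = "SOME t'. t' \<in> T1 \<and> enc t' = enc t"
    note r = relator_rep[OF enc that]
    have "ev ?t - ev t \<in> J2" using ev_U[OF r(2)] r(1) that by (simp add: ev_diff T1_closed)
    then show ?thesis using r(1) that
      by (simp add: p_def carrier_relator[OF enc] coset_eq_iff[OF J2_ideal] ev_closed T1_closed)
  qed
  have "p \<in> bimodule_hom A ?M C"
    unfolding bimodule_hom_def
  proof (intro CollectI conjI ballI)
    show "p \<in> carrier ?M \<rightarrow>\<^sub>E carrier C"
      using p_enc by (auto simp: p_def carrier_relator[OF enc] C_fields intro: ev_T1)
    fix x assume "x \<in> carrier ?M"
    then obtain s where s: "x = enc s" "s \<in> T1" by (auto simp: carrier_relator[OF enc])
    show "p (x \<oplus>\<^bsub>?M\<^esub> y) = p x \<oplus>\<^bsub>C\<^esub> p y" if "y \<in> carrier ?M" for y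
    proof -
      obtain t where "y = enc t" "t \<in> T1" using \<open>y \<in> carrier ?M\<close> by (auto simp: carrier_relator[OF enc])
      then show ?thesis using s C_ops(1)[OF F_closed(5) ev_T1 ev_T1]
        by (simp add: add_relator[OF enc] p_enc T1_add ev_add T1_closed)
    qed
  next
    fix a x assume "a \<in> carrier A" "x \<in> carrier ?M"
    then obtain f s where "a = J +>\<^bsub>F\<^esub> f" "f \<in> carrier F" "x = enc s" "s \<in> T1"
      by (auto simp: carrier_relator[OF enc] carrier_A)
    then show "p (a \<odot>\<^bsub>?M\<^esub> x) = a \<odot>\<^bsub>C\<^esub> p x" "p (rsmult ?M x a) = rsmult C (p x) a"
      using C_ops(2,3)[OF _ ev_T1 ev_T1]
      by (simp_all add: smult_relator[OF enc] p_enc iota_T1 T1_iota ev_mult iota_closed T1_closed ev_iota)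
  qed
  moreover have "p ` carrier ?M = carrier C"
  proof -
    have "p ` carrier ?M = (\<lambda>t. J2 +>\<^bsub>F\<^esub> ev t) ` T1"
      using p_enc by (force simp: carrier_relator[OF enc])
    also have "\<dots> = (\<lambda>x. J2 +>\<^bsub>F\<^esub> x) ` (ev ` T1)" by (simp add: image_image)
    also have "\<dots> = carrier C" unfolding C_fields J_eq[symmetric] ..
    finally show ?thesis .
  qed
  \<comment> \<open>A lift of the identity of C along \<open>p\<close> is the desired
    section.\<close>
  moreover have "(\<lambda>x\<in>carrier C. x) \<in> bimodule_hom A C C"
    unfolding bimodule_hom_def using C.left_closed C.right_closed by auto
  ultimately obtain s where s: "s \<in> bimodule_hom A C ?M" "\<forall>x\<in>carrier C. p (s x) = (\<lambda>x\<in>carrier C. x) x"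
    using projective C M unfolding projective_bimodule_def by blast
  have "\<exists>t. t \<in> T1 \<and> s (J2 +>\<^bsub>F\<^esub> j y) = enc t \<and> ev t - j y \<in> J2" if "y \<in> Y" for y
  proof -
    have c: "J2 +>\<^bsub>F\<^esub> j y \<in> carrier C" using j_in_J[OF that] by (simp add: C_fields)
    then have "s (J2 +>\<^bsub>F\<^esub> j y) \<in> carrier ?M" using s(1) by (auto simp: bimodule_hom_def)
    then obtain t where t: "s (J2 +>\<^bsub>F\<^esub> j y) = enc t" "t \<in> T1" by (auto simp: carrier_relator[OF enc])
    have "J2 +>\<^bsub>F\<^esub> ev t = J2 +>\<^bsub>F\<^esub> j y" using s(2) c t p_enc[OF t(2)] by auto
    then have "ev t - j y \<in> J2"
      using t that by (simp add: coset_eq_iff[OF J2_ideal] ev_closed T1_closed j_closed)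
    then show ?thesis using t by auto
  qed
  then obtain tau where tau: "\<And>y. y \<in> Y \<Longrightarrow> tau y \<in> T1 \<and> s (J2 +>\<^bsub>F\<^esub> j y) = enc (tau y) \<and> ev (tau y) - j y \<in> J2"
    by metis
  have s0: "s (J2 +>\<^bsub>F\<^esub> ev t) = enc 0" if "t \<in> T1" "ev t \<in> J2" for t
  proof -
    have "J2 +>\<^bsub>F\<^esub> ev t = J2 +>\<^bsub>F\<^esub> ev 0"
      using that by (simp add: coset_eq_iff[OF J2_ideal] ev_closed T1_closed ev_zero F_closed)
    then show ?thesis using relator_hom_zero[OF enc s(1)] by (simp add: ev_zero)
  qed
  \<comment> \<open>Iteration of \<open>conormal_kernel_step\<close>: \<open>ev e\<close> lies in
    J2, so \<open>s\<close> sends its class to zero, \<open>e - e'\<close> lies in U, and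
    \<open>z\<close> is replaced modulo U by elements of ever higher \<open>wt0\<close>.\<close>
  have "\<exists>e. Poly_Mapping.keys e \<subseteq> {w \<in> W1. k \<le> wt0 w} \<and> z - e \<in> U \<and> ev e \<in> J2" for k
  proof (induction k)
    case 0
    then show ?case using z evz U_zero by (intro exI[of _ z]) (auto simp: T1_def)
  next
    case (Suc k)
    then obtain e where e: "Poly_Mapping.keys e \<subseteq> {w \<in> W1. k \<le> wt0 w}" "z - e \<in> U" "ev e \<in> J2" by blast
    have eT: "e \<in> T1" using e(1) by (auto simp: T1_def)
    obtain e' where e': "Poly_Mapping.keys e' \<subseteq> {w \<in> W1. Suc k \<le> wt0 w}" "s (J2 +>\<^bsub>F\<^esub> ev e) = enc (e - e')"
      using conormal_kernel_step[OF enc s(1) tau e(1)] by auto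
    have e'T: "e' \<in> T1" using e'(1) by (auto simp: T1_def)
    have "enc (e - e') = enc 0" using e'(2) s0[OF eT e(3)] by simp
    then have ee: "e - e' \<in> U" using enc[of "e - e'" 0] eT e'T T1_zero T1_diff by auto
    have "ev e' = ev e + - ev (e - e')" using eT e'T by (simp add: ev_diff T1_closed)
    then have "ev e' \<in> J2" using e(3) J2_add J2_uminus[OF ev_U[OF ee]] by metis
    moreover have "z - e' \<in> U" using U_add[OF e(2) ee] by simp
    ultimately show ?case using e'(1) by blast
  qed
  \<comment> \<open>Beyond all weights of \<open>z\<close>: cutting \<open>z - e\<close> to weights
    below \<open>k\<close> leaves exactly \<open>z\<close>, and the cut stays in U.\<close>
  moreover define k where "k = Suc (Max (insert 0 (wt0 ` Poly_Mapping.keys z)))"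
  ultimately obtain e where e: "Poly_Mapping.keys e \<subseteq> {w \<in> W1. k \<le> wt0 w}" "z - e \<in> U" by blast
  have "wt0 w < k" if "w \<in> Poly_Mapping.keys z" for w
    unfolding k_def using that by (auto simp: less_Suc_eq_le)
  then have "restrict_keys (\<lambda>w. wt0 w < k) z = z" by (rule restrict_keys_id)
  moreover have "restrict_keys (\<lambda>w. wt0 w < k) e = 0" using e(1) by (intro restrict_keys_eq_0) auto
  ultimately have "restrict_keys (\<lambda>w. wt0 w < k) (z - e) = z" by (simp add: restrict_keys_diff)
  then show ?thesis using restrict_U[OF e(2), of k] by simp
qed

text \<open>A generator d(s) t already begins with an ordinary letter, as J has no constant terms,
  and t d(s) differs from d(t) s by an element of N.\<close>

lemma U_decomposition:
  assumes "u \<in> U"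
  shows "\<exists>n\<in>N. \<forall>w\<in>Poly_Mapping.keys (u - n). \<exists>x\<in>X. \<exists>ws. w = Word (Inl x # ws)"
proof -
  have *: "\<exists>x\<in>X. \<exists>ws. w = Word (Inl x # ws)"
    if "s \<in> T1" "t \<in> T1" "w \<in> Poly_Mapping.keys (iota (ev s) * t)" for s t w
  proof -
    from that(3) obtain u v where w: "w = u + v" "u \<in> Poly_Mapping.keys (iota (ev s))" by (rule keys_multE)
    have "ev s \<in> carrier F" using that(1) by (simp add: ev_closed T1_closed)
    then have "Poly_Mapping.keys (ev s) \<subseteq> words_over X" by (simp add: carrier_free_algebra)
    with keys_iota[of "ev s" "Poly_Mapping.keys (ev s)"] w(2)
    obtain a where a: "u = iw a" "a \<in> Poly_Mapping.keys (ev s)" "a \<in> words_over X" by blast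
    have "0 < word_degree dx a" using J_degree_pos ev_T1[OF that(1)] a(2) by auto
    then obtain x xs where "letters a = x # xs" by (cases "letters a") (auto simp: word_degree_def)
    then show ?thesis using w a by (auto simp: map_word_def plus_word_def words_over_def)
  qed
  show ?thesis using assms unfolding U_def
  proof (induction rule: add_span.induct)
    case zero
    then show ?case using N_zero by (intro bexI[of _ 0]) auto
  next
    case (base g)
    then obtain w c w' d where g: "g = iota (ev (Poly_Mapping.single w c)) * Poly_Mapping.single w' d \<or>
        g = Poly_Mapping.single w' d * iota (ev (Poly_Mapping.single w c))" "w \<in> W1" "w' \<in> W1" by blast
    let ?s = "Poly_Mapping.single w c" and ?t = "Poly_Mapping.single w' d"
    have t: "?s \<in> T1" "?t \<in> T1" using g T1_single by auto
    from g(1) show ?case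
    proof
      assume "g = iota (ev ?s) * ?t"
      then show ?thesis using *[OF t] N_zero by (intro bexI[of _ 0]) auto
    next
      assume g: "g = ?t * iota (ev ?s)"
      have "\<forall>w\<in>Poly_Mapping.keys (g - (?t * iota (ev ?s) - iota (ev ?t) * ?s)). \<exists>x\<in>X. \<exists>ws. w = Word (Inl x # ws)"
        using *[OF t(2,1)] by (simp add: g)
      then show ?thesis using N_ev[OF t(2,1)] by blast
    qed
  next
    case (add p q)
    then obtain n n' where n: "n \<in> N" "\<forall>w\<in>Poly_Mapping.keys (p - n). \<exists>x\<in>X. \<exists>ws. w = Word (Inl x # ws)"
      "n' \<in> N" "\<forall>w\<in>Poly_Mapping.keys (q - n'). \<exists>x\<in>X. \<exists>ws. w = Word (Inl x # ws)" by blast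
    have "p + q - (n + n') = (p - n) + (q - n')" by simp
    then have "Poly_Mapping.keys (p + q - (n + n')) \<subseteq> Poly_Mapping.keys (p - n) \<union> Poly_Mapping.keys (q - n')"
      using keys_add by metis
    then show ?case using n N_add[OF n(1,3)] by (intro bexI[of _ "n + n'"]) blast+
  qed
qed

text \<open>An ordinary first letter belongs to the left outer factor, so stripping it leaves a word
  with exactly one relation letter.\<close>

lemma lderiv_T1:
  assumes "p \<in> T1" "x \<in> X"
  shows "lderiv (Inl x) p \<in> T1"
proof -
  have "w \<in> W1" if "w \<in> Poly_Mapping.keys (lderiv (Inl x) p)" for w
  proof (cases w)
    case (Word ws)
    then have "Word (Inl x # ws) \<in> W1" using that assms(1) by (auto simp: T1_def in_keys_iff)
    then obtain a y b where w: "Word (Inl x # ws) = iw a + Word [Inr y] + iw b"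
      "a \<in> words_over X" "y \<in> Y" "b \<in> words_over X" by (auto simp: W1_def)
    then obtain as where as: "a = Word (x # as)"
      by (cases a; cases "letters a") (auto simp: map_word_def plus_word_def)
    then have "w = iw (Word as) + Word [Inr y] + iw b" using w Word by (simp add: map_word_def plus_word_def)
    then show ?thesis unfolding W1_def using w as by auto
  qed
  then show ?thesis by (auto simp: T1_def)
qed

text \<open>
  Exactness of \<open>L \<otimes> L \<rightarrow> F \<otimes> L \<otimes> F \<rightarrow> F\<close>, suitably completed: as \<open>J\<close> lies in the augmentation ideal,
  modulo \<open>N\<close> a syzygy has no term beginning with a relation letter, so that its left derivatives are
  syzygies of smaller degree.
\<close>

lemma syzygy_trivial:
  assumes "z \<in> T1" "ev z = 0"
  shows "z \<in> N"
proof -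
  have hom: "z \<in> N" if "z \<in> T1" "ev z = 0" "\<And>w. w \<in> Poly_Mapping.keys z \<Longrightarrow> wt w = D" for D z
    using that
  proof (induction D arbitrary: z rule: less_induct)
    case (less D)
    have "z \<in> U" using less.prems J2_zero by (intro conormal_kernel) auto
    then obtain n where n: "n \<in> N" "\<forall>w\<in>Poly_Mapping.keys (z - n). \<exists>x\<in>X. \<exists>ws. w = Word (Inl x # ws)"
      using U_decomposition by blast
    \<comment> \<open>Cutting \<open>n\<close> to degree \<open>D\<close> keeps it in N and makes
      the difference \<open>q\<close> homogeneous.\<close>
    define nD where "nD = restrict_keys (\<lambda>w. wt w = D) n"
    define q where "q = z - nD"
    have nD: "nD \<in> N" unfolding nD_def by (rule restrict_N[OF n(1)])
    have q_eq: "q = restrict_keys (\<lambda>w. wt w = D) (z - n)"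
      using less.prems(3) by (simp add: q_def nD_def restrict_keys_diff restrict_keys_id)
    have qT: "q \<in> T1" unfolding q_def using less.prems(1) N_T1[OF nD] by (rule T1_diff)
    have ev_q: "ev q = 0" unfolding q_def using less.prems ev_N[OF nD] N_T1[OF nD] by (simp add: ev_diff T1_closed)
    have ex: "\<exists>x\<in>Inl ` X. \<exists>ws. w = Word (x # ws)" if "w \<in> Poly_Mapping.keys q" for w
      using n(2) that unfolding q_eq by fastforce
    let ?d = "\<lambda>x. lderiv (Inl x) q"
    have dT: "?d x \<in> T1" if "x \<in> X" for x using lderiv_T1[OF qT that] .
    have q_sum: "q = (\<Sum>x\<in>X. gen (Inl x) * ?d x)"
      using sum_gen_lderiv[of "Inl ` X" q] ex finite_X by (simp add: sum.reindex)
    have "ev (\<Sum>x\<in>S. gen (Inl x) * ?d x) = (\<Sum>x\<in>S. gen x * ev (?d x)) \<and>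
        (\<Sum>x\<in>S. gen (Inl x) * ?d x) \<in> carrier T" if "finite S" "S \<subseteq> X" for S
      using that
    proof (induction S rule: finite_induct)
      case empty
      then show ?case by (simp add: ev_zero T_closed)
    next
      case (insert x S)
      have "gen (Inl x) \<in> carrier T" "?d x \<in> carrier T" using insert.prems dT T1_closed by auto
      then show ?case using insert by (simp add: ev_add ev_mult T_closed ev_gen)
    qed
    from this[OF finite_X subset_refl] have "(\<Sum>x\<in>X. gen x * ev (?d x)) = 0"
      using q_sum ev_q by simp
    \<comment> \<open>Left derivatives separate the summands, so each \<open>ev (?d x)\<close>
      vanishes on its own.\<close>
    then have dz: "lderiv x0 (\<Sum>x\<in>X. gen x * ev (?d x)) = 0" for x0 by simp
    have ev_d: "ev (?d x) = 0" if "x \<in> X" for x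
      using dz[of x] that finite_X by (simp add: lderiv_sum lderiv_gen_mult)
    have "?d x \<in> N" if x: "x \<in> X" for x
    proof (cases "dx x \<le> D")
      case True
      show ?thesis
      proof (rule less.IH[of "D - dx x"])
        show "D - dx x < D" using True dx_pos[OF x] by simp
        fix w assume w: "w \<in> Poly_Mapping.keys (?d x)"
        obtain ws where ws: "w = Word ws" by (cases w)
        have "Word (Inl x # ws) \<in> Poly_Mapping.keys q" using w by (simp add: ws in_keys_iff)
        then have "wt (Word (Inl x # ws)) = D" unfolding q_eq by simp
        then show "wt w = D - dx x" by (simp add: ws)
      qed (use x dT ev_d in auto)
    next
      case False
      \<comment> \<open>A word of the derivative, with \<open>x\<close> put back in front, would
        have weight at least \<open>dx x\<close>, which exceeds \<open>D\<close>.\<close>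
      have "?d x = 0"
      proof (rule ccontr)
        assume "?d x \<noteq> 0"
        then obtain w where w: "w \<in> Poly_Mapping.keys (?d x)" by (metis poly_mapping_eqI in_keys_iff lookup_zero)
        obtain ws where ws: "w = Word ws" by (cases w)
        have "Word (Inl x # ws) \<in> Poly_Mapping.keys q" using w by (simp add: ws in_keys_iff)
        then have "wt (Word (Inl x # ws)) = D" unfolding q_eq by simp
        then show False using False by simp
      qed
      then show ?thesis using N_zero by simp
    qed
    then have "gen (Inl x) * ?d x \<in> N" if "x \<in> X" for x
      using N_iota[of "?d x" "Word [x]"] that iota_gen[OF that] by (simp add: gen_def)
    then have "q \<in> N" using q_sum N_zero N_add by (metis (no_types, lifting) sum_mem_closed)
    then show ?case using N_add[OF _ nD, of q] by (simp add: q_def)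
  qed
  define Ds where "Ds = wt ` Poly_Mapping.keys z"
  have "restrict_keys (\<lambda>w. wt w = D) z \<in> N" for D
  proof (rule hom[of _ D])
    show "ev (restrict_keys (\<lambda>w. wt w = D) z) = 0"
      using restrict_keys_ev[OF T1_closed[OF assms(1)], of D] assms(2) by simp
  qed (use assms in \<open>auto intro: T1_restrict\<close>)
  then have "(\<Sum>D\<in>Ds. restrict_keys (\<lambda>w. wt w = D) z) \<in> N"
    using N_zero N_add by (intro sum_mem_closed)
  moreover have "z = (\<Sum>D\<in>Ds. restrict_keys (\<lambda>w. wt w = D) z)"
    unfolding Ds_def by (rule sum_restrict_keys) auto
  ultimately show ?thesis by simp
qed

end

section \<open>Instances of two-term algebras\<close>

lemma two_term_encoding:
  fixes S :: "'w::ab_group_add set" and M :: "'m::ab_group_add set"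
  assumes "S \<times> M \<lesssim> (UNIV :: 'u set)"
    and I: "0 \<in> I" "\<And>x. x \<in> I \<Longrightarrow> - x \<in> I" "\<And>x y. x \<in> I \<Longrightarrow> y \<in> I \<Longrightarrow> x + y \<in> I"
    and N: "0 \<in> N" "\<And>x. x \<in> N \<Longrightarrow> - x \<in> N" "\<And>x y. x \<in> N \<Longrightarrow> y \<in> N \<Longrightarrow> x + y \<in> N"
  shows "\<exists>enc :: 'w \<times> 'm \<Rightarrow> 'u. \<forall>p\<in>S. \<forall>q\<in>S. \<forall>u\<in>M. \<forall>v\<in>M.
    enc (p, u) = enc (q, v) \<longleftrightarrow> p - q \<in> I \<and> u - v \<in> N"
proof -
  have "\<exists>enc :: 'w \<times> 'm \<Rightarrow> 'u. \<forall>x\<in>S \<times> M. \<forall>y\<in>S \<times> M.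
      enc x = enc y \<longleftrightarrow> fst x - fst y \<in> I \<and> snd x - snd y \<in> N"
  proof (rule quotient_encoding[OF assms(1)])
    fix x y z :: "'w \<times> 'm"
    show "fst x - fst x \<in> I \<and> snd x - snd x \<in> N" using I(1) N(1) by simp
    show "fst y - fst x \<in> I \<and> snd y - snd x \<in> N" if "fst x - fst y \<in> I \<and> snd x - snd y \<in> N"
      using that I(2)[of "fst x - fst y"] N(2)[of "snd x - snd y"] by simp
    show "fst x - fst z \<in> I \<and> snd x - snd z \<in> N"
      if "fst x - fst y \<in> I \<and> snd x - snd y \<in> N" "fst y - fst z \<in> I \<and> snd y - snd z \<in> N"
      using that I(3)[of "fst x - fst y" "fst y - fst z"] N(3)[of "snd x - snd y" "snd y - snd z"] by simp
  qed
  then obtain enc :: "'w \<times> 'm \<Rightarrow> 'u" where enc: "\<forall>x\<in>S \<times> M. \<forall>y\<in>S \<times> M.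
      enc x = enc y \<longleftrightarrow> fst x - fst y \<in> I \<and> snd x - snd y \<in> N" by blast
  then show ?thesis by (intro exI[of _ enc]) simp
qed

lemma ideal_monoid_algebra_closed:
  fixes Ws :: "'w::monoid_add set" and I :: "('w \<Rightarrow>\<^sub>0 'k::field) set"
  assumes "ideal I (monoid_algebra Ws)" "additive_submonoid Ws"
  shows "0 \<in> I" "x \<in> I \<Longrightarrow> y \<in> I \<Longrightarrow> x + y \<in> I" "x \<in> I \<Longrightarrow> - x \<in> I" "I \<subseteq> carrier (monoid_algebra Ws)"
    "x \<in> I \<Longrightarrow> p \<in> carrier (monoid_algebra Ws) \<Longrightarrow> p * x \<in> I"
    "x \<in> I \<Longrightarrow> p \<in> carrier (monoid_algebra Ws) \<Longrightarrow> x * p \<in> I"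
proof -
  interpret I: ideal I "monoid_algebra Ws :: ('k, 'w \<Rightarrow>\<^sub>0 'k) module" by fact
  show "0 \<in> I" using additive_subgroup.zero_closed[OF ideal.axioms(1)[OF assms(1)]] by simp
  show "x \<in> I \<Longrightarrow> y \<in> I \<Longrightarrow> x + y \<in> I" using additive_subgroup.a_closed[OF ideal.axioms(1)[OF assms(1)], of x y] by simp
  have l: "x \<in> I \<Longrightarrow> p \<in> carrier (monoid_algebra Ws) \<Longrightarrow> p * x \<in> I" for p
    using I.I_l_closed[of x p] by simp
  then show "x \<in> I \<Longrightarrow> p \<in> carrier (monoid_algebra Ws) \<Longrightarrow> p * x \<in> I" .
  show "x \<in> I \<Longrightarrow> p \<in> carrier (monoid_algebra Ws) \<Longrightarrow> x * p \<in> I"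
    using I.I_r_closed[of x p] by simp
  show "x \<in> I \<Longrightarrow> - x \<in> I"
    using l[OF _ monoid_algebra_closed(4)[OF assms(2) monoid_algebra_closed(6)[OF assms(2)]]] by simp
  show "I \<subseteq> carrier (monoid_algebra Ws)" using I.Icarr by auto
qed

text \<open>With \<open>d\<close> the inclusion of an ideal, crossing is an equality. Two cases are
  used: I = 0 with M = J, which is the resolution J -> F, and M = 0, which codes a quotient
  algebra.\<close>

lemma two_term_ideals:
  fixes Ws :: "'w::monoid_add set"
  assumes Ws: "additive_submonoid Ws" and Fs: "Fs = carrier (monoid_algebra Ws :: ('k::field, 'w \<Rightarrow>\<^sub>0 'k) module)"
    and I: "ideal I (monoid_algebra Ws)" and M: "ideal M (monoid_algebra Ws)"
    and IM: "\<And>p u. p \<in> I \<Longrightarrow> u \<in> M \<Longrightarrow> p * u = 0 \<and> u * p = 0"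
    and enc: "\<And>p q u v. p \<in> Fs \<Longrightarrow> q \<in> Fs \<Longrightarrow> u \<in> M \<Longrightarrow> v \<in> M \<Longrightarrow>
      enc (p, u) = enc (q, v) \<longleftrightarrow> p - q \<in> I \<and> u - v \<in> {0}"
  shows "two_term Ws M (*) (*) (\<lambda>u. u) I {0} enc Fs"
proof -
  note Ic = ideal_monoid_algebra_closed[OF I Ws]
  note Mc = ideal_monoid_algebra_closed[OF M Ws]
  show ?thesis
    by unfold_locales
      (use Ws Fs Ic Mc IM enc in \<open>auto simp: single_zero_central mult.assoc distrib_left distrib_right\<close>)
qed

section \<open>Generic matrices\<close>

lemma koszul_trivial_add:
  assumes "koszul_trivial S f I a" "koszul_trivial S f I b" "0 \<in> S" "\<And>x y. x \<in> S \<Longrightarrow> y \<in> S \<Longrightarrow> x + y \<in> S"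
  shows "koszul_trivial S f I (\<lambda>i. a i + b i)"
proof -
  have "koszul_trivial S f I (\<lambda>i. \<Sum>d\<in>{True, False}. (if d then a else b) i)"
    using assms by (intro koszul_trivial_sum) auto
  then show ?thesis by simp
qed

lemma koszul_trivial_mult:
  assumes "koszul_trivial S f I a" "p \<in> S" "\<And>x y. x \<in> S \<Longrightarrow> y \<in> S \<Longrightarrow> x * y \<in> S"
  shows "koszul_trivial S f I (\<lambda>i. p * a i)"
proof -
  obtain s where s: "\<forall>i\<in>I. \<forall>l\<in>I. s i l \<in> S \<and> s i l = - s l i" "\<forall>i\<in>I. s i i = 0"
    "\<forall>i\<in>I. a i = (\<Sum>l\<in>I. s i l * f l)"
    using assms(1) unfolding koszul_trivial_def by blast
  show ?thesis unfolding koszul_trivial_def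
  proof (intro exI[of _ "\<lambda>i l. p * s i l"] conjI ballI)
    fix i l assume "i \<in> I" "l \<in> I"
    then have sil: "s i l \<in> S" "s i l = - s l i" using s(1) by blast+
    show "p * s i l \<in> S" by (rule assms(3)[OF assms(2) sil(1)])
    show "p * s i l = - (p * s l i)" by (subst sil(2)) simp
  qed (use s(2,3) in \<open>auto simp: sum_distrib_left mult.assoc\<close>)
qed

lemma poly_mapping_double_eq_0:
  fixes x :: "'w \<Rightarrow>\<^sub>0 'k::field_char_0"
  assumes "x + x = 0"
  shows "x = 0"
proof (rule poly_mapping_eqI)
  fix m
  have "Poly_Mapping.lookup x m + Poly_Mapping.lookup x m = 0"
    using arg_cong[OF assms, of "\<lambda>p. Poly_Mapping.lookup p m"] by (simp add: lookup_add)
  then show "Poly_Mapping.lookup x m = Poly_Mapping.lookup 0 m" by (simp add: mult_2[symmetric])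
qed

text \<open>Interchanging the indices in the double sum changes its sign by skewness, and
  characteristic 0 allows division by 2.\<close>

lemma koszul_trivial_sum_zero:
  fixes f :: "'i \<Rightarrow> 'w::comm_monoid_add \<Rightarrow>\<^sub>0 'k::field_char_0"
  assumes "koszul_trivial S f I a"
  shows "(\<Sum>i\<in>I. a i * f i) = 0"
proof -
  obtain s where s: "\<forall>i\<in>I. \<forall>l\<in>I. s i l \<in> S \<and> s i l = - s l i" "\<forall>i\<in>I. a i = (\<Sum>l\<in>I. s i l * f l)"
    using assms unfolding koszul_trivial_def by blast
  let ?X = "\<Sum>i\<in>I. \<Sum>l\<in>I. s i l * f l * f i"
  have "?X = (\<Sum>l\<in>I. \<Sum>i\<in>I. s i l * f l * f i)" by (rule sum.swap)
  also have "\<dots> = (\<Sum>l\<in>I. \<Sum>i\<in>I. - (s l i * f i * f l))"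
  proof (intro sum.cong refl)
    fix l i assume "l \<in> I" "i \<in> I"
    then have "s i l = - s l i" using s(1) by blast
    then show "s i l * f l * f i = - (s l i * f i * f l)" by (simp add: ac_simps)
  qed
  also have "\<dots> = - ?X" by (simp add: sum_negf)
  finally have "?X + ?X = 0" by (simp only: eq_neg_iff_add_eq_0)
  then have "?X = 0" by (rule poly_mapping_double_eq_0)
  moreover have "(\<Sum>i\<in>I. a i * f i) = ?X" using s(2) by (simp add: sum_distrib_right)
  ultimately show ?thesis by simp
qed

context graded_presentation
begin

context
  fixes n :: nat
begin

abbreviation Wn :: "('x \<times> nat \<times> nat) set" where "Wn \<equiv> rep_coordinates X n"
abbreviation P :: "('k, (('x \<times> nat \<times> nat) \<Rightarrow>\<^sub>0 nat) \<Rightarrow>\<^sub>0 'k) module" where "P \<equiv> poly_algebra Wn"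

definition generic_matrix :: "'x \<Rightarrow> nat \<times> nat \<Rightarrow> (('x \<times> nat \<times> nat) \<Rightarrow>\<^sub>0 nat) \<Rightarrow>\<^sub>0 'k" where
  "generic_matrix x = (\<lambda>e\<in>matrix_indices n. pvar (x, e))"

definition generic_rep :: "('x word \<Rightarrow>\<^sub>0 'k) \<Rightarrow> nat \<times> nat \<Rightarrow> (('x \<times> nat \<times> nat) \<Rightarrow>\<^sub>0 nat) \<Rightarrow>\<^sub>0 'k" where
  "generic_rep = free_eval (matrix_algebra n P) generic_matrix"

abbreviation Ix :: "('y \<times> nat \<times> nat) set" where "Ix \<equiv> Y \<times> matrix_indices n"

definition rel :: "'y \<times> nat \<times> nat \<Rightarrow> (('x \<times> nat \<times> nat) \<Rightarrow>\<^sub>0 nat) \<Rightarrow>\<^sub>0 'k" where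
  "rel = (\<lambda>(y, e). generic_rep (j y) e)"

lemma P_comm: "comm_k_algebra P" by (rule comm_k_algebra_poly_algebra)
lemma P_algebra: "k_algebra P" using P_comm by (rule comm_k_algebra.axioms)
lemma MP_algebra: "k_algebra (matrix_algebra n P)" by (rule k_algebra.k_algebra_matrix_algebra[OF P_algebra])

lemma finite_Wn: "finite Wn" and finite_Ix: "finite Ix"
  by (simp_all add: rep_coordinates_def finite_X finite_Y)

lemmas P_closed = poly_algebra_closed[where W = Wn and ?'k = 'k]

lemma generic_matrix_closed: "x \<in> X \<Longrightarrow> generic_matrix x \<in> carrier (matrix_algebra n P)"
  by (auto simp: generic_matrix_def rep_coordinates_def)

lemma generic_rep_map: "algebra_map F (matrix_algebra n P) generic_rep"
  unfolding generic_rep_def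
  by (rule k_algebra.free_eval_algebra_map[OF MP_algebra]) (auto simp del: matrix_algebra_simps intro: generic_matrix_closed)

lemma generic_rep_closed: "p \<in> carrier F \<Longrightarrow> generic_rep p \<in> matrix_indices n \<rightarrow>\<^sub>E carrier P"
  using algebra_map_closed[OF generic_rep_map] by simp

lemma generic_rep_entry: "p \<in> carrier F \<Longrightarrow> e \<in> matrix_indices n \<Longrightarrow> generic_rep p e \<in> carrier P"
  using generic_rep_closed by (auto simp: PiE_iff)

lemma generic_rep_gen: "x \<in> X \<Longrightarrow> generic_rep (gen x) = generic_matrix x"
  unfolding generic_rep_def
  by (rule k_algebra.free_eval_gen[OF MP_algebra]) (rule generic_matrix_closed)

lemma finsum_P:
  assumes "\<And>i. i \<in> S \<Longrightarrow> f i \<in> carrier P"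
  shows "finsum P f S = sum f S"
proof -
  have "abelian_monoid P"
    using P_algebra by (simp add: k_algebra_def ring.is_abelian_group abelian_group.axioms)
  then show ?thesis
    using finsum_monoid_algebra[of "monomials_over Wn" S f] assms additive_submonoid_monomials[of Wn]
    by (simp add: poly_algebra_eq)
qed

lemma matrix_mult_P:
  assumes "Ma \<in> matrix_indices n \<rightarrow>\<^sub>E carrier P" "Mb \<in> matrix_indices n \<rightarrow>\<^sub>E carrier P" "i < n" "l < n"
  shows "(Ma \<otimes>\<^bsub>matrix_algebra n P\<^esub> Mb) (i, l) = (\<Sum>k<n. Ma (i, k) * Mb (k, l))"
proof -
  have "Ma (i, k) * Mb (k, l) \<in> carrier P" if "k < n" for k
    using assms that by (intro P_closed) (auto simp: PiE_iff)
  then show ?thesis using assms finsum_P[of "{..<n}" "\<lambda>k. Ma (i, k) * Mb (k, l)"] by simp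
qed

lemma generic_rep_mult:
  assumes "p \<in> carrier F" "q \<in> carrier F" "i < n" "l < n"
  shows "generic_rep (p * q) (i, l) = (\<Sum>k<n. generic_rep p (i, k) * generic_rep q (k, l))"
  using algebra_map_mult[OF generic_rep_map assms(1,2)] matrix_mult_P[OF generic_rep_closed generic_rep_closed] assms
  by simp

lemma generic_rep_add:
  assumes "p \<in> carrier F" "q \<in> carrier F" "e \<in> matrix_indices n"
  shows "generic_rep (p + q) e = generic_rep p e + generic_rep q e"
  using algebra_map_add[OF generic_rep_map assms(1,2)] assms(3) by simp

lemma generic_rep_zero: "e \<in> matrix_indices n \<Longrightarrow> generic_rep 0 e = 0"
  using generic_rep_add[of 0 0 e] F_closed(5) by simp

lemma rel_closed: "i \<in> Ix \<Longrightarrow> rel i \<in> carrier P"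
  by (auto simp: rel_def j_closed generic_rep_entry)

text \<open>All entries of the matrix of \<open>x\<close> receive the degree of \<open>x\<close>.
  Matrix products add these degrees, so homogeneous elements of F have homogeneous entries, as the
  regular sequence criterion requires of the relations.\<close>

definition wtP :: "('x \<times> nat \<times> nat \<Rightarrow>\<^sub>0 nat) \<Rightarrow> nat" where
  "wtP m = (\<Sum>v\<in>Poly_Mapping.keys m. Poly_Mapping.lookup m v * dx (fst v))"

lemma wtP_zero: "wtP 0 = 0" by (simp add: wtP_def)

lemma wtP_add: "wtP (u + v) = wtP u + wtP v"
  unfolding wtP_def by (rule setsum_keys_plus_distrib) (auto simp: distrib_right)

lemma keys_generic_word:
  assumes "w \<in> words_over X" "i < n" "l < n"
    "m \<in> Poly_Mapping.keys (word_prod (matrix_algebra n P) generic_matrix w (i, l))"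
  shows "wtP m = word_degree dx w"
proof -
  interpret MP: k_algebra "matrix_algebra n P" by (rule MP_algebra)
  have gm: "generic_matrix \<in> X \<rightarrow> carrier (matrix_algebra n P)" using generic_matrix_closed by blast
  have "Word xs \<in> words_over X \<Longrightarrow> i < n \<Longrightarrow> l < n \<Longrightarrow>
      m \<in> Poly_Mapping.keys (word_prod (matrix_algebra n P) generic_matrix (Word xs) (i, l)) \<Longrightarrow>
      wtP m = word_degree dx (Word xs)" for xs i l m
  proof (induction xs arbitrary: i l m)
    case Nil
    then show ?case by (auto simp: word_prod_def wtP_zero split: if_splits)
  next
    case (Cons x xs)
    let ?w = "word_prod (matrix_algebra n P) generic_matrix (Word xs)"
    have x: "x \<in> X" "Word xs \<in> words_over X" using Cons.prems(1) by auto
    have "?w \<in> carrier (matrix_algebra n P)" using MP.word_prod_closed[OF gm x(2)] .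
    then have "word_prod (matrix_algebra n P) generic_matrix (Word (x # xs)) (i, l)
        = (\<Sum>k<n. generic_matrix x (i, k) * ?w (k, l))"
      using matrix_mult_P[of "generic_matrix x" ?w i l] generic_matrix_closed[OF x(1)] Cons.prems(2,3)
      by (simp add: word_prod_def del: matrix_algebra_simps(2)) 
    then obtain k where k: "k < n" "m \<in> Poly_Mapping.keys (generic_matrix x (i, k) * ?w (k, l))"
      using Cons.prems(4) keys_sum[of "\<lambda>k. generic_matrix x (i, k) * ?w (k, l)" "{..<n}"] by auto
    from k(2) obtain m1 m2 where m: "m = m1 + m2" "m1 \<in> Poly_Mapping.keys (generic_matrix x (i, k))"
      "m2 \<in> Poly_Mapping.keys (?w (k, l))" by (rule keys_multE)
    have "wtP m1 = dx x"
      using m(2) k(1) Cons.prems(2) by (simp add: generic_matrix_def pvar_def wtP_def)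
    moreover have "wtP m2 = word_degree dx (Word xs)"
      using Cons.IH[OF x(2) k(1) Cons.prems(3) m(3)] .
    ultimately show ?case by (simp add: m wtP_add)
  qed
  then show ?thesis using assms by (metis word.exhaust)
qed

lemma keys_generic_rep:
  assumes "Poly_Mapping.keys p \<subseteq> {w \<in> words_over X. word_degree dx w = D}" "e \<in> matrix_indices n"
    "m \<in> Poly_Mapping.keys (generic_rep p e)"
  shows "wtP m = D"
  using assms(1,3)
proof (induction p arbitrary: m rule: poly_mapping_induct_single)
  case zero
  then show ?case using assms(2) by (simp add: generic_rep_zero)
next
  case (single w c)
  obtain i l where e: "e = (i, l)" "i < n" "l < n" using assms(2) by (cases e) auto
  have "generic_rep (Poly_Mapping.single w c) = c \<odot>\<^bsub>matrix_algebra n P\<^esub> word_prod (matrix_algebra n P) generic_matrix w"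
    unfolding generic_rep_def using single(1) generic_matrix_closed
    by (intro k_algebra.free_eval_word[OF MP_algebra, where X = X]) blast+
  then have "m \<in> Poly_Mapping.keys (Poly_Mapping.single 0 c * word_prod (matrix_algebra n P) generic_matrix w (i, l))"
    using single(2) e by simp
  then have "m \<in> Poly_Mapping.keys (word_prod (matrix_algebra n P) generic_matrix w (i, l))"
    by (rule keys_multE) (simp split: if_splits)
  then show ?case using keys_generic_word[OF _ e(2,3)] single(1) by auto
next
  case (add p q)
  then have "p \<in> carrier F" "q \<in> carrier F" by (auto simp: carrier_free_algebra)
  then have "m \<in> Poly_Mapping.keys (generic_rep p e) \<union> Poly_Mapping.keys (generic_rep q e)"
    using add.prems assms(2) keys_add[of "generic_rep p e" "generic_rep q e"] by (auto simp: generic_rep_add)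
  then show ?case using add.IH by auto
qed

lemma keys_rel: "i \<in> Ix \<Longrightarrow> m \<in> Poly_Mapping.keys (rel i) \<Longrightarrow> wtP m = dy (fst i)"
  using keys_generic_rep[of "j (fst i)" "dy (fst i)" "snd i" m] j_closed j_degree
  by (fastforce simp: rel_def carrier_free_algebra)

subsection \<open>The ideal of the representation scheme\<close>

abbreviation rel_ideal where "rel_ideal \<equiv> Idl\<^bsub>P\<^esub> (rel ` Ix)"

lemma rel_ideal_ideal: "ideal rel_ideal P"
proof -
  interpret P: k_algebra P by (rule P_algebra)
  show ?thesis using rel_closed by (intro P.genideal_ideal) auto
qed

lemma rel_in_ideal: "i \<in> Ix \<Longrightarrow> rel i \<in> rel_ideal"
proof -
  interpret P: k_algebra P by (rule P_algebra)
  have "rel ` Ix \<subseteq> carrier P" using rel_closed by auto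
  then show "i \<in> Ix \<Longrightarrow> rel i \<in> rel_ideal" using P.genideal_self by blast
qed

lemmas rel_ideal_closed = ideal_monoid_algebra_closed[OF rel_ideal_ideal[unfolded poly_algebra_eq]
    additive_submonoid_monomials, folded poly_algebra_eq]

lemma generic_rep_J:
  assumes "v \<in> J" "e \<in> matrix_indices n"
  shows "generic_rep v e \<in> rel_ideal"
proof -
  obtain t where t: "t \<in> T1" "v = ev t" using assms(1) J_eq by auto
  have "\<forall>e\<in>matrix_indices n. generic_rep (ev t) e \<in> rel_ideal"
    using t(1)
  proof (induction rule: T1_induct)
    case zero
    then show ?case using rel_ideal_closed(1) by (auto simp: ev_zero generic_rep_zero)
  next
    case (single a y b c)
    let ?a = "Poly_Mapping.single a c" and ?b = "Poly_Mapping.single b (1::'k)"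
    have ab: "?a \<in> carrier F" "?b \<in> carrier F" "j y \<in> carrier F" using single j_closed by auto
    have e: "ev (iota ?a * gen (Inr y) * iota ?b) = ?a * j y * ?b"
      using ab single T1_closed[OF T1_gen[OF single(2)]]
      by (simp add: ev_mult T_closed iota_closed ev_iota ev_gen)
    have 1: "generic_rep (?a * j y) (i, l) \<in> rel_ideal" if "i < n" "l < n" for i l
      unfolding generic_rep_mult[OF ab(1,3) that]
      using that single(2) ab rel_in_ideal
      by (intro sum_mem_closed rel_ideal_closed(1,2,5)) (auto simp: rel_def generic_rep_entry)
    have "generic_rep (?a * j y * ?b) (i, l) \<in> rel_ideal" if "i < n" "l < n" for i l
      unfolding generic_rep_mult[OF F_closed(2)[OF ab(1,3)] ab(2) that]
      using that 1 ab
      by (intro sum_mem_closed rel_ideal_closed(1,2,6)) (auto simp: generic_rep_entry)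
    then show ?case unfolding e by (auto simp: matrix_indices_def)
  next
    case (add p q)
    then show ?case using rel_ideal_closed(2)
      by (simp add: ev_add T1_closed generic_rep_add ev_closed)
  qed
  then show ?thesis using assms(2) t(2) by simp
qed

lemma quotient_map: "algebra_map F A (\<lambda>f. J +>\<^bsub>F\<^esub> f)"
  by (rule algebra_mapI) (auto simp: A_ops[simplified] coset_A A_fields(3))

lemma lepoll_P:
  assumes "(UNIV :: 'k set) \<lesssim> K"
  shows "carrier P \<lesssim> K" "infinite K"
proof -
  have "infinite (UNIV :: 'k set)" by (simp add: infinite_UNIV_char_0)
  then show K: "infinite K" using assms by (metis lepoll_def finite_subset finite_image_iff)
  show "carrier P \<lesssim> K"
    unfolding poly_algebra_eq
    by (rule lepoll_monoid_algebra[OF K countable_monomials_over[OF finite_Wn] assms])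
qed

text \<open>The images of the generic matrices satisfy the relations in Q, so the representation of
  F factors through A; it is defined on chosen representatives of cosets.\<close>

lemma alg_hom_matrix_quotient:
  assumes Q: "k_algebra Q" and h: "algebra_map P Q h"
    and h0: "\<And>p. p \<in> rel_ideal \<Longrightarrow> h p = \<zero>\<^bsub>Q\<^esub>"
  obtains r where "r \<in> alg_hom A (matrix_algebra n Q)"
    "\<And>f. f \<in> carrier F \<Longrightarrow> r (J +>\<^bsub>F\<^esub> f) = map_matrix n h (generic_rep f)"
proof -
  interpret Q: k_algebra Q by fact
  interpret MQ: k_algebra "matrix_algebra n Q" by (rule Q.k_algebra_matrix_algebra)
  let ?k = "\<lambda>f. map_matrix n h (generic_rep f)"
  have k: "algebra_map F (matrix_algebra n Q) ?k"
    by (rule algebra_map_comp[OF generic_rep_map algebra_map_map_matrix[OF h P_algebra Q]])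
  have kJ: "?k f = ?k g" if "f \<in> carrier F" "g \<in> carrier F" "f - g \<in> J" for f g
  proof -
    have "?k (f - g) = \<zero>\<^bsub>matrix_algebra n Q\<^esub>"
      using generic_rep_J[OF that(3)] h0 by (auto simp: map_matrix_def intro!: restrict_ext)
    moreover have "?k f = ?k (f - g) \<oplus>\<^bsub>matrix_algebra n Q\<^esub> ?k g"
      using algebra_map_add[OF k, of "f - g" g] that F_closed(3)[OF that(1,2)]
      by (simp del: matrix_algebra_simps)
    ultimately show ?thesis using algebra_map_closed[OF k that(2)] MQ.l_zero by metis
  qed
  define r where "r = (\<lambda>a\<in>carrier A. ?k (SOME f. f \<in> a))"
  have r: "r (J +>\<^bsub>F\<^esub> f) = ?k f" if "f \<in> carrier F" for f
    using coset_A[OF that] kJ[OF coset_rep(1)[OF that] that coset_rep(2)[OF that]]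
    by (simp add: r_def)
  have "algebra_map A (matrix_algebra n Q) r"
  proof (rule algebra_mapI)
    fix x assume "x \<in> carrier A"
    then obtain f where f: "x = J +>\<^bsub>F\<^esub> f" "f \<in> carrier F" by (auto simp: carrier_A)
    show "r x \<in> carrier (matrix_algebra n Q)"
      using f algebra_map_closed[OF k] by (simp add: r del: matrix_algebra_simps)
    show "r (c \<odot>\<^bsub>A\<^esub> x) = c \<odot>\<^bsub>matrix_algebra n Q\<^esub> r x" for c
      using f algebra_map_smult[OF k f(2), of c] by (simp add: A_ops(3) r F_closed del: matrix_algebra_simps)
    fix y assume "y \<in> carrier A"
    then obtain g where g: "y = J +>\<^bsub>F\<^esub> g" "g \<in> carrier F" by (auto simp: carrier_A)
    show "r (x \<otimes>\<^bsub>A\<^esub> y) = r x \<otimes>\<^bsub>matrix_algebra n Q\<^esub> r y"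
      "r (x \<oplus>\<^bsub>A\<^esub> y) = r x \<oplus>\<^bsub>matrix_algebra n Q\<^esub> r y"
      using f g algebra_map_mult[OF k f(2) g(2)] algebra_map_add[OF k f(2) g(2)]
      by (simp_all add: A_ops r F_closed del: matrix_algebra_simps)
  next
    show "r \<one>\<^bsub>A\<^esub> = \<one>\<^bsub>matrix_algebra n Q\<^esub>"
      using r[OF F_closed(6)] algebra_map_one[OF k] by (simp add: A_fields del: matrix_algebra_simps)
  qed
  then have "r \<in> alg_hom A (matrix_algebra n Q)" by (simp add: alg_hom_iff r_def)
  then show ?thesis using that r by blast
qed

text \<open>The relations vanish in \<open>B\<close> because \<open>\<rho>\<close> represents A.
  Conversely P modulo the relations, coded in \<open>'u\<close>, carries a representation of A; the
  map from \<open>B\<close> that classifies it composes with the evaluation P -> B to the quotient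
  map, so nothing outside the relation ideal dies in \<open>B\<close>.\<close>

lemma defining_ideal_eq:
  fixes B :: "('k, 'u) module"
  assumes rep: "represents_rep A n B \<rho>" and ku: "(UNIV :: 'k set) \<lesssim> (UNIV :: 'u set)"
  shows "rep_defining_ideal X J n B \<rho> = rel_ideal"
proof -
  have rho: "\<rho> \<in> alg_hom A (matrix_algebra n B)"
    and bij: "\<And>C :: ('k, 'u) module. comm_k_algebra C \<Longrightarrow>
        bij_betw (\<lambda>\<psi>. \<lambda>x\<in>carrier A. map_matrix n \<psi> (\<rho> x)) (alg_hom B C) (alg_hom A (matrix_algebra n C))"
    using rep by (auto simp: represents_rep_def)
  interpret B: comm_k_algebra B using rep by (simp add: represents_rep_def)
  interpret MB: k_algebra "matrix_algebra n B" by (rule B.k_algebra_matrix_algebra)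
  interpret P: comm_k_algebra P by (rule P_comm)
  let ?s = "\<lambda>(x, e). \<rho> (J +>\<^bsub>F\<^esub> gen x) e"
  let ?phi = "poly_eval B ?s"
  have rho': "algebra_map A (matrix_algebra n B) \<rho>" using rho by (simp add: alg_hom_iff)
  have s: "?s \<in> Wn \<rightarrow> carrier B"
  proof
    fix v assume "v \<in> Wn"
    then obtain x e where v: "v = (x, e)" "x \<in> X" "e \<in> matrix_indices n" by (auto simp: rep_coordinates_def)
    then show "?s v \<in> carrier B"
      using algebra_map_closed[OF rho' coset_A[OF gen_closed[OF v(2)]]] by (auto simp: PiE_iff)
  qed
  have phi: "algebra_map P B ?phi" by (rule B.poly_eval_algebra_map[OF s])
  have phi_rep: "?phi (generic_rep p e) = \<rho> (J +>\<^bsub>F\<^esub> p) e" if "p \<in> carrier F" "e \<in> matrix_indices n" for p e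
  proof -
    have "map_matrix n ?phi (generic_rep p) = \<rho> (J +>\<^bsub>F\<^esub> p)"
    proof (rule algebra_map_free_algebra_eq[where X = X])
      show "algebra_map F (matrix_algebra n B) (\<lambda>p. map_matrix n ?phi (generic_rep p))"
        by (rule algebra_map_comp[OF generic_rep_map algebra_map_map_matrix[OF phi P_algebra B.k_algebra_axioms]])
      show "algebra_map F (matrix_algebra n B) (\<lambda>p. \<rho> (J +>\<^bsub>F\<^esub> p))"
        by (rule algebra_map_comp[OF quotient_map rho'])
      fix x assume x: "x \<in> X"
      have c: "\<rho> (J +>\<^bsub>F\<^esub> gen x) \<in> matrix_indices n \<rightarrow>\<^sub>E carrier B"
        using algebra_map_closed[OF rho' coset_A[OF gen_closed[OF x]]] by simp
      show "map_matrix n ?phi (generic_rep (gen x)) = \<rho> (J +>\<^bsub>F\<^esub> gen x)"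
      proof (rule matrix_eqI)
        show "\<rho> (J +>\<^bsub>F\<^esub> gen x) \<in> extensional (matrix_indices n)" using c by (auto simp: PiE_iff)
        fix i l assume il: "i < n" "l < n"
        have "?s (x, i, l) \<in> carrier B" using c il by (auto simp: PiE_iff)
        then have "?phi (pvar (x, i, l)) = ?s (x, i, l)" by (rule B.poly_eval_pvar)
        then show "map_matrix n ?phi (generic_rep (gen x)) (i, l) = \<rho> (J +>\<^bsub>F\<^esub> gen x) (i, l)"
          using il x by (simp add: generic_rep_gen generic_matrix_def)
      qed simp
    qed (rule that(1))
    from fun_cong[OF this, of e] show ?thesis using that(2) by (simp add: map_matrix_def)
  qed
  have "rel_ideal \<subseteq> rep_defining_ideal X J n B \<rho>"
  proof
    fix f assume "f \<in> rel_ideal"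
    then obtain c where c: "f = (\<Sum>i\<in>Ix. c i * rel i)" "\<forall>i\<in>Ix. c i \<in> carrier P"
      using genideal_image_poly_algebra[OF finite_Ix, of rel Wn] rel_closed by auto
    let ?K = "{f \<in> carrier P. ?phi f = \<zero>\<^bsub>B\<^esub>}"
    have "c i * rel i \<in> ?K" if i: "i \<in> Ix" for i
    proof -
      obtain y e where ye: "i = (y, e)" "y \<in> Y" "e \<in> matrix_indices n" using i by auto
      have "?phi (rel i) = \<rho> (J +>\<^bsub>F\<^esub> j y) e" using phi_rep[OF j_closed[OF ye(2)] ye(3)] by (simp add: ye rel_def)
      also have "J +>\<^bsub>F\<^esub> j y = \<zero>\<^bsub>A\<^esub>"
        using F.a_rcos_zero[OF relation_ideal_ideal j_in_J[OF ye(2)]] by (simp add: A_fields)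
      also have "\<rho> \<zero>\<^bsub>A\<^esub> = \<zero>\<^bsub>matrix_algebra n B\<^esub>"
        using algebra_map_zero[OF algebra_map_comp[OF quotient_map rho'] F.ring_axioms MB.ring_axioms]
          F.a_rcos_zero[OF relation_ideal_ideal J_zero] by (simp add: A_fields)
      finally have "?phi (rel i) = \<zero>\<^bsub>B\<^esub>" using ye(3) by simp
      then have "?phi (c i * rel i) = \<zero>\<^bsub>B\<^esub>"
        using algebra_map_mult[OF phi, of "c i" "rel i"] c(2) i rel_closed[OF i] algebra_map_closed[OF phi, of "c i"] by auto
      then show ?thesis using c(2) i rel_closed[OF i] by (auto intro: P_closed)
    qed
    moreover have "0 \<in> ?K" using algebra_map_zero[OF phi P.ring_axioms B.ring_axioms] P_closed by simp
    moreover have "x + y \<in> ?K" if "x \<in> ?K" "y \<in> ?K" for x y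
      using that algebra_map_add[OF phi, of x y] by (auto intro: P_closed)
    ultimately have "f \<in> ?K" unfolding c(1) by (intro sum_mem_closed)
    then show "f \<in> rep_defining_ideal X J n B \<rho>" by (simp add: rep_defining_ideal_def)
  qed
  moreover have "rep_defining_ideal X J n B \<rho> \<subseteq> rel_ideal"
  proof
    fix f assume "f \<in> rep_defining_ideal X J n B \<rho>"
    then have f: "f \<in> carrier P" "?phi f = \<zero>\<^bsub>B\<^esub>" by (simp_all add: rep_defining_ideal_def)
    let ?Z = "{0 :: (('x \<times> nat \<times> nat) \<Rightarrow>\<^sub>0 nat) \<Rightarrow>\<^sub>0 'k}"
    have "carrier P \<times> ?Z \<lesssim> (UNIV :: 'u set)"
      using lepoll_P[OF ku] by (intro lepoll_square) (auto intro: finite_lepoll_infinite)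
    from two_term_encoding[OF this, of rel_ideal ?Z] rel_ideal_closed(1-3)
    obtain enc :: "_ \<Rightarrow> 'u" where enc: "\<forall>p\<in>carrier P. \<forall>q\<in>carrier P. \<forall>u\<in>?Z. \<forall>v\<in>?Z.
        enc (p, u) = enc (q, v) \<longleftrightarrow> p - q \<in> rel_ideal \<and> u - v \<in> ?Z" by auto
    \<comment> \<open>The quotient of P by the relations, as a two-term algebra with zero
      module.\<close>
    interpret Q: two_term "monomials_over Wn" ?Z "(*)" "(*)" "\<lambda>u. u" rel_ideal ?Z 0 enc "carrier P"
    proof (rule two_term_ideals)
      show "ideal rel_ideal (monoid_algebra (monomials_over Wn))"
        using rel_ideal_ideal by (simp add: poly_algebra_eq)
      show "ideal ?Z (monoid_algebra (monomials_over Wn))"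
        using P.zeroideal by (simp add: poly_algebra_eq)
    qed (use enc in \<open>auto simp: additive_submonoid_monomials poly_algebra_eq\<close>)
    have Q: "comm_k_algebra Q.alg" by (rule Q.comm_k_algebra_alg) (simp_all add: mult.commute)
    then interpret QA: comm_k_algebra Q.alg .
    have h: "algebra_map P Q.alg (\<lambda>p. enc (p, 0))"
      by (rule algebra_mapI) (simp_all add: Q.add_enc Q.mult_enc Q.smult_enc Q.one_alg Q.enc_closed Q.Fs_closed
        Q.sigma_closed)
    have "enc (p, 0) = \<zero>\<^bsub>Q.alg\<^esub>" if "p \<in> rel_ideal" for p
      using that rel_ideal_closed(4) enc P_closed(5) by (auto simp: Q.zero_alg)
    from alg_hom_matrix_quotient[OF QA.k_algebra_axioms h this]
    obtain r where r: "r \<in> alg_hom A (matrix_algebra n Q.alg)"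
      "\<And>f. f \<in> carrier F \<Longrightarrow> r (J +>\<^bsub>F\<^esub> f) = map_matrix n (\<lambda>p. enc (p, 0)) (generic_rep f)" by blast
    from bij_betw_imp_surj_on[OF bij[OF Q]] r(1)
    obtain \<psi> where psi: "\<psi> \<in> alg_hom B Q.alg" "r = (\<lambda>x\<in>carrier A. map_matrix n \<psi> (\<rho> x))" by auto
    have psi': "algebra_map B Q.alg \<psi>" using psi(1) by (simp add: alg_hom_iff)
    have "\<psi> (?phi f) = enc (f, 0)"
    proof (rule algebra_map_poly_algebra_eq[OF algebra_map_comp[OF phi psi'] h _ f(1)])
      fix v assume "v \<in> Wn"
      then obtain x i l where v: "v = (x, i, l)" "x \<in> X" "i < n" "l < n" by (auto simp: rep_coordinates_def)
      have "?phi (pvar v) = ?s v" using s \<open>v \<in> Wn\<close> by (intro B.poly_eval_pvar) blast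
      then have "\<psi> (?phi (pvar v)) = map_matrix n \<psi> (\<rho> (J +>\<^bsub>F\<^esub> gen x)) (i, l)" using v by simp
      also have "\<dots> = r (J +>\<^bsub>F\<^esub> gen x) (i, l)" using coset_A[OF gen_closed[OF v(2)]] by (simp add: psi(2))
      also have "\<dots> = enc (pvar v, 0)" using v by (simp add: r(2) generic_rep_gen generic_matrix_def)
      finally show "\<psi> (?phi (pvar v)) = enc (pvar v, 0)" .
    qed
    moreover have "\<psi> (?phi f) = \<zero>\<^bsub>Q.alg\<^esub>"
      using algebra_map_zero[OF psi' B.ring_axioms QA.ring_axioms] by (simp add: f(2))
    ultimately have "enc (f, 0) = enc (0, 0)" by (simp add: Q.zero_alg)
    then show "f \<in> rel_ideal" using enc f(1) P_closed(5) by auto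
  qed
  ultimately show ?thesis by blast
qed

subsection \<open>The truncated Koszul complex\<close>

text \<open>The free module on the entries of the relations; finitely supported functions make it a
  subset of an additive group type, as \<open>two_term\<close> expects.\<close>

definition K1 :: "('y \<times> nat \<times> nat \<Rightarrow>\<^sub>0 (('x \<times> nat \<times> nat) \<Rightarrow>\<^sub>0 nat) \<Rightarrow>\<^sub>0 'k) set" where
  "K1 = {u. Poly_Mapping.keys u \<subseteq> Ix \<and> (\<forall>i. Poly_Mapping.lookup u i \<in> carrier P)}"

definition scaleK :: "((('x \<times> nat \<times> nat) \<Rightarrow>\<^sub>0 nat) \<Rightarrow>\<^sub>0 'k) \<Rightarrow>
    ('y \<times> nat \<times> nat \<Rightarrow>\<^sub>0 (('x \<times> nat \<times> nat) \<Rightarrow>\<^sub>0 nat) \<Rightarrow>\<^sub>0 'k) \<Rightarrow>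
    ('y \<times> nat \<times> nat \<Rightarrow>\<^sub>0 (('x \<times> nat \<times> nat) \<Rightarrow>\<^sub>0 nat) \<Rightarrow>\<^sub>0 'k)" where
  "scaleK p u = Poly_Mapping.map ((*) p) u"

definition dK :: "('y \<times> nat \<times> nat \<Rightarrow>\<^sub>0 (('x \<times> nat \<times> nat) \<Rightarrow>\<^sub>0 nat) \<Rightarrow>\<^sub>0 'k) \<Rightarrow> (('x \<times> nat \<times> nat) \<Rightarrow>\<^sub>0 nat) \<Rightarrow>\<^sub>0 'k" where
  "dK u = (\<Sum>i\<in>Ix. Poly_Mapping.lookup u i * rel i)"

definition Kos :: "('y \<times> nat \<times> nat \<Rightarrow>\<^sub>0 (('x \<times> nat \<times> nat) \<Rightarrow>\<^sub>0 nat) \<Rightarrow>\<^sub>0 'k) set" where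
  "Kos = {u \<in> K1. koszul_trivial (carrier P) rel Ix (Poly_Mapping.lookup u)}"

lemma lookup_scaleK [simp]: "Poly_Mapping.lookup (scaleK p u) i = p * Poly_Mapping.lookup u i"
  by (simp add: scaleK_def map.rep_eq when_def)

lemma scaleK_closed: "p \<in> carrier P \<Longrightarrow> u \<in> K1 \<Longrightarrow> scaleK p u \<in> K1"
proof -
  have "Poly_Mapping.keys (scaleK p u) \<subseteq> Poly_Mapping.keys u" by (auto simp: in_keys_iff)
  then show "p \<in> carrier P \<Longrightarrow> u \<in> K1 \<Longrightarrow> scaleK p u \<in> K1" by (auto simp: K1_def intro: P_closed)
qed

lemma K1_closed: "0 \<in> K1" "u \<in> K1 \<Longrightarrow> v \<in> K1 \<Longrightarrow> u + v \<in> K1" "u \<in> K1 \<Longrightarrow> - u \<in> K1"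
proof -
  show "0 \<in> K1" by (simp add: K1_def P_closed)
  show "u \<in> K1 \<Longrightarrow> v \<in> K1 \<Longrightarrow> u + v \<in> K1"
    using keys_add_subset[of u Ix v] by (simp add: K1_def P_closed lookup_add)
  show "u \<in> K1 \<Longrightarrow> - u \<in> K1" by (auto simp: K1_def P_closed in_keys_iff)
qed

lemma single_K1: "i \<in> Ix \<Longrightarrow> p \<in> carrier P \<Longrightarrow> Poly_Mapping.single i p \<in> K1"
  by (auto simp: K1_def lookup_single when_def P_closed)

lemma lepoll_K1:
  assumes "(UNIV :: 'k set) \<lesssim> K"
  shows "K1 \<lesssim> K"
proof -
  have "K1 \<subseteq> {u. Poly_Mapping.keys u \<subseteq> Ix \<and> Poly_Mapping.lookup u ` Ix \<subseteq> carrier P}"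
    by (auto simp: K1_def)
  then have "K1 \<lesssim> {u. Poly_Mapping.keys u \<subseteq> Ix \<and> Poly_Mapping.lookup u ` Ix \<subseteq> carrier P}"
    by (rule subset_imp_lepoll)
  also have "\<dots> \<lesssim> K"
    using lepoll_P[OF assms] finite_Ix by (intro lepoll_poly_mappings) (auto intro: countable_finite)
  finally show ?thesis .
qed

lemma Kos_closed:
  "0 \<in> Kos" "u \<in> Kos \<Longrightarrow> v \<in> Kos \<Longrightarrow> u + v \<in> Kos" "u \<in> Kos \<Longrightarrow> - u \<in> Kos"
  "p \<in> carrier P \<Longrightarrow> u \<in> Kos \<Longrightarrow> scaleK p u \<in> Kos"
proof -
  show z: "0 \<in> Kos"
    unfolding Kos_def koszul_trivial_def by (auto simp: K1_closed P_closed intro: exI[of _ "\<lambda>_ _. 0"])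
  show "u \<in> Kos \<Longrightarrow> v \<in> Kos \<Longrightarrow> u + v \<in> Kos"
    using koszul_trivial_add[of "carrier P" rel Ix "Poly_Mapping.lookup u" "Poly_Mapping.lookup v"] P_closed
    by (simp add: Kos_def K1_closed lookup_add[abs_def])
  show s: "p \<in> carrier P \<Longrightarrow> u \<in> Kos \<Longrightarrow> scaleK p u \<in> Kos" for p
    using koszul_trivial_mult[of "carrier P" rel Ix "Poly_Mapping.lookup u" p] P_closed(2)
    by (simp add: Kos_def scaleK_closed fun_eq_iff[symmetric] del: matrix_algebra_simps) (simp add: lookup_scaleK[abs_def])
  have "- u = scaleK (- 1) u" by (rule poly_mapping_eqI) simp
  then show "u \<in> Kos \<Longrightarrow> - u \<in> Kos" using s[of "- 1"] P_closed by simp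
qed

lemma dK_closed: "u \<in> K1 \<Longrightarrow> dK u \<in> carrier P"
  unfolding dK_def by (intro poly_algebra_sum_closed P_closed rel_closed) (auto simp: K1_def)

lemma dK_single: "i \<in> Ix \<Longrightarrow> dK (Poly_Mapping.single i p) = p * rel i"
  unfolding dK_def using finite_Ix
  by (simp add: lookup_single when_def if_distrib[of "\<lambda>x. x * _"] sum.delta cong: if_cong del: mem_Sigma_iff)

text \<open>The skew matrix is the one of the exterior product of u and v, whose Koszul boundary is
  the given element.\<close>

lemma crossing_Kos:
  assumes "u \<in> K1" "v \<in> K1"
  shows "scaleK (dK v) u - scaleK (dK u) v \<in> Kos"
proof -
  have K: "scaleK (dK v) u - scaleK (dK u) v \<in> K1"
    using K1_closed(2)[of "scaleK (dK v) u" "- scaleK (dK u) v"] K1_closed(3) scaleK_closed dK_closed assms by simp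
  let ?u = "Poly_Mapping.lookup u" and ?v = "Poly_Mapping.lookup v"
  have "koszul_trivial (carrier P) rel Ix (Poly_Mapping.lookup (scaleK (dK v) u - scaleK (dK u) v))"
    unfolding koszul_trivial_def
  proof (intro exI[of _ "\<lambda>i l. ?u i * ?v l - ?u l * ?v i"] conjI ballI)
    fix i assume "i \<in> Ix"
    have "Poly_Mapping.lookup (scaleK (dK v) u - scaleK (dK u) v) i
        = (\<Sum>l\<in>Ix. ?v l * rel l) * ?u i - (\<Sum>l\<in>Ix. ?u l * rel l) * ?v i"
      by (simp add: lookup_minus dK_def)
    also have "\<dots> = (\<Sum>l\<in>Ix. ?v l * rel l * ?u i) - (\<Sum>l\<in>Ix. ?u l * rel l * ?v i)"
      by (simp only: sum_distrib_right)
    also have "\<dots> = (\<Sum>l\<in>Ix. (?u i * ?v l - ?u l * ?v i) * rel l)"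
      unfolding sum_subtractf[symmetric] by (rule sum.cong) (simp_all add: algebra_simps)
    finally show "Poly_Mapping.lookup (scaleK (dK v) u - scaleK (dK u) v) i
        = (\<Sum>l\<in>Ix. (?u i * ?v l - ?u l * ?v i) * rel l)" .
  qed (use assms in \<open>auto simp: K1_def intro!: P_closed\<close>)
  then show ?thesis using K by (simp add: Kos_def)
qed

lemma scaleK_simps:
  "scaleK p (u + v) = scaleK p u + scaleK p v" "scaleK (p + q) u = scaleK p u + scaleK q u"
  "scaleK p (scaleK q u) = scaleK (p * q) u" "scaleK 1 u = u" "scaleK 0 u = 0"
  by (rule poly_mapping_eqI; simp add: lookup_add algebra_simps)+

lemma dK_simps:
  "dK (u + v) = dK u + dK v" "dK (scaleK p u) = p * dK u"
  by (simp_all add: dK_def lookup_add distrib_right sum.distrib sum_distrib_left mult.assoc)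

lemma dK_Kos: "u \<in> Kos \<Longrightarrow> dK u = 0"
  using koszul_trivial_sum_zero[of "carrier P" rel Ix "Poly_Mapping.lookup u"] by (simp add: Kos_def dK_def)

lemma Kos_sub: "u \<in> Kos \<Longrightarrow> u \<in> K1"
  by (simp add: Kos_def)

text \<open>The quotient by \<open>Kos\<close> supplies the crossing relation, and the differential
  descends to it because Koszul boundaries are cycles.\<close>

lemma two_term_koszul:
  assumes "\<And>p q u v. p \<in> carrier P \<Longrightarrow> q \<in> carrier P \<Longrightarrow> u \<in> K1 \<Longrightarrow> v \<in> K1 \<Longrightarrow>
      enc (p, u) = enc (q, v) \<longleftrightarrow> p - q \<in> {0} \<and> u - v \<in> Kos"
  shows "two_term (monomials_over Wn) K1 scaleK (\<lambda>u p. scaleK p u) dK {0} Kos enc (carrier P)"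
  by unfold_locales
    (use assms Kos_closed in \<open>auto simp: additive_submonoid_monomials poly_algebra_eq[symmetric] K1_closed P_closed(5)
      scaleK_closed dK_closed scaleK_simps dK_simps Kos_sub mult.commute
      distrib_right intro: crossing_Kos dest: dK_Kos\<close>)

end

end

section \<open>Matrices over DG algebras\<close>

lemma matrix_dga_simps [simp]:
  "carrier (matrix_dga n C) = carrier (matrix_algebra n C)"
  "mult (matrix_dga n C) = mult (matrix_algebra n C)"
  "one (matrix_dga n C) = one (matrix_algebra n C)"
  "ring.zero (matrix_dga n C) = ring.zero (matrix_algebra n C)"
  "add (matrix_dga n C) = add (matrix_algebra n C)"
  "smult (matrix_dga n C) = smult (matrix_algebra n C)"
  "comp (matrix_dga n C) i = matrix_indices n \<rightarrow>\<^sub>E comp C i"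
  "diff (matrix_dga n C) = map_matrix n (diff C)"
  by (simp_all add: matrix_dga_def module.defs dga.defs fun_eq_iff)

lemma algebra_map_matrix_dga:
  "algebra_map A (matrix_dga n C) f \<longleftrightarrow> algebra_map A (matrix_algebra n C) f"
  by (simp add: algebra_map_def ring_hom_def)

lemma dga_hom_iff:
  "f \<in> dga_hom D E \<longleftrightarrow> algebra_map D E f \<and> f \<in> extensional (carrier D) \<and>
     (\<forall>i. \<forall>x\<in>comp D i. f x \<in> comp E i) \<and> (\<forall>x\<in>carrier D. f (diff D x) = diff E (f x))"
  unfolding dga_hom_def alg_hom_iff by blast

context dg_algebra
begin

lemma comp_carrierD: "x \<in> comp D i \<Longrightarrow> x \<in> carrier D"
  using comp_carrier by blast

lemma diff_zero: "diff D \<zero> = \<zero>"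
  using diff_comp_0[OF comp_zero] .

text \<open>The axioms locate the differential only on homogeneous elements; the general case goes
  through the decomposition into components.\<close>

lemma diff_closed:
  assumes "x \<in> carrier D"
  shows "diff D x \<in> carrier D"
proof -
  have hom: "diff D y \<in> carrier D" if "y \<in> comp D i" for y i
    using that diff_comp[of y] diff_comp_0[of y] comp_carrierD by (cases i) auto
  obtain f where f: "\<forall>i. f i \<in> comp D i" "finite {i. f i \<noteq> \<zero>}" "x = (\<Oplus>i\<in>{i. f i \<noteq> \<zero>}. f i)"
    using direct_sum[OF assms] by blast
  have "diff D (\<Oplus>i\<in>K. f i) \<in> carrier D" if "finite K" for K
    using that
  proof (induction K rule: finite_induct)
    case empty
    then show ?case by (simp add: diff_zero)
  next
    case (insert k K)
    have "f \<in> K \<rightarrow> carrier D" "f k \<in> carrier D" using f(1) comp_carrierD by blast+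
    then show ?case using insert f(1) hom by (simp add: diff_add) (metis a_closed)
  qed
  then show ?thesis using f by simp
qed

lemma comp_finsum:
  assumes "\<And>i. i \<in> K \<Longrightarrow> f i \<in> comp D d"
  shows "(\<Oplus>i\<in>K. f i) \<in> comp D d"
  using assms
proof (induction K rule: infinite_finite_induct)
  case (insert k K)
  then have "f \<in> K \<rightarrow> carrier D" "f k \<in> carrier D" using comp_carrierD by blast+
  then show ?case using insert comp_add by simp
qed (simp_all add: comp_zero finsum_infinite)

lemma diff_finsum:
  assumes "f \<in> K \<rightarrow> carrier D"
  shows "diff D (\<Oplus>i\<in>K. f i) = (\<Oplus>i\<in>K. diff D (f i))"
proof -
  have "abelian_monoid D" by (rule abelian_monoid_axioms)
  then show ?thesis using assms by (intro finsum_hom) (auto simp: diff_add diff_zero diff_closed)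
qed

lemma matrix_comp_carrier: "M \<in> matrix_indices n \<rightarrow>\<^sub>E comp D i \<Longrightarrow> M \<in> carrier (matrix_algebra n D)"
  using comp_carrierD by (auto simp: PiE_iff)

lemma matrix_comp_mult:
  assumes "M \<in> matrix_indices n \<rightarrow>\<^sub>E comp D i" "N \<in> matrix_indices n \<rightarrow>\<^sub>E comp D j"
  shows "M \<otimes>\<^bsub>matrix_algebra n D\<^esub> N \<in> matrix_indices n \<rightarrow>\<^sub>E comp D (i + j)"
  using assms by (auto intro!: comp_finsum comp_mult simp: PiE_iff)

text \<open>All entries of \<open>M\<close> have the same degree, so one sign serves every summand
  of a matrix product.\<close>

lemma matrix_leibniz:
  assumes M: "M \<in> matrix_indices n \<rightarrow>\<^sub>E comp D i" and N: "N \<in> carrier (matrix_algebra n D)"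
  shows "map_matrix n (diff D) (M \<otimes>\<^bsub>matrix_algebra n D\<^esub> N) =
    map_matrix n (diff D) M \<otimes>\<^bsub>matrix_algebra n D\<^esub> N \<oplus>\<^bsub>matrix_algebra n D\<^esub>
    ((-1) ^ i) \<odot>\<^bsub>matrix_algebra n D\<^esub> (M \<otimes>\<^bsub>matrix_algebra n D\<^esub> map_matrix n (diff D) N)"
proof (rule matrix_eqI)
  fix a b assume ab: "a < n" "b < n"
  have Mi: "M (a, k) \<in> comp D i" if "k < n" for k
    using M that ab by (auto simp: PiE_iff)
  note Mc = Mi comp_carrierD[OF Mi]
  have Nc: "N (k, b) \<in> carrier D" if "k < n" for k using N that ab by (auto simp: PiE_iff)
  let ?x = "\<lambda>k. diff D (M (a, k)) \<otimes> N (k, b)" and ?y = "\<lambda>k. M (a, k) \<otimes> diff D (N (k, b))"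
  have "map_matrix n (diff D) (M \<otimes>\<^bsub>matrix_algebra n D\<^esub> N) (a, b) = diff D (\<Oplus>k\<in>{..<n}. M (a, k) \<otimes> N (k, b))"
    using ab by simp
  also have "\<dots> = (\<Oplus>k\<in>{..<n}. diff D (M (a, k) \<otimes> N (k, b)))"
    using Mc Nc by (intro diff_finsum) auto
  also have "\<dots> = (\<Oplus>k\<in>{..<n}. ?x k \<oplus> ((-1) ^ i) \<odot> ?y k)"
    using Mc Nc by (intro finsum_cong' refl) (auto intro!: leibniz smult_closed simp: diff_closed)
  also have "\<dots> = (\<Oplus>k\<in>{..<n}. ?x k) \<oplus> (\<Oplus>k\<in>{..<n}. ((-1) ^ i) \<odot> ?y k)"
    using Mc Nc by (intro finsum_addf) (auto intro!: smult_closed simp: diff_closed)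
  also have "(\<Oplus>k\<in>{..<n}. ((-1) ^ i) \<odot> ?y k) = ((-1) ^ i) \<odot> (\<Oplus>k\<in>{..<n}. ?y k)"
    using Mc Nc by (intro smult_finsum[symmetric]) (auto simp: diff_closed)
  finally have e: "map_matrix n (diff D) (M \<otimes>\<^bsub>matrix_algebra n D\<^esub> N) (a, b)
      = (\<Oplus>k\<in>{..<n}. ?x k) \<oplus> ((-1) ^ i) \<odot> (\<Oplus>k\<in>{..<n}. ?y k)" .
  have "(\<Oplus>k\<in>{..<n}. ?x k) = (\<Oplus>k\<in>{..<n}. map_matrix n (diff D) M (a, k) \<otimes> N (k, b))"
    "(\<Oplus>k\<in>{..<n}. ?y k) = (\<Oplus>k\<in>{..<n}. M (a, k) \<otimes> map_matrix n (diff D) N (k, b))"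
    using Mc Nc ab by (intro finsum_cong' refl; auto simp: diff_closed)+
  then show "map_matrix n (diff D) (M \<otimes>\<^bsub>matrix_algebra n D\<^esub> N) (a, b) =
      (map_matrix n (diff D) M \<otimes>\<^bsub>matrix_algebra n D\<^esub> N \<oplus>\<^bsub>matrix_algebra n D\<^esub>
    ((-1) ^ i) \<odot>\<^bsub>matrix_algebra n D\<^esub> (M \<otimes>\<^bsub>matrix_algebra n D\<^esub> map_matrix n (diff D) N)) (a, b)"
    unfolding e using ab by simp
qed auto

lemma matrix_diff_add:
  assumes "M \<in> carrier (matrix_algebra n D)" "N \<in> carrier (matrix_algebra n D)"
  shows "map_matrix n (diff D) (M \<oplus>\<^bsub>matrix_algebra n D\<^esub> N) =
    map_matrix n (diff D) M \<oplus>\<^bsub>matrix_algebra n D\<^esub> map_matrix n (diff D) N"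
  using assms by (intro matrix_eqI) (auto simp: diff_add PiE_iff)

end

lemma dga_hom_comp:
  assumes "f \<in> dga_hom D E" "g \<in> dga_hom E E'" "dg_algebra D"
  shows "(\<lambda>x\<in>carrier D. g (f x)) \<in> dga_hom D E'"
proof -
  interpret D: dg_algebra D by fact
  have f: "algebra_map D E f" "\<And>i x. x \<in> comp D i \<Longrightarrow> f x \<in> comp E i"
      "\<And>x. x \<in> carrier D \<Longrightarrow> f (diff D x) = diff E (f x)"
    and g: "algebra_map E E' g" "\<And>i x. x \<in> comp E i \<Longrightarrow> g x \<in> comp E' i"
      "\<And>x. x \<in> carrier E \<Longrightarrow> g (diff E x) = diff E' (g x)"
    using assms(1,2) unfolding dga_hom_iff by blast+
  have "algebra_map D E' (\<lambda>x\<in>carrier D. g (f x))"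
    by (rule algebra_map_cong[OF algebra_map_comp[OF f(1) g(1)]]) (auto intro: D.ring_axioms D.k_algebra_axioms)
  then show ?thesis
    unfolding dga_hom_iff using f g algebra_map_closed[OF f(1)] D.comp_carrierD
    by (auto simp: D.diff_closed)
qed

section \<open>The universal crossed module of representations\<close>

text \<open>Fixes codings in \<open>'u\<close> of the Koszul terms, modulo \<open>Kos\<close>, and
  of J -> F. They exist as soon as \<open>'u\<close> is at least as large as the field.\<close>

locale koszul_coding = minimal_ncci X dx Y dy j
  for X :: "'x set" and dx :: "'x \<Rightarrow> nat" and Y :: "'y set" and dy :: "'y \<Rightarrow> nat"
    and j :: "'y \<Rightarrow> 'x word \<Rightarrow>\<^sub>0 'k::field_char_0" +
  fixes n :: nat
    and encK :: "((('x \<times> nat \<times> nat) \<Rightarrow>\<^sub>0 nat) \<Rightarrow>\<^sub>0 'k) \<times>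
      ('y \<times> nat \<times> nat \<Rightarrow>\<^sub>0 (('x \<times> nat \<times> nat) \<Rightarrow>\<^sub>0 nat) \<Rightarrow>\<^sub>0 'k) \<Rightarrow> 'u"
    and encD :: "('x word \<Rightarrow>\<^sub>0 'k) \<times> ('x word \<Rightarrow>\<^sub>0 'k) \<Rightarrow> 'u"
  assumes encK: "\<And>p q u v. p \<in> carrier (P n) \<Longrightarrow> q \<in> carrier (P n) \<Longrightarrow> u \<in> K1 n \<Longrightarrow> v \<in> K1 n \<Longrightarrow>
      encK (p, u) = encK (q, v) \<longleftrightarrow> p - q \<in> {0} \<and> u - v \<in> Kos n"
    and encD: "\<And>p q u v. p \<in> carrier F \<Longrightarrow> q \<in> carrier F \<Longrightarrow> u \<in> J \<Longrightarrow> v \<in> J \<Longrightarrow>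
      encD (p, u) = encD (q, v) \<longleftrightarrow> p - q \<in> {0} \<and> u - v \<in> {0}"
begin

abbreviation "Q \<equiv> P n"

sublocale C: two_term "monomials_over (Wn n)" "K1 n" scaleK "\<lambda>u p. scaleK p u" "dK n" "{0}" "Kos n" 0 encK "carrier Q"
  by (rule two_term_koszul) (rule encK)

text \<open>The path object, coded by the same elements.\<close>

sublocale E: two_term "monomials_over (Wn n)" "K1 n" scaleK "\<lambda>u p. scaleK p u" "dK n" "{0}" "Kos n" 1 encK "carrier Q"
  by (rule two_term_koszul) (rule encK)

text \<open>The resolution \<open>J \<rightarrow> F\<close> of \<open>A\<close>.\<close>

sublocale D: two_term "words_over X" J "(*)" "(*)" "\<lambda>u. u" "{0}" "{0}" 0 encD "carrier F"
proof (rule two_term_ideals)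
  show "ideal {0} (monoid_algebra (words_over X) :: ('k, 'x word \<Rightarrow>\<^sub>0 'k) module)" using F.zeroideal by (simp add: free_algebra_eq)
  show "ideal J (monoid_algebra (words_over X))"
    using relation_ideal_ideal unfolding free_algebra_eq relation_ideal_def .
qed (use encD in \<open>auto simp: additive_submonoid_words free_algebra_eq\<close>)

sublocale Cd: comm_dg_algebra C.dga
  by (rule C.comm_dg_algebra_dga) (auto simp: mult.commute)

sublocale Dd: dg_algebra D.dga
  by (rule D.dg_algebra_dga) simp

sublocale Ec: comm_k_algebra E.alg
  by (rule E.comm_k_algebra_alg) (auto simp: mult.commute)

abbreviation "MC \<equiv> matrix_algebra n C.dga"
abbreviation "MD i \<equiv> matrix_indices n \<rightarrow>\<^sub>E comp C.dga i"
abbreviation "dM \<equiv> map_matrix n (diff C.dga)"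

sublocale MC: k_algebra MC by (rule Cd.k_algebra_matrix_algebra)

lemma MD_carrier: "K \<in> MD i \<Longrightarrow> K \<in> carrier MC"
  by (rule Cd.matrix_comp_carrier)

lemma MD_2: "K \<in> MD 2 \<Longrightarrow> K = \<zero>\<^bsub>MC\<^esub>"
  using C.enc_comp_2[of 2] by (auto simp: PiE_iff C.zero_alg intro!: extensionalityI[of K "matrix_indices n"])

lemma MD_add: "K \<in> MD i \<Longrightarrow> K' \<in> MD i \<Longrightarrow> K \<oplus>\<^bsub>MC\<^esub> K' \<in> MD i"
  using Cd.comp_add by (auto simp: PiE_iff)

lemma MD_zero: "\<zero>\<^bsub>MC\<^esub> \<in> MD i"
  using Cd.comp_zero[of i] by auto

lemma inK_map: "algebra_map Q C.dga (\<lambda>p. encK (p, 0))"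
  by (rule algebra_mapI)
    (simp_all add: C.add_enc C.mult_enc C.smult_enc C.one_alg C.enc_closed C.closed C.lact_zero C.ract_zero C.d_zero)

definition G :: "('x word \<Rightarrow>\<^sub>0 'k) \<Rightarrow> nat \<times> nat \<Rightarrow> 'u" where
  "G f = map_matrix n (\<lambda>p. encK (p, 0)) (generic_rep n f)"

lemma G_map: "algebra_map F MC G"
  unfolding G_def
  by (rule algebra_map_comp[OF generic_rep_map algebra_map_map_matrix[OF inK_map P_algebra Cd.k_algebra_axioms]])

lemma G_0: "f \<in> carrier F \<Longrightarrow> G f \<in> MD 0"
  using generic_rep_entry[of f _ n] by (auto simp: G_def map_matrix_def C.enc_comp_0)

lemma dM_0: "K \<in> MD 0 \<Longrightarrow> dM K = \<zero>\<^bsub>MC\<^esub>"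
  using Cd.diff_comp_0 by (auto simp: map_matrix_def PiE_iff intro!: restrict_ext)

definition yK :: "'y \<Rightarrow> nat \<times> nat \<Rightarrow> 'u" where
  "yK y = (\<lambda>e\<in>matrix_indices n. encK (0, Poly_Mapping.single (y, e) 1))"

lemma yK_1: "y \<in> Y \<Longrightarrow> yK y \<in> MD 1"
  using C.enc_comp_1 by (auto simp: yK_def intro!: C.enc_comp_1 single_K1 C.Fs_closed)

lemma dM_yK: "y \<in> Y \<Longrightarrow> dM (yK y) = G (j y)"
  by (rule matrix_eqI[of _ n])
    (auto simp: yK_def G_def rel_def C.diff_enc single_K1 C.Fs_closed dK_single)

text \<open>The bimodule map J -> M_n(C) before descending to J: on words with one relation letter
  it lifts the generic value of \<open>ev\<close> through the differential.\<close>

definition Phi :: "(('x + 'y) word \<Rightarrow>\<^sub>0 'k) \<Rightarrow> nat \<times> nat \<Rightarrow> 'u" where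
  "Phi = free_eval MC (case_sum (\<lambda>x. G (gen x)) yK)"

lemma Phi_map: "algebra_map T MC Phi"
  unfolding Phi_def using MD_carrier[OF G_0[OF gen_closed]] MD_carrier[OF yK_1]
  by (intro MC.free_eval_algebra_map) (auto simp del: matrix_algebra_simps)

lemma Phi_gen: "x \<in> X \<Longrightarrow> Phi (gen (Inl x)) = G (gen x)" "y \<in> Y \<Longrightarrow> Phi (gen (Inr y)) = yK y"
  unfolding Phi_def using MD_carrier[OF G_0[OF gen_closed]] MD_carrier[OF yK_1]
  by (simp_all add: MC.free_eval_gen del: matrix_algebra_simps)

lemma Phi_iota: "p \<in> carrier F \<Longrightarrow> Phi (iota p) = G p"
  by (rule algebra_map_free_algebra_eq[OF algebra_map_comp[OF iota_map Phi_map] G_map])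
    (simp_all add: iota_gen Phi_gen)

text \<open>The outer factors of a word have degree 0 and hence zero differential, so the Leibniz
  rule differentiates only the matrix of the relation letter, into the generic value of its
  relation.\<close>

lemma Phi_T1:
  assumes "t \<in> T1"
  shows "Phi t \<in> MD 1 \<and> dM (Phi t) = G (ev t)"
  using assms
proof (induction rule: T1_induct)
  case zero
  have "Phi 0 = \<zero>\<^bsub>MC\<^esub>" "G 0 = \<zero>\<^bsub>MC\<^esub>"
    using algebra_map_zero[OF Phi_map T.ring_axioms MC.ring_axioms]
      algebra_map_zero[OF G_map F.ring_axioms MC.ring_axioms] by (simp_all del: matrix_algebra_simps)
  moreover have "dM \<zero>\<^bsub>MC\<^esub> = \<zero>\<^bsub>MC\<^esub>" by (rule dM_0) (rule MD_zero)
  ultimately show ?case using MD_zero[of 1] by (simp add: ev_zero del: matrix_algebra_simps)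
next
  case (single a y b c)
  let ?a = "Poly_Mapping.single a c" and ?b = "Poly_Mapping.single b (1::'k)"
  have ab: "?a \<in> carrier F" "?b \<in> carrier F" "j y \<in> carrier F" using single j_closed by auto
  have T: "iota ?a \<in> carrier T" "gen (Inr y) \<in> carrier T" "iota ?b \<in> carrier T"
    using ab single by (auto intro: iota_closed)
  have e: "ev (iota ?a * gen (Inr y) * iota ?b) = ?a * j y * ?b"
    using ab single T by (simp add: ev_mult T_closed ev_iota ev_gen)
  let ?A = "G ?a" and ?B = "G ?b" and ?y = "yK y"
  have m: "?A \<in> MD 0" "?B \<in> MD 0" "?y \<in> MD 1" using G_0 ab yK_1 single by auto
  note mc = MD_carrier[OF m(1)] MD_carrier[OF m(2)] MD_carrier[OF m(3)]
  have Phi: "Phi (iota ?a * gen (Inr y) * iota ?b) = ?A \<otimes>\<^bsub>MC\<^esub> ?y \<otimes>\<^bsub>MC\<^esub> ?B"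
    using algebra_map_mult[OF Phi_map T_closed(2)[OF T(1,2)] T(3)] algebra_map_mult[OF Phi_map T(1,2)] ab single
    by (simp add: Phi_iota Phi_gen del: matrix_algebra_simps)
  have Ay: "?A \<otimes>\<^bsub>MC\<^esub> ?y \<in> MD 1" using Cd.matrix_comp_mult[OF m(1,3)] by simp
  then have 1: "?A \<otimes>\<^bsub>MC\<^esub> ?y \<otimes>\<^bsub>MC\<^esub> ?B \<in> MD 1" using Cd.matrix_comp_mult[OF Ay m(2)] by simp
  have dAy: "dM (?A \<otimes>\<^bsub>MC\<^esub> ?y) = ?A \<otimes>\<^bsub>MC\<^esub> G (j y)"
    using Cd.matrix_leibniz[OF m(1) mc(3)] mc algebra_map_closed[OF G_map ab(3)] MC.smult_one
    by (simp add: dM_0[OF m(1)] dM_yK[OF single(2)] del: matrix_algebra_simps)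
  have "dM (?A \<otimes>\<^bsub>MC\<^esub> ?y \<otimes>\<^bsub>MC\<^esub> ?B) = ?A \<otimes>\<^bsub>MC\<^esub> G (j y) \<otimes>\<^bsub>MC\<^esub> ?B"
    using Cd.matrix_leibniz[OF Ay mc(2)] mc MD_carrier[OF Ay] algebra_map_closed[OF G_map ab(3)]
    by (simp add: dM_0[OF m(2)] dAy MC.smult_zero_right del: matrix_algebra_simps)
  also have "\<dots> = G (?a * j y * ?b)"
    using algebra_map_mult[OF G_map F_closed(2)[OF ab(1,3)] ab(2)] algebra_map_mult[OF G_map ab(1,3)]
    by (simp del: matrix_algebra_simps)
  finally show ?case using 1 by (simp only: Phi e)
next
  case (add p q)
  have "Phi (p + q) = Phi p \<oplus>\<^bsub>MC\<^esub> Phi q" "G (ev (p + q)) = G (ev p) \<oplus>\<^bsub>MC\<^esub> G (ev q)"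
    using algebra_map_add[OF Phi_map T1_closed[OF add(1)] T1_closed[OF add(2)]]
      algebra_map_add[OF G_map ev_closed[OF T1_closed[OF add(1)]] ev_closed[OF T1_closed[OF add(2)]]] add(1,2)
    by (simp_all add: ev_add T1_closed del: matrix_algebra_simps)
  then show ?case
    using add(3,4) MD_add[of "Phi p" 1 "Phi q"]
      Cd.matrix_diff_add[OF MD_carrier[OF add(3)[THEN conjunct1]] MD_carrier[OF add(4)[THEN conjunct1]]]
    by (simp del: matrix_algebra_simps)
qed

text \<open>A product of two matrices of degree 1 has degree 2 and is zero; its Leibniz rule equates
  G (ev s) Phi t with Phi s G (ev t), which is the vanishing of \<open>Phi\<close> on a generator of
  N.\<close>

lemma Phi_N:
  assumes "p \<in> N"
  shows "Phi p = \<zero>\<^bsub>MC\<^esub>"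
proof -
  have "p \<in> T1 \<and> Phi p = \<zero>\<^bsub>MC\<^esub>" using assms unfolding N_def
  proof (induction rule: add_span.induct)
    case zero
    then show ?case using algebra_map_zero[OF Phi_map T.ring_axioms MC.ring_axioms] T1_zero
      by (simp del: matrix_algebra_simps)
  next
    case (base g)
    then obtain w c w' d where g: "g = Poly_Mapping.single w c * iota (ev (Poly_Mapping.single w' d)) -
       iota (ev (Poly_Mapping.single w c)) * Poly_Mapping.single w' d" "w \<in> W1" "w' \<in> W1" by blast
    let ?s = "Poly_Mapping.single w c" and ?t = "Poly_Mapping.single w' d"
    have t: "?s \<in> T1" "?t \<in> T1" using g T1_single by auto
    have c: "?s \<in> carrier T" "?t \<in> carrier T" "iota (ev ?s) \<in> carrier T" "iota (ev ?t) \<in> carrier T"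
      "ev ?s \<in> carrier F" "ev ?t \<in> carrier F"
      using t T1_closed ev_iota_T1 ev_closed by blast+
    have gT: "g \<in> T1" unfolding g(1) using t c by (auto intro!: T1_diff iota_T1 T1_iota)
    note P1 = Phi_T1[OF t(1), THEN conjunct1] and P2 = Phi_T1[OF t(2), THEN conjunct1]
    let ?x = "Phi ?s \<otimes>\<^bsub>MC\<^esub> G (ev ?t)" and ?y = "G (ev ?s) \<otimes>\<^bsub>MC\<^esub> Phi ?t"
    have xy: "?x \<in> carrier MC" "?y \<in> carrier MC"
      using MD_carrier[OF P1] MD_carrier[OF P2] algebra_map_closed[OF G_map] c by (auto simp del: matrix_algebra_simps)
    have "Phi ?s \<otimes>\<^bsub>MC\<^esub> Phi ?t \<in> MD 2" using Cd.matrix_comp_mult[OF P1 P2] by (simp add: numeral_2_eq_2)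
    then have "Phi ?s \<otimes>\<^bsub>MC\<^esub> Phi ?t = \<zero>\<^bsub>MC\<^esub>" by (rule MD_2)
    then have "dM (Phi ?s \<otimes>\<^bsub>MC\<^esub> Phi ?t) = \<zero>\<^bsub>MC\<^esub>" using dM_0[OF MD_zero] by (simp del: matrix_algebra_simps)
    then have "?y \<oplus>\<^bsub>MC\<^esub> (-1) \<odot>\<^bsub>MC\<^esub> ?x = \<zero>\<^bsub>MC\<^esub>"
      using Cd.matrix_leibniz[OF P1 MD_carrier[OF P2]] Phi_T1[OF t(1)] Phi_T1[OF t(2)] by (simp del: matrix_algebra_simps)
    then have eq: "?y = ?x"
      using xy MC.smult_minus_one[OF xy(1)] by (metis MC.minus_equality MC.minus_minus MC.a_inv_closed)
    have "?s * iota (ev ?t) \<in> carrier T" "iota (ev ?s) * ?t \<in> carrier T" using c by (auto intro: T_closed)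
    then have "Phi (g + iota (ev ?s) * ?t) = Phi g \<oplus>\<^bsub>MC\<^esub> Phi (iota (ev ?s) * ?t)"
      using algebra_map_add[OF Phi_map T1_closed[OF gT]] by (simp del: matrix_algebra_simps)
    moreover have "g + iota (ev ?s) * ?t = ?s * iota (ev ?t)" by (simp add: g)
    moreover have "Phi (?s * iota (ev ?t)) = ?x" "Phi (iota (ev ?s) * ?t) = ?y"
      using algebra_map_mult[OF Phi_map c(1,4)] algebra_map_mult[OF Phi_map c(3,2)] c by (simp_all add: Phi_iota del: matrix_algebra_simps)
    ultimately have "?x = Phi g \<oplus>\<^bsub>MC\<^esub> ?x" using eq by (simp del: matrix_algebra_simps)
    then show ?case using gT MD_carrier[OF Phi_T1[OF gT, THEN conjunct1]] xy(1)
      by (metis MC.add.r_cancel_one')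
  next
    case (add p q)
    then show ?case
      using algebra_map_add[OF Phi_map, of p q] T1_closed T1_add by (simp del: matrix_algebra_simps)
  qed
  then show ?thesis by simp
qed

text \<open>The bimodule map \<open>J \<rightarrow> M\<^sub>n(C)\<close>, well defined because all syzygies of the relations are trivial.\<close>

definition gamma :: "('x word \<Rightarrow>\<^sub>0 'k) \<Rightarrow> nat \<times> nat \<Rightarrow> 'u" where
  "gamma v = Phi (SOME t. t \<in> T1 \<and> ev t = v)"

lemma gamma_ev:
  assumes "t \<in> T1"
  shows "gamma (ev t) = Phi t"
proof -
  let ?t = "SOME t'. t' \<in> T1 \<and> ev t' = ev t"
  have t: "?t \<in> T1" "ev ?t = ev t"
    using someI[of "\<lambda>t'. t' \<in> T1 \<and> ev t' = ev t" t] assms by auto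
  have "?t - t \<in> N" using t assms by (intro syzygy_trivial T1_diff) (auto simp: ev_diff T1_closed)
  then have "Phi ((?t - t) + t) = \<zero>\<^bsub>MC\<^esub> \<oplus>\<^bsub>MC\<^esub> Phi t"
    using algebra_map_add[OF Phi_map, of "?t - t" t] T1_closed[OF T1_diff[OF t(1) assms]] T1_closed[OF assms]
    by (simp add: Phi_N del: matrix_algebra_simps diff_add_cancel)
  then show ?thesis
    using MD_carrier[OF Phi_T1[OF assms, THEN conjunct1]] by (simp add: gamma_def del: matrix_algebra_simps)
qed

lemma gamma_1: "v \<in> J \<Longrightarrow> gamma v \<in> MD 1" and dM_gamma: "v \<in> J \<Longrightarrow> dM (gamma v) = G v"
proof -
  assume "v \<in> J"
  then obtain t where t: "t \<in> T1" "v = ev t" using J_eq by auto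
  show "gamma v \<in> MD 1" "dM (gamma v) = G v"
    unfolding t(2) gamma_ev[OF t(1)] using Phi_T1[OF t(1)] by blast+
qed

lemma gamma_carrier: "v \<in> J \<Longrightarrow> gamma v \<in> carrier MC"
  by (rule MD_carrier[OF gamma_1])

lemma gamma_add: "u \<in> J \<Longrightarrow> v \<in> J \<Longrightarrow> gamma (u + v) = gamma u \<oplus>\<^bsub>MC\<^esub> gamma v"
proof -
  assume "u \<in> J" "v \<in> J"
  then obtain s t where s: "s \<in> T1" "u = ev s" and t: "t \<in> T1" "v = ev t" using J_eq by auto
  have "u + v = ev (s + t)" using s t by (simp add: ev_add T1_closed)
  then show ?thesis
    using s t gamma_ev[OF T1_add[OF s(1) t(1)]] algebra_map_add[OF Phi_map, of s t]
    by (simp add: gamma_ev T1_closed del: matrix_algebra_simps)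
qed

lemma gamma_mult:
  assumes "p \<in> carrier F" "v \<in> J"
  shows "gamma (p * v) = G p \<otimes>\<^bsub>MC\<^esub> gamma v" "gamma (v * p) = gamma v \<otimes>\<^bsub>MC\<^esub> G p"
proof -
  obtain t where t: "t \<in> T1" "v = ev t" using assms(2) J_eq by auto
  have "p * v = ev (iota p * t)" "v * p = ev (t * iota p)"
    using t assms(1) by (simp_all add: ev_mult T1_closed iota_closed ev_iota)
  then show "gamma (p * v) = G p \<otimes>\<^bsub>MC\<^esub> gamma v" "gamma (v * p) = gamma v \<otimes>\<^bsub>MC\<^esub> G p"
    using t assms(1) gamma_ev[OF iota_T1[OF assms(1) t(1)]] gamma_ev[OF T1_iota[OF assms(1) t(1)]]
      algebra_map_mult[OF Phi_map iota_closed[OF assms(1)] T1_closed[OF t(1)]]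
      algebra_map_mult[OF Phi_map T1_closed[OF t(1)] iota_closed[OF assms(1)]]
    by (simp_all add: gamma_ev Phi_iota del: matrix_algebra_simps)
qed

lemma gamma_j: "y \<in> Y \<Longrightarrow> gamma (j y) = yK y"
  using gamma_ev[OF T1_gen] by (simp add: ev_gen Phi_gen)

lemma gamma_zero: "gamma 0 = \<zero>\<^bsub>MC\<^esub>"
  using gamma_ev[OF T1_zero] algebra_map_zero[OF Phi_map T.ring_axioms MC.ring_axioms]
  by (simp add: ev_zero del: matrix_algebra_simps)

lemma gamma_smult: "v \<in> J \<Longrightarrow> gamma (Poly_Mapping.single 0 c * v) = c \<odot>\<^bsub>MC\<^esub> gamma v"
proof -
  assume v: "v \<in> J"
  have "G (Poly_Mapping.single 0 c) = c \<odot>\<^bsub>MC\<^esub> \<one>\<^bsub>MC\<^esub>"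
    using algebra_map_smult[OF G_map, of 1 c] algebra_map_one[OF G_map] F_closed(6)
    by (simp del: matrix_algebra_simps)
  moreover have "(c \<odot>\<^bsub>MC\<^esub> \<one>\<^bsub>MC\<^esub>) \<otimes>\<^bsub>MC\<^esub> gamma v = c \<odot>\<^bsub>MC\<^esub> gamma v"
    using MC.smult_mult_l[OF MC.one_closed gamma_carrier[OF v], of c] gamma_carrier[OF v]
    by (simp del: matrix_algebra_simps)
  ultimately show ?thesis using gamma_mult(1)[OF _ v, of "Poly_Mapping.single 0 c"]
    by (simp del: matrix_algebra_simps)
qed

lemma gamma_mult_gamma: "u \<in> J \<Longrightarrow> v \<in> J \<Longrightarrow> gamma u \<otimes>\<^bsub>MC\<^esub> gamma v = \<zero>\<^bsub>MC\<^esub>"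
  using Cd.matrix_comp_mult[OF gamma_1 gamma_1, of u v] by (intro MD_2) (simp add: numeral_2_eq_2)

lemma D_dec:
  assumes "f \<in> carrier F" "v \<in> J"
  shows "D.dec (encD (f, v)) = (f, v)"
  using D.dec_enc[OF assms] by auto

definition Psi :: "'u \<Rightarrow> nat \<times> nat \<Rightarrow> 'u" where
  "Psi = (\<lambda>x\<in>carrier D.dga. G (fst (D.dec x)) \<oplus>\<^bsub>MC\<^esub> gamma (snd (D.dec x)))"

lemma Psi_enc:
  assumes "f \<in> carrier F" "v \<in> J"
  shows "Psi (encD (f, v)) = G f \<oplus>\<^bsub>MC\<^esub> gamma v"
  using assms D.enc_closed[OF assms] by (simp add: Psi_def D_dec del: matrix_algebra_simps)

lemma Psi_hom: "Psi \<in> dga_hom D.dga (matrix_dga n C.dga)"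
proof -
  note Gc = algebra_map_closed[OF G_map] and gc = gamma_carrier
  note [simp del] = matrix_algebra_simps
  have "algebra_map D.dga MC Psi"
  proof (rule algebra_mapI)
    fix x assume "x \<in> carrier D.dga"
    then have "x \<in> carrier D.alg" by simp
    then obtain f u where x: "x = encD (f, u)" "f \<in> carrier F" "u \<in> J" by (rule D.carrier_algE)
    show "Psi x \<in> carrier MC" using x Gc gc by (simp add: Psi_enc)
    show "Psi (c \<odot>\<^bsub>D.dga\<^esub> x) = c \<odot>\<^bsub>MC\<^esub> Psi x" for c
      using x Gc gc J_mult(1)[of u "Poly_Mapping.single 0 c"] algebra_map_smult[OF G_map x(2), of c]
      by (simp add: D.smult_enc Psi_enc gamma_smult MC.smult_r_distr F_closed)
    fix y assume "y \<in> carrier D.dga"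
    then have "y \<in> carrier D.alg" by simp
    then obtain g v where y: "y = encD (g, v)" "g \<in> carrier F" "v \<in> J" by (rule D.carrier_algE)
    show "Psi (x \<oplus>\<^bsub>D.dga\<^esub> y) = Psi x \<oplus>\<^bsub>MC\<^esub> Psi y"
      using x y Gc gc algebra_map_add[OF G_map x(2) y(2)]
      by (simp add: D.add_enc Psi_enc gamma_add F_closed J_add MC.a_ac)
    have fv: "f * v \<in> J" "u * g \<in> J" using x y J_mult by auto
    have "Psi (x \<otimes>\<^bsub>D.dga\<^esub> y) = G f \<otimes>\<^bsub>MC\<^esub> G g \<oplus>\<^bsub>MC\<^esub> (G f \<otimes>\<^bsub>MC\<^esub> gamma v \<oplus>\<^bsub>MC\<^esub> gamma u \<otimes>\<^bsub>MC\<^esub> G g)"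
      using x y fv algebra_map_mult[OF G_map x(2) y(2)] J_add[OF fv]
      by (simp add: D.mult_enc Psi_enc gamma_add gamma_mult F_closed)
    \<comment> \<open>The cross term gamma u gamma v of the expanded product vanishes for degree
      reasons, and the product of \<open>D\<close> has no such term.\<close>
    also have "\<dots> = (G f \<oplus>\<^bsub>MC\<^esub> gamma u) \<otimes>\<^bsub>MC\<^esub> (G g \<oplus>\<^bsub>MC\<^esub> gamma v)"
      using Gc[OF x(2)] Gc[OF y(2)] gc[OF x(3)] gc[OF y(3)]
      by (simp add: MC.l_distr MC.r_distr gamma_mult_gamma[OF x(3) y(3)] MC.a_ac)
    finally show "Psi (x \<otimes>\<^bsub>D.dga\<^esub> y) = Psi x \<otimes>\<^bsub>MC\<^esub> Psi y" using x y by (simp add: Psi_enc)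
  next
    show "Psi \<one>\<^bsub>D.dga\<^esub> = \<one>\<^bsub>MC\<^esub>"
      using algebra_map_one[OF G_map] F_closed(6) by (simp add: D.one_alg Psi_enc J_zero gamma_zero)
  qed
  moreover have "Psi x \<in> MD i" if "x \<in> comp D.dga i" for x i
    using that
  proof (cases rule: D.dga_degree_cases)
    case (1 p)
    then show ?thesis using G_0[of p] Gc[of p] by (simp add: Psi_enc J_zero gamma_zero)
  next
    case (2 u)
    then show ?thesis using gamma_1[of u] gc[of u] algebra_map_zero[OF G_map F.ring_axioms MC.ring_axioms]
      by (simp add: Psi_enc F_closed)
  next
    case 3
    then show ?thesis using MD_zero algebra_map_zero[OF G_map F.ring_axioms MC.ring_axioms]
      by (simp add: Psi_enc F_closed J_zero gamma_zero)
  qed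
  moreover have "Psi (diff D.dga x) = dM (Psi x)" if "x \<in> carrier D.dga" for x
  proof -
    have "x \<in> carrier D.alg" using that by simp
    then obtain f u where x: "x = encD (f, u)" "f \<in> carrier F" "u \<in> J" by (rule D.carrier_algE)
    have "dM (G f \<oplus>\<^bsub>MC\<^esub> gamma u) = G u"
      using Cd.matrix_diff_add[OF Gc[OF x(2)] gc[OF x(3)]] dM_0[OF G_0[OF x(2)]] dM_gamma[OF x(3)]
        Gc[OF J_sub[OF x(3)]] by simp
    then show ?thesis using x Gc[OF J_sub[OF x(3)]]
      by (simp add: D.diff_enc Psi_enc J_sub J_zero gamma_zero)
  qed
  ultimately show ?thesis
    unfolding dga_hom_iff algebra_map_matrix_dga by (simp add: Psi_def)
qed

end

section \<open>Homology of DG algebras\<close>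

lemma carrier_homology: "carrier (homology D p) = (\<lambda>x. boundaries D p +>\<^bsub>D\<^esub> x) ` cycles D p"
  by (auto simp: homology_def FactGroup_def RCOSETS_def r_coset_def a_r_coset_def')

lemma concentrated_simps [simp]:
  "carrier (concentrated A) = carrier A" "mult (concentrated A) = mult A" "one (concentrated A) = one A"
  "ring.zero (concentrated A) = ring.zero A" "add (concentrated A) = add A" "smult (concentrated A) = smult A"
  "comp (concentrated A) i = (if i = 0 then carrier A else {\<zero>\<^bsub>A\<^esub>})" "diff (concentrated A) x = \<zero>\<^bsub>A\<^esub>"
  by (simp_all add: concentrated_def module.defs dga.defs)

lemma algebra_map_to_concentrated: "algebra_map B (concentrated A) f \<longleftrightarrow> algebra_map B A f"
  by (simp add: algebra_map_def ring_hom_def)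

lemma algebra_map_from_concentrated: "algebra_map (concentrated A) B f \<longleftrightarrow> algebra_map A B f"
  by (simp add: algebra_map_def ring_hom_def)

context dg_algebra
begin

lemma zero_boundary: "\<zero> \<in> boundaries D p"
  unfolding boundaries_def using diff_zero comp_zero by force

lemma zero_cycle: "\<zero> \<in> cycles D p"
  by (simp add: cycles_def comp_zero diff_zero)

lemma boundaries_cycles: "boundaries D p \<subseteq> cycles D p"
  unfolding boundaries_def cycles_def using diff_comp diff_diff comp_carrierD by blast

lemma mem_coset: "x \<in> carrier D \<Longrightarrow> x \<in> boundaries D p +>\<^bsub>D\<^esub> x"
  using zero_boundary by (force simp: a_r_coset_def')

lemma comp_0_cycle: "x \<in> comp D 0 \<Longrightarrow> x \<in> cycles D 0"
  by (simp add: cycles_def diff_comp_0)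

lemma trivial_homology:
  assumes "trivial_group (homology D p)" "z \<in> comp D p" "diff D z = \<zero>"
  shows "\<exists>b\<in>comp D (Suc p). diff D b = z"
proof -
  have "carrier (homology D p) = {boundaries D p}"
    using assms(1) by (simp add: trivial_group_def homology_def)
  moreover have "boundaries D p +>\<^bsub>D\<^esub> z \<in> carrier (homology D p)"
    using assms(2,3) by (simp add: carrier_homology cycles_def)
  ultimately have "boundaries D p +>\<^bsub>D\<^esub> z = boundaries D p" by simp
  then have "z \<in> boundaries D p" using mem_coset[of z p] comp_carrierD[OF assms(2)] by simp
  then show ?thesis by (auto simp: boundaries_def)
qed

lemma boundaries_concentrated: "boundaries (concentrated B) p = {\<zero>\<^bsub>B\<^esub>}"
  by (simp add: boundaries_def)

text \<open>Every element of degree 0 is a cycle, and an algebra concentrated in degree 0 is its own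
  homology.\<close>

lemma resolution_surj:
  assumes q: "quasi_iso D (concentrated B) q" and B: "k_algebra B" and a: "a \<in> carrier B"
  shows "\<exists>r\<in>comp D 0. q r = a"
proof -
  interpret B: k_algebra B by fact
  have hom: "\<And>i x. x \<in> comp D i \<Longrightarrow> q x \<in> comp (concentrated B) i"
    and bij: "bij_betw (homology_map (concentrated B) q 0) (carrier (homology D 0)) (carrier (homology (concentrated B) 0))"
    using q unfolding quasi_iso_def dga_hom_iff by blast+
  have one: "{\<zero>\<^bsub>B\<^esub>} +>\<^bsub>concentrated B\<^esub> b = {b}" if "b \<in> carrier B" for b
    using that by (simp add: a_r_coset_def')
  have "a \<in> cycles (concentrated B) 0" using a by (simp add: cycles_def)
  then have "{a} \<in> carrier (homology (concentrated B) 0)"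
    using one[OF a] by (force simp: carrier_homology boundaries_concentrated)
  then obtain V where V: "V \<in> carrier (homology D 0)" "homology_map (concentrated B) q 0 V = {a}"
    using bij_betw_imp_surj_on[OF bij] by (metis imageE)
  then obtain x where x: "V = boundaries D 0 +>\<^bsub>D\<^esub> x" "x \<in> cycles D 0" by (auto simp: carrier_homology)
  then have x0: "x \<in> comp D 0" by (simp add: cycles_def)
  then have "q x \<in> carrier B" using hom[OF x0] by simp
  then have "q x \<in> homology_map (concentrated B) q 0 V"
    unfolding homology_map_def x(1) boundaries_concentrated
    using mem_coset[OF comp_carrierD[OF x0], of 0] one[of "q x"] by blast
  then show ?thesis using V(2) x0 by auto
qed

text \<open>By injectivity on homology in degree 0, an element of degree 0 that \<open>q\<close>
  kills has the class of zero.\<close>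

lemma resolution_kernel:
  assumes q: "quasi_iso D (concentrated B) q" and B: "k_algebra B"
    and r: "r \<in> comp D 0" "q r = \<zero>\<^bsub>B\<^esub>"
  shows "\<exists>s\<in>comp D 1. diff D s = r"
proof -
  interpret B: k_algebra B by fact
  have q_hom: "q \<in> dga_hom D (concentrated B)"
    and bij: "bij_betw (homology_map (concentrated B) q 0) (carrier (homology D 0)) (carrier (homology (concentrated B) 0))"
    using q unfolding quasi_iso_def by blast+
  then have "algebra_map D (concentrated B) q" and qd: "\<And>x. x \<in> carrier D \<Longrightarrow> q (diff D x) = \<zero>\<^bsub>B\<^esub>"
    unfolding dga_hom_iff by auto
  then have map: "algebra_map D B q" by (simp only: algebra_map_to_concentrated)
  have z: "homology_map (concentrated B) q 0 (boundaries D 0 +>\<^bsub>D\<^esub> x) = {\<zero>\<^bsub>B\<^esub>}"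
    if x: "x \<in> comp D 0" "q x = \<zero>\<^bsub>B\<^esub>" for x
  proof -
    have "q y = \<zero>\<^bsub>B\<^esub>" if "y \<in> boundaries D 0 +>\<^bsub>D\<^esub> x" for y
    proof -
      from that obtain s where s: "s \<in> comp D (Suc 0)" "y = diff D s \<oplus> x"
        by (auto simp: a_r_coset_def' boundaries_def)
      then show ?thesis
        using algebra_map_add[OF map diff_closed[OF comp_carrierD[OF s(1)]] comp_carrierD[OF x(1)]]
          qd[OF comp_carrierD[OF s(1)]] x(2) by simp
    qed
    then show ?thesis
      unfolding homology_map_def boundaries_concentrated
      using mem_coset[OF comp_carrierD[OF x(1)], of 0] by (auto simp: a_r_coset_def')
  qed
  have "q \<zero> = \<zero>\<^bsub>B\<^esub>" using algebra_map_zero[OF map ring_axioms B.ring_axioms] .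
  then have "homology_map (concentrated B) q 0 (boundaries D 0 +>\<^bsub>D\<^esub> r)
      = homology_map (concentrated B) q 0 (boundaries D 0 +>\<^bsub>D\<^esub> \<zero>)"
    using z[OF r] z[OF comp_zero] by simp
  moreover have "boundaries D 0 +>\<^bsub>D\<^esub> r \<in> carrier (homology D 0)" "boundaries D 0 +>\<^bsub>D\<^esub> \<zero> \<in> carrier (homology D 0)"
    using comp_0_cycle[OF r(1)] zero_cycle by (auto simp: carrier_homology)
  ultimately have "boundaries D 0 +>\<^bsub>D\<^esub> r = boundaries D 0 +>\<^bsub>D\<^esub> \<zero>"
    using bij_betw_imp_inj_on[OF bij] by (meson inj_onD)
  then have "r \<in> boundaries D 0 +>\<^bsub>D\<^esub> \<zero>" using mem_coset[OF comp_carrierD[OF r(1)], of 0] by simp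
  then obtain s where "s \<in> comp D (Suc 0)" "r = diff D s \<oplus> \<zero>" by (auto simp: a_r_coset_def' boundaries_def)
  then show ?thesis using diff_closed[OF comp_carrierD] by auto
qed

lemma free_eval_comp_0:
  assumes s: "s \<in> X \<rightarrow> comp D 0" and p: "p \<in> carrier (free_algebra X)"
  shows "free_eval D s p \<in> comp D 0"
proof -
  have "foldr (\<lambda>x p. s x \<otimes> p) xs \<one> \<in> comp D 0" if "set xs \<subseteq> X" for xs
    using that
  proof (induction xs)
    case (Cons x xs)
    then have "s x \<in> comp D 0" using s by auto
    then show ?case using Cons comp_mult[of "s x" 0 _ 0] by simp
  qed (simp add: comp_one)
  then show ?thesis
    unfolding free_eval_def linear_extension_def word_prod_def
    using p by (intro comp_finsum comp_smult) (auto simp: carrier_free_algebra words_over_def)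
qed

end

text \<open>Serves the positive degrees, where neither J -> F nor A has nonzero cycles.\<close>

lemma singleton_homology:
  assumes D: "dg_algebra D" and E: "dg_algebra E" and f: "f \<zero>\<^bsub>D\<^esub> = \<zero>\<^bsub>E\<^esub>"
    and cD: "cycles D p = {\<zero>\<^bsub>D\<^esub>}" and cE: "cycles E p = {\<zero>\<^bsub>E\<^esub>}"
  shows "bij_betw (homology_map E f p) (carrier (homology D p)) (carrier (homology E p))"
proof -
  interpret D: dg_algebra D by fact
  interpret E: dg_algebra E by fact
  have b: "boundaries D p = {\<zero>\<^bsub>D\<^esub>}" "boundaries E p = {\<zero>\<^bsub>E\<^esub>}"
    using D.boundaries_cycles[of p] D.zero_boundary[of p] E.boundaries_cycles[of p] E.zero_boundary[of p] cD cE by auto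
  have "carrier (homology D p) = {{\<zero>\<^bsub>D\<^esub>}}" "carrier (homology E p) = {{\<zero>\<^bsub>E\<^esub>}}"
    by (simp_all add: carrier_homology cD cE b a_r_coset_def')
  moreover have "homology_map E f p {\<zero>\<^bsub>D\<^esub>} = {\<zero>\<^bsub>E\<^esub>}"
    by (simp add: homology_map_def b f a_r_coset_def')
  ultimately show ?thesis by (simp add: bij_betw_def)
qed

text \<open>\<open>poly_eval\<close> needs a commutative target, while a graded commutative algebra
  commutes only up to sign; the coordinates are sent to its part of degree 0, where the sign is
  trivial.\<close>

lemma comm_k_algebra_comp_0:
  assumes "comm_dg_algebra S"
  shows "comm_k_algebra (S\<lparr>carrier := comp S 0\<rparr>)" "algebra_map (S\<lparr>carrier := comp S 0\<rparr>) S (\<lambda>x. x)"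
proof -
  interpret S: comm_dg_algebra S by fact
  let ?S = "S\<lparr>carrier := comp S 0\<rparr>"
  have neg: "\<ominus>\<^bsub>S\<^esub> x \<in> comp S 0" if "x \<in> comp S 0" for x
    using S.comp_smult[OF that, of "-1"] S.smult_minus_one[OF S.comp_carrierD[OF that]] by simp
  note c = S.comp_carrierD
  have "abelian_group ?S"
  proof (rule abelian_groupI)
    fix x assume "x \<in> carrier ?S"
    then show "\<exists>y\<in>carrier ?S. y \<oplus>\<^bsub>?S\<^esub> x = \<zero>\<^bsub>?S\<^esub>"
      using neg c by (intro bexI[of _ "\<ominus>\<^bsub>S\<^esub> x"]) (auto simp: S.l_neg)
  qed (auto simp: S.comp_add S.comp_zero c S.a_ac)
  moreover have "monoid ?S"
    using S.comp_mult[of _ 0 _ 0] by (intro monoidI) (auto simp: S.comp_one c S.m_assoc)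
  ultimately have "ring ?S"
    by (rule ringI) (auto simp: c S.l_distr S.r_distr)
  then have "k_algebra ?S"
    by (rule k_algebra.intro, unfold_locales)
      (auto simp: c S.comp_smult S.smult_l_distr S.smult_r_distr S.smult_assoc S.smult_one S.smult_mult_l S.smult_mult_r)
  moreover have "x \<otimes>\<^bsub>S\<^esub> y = y \<otimes>\<^bsub>S\<^esub> x" if "x \<in> comp S 0" "y \<in> comp S 0" for x y
    using S.graded_comm[OF that] S.smult_one[of "y \<otimes>\<^bsub>S\<^esub> x"] c that by simp
  ultimately show "comm_k_algebra ?S"
    by (intro comm_k_algebra.intro comm_k_algebra_axioms.intro) auto
  show "algebra_map ?S S (\<lambda>x. x)" by (rule algebra_mapI) (auto simp: c)
qed

lemma (in two_term) finsum_enc: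
  assumes "finite K" "\<And>i. i \<in> K \<Longrightarrow> p i \<in> Fs" "\<And>i. i \<in> K \<Longrightarrow> u i \<in> M"
  shows "finsum alg (\<lambda>i. enc (p i, u i)) K = enc (sum p K, sum u K)"
proof -
  interpret A: k_algebra alg by (rule k_algebra_alg)
  have "finsum alg (\<lambda>i. enc (p i, u i)) K = enc (sum p K, sum u K) \<and> sum p K \<in> Fs \<and> sum u K \<in> M"
    using assms
  proof (induction K rule: finite_induct)
    case empty
    then show ?case by (simp add: zero_alg closed)
  next
    case (insert k K)
    then have "(\<lambda>i. enc (p i, u i)) \<in> K \<rightarrow> carrier alg" "enc (p k, u k) \<in> carrier alg"
      using enc_closed by auto
    then show ?case using insert by (simp add: add_enc closed)
  qed
  then show ?thesis by simp
qed

lemma (in two_term) finsum_dga: "finsum dga = finsum alg"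
  by (simp add: finsum_def finprod_def fun_eq_iff)

section \<open>Lifting to the resolution by the relation ideal\<close>

context koszul_coding
begin

lemma lift_resolution:
  fixes encA :: "('x word \<Rightarrow>\<^sub>0 'k) \<times> ('x word \<Rightarrow>\<^sub>0 'k) \<Rightarrow> 'u" and R :: "('k, 'u) dga"
  assumes encA: "\<And>p q u v. p \<in> carrier F \<Longrightarrow> q \<in> carrier F \<Longrightarrow> u \<in> {0} \<Longrightarrow> v \<in> {0} \<Longrightarrow>
      encA (p, u) = encA (q, v) \<longleftrightarrow> p - q \<in> J \<and> u - v \<in> {0}"
    and R: "cofibrant_resolution A R q"
  shows "\<exists>h\<in>dga_hom R D.dga. \<forall>r\<in>carrier R. \<forall>f\<in>carrier F. \<forall>v\<in>J. h r = encD (f, v) \<longrightarrow> q r = J +>\<^bsub>F\<^esub> f"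
proof -
  interpret B: two_term "words_over X" "{0}" "(*)" "(*)" "\<lambda>u. u" J "{0}" 0 encA "carrier F"
  proof (rule two_term_ideals)
    show "ideal {0} (monoid_algebra (words_over X) :: ('k, 'x word \<Rightarrow>\<^sub>0 'k) module)"
      using F.zeroideal by (simp add: free_algebra_eq)
    show "ideal J (monoid_algebra (words_over X))"
      using relation_ideal_ideal unfolding free_algebra_eq relation_ideal_def .
  qed (use encA in \<open>auto simp: additive_submonoid_words free_algebra_eq\<close>)
  interpret Bd: dg_algebra B.dga by (rule B.dg_algebra_dga) simp
  have cof: "cofibrant R" and qi: "quasi_iso R (concentrated A) q"
    using R by (simp_all add: cofibrant_resolution_def)
  interpret R: dg_algebra R using cof by (simp add: cofibrant_def)
  have B_zero: "x = encA (0, 0)" if "x \<in> comp B.dga i" "i > 0" for x i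
    using that by (cases rule: B.dga_degree_cases) auto
  define p where "p = (\<lambda>x\<in>carrier D.dga. encA (fst (D.dec x), 0))"
  have p_enc: "p (encD (f, v)) = encA (f, 0)" if "f \<in> carrier F" "v \<in> J" for f v
    using that D.enc_closed[OF that] by (simp add: p_def D_dec)
  have p_hom: "p \<in> dga_hom D.dga B.dga"
    unfolding dga_hom_iff
  proof (intro conjI allI ballI)
    show "algebra_map D.dga B.dga p"
    proof (rule algebra_mapI)
      fix x assume "x \<in> carrier D.dga"
      then have "x \<in> carrier D.alg" by simp
      then obtain f u where x: "x = encD (f, u)" "f \<in> carrier F" "u \<in> J" by (rule D.carrier_algE)
      show "p x \<in> carrier B.dga" using x by (simp add: p_enc B.enc_closed)
      show "p (c \<odot>\<^bsub>D.dga\<^esub> x) = c \<odot>\<^bsub>B.dga\<^esub> p x" for c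
        using x J_mult(1)[of u "Poly_Mapping.single 0 c"]
        by (simp add: D.smult_enc p_enc B.smult_enc F_closed)
      fix y assume "y \<in> carrier D.dga"
      then have "y \<in> carrier D.alg" by simp
      then obtain g v where y: "y = encD (g, v)" "g \<in> carrier F" "v \<in> J" by (rule D.carrier_algE)
      show "p (x \<oplus>\<^bsub>D.dga\<^esub> y) = p x \<oplus>\<^bsub>B.dga\<^esub> p y"
        using x y by (simp add: D.add_enc p_enc B.add_enc F_closed J_add)
      show "p (x \<otimes>\<^bsub>D.dga\<^esub> y) = p x \<otimes>\<^bsub>B.dga\<^esub> p y"
        using x y J_add[OF J_mult(1)[OF y(3) x(2)] J_mult(2)[OF x(3) y(2)]]
        by (simp add: D.mult_enc p_enc B.mult_enc F_closed)
    next
      show "p \<one>\<^bsub>D.dga\<^esub> = \<one>\<^bsub>B.dga\<^esub>" using p_enc[OF F_closed(6) J_zero] by (simp add: D.one_alg B.one_alg)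
    qed
    show "p \<in> extensional (carrier D.dga)" by (simp add: p_def)
    show "p x \<in> comp B.dga i" if "x \<in> comp D.dga i" for x i
      using that
    proof (cases rule: D.dga_degree_cases)
      case (1 f)
      then show ?thesis by (simp add: p_enc J_zero B.enc_comp_0)
    next
      case (2 u)
      then show ?thesis using B.zero_comp[of 1] by (simp add: p_enc F_closed)
    next
      case 3
      then show ?thesis using B.zero_comp[of i] by (simp add: p_enc F_closed J_zero)
    qed
    show "p (diff D.dga x) = diff B.dga (p x)" if "x \<in> carrier D.dga" for x
    proof -
      have "x \<in> carrier D.alg" using that by simp
      then obtain f u where x: "x = encD (f, u)" "f \<in> carrier F" "u \<in> J" by (rule D.carrier_algE)
      then show ?thesis
        using encA[of u 0 0 0] J_sub[OF x(3)] by (simp add: D.diff_enc p_enc B.diff_enc J_zero F_closed)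
    qed
  qed
  have fib: "fibration D.dga B.dga p"
    unfolding fibration_def
  proof (intro conjI allI impI p_hom)
    fix i :: nat assume i: "0 < i"
    have "comp B.dga i = {encA (0, 0)}"
    proof
      show "comp B.dga i \<subseteq> {encA (0, 0)}" using B_zero[OF _ i] by (intro subsetI) simp
      show "{encA (0, 0)} \<subseteq> comp B.dga i" using B.zero_comp[of i] by simp
    qed
    moreover have "p ` comp D.dga i \<subseteq> comp B.dga i" using p_hom unfolding dga_hom_iff by blast
    moreover have "comp D.dga i \<noteq> {}" using Dd.comp_zero by blast
    ultimately show "p ` comp D.dga i = comp B.dga i" by (metis image_is_empty subset_singletonD)
  qed
  have p0: "p \<zero>\<^bsub>D.dga\<^esub> = \<zero>\<^bsub>B.dga\<^esub>" using p_enc[OF F_closed(5) J_zero] by (simp add: D.zero_alg B.zero_alg)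
  have qiso: "quasi_iso D.dga B.dga p"
    unfolding quasi_iso_def
  proof (intro conjI allI p_hom)
    fix k :: nat
    show "bij_betw (homology_map B.dga p k) (carrier (homology D.dga k)) (carrier (homology B.dga k))"
    proof (cases "k = 0")
      case False
      have "x = \<zero>\<^bsub>D.dga\<^esub>" if "x \<in> cycles D.dga k" for x
      proof -
        have "x \<in> comp D.dga k" "diff D.dga x = encD (0, 0)" using that by (auto simp: cycles_def D.zero_alg)
        then show ?thesis
          using False by (cases rule: D.dga_degree_cases)
            (auto simp: D.diff_enc F_closed D.zero_alg encD J_zero J_sub)
      qed
      then have "cycles D.dga k = {\<zero>\<^bsub>D.dga\<^esub>}" using Dd.zero_cycle by blast
      moreover have "cycles B.dga k = {\<zero>\<^bsub>B.dga\<^esub>}"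
        using B_zero False Bd.zero_cycle by (auto simp: cycles_def B.zero_alg)
      ultimately show ?thesis by (intro singleton_homology Dd.dg_algebra_axioms Bd.dg_algebra_axioms p0)
    next
      case True
      have bD: "boundaries D.dga 0 = (\<lambda>v. encD (v, 0)) ` J"
        unfolding boundaries_def by (force simp: D.comp_dga D.diff_enc F_closed)
      have bB: "boundaries B.dga 0 = {encA (0, 0)}"
        unfolding boundaries_def by (force simp: B.comp_dga B.diff_enc F_closed)
      have cD: "cycles D.dga 0 = (\<lambda>f. encD (f, 0)) ` carrier F"
        unfolding cycles_def by (auto simp: D.comp_dga D.diff_enc J_zero D.zero_alg)
      have cB: "cycles B.dga 0 = (\<lambda>f. encA (f, 0)) ` carrier F"
        unfolding cycles_def by (auto simp: B.comp_dga B.diff_enc B.zero_alg)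
      have cosD: "boundaries D.dga 0 +>\<^bsub>D.dga\<^esub> encD (f, 0) = (\<lambda>v. encD (v + f, 0)) ` J" if "f \<in> carrier F" for f
        unfolding bD a_r_coset_def' using that J_sub J_zero by (force simp: D.add_enc)
      have cosB: "boundaries B.dga 0 +>\<^bsub>B.dga\<^esub> encA (f, 0) = {encA (f, 0)}" if "f \<in> carrier F" for f
        unfolding bB a_r_coset_def' using that by (simp add: B.add_enc F_closed)
      have hD: "carrier (homology D.dga 0) = (\<lambda>f. (\<lambda>v. encD (v + f, 0)) ` J) ` carrier F"
        unfolding carrier_homology cD image_image using cosD by (rule image_cong[OF refl])
      have hB: "carrier (homology B.dga 0) = (\<lambda>f. {encA (f, 0)}) ` carrier F"
        unfolding carrier_homology cB image_image using cosB by (rule image_cong[OF refl])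
      have hm: "homology_map B.dga p 0 ((\<lambda>v. encD (v + f, 0)) ` J) = {encA (f, 0)}" if f: "f \<in> carrier F" for f
      proof -
        have "boundaries B.dga 0 +>\<^bsub>B.dga\<^esub> p (encD (v + f, 0)) = {encA (f, 0)}" if "v \<in> J" for v
        proof -
          have "v + f \<in> carrier F" using F_closed(1)[OF J_sub[OF that] f] .
          moreover have "encA (v + f, 0) = encA (f, 0)" using encA[of "v + f" f 0 0] calculation f that by simp
          ultimately show ?thesis using cosB[OF f] by (simp add: p_enc J_zero)
        qed
        then show ?thesis unfolding homology_map_def using J_zero by auto
      qed
      have "bij_betw (homology_map B.dga p 0) (carrier (homology D.dga 0)) (carrier (homology B.dga 0))"
        unfolding bij_betw_def
      proof
        show "homology_map B.dga p 0 ` carrier (homology D.dga 0) = carrier (homology B.dga 0)"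
          unfolding hD hB image_image using hm by (rule image_cong[OF refl])
        show "inj_on (homology_map B.dga p 0) (carrier (homology D.dga 0))"
        proof (rule inj_onI)
          fix V V' assume V: "V \<in> carrier (homology D.dga 0)" and V': "V' \<in> carrier (homology D.dga 0)"
            and eq: "homology_map B.dga p 0 V = homology_map B.dga p 0 V'"
          from V obtain f where f: "V = (\<lambda>v. encD (v + f, 0)) ` J" "f \<in> carrier F" unfolding hD by blast
          from V' obtain g where g: "V' = (\<lambda>v. encD (v + g, 0)) ` J" "g \<in> carrier F" unfolding hD by blast
          have "encA (f, 0) = encA (g, 0)" using eq hm f g by simp
          then have "f - g \<in> J" using encA f(2) g(2) by simp
          then have "(\<lambda>k. k + f) ` J = (\<lambda>k. k + g) ` J"
            using coset_eq_iff[OF relation_ideal_ideal f(2) g(2)] by (simp add: coset_eq)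
          then have "(\<lambda>x. encD (x, 0)) ` (\<lambda>k. k + f) ` J = (\<lambda>x. encD (x, 0)) ` (\<lambda>k. k + g) ` J" by simp
          then show "V = V'" unfolding f(1) g(1) image_image .
        qed
      qed
      then show ?thesis using True by simp
    qed
  qed
  define kap where "kap = (\<lambda>a\<in>carrier A. encA (SOME f. f \<in> a, 0))"
  have kap: "kap (J +>\<^bsub>F\<^esub> f) = encA (f, 0)" if "f \<in> carrier F" for f
    using coset_A[OF that] coset_rep[OF that] that encA by (simp add: kap_def)
  have kap_hom: "kap \<in> dga_hom (concentrated A) B.dga"
    unfolding dga_hom_iff algebra_map_from_concentrated
  proof (intro conjI allI ballI)
    show "algebra_map A B.dga kap"
    proof (rule algebra_mapI)
      fix x assume "x \<in> carrier A"
      then obtain f where f: "x = J +>\<^bsub>F\<^esub> f" "f \<in> carrier F" by (auto simp: carrier_A)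
      show "kap x \<in> carrier B.dga" using f by (simp add: kap B.enc_closed)
      show "kap (c \<odot>\<^bsub>A\<^esub> x) = c \<odot>\<^bsub>B.dga\<^esub> kap x" for c
        using f by (simp add: A_ops kap F_closed B.smult_enc)
      fix y assume "y \<in> carrier A"
      then obtain g where g: "y = J +>\<^bsub>F\<^esub> g" "g \<in> carrier F" by (auto simp: carrier_A)
      show "kap (x \<oplus>\<^bsub>A\<^esub> y) = kap x \<oplus>\<^bsub>B.dga\<^esub> kap y" "kap (x \<otimes>\<^bsub>A\<^esub> y) = kap x \<otimes>\<^bsub>B.dga\<^esub> kap y"
        using f g by (simp_all add: A_ops kap F_closed B.add_enc B.mult_enc)
    next
      show "kap \<one>\<^bsub>A\<^esub> = \<one>\<^bsub>B.dga\<^esub>" using kap[OF F_closed(6)] by (simp add: A_fields B.one_alg)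
    qed
    show "kap \<in> extensional (carrier (concentrated A))" by (simp add: kap_def)
    have kap0: "kap \<zero>\<^bsub>A\<^esub> = encA (0, 0)"
      using kap[OF F_closed(5)] F.a_rcos_zero[OF relation_ideal_ideal J_zero] by (simp add: A_fields)
    show "kap x \<in> comp B.dga i" if "x \<in> comp (concentrated A) i" for x i
      using that kap0 B.zero_comp[of i] by (auto simp: carrier_A kap intro: B.enc_comp_0 split: if_splits)
    show "kap (diff (concentrated A) x) = diff B.dga (kap x)" if "x \<in> carrier (concentrated A)" for x
      using that kap0 by (auto simp: carrier_A kap B.diff_enc)
  qed
  have q_hom: "q \<in> dga_hom R (concentrated A)" using qi by (simp add: quasi_iso_def)
  have "(\<lambda>x\<in>carrier R. kap (q x)) \<in> dga_hom R B.dga"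
    by (rule dga_hom_comp[OF q_hom kap_hom R.dg_algebra_axioms])
  then obtain h where h: "h \<in> dga_hom R D.dga" "\<forall>x\<in>carrier R. p (h x) = (\<lambda>x\<in>carrier R. kap (q x)) x"
    using cof fib qiso Dd.dg_algebra_axioms Bd.dg_algebra_axioms unfolding cofibrant_def by blast
  have "q r = J +>\<^bsub>F\<^esub> f" if "r \<in> carrier R" "f \<in> carrier F" "v \<in> J" "h r = encD (f, v)" for r f v
  proof -
    have "q r \<in> carrier A" using q_hom that(1) by (auto simp: dga_hom_iff algebra_map_to_concentrated algebra_map_closed)
    then obtain g where g: "q r = J +>\<^bsub>F\<^esub> g" "g \<in> carrier F" by (auto simp: carrier_A)
    have "encA (f, 0) = kap (q r)" using h(2) that p_enc[OF that(2,3)] by auto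
    then have "encA (f, 0) = encA (g, 0)" using g by (simp add: kap)
    then have "f - g \<in> J" using encA that(2) g(2) by simp
    then show ?thesis using coset_eq_iff[OF relation_ideal_ideal that(2) g(2)] g(1) by simp
  qed
  then show ?thesis using h(1) by blast
qed

end

section \<open>The path object\<close>

context koszul_coding
begin

text \<open>A representative in the free module of an entry of degree 1. It is determined only
  modulo \<open>Kos\<close>, so its sum and product rules are stated after coding by
  \<open>encK\<close>.\<close>

definition gamma_coeff :: "('x word \<Rightarrow>\<^sub>0 'k) \<Rightarrow> nat \<times> nat \<Rightarrow> 'y \<times> nat \<times> nat \<Rightarrow>\<^sub>0 (('x \<times> nat \<times> nat) \<Rightarrow>\<^sub>0 nat) \<Rightarrow>\<^sub>0 'k" where
  "gamma_coeff v e = (SOME u. u \<in> K1 n \<and> gamma v e = encK (0, u))"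

lemma gamma_coeff_closed: "v \<in> J \<Longrightarrow> e \<in> matrix_indices n \<Longrightarrow> gamma_coeff v e \<in> K1 n"
  and gamma_enc: "v \<in> J \<Longrightarrow> e \<in> matrix_indices n \<Longrightarrow> gamma v e = encK (0, gamma_coeff v e)"
proof -
  assume "v \<in> J" "e \<in> matrix_indices n"
  then have "gamma v e \<in> comp C.dga (Suc 0)" using gamma_1 by (auto simp: PiE_iff)
  then have "\<exists>u. u \<in> K1 n \<and> gamma v e = encK (0, u)" unfolding C.comp_dga by blast
  from someI_ex[OF this] show "gamma_coeff v e \<in> K1 n" "gamma v e = encK (0, gamma_coeff v e)" unfolding gamma_coeff_def by blast+
qed

lemma encK_eq: "p \<in> carrier Q \<Longrightarrow> u \<in> K1 n \<Longrightarrow> v \<in> K1 n \<Longrightarrow> encK (p, u) = encK (p, v) \<longleftrightarrow> u - v \<in> Kos n"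
  using encK by simp

lemma encK_fst: "encK (p, u) = encK (q, v) \<Longrightarrow> p \<in> carrier Q \<Longrightarrow> q \<in> carrier Q \<Longrightarrow> u \<in> K1 n \<Longrightarrow> v \<in> K1 n \<Longrightarrow> p = q"
  using encK by simp

lemma sum_K1: "(\<And>i. i \<in> S \<Longrightarrow> f i \<in> K1 n) \<Longrightarrow> sum f S \<in> K1 n"
  by (rule sum_mem_closed) (auto simp: K1_closed)

lemma sum_Kos: "(\<And>i. i \<in> S \<Longrightarrow> f i \<in> Kos n) \<Longrightarrow> sum f S \<in> Kos n"
  by (rule sum_mem_closed) (auto simp: Kos_closed)

lemma dK_gamma_coeff:
  assumes v: "v \<in> J" and e: "e \<in> matrix_indices n"
  shows "dK n (gamma_coeff v e) = generic_rep n v e"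
proof -
  have "dM (gamma v) e = G v e" using dM_gamma[OF v] by simp
  then have "encK (dK n (gamma_coeff v e), 0) = encK (generic_rep n v e, 0)"
    using e gamma_coeff_closed[OF v e] by (simp add: map_matrix_def G_def gamma_enc[OF v e] C.diff_enc C.closed)
  then show ?thesis
    by (rule encK_fst) (auto intro: dK_closed gamma_coeff_closed v e generic_rep_entry J_sub K1_closed)
qed

lemma gamma_coeff_add:
  assumes "u \<in> J" "v \<in> J" "e \<in> matrix_indices n"
  shows "gamma (u + v) e = encK (0, gamma_coeff u e + gamma_coeff v e)"
  using assms gamma_coeff_closed by (simp add: gamma_add gamma_enc C.add_enc P_closed)

lemma gamma_coeff_sum_mult:
  assumes "p \<in> carrier F" "v \<in> J" "i < n" "l < n"
  shows "gamma (p * v) (i, l) = encK (0, \<Sum>k<n. scaleK (generic_rep n p (i, k)) (gamma_coeff v (k, l)))"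
    "gamma (v * p) (i, l) = encK (0, \<Sum>k<n. scaleK (generic_rep n p (k, l)) (gamma_coeff v (i, k)))"
proof -
  have pe: "generic_rep n p (a, b) \<in> carrier Q" if "a < n" "b < n" for a b
    using generic_rep_entry[of p "(a, b)" n] assms that by simp
  have ge: "gamma_coeff v (a, b) \<in> K1 n" "gamma v (a, b) = encK (0, gamma_coeff v (a, b))" if "a < n" "b < n" for a b
    using gamma_coeff_closed[of v "(a, b)"] gamma_enc[of v "(a, b)"] assms that by simp_all
  have Ge: "G p (a, b) = encK (generic_rep n p (a, b), 0)" if "a < n" "b < n" for a b
    using that by (simp add: G_def)
  have "gamma (p * v) (i, l) = finsum C.dga (\<lambda>k. G p (i, k) \<otimes>\<^bsub>C.dga\<^esub> gamma v (k, l)) {..<n}"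
    using assms by (simp add: gamma_mult)
  also have "\<dots> = finsum C.dga (\<lambda>k. encK (0, scaleK (generic_rep n p (i, k)) (gamma_coeff v (k, l)))) {..<n}"
    using assms pe ge by (intro Cd.finsum_cong')
      (auto simp: Ge C.mult_enc P_closed K1_closed scaleK_closed C.closed C.ract_zero C.lact_zero C.zero_lact intro!: C.enc_closed)
  also have "\<dots> = encK (sum (\<lambda>_. 0) {..<n}, \<Sum>k<n. scaleK (generic_rep n p (i, k)) (gamma_coeff v (k, l)))"
    unfolding C.finsum_dga using assms pe ge by (intro C.finsum_enc) (auto simp: P_closed scaleK_closed)
  finally show "gamma (p * v) (i, l) = encK (0, \<Sum>k<n. scaleK (generic_rep n p (i, k)) (gamma_coeff v (k, l)))" by simp
  have "gamma (v * p) (i, l) = finsum C.dga (\<lambda>k. gamma v (i, k) \<otimes>\<^bsub>C.dga\<^esub> G p (k, l)) {..<n}"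
    using assms by (simp add: gamma_mult)
  also have "\<dots> = finsum C.dga (\<lambda>k. encK (0, scaleK (generic_rep n p (k, l)) (gamma_coeff v (i, k)))) {..<n}"
    using assms pe ge by (intro Cd.finsum_cong')
      (auto simp: Ge C.mult_enc P_closed K1_closed scaleK_closed C.closed C.ract_zero C.lact_zero C.zero_lact C.d_zero C.zero_ract intro!: C.enc_closed)
  also have "\<dots> = encK (sum (\<lambda>_. 0) {..<n}, \<Sum>k<n. scaleK (generic_rep n p (k, l)) (gamma_coeff v (i, k)))"
    unfolding C.finsum_dga using assms pe ge by (intro C.finsum_enc) (auto simp: P_closed scaleK_closed)
  finally show "gamma (v * p) (i, l) = encK (0, \<Sum>k<n. scaleK (generic_rep n p (k, l)) (gamma_coeff v (i, k)))" by simp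
qed

lemma E_dec:
  assumes "p \<in> carrier Q" "u \<in> K1 n"
  shows "fst (E.dec (encK (p, u))) = p" "dK n (snd (E.dec (encK (p, u)))) = dK n u"
proof -
  obtain p' u' where *: "E.dec (encK (p, u)) = (p', u')" "p' \<in> carrier Q" "u' \<in> K1 n" "p' - p \<in> {0}" "u' - u \<in> Kos n"
    using E.dec_enc[OF assms] by metis
  then show "fst (E.dec (encK (p, u))) = p" by simp
  have "dK n u' - dK n u = 0" using dK_Kos[OF *(5)] C.d_diff[OF *(3) assms(2)] by simp
  then show "dK n (snd (E.dec (encK (p, u)))) = dK n u" using * by simp
qed

section \<open>The two end points of the path object\<close>

lemma source_map: "algebra_map E.alg Q (\<lambda>x. fst (E.dec x))"
proof (rule algebra_mapI)
  fix x assume "x \<in> carrier E.alg"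
  then obtain p u where x: "x = encK (p, u)" "p \<in> carrier Q" "u \<in> K1 n" by (rule E.carrier_algE)
  show "fst (E.dec x) \<in> carrier Q" using x by (simp add: E_dec)
  show "fst (E.dec (c \<odot>\<^bsub>E.alg\<^esub> x)) = c \<odot>\<^bsub>Q\<^esub> fst (E.dec x)" for c
    using x by (simp add: E.smult_enc E_dec C.closed)
  fix y assume "y \<in> carrier E.alg"
  then obtain q v where y: "y = encK (q, v)" "q \<in> carrier Q" "v \<in> K1 n" by (rule E.carrier_algE)
  show "fst (E.dec (x \<oplus>\<^bsub>E.alg\<^esub> y)) = fst (E.dec x) \<oplus>\<^bsub>Q\<^esub> fst (E.dec y)"
    using x y by (simp add: E.add_enc E_dec C.closed)
  show "fst (E.dec (x \<otimes>\<^bsub>E.alg\<^esub> y)) = fst (E.dec x) \<otimes>\<^bsub>Q\<^esub> fst (E.dec y)"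
    using x y by (simp add: E.mult_enc E_dec C.closed)
next
  show "fst (E.dec \<one>\<^bsub>E.alg\<^esub>) = \<one>\<^bsub>Q\<^esub>" by (simp add: E.one_alg E_dec C.closed)
qed

definition target :: "'u \<Rightarrow> 'u" where
  "target x = encK (fst (E.dec x) + dK n (snd (E.dec x)), 0)"

lemma target_enc: "p \<in> carrier Q \<Longrightarrow> u \<in> K1 n \<Longrightarrow> target (encK (p, u)) = encK (p + dK n u, 0)"
  by (simp add: target_def E_dec)

text \<open>With eps = 1 the product contains u d(v), and p q + d(p v + u q + u d(v)) = (p + d(u))
  (q + d(v)).\<close>

lemma target_map: "algebra_map E.alg C.dga target"
proof (rule algebra_mapI)
  fix x assume "x \<in> carrier E.alg"
  then obtain p u where x: "x = encK (p, u)" "p \<in> carrier Q" "u \<in> K1 n" by (rule E.carrier_algE)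
  show "target x \<in> carrier C.dga" using x by (simp add: target_enc C.enc_closed C.closed)
  show "target (c \<odot>\<^bsub>E.alg\<^esub> x) = c \<odot>\<^bsub>C.dga\<^esub> target x" for c
    using x by (simp add: E.smult_enc C.smult_enc target_enc C.closed dK_simps distrib_left C.lact_zero)
  fix y assume "y \<in> carrier E.alg"
  then obtain q v where y: "y = encK (q, v)" "q \<in> carrier Q" "v \<in> K1 n" by (rule E.carrier_algE)
  show "target (x \<oplus>\<^bsub>E.alg\<^esub> y) = target x \<oplus>\<^bsub>C.dga\<^esub> target y"
    using x y by (simp add: E.add_enc C.add_enc target_enc C.closed dK_simps add_ac)
  show "target (x \<otimes>\<^bsub>E.alg\<^esub> y) = target x \<otimes>\<^bsub>C.dga\<^esub> target y"
    using x y by (simp add: E.mult_enc C.mult_enc target_enc C.closed dK_simps C.lact_zero C.ract_zero C.d_zero single_one algebra_simps)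
next
  show "target \<one>\<^bsub>E.alg\<^esub> = \<one>\<^bsub>C.dga\<^esub>" by (simp add: E.one_alg C.one_alg target_enc C.closed C.d_zero)
qed

section \<open>The homotopy attached to an endomorphism of F over A\<close>

context
  fixes th :: "'x \<Rightarrow> 'x word \<Rightarrow>\<^sub>0 'k"
  assumes th: "\<And>x. x \<in> X \<Longrightarrow> th x \<in> carrier F" "\<And>x. x \<in> X \<Longrightarrow> th x - gen x \<in> J"
begin

text \<open>In the application \<open>th x\<close> is the value of the lift on a chosen preimage of
  \<open>x\<close> in R, so that \<open>theta\<close> is the composite F -> R -> F.\<close>

definition theta :: "('x word \<Rightarrow>\<^sub>0 'k) \<Rightarrow> 'x word \<Rightarrow>\<^sub>0 'k" where
  "theta = free_eval F th"

lemma theta_map: "algebra_map F F theta"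
  unfolding theta_def using th by (intro F.free_eval_algebra_map) auto

lemma theta_gen: "x \<in> X \<Longrightarrow> theta (gen x) = th x"
  unfolding theta_def using th by (simp add: F.free_eval_gen)

lemma theta_closed: "f \<in> carrier F \<Longrightarrow> theta f \<in> carrier F"
  using algebra_map_closed[OF theta_map] .

lemma theta_J:
  assumes "f \<in> carrier F"
  shows "theta f - f \<in> J"
proof -
  have "J +>\<^bsub>F\<^esub> theta f = J +>\<^bsub>F\<^esub> f"
  proof (rule algebra_map_free_algebra_eq[OF _ _ _ assms])
    show "algebra_map F A (\<lambda>f. J +>\<^bsub>F\<^esub> theta f)" by (rule algebra_map_comp[OF theta_map quotient_map])
    show "algebra_map F A (\<lambda>f. J +>\<^bsub>F\<^esub> f)" by (rule quotient_map)
    show "J +>\<^bsub>F\<^esub> theta (gen x) = J +>\<^bsub>F\<^esub> gen x" if "x \<in> X" for x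
      using coset_eq_iff[OF relation_ideal_ideal th(1)[OF that] gen_closed[OF that]] th(2)[OF that] theta_gen[OF that]
      by simp
  qed
  then show ?thesis
    using coset_eq_iff[OF relation_ideal_ideal theta_closed[OF assms] assms] by simp
qed

text \<open>The path from the generic value of \<open>f\<close> to that of \<open>theta f\<close>:
  its second part lifts the generic value of theta f - f, an element of J, through the
  differential.\<close>

definition path_rep :: "('x word \<Rightarrow>\<^sub>0 'k) \<Rightarrow> nat \<times> nat \<Rightarrow> 'u" where
  "path_rep f = (\<lambda>e\<in>matrix_indices n. encK (generic_rep n f e, gamma_coeff (theta f - f) e))"

text \<open>With a = theta f - f and b = theta g - g one has theta (f g) - f g = f b + a g + a b;
  the last term is the one that eps = 1 adds to the product.\<close>

lemma path_rep_map: "algebra_map F (matrix_algebra n E.alg) path_rep"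
proof (rule algebra_mapI)
  have gc: "generic_rep n f e \<in> carrier Q" "gamma_coeff (theta f - f) e \<in> K1 n"
    "gamma (theta f - f) e = encK (0, gamma_coeff (theta f - f) e)"
    if "f \<in> carrier F" "e \<in> matrix_indices n" for f e
    using generic_rep_entry[OF that] gamma_coeff_closed[OF theta_J[OF that(1)] that(2)] gamma_enc[OF theta_J[OF that(1)] that(2)] by auto
  \<comment> \<open>Inside a code, the coefficient chosen by \<open>gamma_coeff\<close> may be
    replaced by any other representative of the same class.\<close>
  have eqI: "encK (p, gamma_coeff (theta f - f) e) = encK (p, u)"
    if "f \<in> carrier F" "e \<in> matrix_indices n" "p \<in> carrier Q" "u \<in> K1 n" "gamma (theta f - f) e = encK (0, u)" for f e p u
    using that gc[OF that(1,2)] encK_eq[of 0 "gamma_coeff (theta f - f) e" u] encK_eq[of p "gamma_coeff (theta f - f) e" u] by (simp add: P_closed)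
  fix f assume f: "f \<in> carrier F"
  show "path_rep f \<in> carrier (matrix_algebra n E.alg)" using gc[OF f] E.enc_closed by (auto simp: path_rep_def)
  show "path_rep (c \<odot>\<^bsub>F\<^esub> f) = c \<odot>\<^bsub>matrix_algebra n E.alg\<^esub> path_rep f" for c
  proof (rule matrix_eqI[of _ n])
    fix i l assume il: "i < n" "l < n"
    let ?e = "(i, l)" and ?c = "Poly_Mapping.single 0 c"
    have e: "?e \<in> matrix_indices n" using il by simp
    have cf: "?c * f \<in> carrier F" using f by (auto intro: F_closed)
    have "theta (?c * f) - ?c * f = ?c * (theta f - f)"
      using algebra_map_smult[OF theta_map f, of c] by (simp add: right_diff_distrib)
    then have "gamma (theta (?c * f) - ?c * f) ?e = (c \<odot>\<^bsub>MC\<^esub> gamma (theta f - f)) ?e"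
      using gamma_smult[OF theta_J[OF f], of c] by (simp only:)
    also have "\<dots> = encK (0, scaleK (Poly_Mapping.single 0 c) (gamma_coeff (theta f - f) ?e))"
      using il gc[OF f e] by (simp add: C.smult_enc P_closed)
    finally have g: "gamma (theta (?c * f) - ?c * f) ?e = encK (0, scaleK (Poly_Mapping.single 0 c) (gamma_coeff (theta f - f) ?e))" .
    have r: "generic_rep n (?c * f) ?e = Poly_Mapping.single 0 c * generic_rep n f ?e"
      using fun_cong[OF algebra_map_smult[OF generic_rep_map f, of n c], of ?e] il by simp
    have "path_rep (?c * f) ?e = encK (Poly_Mapping.single 0 c * generic_rep n f ?e, scaleK (Poly_Mapping.single 0 c) (gamma_coeff (theta f - f) ?e))"
      using il e eqI[OF cf e _ _ g] gc[OF f e] by (simp add: path_rep_def r C.closed)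
    then show "path_rep (c \<odot>\<^bsub>F\<^esub> f) ?e = (c \<odot>\<^bsub>matrix_algebra n E.alg\<^esub> path_rep f) ?e"
      using il gc[OF f e] by (simp add: path_rep_def E.smult_enc)
  qed (auto simp: path_rep_def)
  fix g assume g: "g \<in> carrier F"
  show "path_rep (f \<oplus>\<^bsub>F\<^esub> g) = path_rep f \<oplus>\<^bsub>matrix_algebra n E.alg\<^esub> path_rep g"
  proof (rule matrix_eqI[of _ n])
    fix i l assume il: "i < n" "l < n"
    let ?e = "(i, l)"
    have e: "?e \<in> matrix_indices n" using il by simp
    have "theta (f + g) - (f + g) = (theta f - f) + (theta g - g)"
      using algebra_map_add[OF theta_map f g] by simp
    then have "gamma (theta (f + g) - (f + g)) ?e = encK (0, gamma_coeff (theta f - f) ?e + gamma_coeff (theta g - g) ?e)"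
      using gamma_coeff_add[OF theta_J[OF f] theta_J[OF g] e] by (simp only:)
    from eqI[OF F_closed(1)[OF f g] e _ _ this]
    show "path_rep (f \<oplus>\<^bsub>F\<^esub> g) ?e = (path_rep f \<oplus>\<^bsub>matrix_algebra n E.alg\<^esub> path_rep g) ?e"
      using il gc[OF f e] gc[OF g e] by (simp add: path_rep_def E.add_enc C.closed generic_rep_add[OF f g e])
  qed (auto simp: path_rep_def)
  show "path_rep (f \<otimes>\<^bsub>F\<^esub> g) = path_rep f \<otimes>\<^bsub>matrix_algebra n E.alg\<^esub> path_rep g"
  proof (rule matrix_eqI[of _ n])
    fix i l assume il: "i < n" "l < n"
    let ?e = "(i, l)" and ?a = "theta f - f" and ?b = "theta g - g"
    let ?r = "generic_rep n"
    have e: "?e \<in> matrix_indices n" using il by simp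
    have ab: "?a \<in> J" "?b \<in> J" using theta_J f g by auto
    have gcf: "?r f (i, k) \<in> carrier Q" "gamma_coeff ?a (i, k) \<in> K1 n"
      and gcg: "?r g (k, l) \<in> carrier Q" "gamma_coeff ?b (k, l) \<in> K1 n" if "k < n" for k
      using gc[OF f, of "(i, k)"] gc[OF g, of "(k, l)"] il that by auto
    have db: "dK n (gamma_coeff ?b (k, l)) = ?r ?b (k, l)" if "k < n" for k
      using dK_gamma_coeff[OF ab(2), of "(k, l)"] il that by simp
    let ?s1 = "\<lambda>k. scaleK (?r f (i, k)) (gamma_coeff ?b (k, l))" and ?s2 = "\<lambda>k. scaleK (?r g (k, l)) (gamma_coeff ?a (i, k))"
      and ?s3 = "\<lambda>k. scaleK (?r ?b (k, l)) (gamma_coeff ?a (i, k))"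
    have rb: "?r ?b (k, l) \<in> carrier Q" if "k < n" for k
      using generic_rep_entry[OF J_sub[OF ab(2)], of "(k, l)" n] il that by simp
    have s: "?s1 k \<in> K1 n" "?s2 k \<in> K1 n" "?s3 k \<in> K1 n" if "k < n" for k
      using gcf[OF that] gcg[OF that] rb[OF that] by (auto intro: scaleK_closed)
    have fb: "f * ?b \<in> J" "?a * g \<in> J" "?a * ?b \<in> J"
      using J_mult(1)[OF ab(2) f] J_mult(2)[OF ab(1) g] J_mult(2)[OF ab(1) J_sub[OF ab(2)]] .
    have S: "sum ?s1 {..<n} \<in> K1 n" "sum ?s2 {..<n} \<in> K1 n" "sum ?s3 {..<n} \<in> K1 n" using s by (auto intro: sum_K1)
    \<comment> \<open>The term \<open>?a * ?b\<close> is read as right multiplication of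
      \<open>?a\<close> by an element of F; its scalar factor is then the differential of the
      coefficient of \<open>?b\<close>, as in the product of \<open>E\<close>.\<close>
    have "theta (f * g) - f * g = (f * ?b + ?a * g) + ?a * ?b"
      using algebra_map_mult[OF theta_map f g] by (simp add: algebra_simps)
    then have "gamma (theta (f * g) - f * g) ?e = (gamma (f * ?b) \<oplus>\<^bsub>MC\<^esub> gamma (?a * g) \<oplus>\<^bsub>MC\<^esub> gamma (?a * ?b)) ?e"
      using gamma_add[OF J_add[OF fb(1,2)] fb(3)] gamma_add[OF fb(1,2)] by (simp only:)
    also have "\<dots> = encK (0, sum ?s1 {..<n} + sum ?s2 {..<n} + sum ?s3 {..<n})"
      using il S gamma_coeff_sum_mult(1)[OF f ab(2) il] gamma_coeff_sum_mult(2)[OF g ab(1) il] gamma_coeff_sum_mult(2)[OF J_sub[OF ab(2)] ab(1) il]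
      by (simp add: C.add_enc K1_closed P_closed)
    also have "sum ?s1 {..<n} + sum ?s2 {..<n} + sum ?s3 {..<n} = (\<Sum>k<n. ?s1 k + ?s2 k + ?s3 k)"
      by (simp add: sum.distrib)
    finally have gam: "gamma (theta (f * g) - f * g) ?e = encK (0, \<Sum>k<n. ?s1 k + ?s2 k + ?s3 k)" .
    have SK: "(\<Sum>k<n. ?s1 k + ?s2 k + ?s3 k) \<in> K1 n" using s by (intro sum_K1) (auto intro: K1_closed)
    have prod: "?r (f * g) ?e = (\<Sum>k<n. ?r f (i, k) * ?r g (k, l))" using generic_rep_mult[OF f g il] .
    have "path_rep (f * g) ?e = encK (?r (f * g) ?e, \<Sum>k<n. ?s1 k + ?s2 k + ?s3 k)"
      using e eqI[OF F_closed(2)[OF f g] e generic_rep_entry[OF F_closed(2)[OF f g] e] SK gam] by (simp add: path_rep_def)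
    also have "\<dots> = finsum E.alg (\<lambda>k. encK (?r f (i, k) * ?r g (k, l), ?s1 k + ?s2 k + ?s3 k)) {..<n}"
      unfolding prod using s gcf gcg by (intro E.finsum_enc[symmetric]) (auto intro: P_closed K1_closed)
    also have "\<dots> = finsum E.alg (\<lambda>k. path_rep f (i, k) \<otimes>\<^bsub>E.alg\<^esub> path_rep g (k, l)) {..<n}"
    proof (rule Ec.finsum_cong'[OF refl])
      have Hm: "path_rep f (i, k) \<otimes>\<^bsub>E.alg\<^esub> path_rep g (k, l) = encK (?r f (i, k) * ?r g (k, l), ?s1 k + ?s2 k + ?s3 k)" if "k < n" for k
      proof -
        have "path_rep f (i, k) = encK (?r f (i, k), gamma_coeff ?a (i, k))" "path_rep g (k, l) = encK (?r g (k, l), gamma_coeff ?b (k, l))"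
          using il that by (simp_all add: path_rep_def)
        then have "path_rep f (i, k) \<otimes>\<^bsub>E.alg\<^esub> path_rep g (k, l) = encK (?r f (i, k) * ?r g (k, l),
            ?s1 k + ?s2 k + scaleK (Poly_Mapping.single 0 1) (scaleK (dK n (gamma_coeff ?b (k, l))) (gamma_coeff ?a (i, k))))"
          using E.mult_enc[OF gcf[OF that] gcg[OF that]] by (simp only:)
        then show ?thesis by (simp only: db[OF that] single_one scaleK_simps(4))
      qed
      then show "encK (?r f (i, k) * ?r g (k, l), ?s1 k + ?s2 k + ?s3 k) = path_rep f (i, k) \<otimes>\<^bsub>E.alg\<^esub> path_rep g (k, l)"
        if "k \<in> {..<n}" for k using that by simp
      show "(\<lambda>k. path_rep f (i, k) \<otimes>\<^bsub>E.alg\<^esub> path_rep g (k, l)) \<in> {..<n} \<rightarrow> carrier E.alg"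
        using Hm s gcf gcg by (auto intro!: E.enc_closed P_closed K1_closed)
    qed
    also have "\<dots> = (path_rep f \<otimes>\<^bsub>matrix_algebra n E.alg\<^esub> path_rep g) ?e" using il by simp
    finally show "path_rep (f \<otimes>\<^bsub>F\<^esub> g) ?e = (path_rep f \<otimes>\<^bsub>matrix_algebra n E.alg\<^esub> path_rep g) ?e" by simp
  qed (auto simp: path_rep_def)
next
  show "path_rep \<one>\<^bsub>F\<^esub> = \<one>\<^bsub>matrix_algebra n E.alg\<^esub>"
  proof (rule matrix_eqI[of _ n])
    fix i l assume il: "i < n" "l < n"
    let ?e = "(i, l)"
    have e: "?e \<in> matrix_indices n" using il by simp
    have z: "theta 1 - 1 = 0" using algebra_map_one[OF theta_map] by simp
    have "gamma 0 ?e = encK (0, 0)" using il by (simp add: gamma_zero C.zero_alg)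
    then have "gamma_coeff 0 ?e - 0 \<in> Kos n"
      using gamma_enc[OF J_zero e] gamma_coeff_closed[OF J_zero e] encK_eq[of 0 "gamma_coeff 0 ?e" 0] by (simp add: P_closed K1_closed)
    then have "encK (p, gamma_coeff 0 ?e) = encK (p, 0)" if "p \<in> carrier Q" for p
      using encK_eq[of p "gamma_coeff 0 ?e" 0] gamma_coeff_closed[OF J_zero e] that by (simp add: K1_closed)
    moreover have "generic_rep n 1 ?e = (if i = l then 1 else 0)"
      using fun_cong[OF algebra_map_one[OF generic_rep_map], of n ?e] il by simp
    ultimately show "path_rep \<one>\<^bsub>F\<^esub> ?e = \<one>\<^bsub>matrix_algebra n E.alg\<^esub> ?e"
      using il by (simp add: path_rep_def z E.one_alg E.zero_alg P_closed)
  qed (auto simp: path_rep_def)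
qed

text \<open>As the path object is commutative, the path of representations of F extends to an
  algebra map on the coordinate ring, the homotopy itself.\<close>

definition path_map :: "((('x \<times> nat \<times> nat) \<Rightarrow>\<^sub>0 nat) \<Rightarrow>\<^sub>0 'k) \<Rightarrow> 'u" where
  "path_map = poly_eval E.alg (\<lambda>(x, e). path_rep (gen x) e)"

lemma path_rep_entry: "f \<in> carrier F \<Longrightarrow> e \<in> matrix_indices n \<Longrightarrow> path_rep f e = encK (generic_rep n f e, gamma_coeff (theta f - f) e)"
  by (simp add: path_rep_def)

lemma path_rep_closed: "f \<in> carrier F \<Longrightarrow> e \<in> matrix_indices n \<Longrightarrow> path_rep f e \<in> carrier E.alg"
  using algebra_map_closed[OF path_rep_map, of f] by (auto simp: PiE_iff)

lemma path_map_map: "algebra_map Q E.alg path_map"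
  unfolding path_map_def using path_rep_closed[OF gen_closed]
  by (intro Ec.poly_eval_algebra_map) (auto simp: rep_coordinates_def)

text \<open>Two representations of F by matrices over the path object that agree on
  generators.\<close>

lemma path_map_rep:
  assumes f: "f \<in> carrier F" and e: "e \<in> matrix_indices n"
  shows "path_map (generic_rep n f e) = encK (generic_rep n f e, gamma_coeff (theta f - f) e)"
proof -
  have "map_matrix n path_map (generic_rep n f) = path_rep f"
  proof (rule algebra_map_free_algebra_eq[OF _ path_rep_map _ f])
    show "algebra_map F (matrix_algebra n E.alg) (\<lambda>f. map_matrix n path_map (generic_rep n f))"
      by (rule algebra_map_comp[OF generic_rep_map algebra_map_map_matrix[OF path_map_map P_algebra Ec.k_algebra_axioms]])
    show "map_matrix n path_map (generic_rep n (gen x)) = path_rep (gen x)" if x: "x \<in> X" for x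
    proof (rule matrix_eqI[of _ n])
      fix i l assume il: "i < n" "l < n"
      then have "path_map (pvar (x, i, l)) = path_rep (gen x) (i, l)"
        unfolding path_map_def using path_rep_closed[OF gen_closed[OF x], of "(i, l)"] by (subst Ec.poly_eval_pvar) auto
      then show "map_matrix n path_map (generic_rep n (gen x)) (i, l) = path_rep (gen x) (i, l)"
        using il x by (simp add: generic_rep_gen generic_matrix_def)
    qed (auto simp: path_rep_def)
  qed
  then show ?thesis using e path_rep_entry[OF f e] by (metis map_matrix_def restrict_apply')
qed

text \<open>The first end point of the path is the identity of Q, as is seen on the
  coordinates.\<close>

lemma path_map_enc:
  assumes "a \<in> carrier Q"
  shows "\<exists>h\<in>K1 n. path_map a = encK (a, h)"
proof -
  have "fst (E.dec (path_map a)) = a"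
  proof (rule algebra_map_poly_algebra_eq[OF algebra_map_comp[OF path_map_map source_map] _ _ assms])
    show "algebra_map Q Q (\<lambda>a. a)" by (rule algebra_mapI) auto
    fix v assume v': "v \<in> Wn n"
    then obtain x e where v: "v = (x, e)" "x \<in> X" "e \<in> matrix_indices n" by (auto simp: rep_coordinates_def)
    have "path_map (pvar v) = path_rep (gen x) e"
      unfolding path_map_def using path_rep_closed[OF gen_closed[OF v(2)] v(3)] v(1) by (subst Ec.poly_eval_pvar) auto
    then show "fst (E.dec (path_map (pvar v))) = pvar v"
      using v v' gamma_coeff_closed[OF theta_J[OF gen_closed[OF v(2)]] v(3)]
      by (simp add: path_rep_entry generic_rep_gen generic_matrix_def E_dec)
  qed
  moreover obtain p u where "path_map a = encK (p, u)" "p \<in> carrier Q" "u \<in> K1 n"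
    using algebra_map_closed[OF path_map_map assms] by (rule E.carrier_algE)
  ultimately show ?thesis by (auto simp: E_dec)
qed

text \<open>Let m and k be the coefficients of theta (j y) and theta (j y) - j y. Modulo
  \<open>Kos\<close>, m_i is k_i plus the basis element at i, so d(m_i) = d(k_i) + rel_i. The path
  of the zero sum puts the sum of the \<open>?Z i\<close> into \<open>Kos\<close>, and
  \<open>star\<close> does so for the sum of (a_i + d(h_i)) m_i. Their difference is the sum of the
  a_i times basis elements, up to crossing terms d(h_i) m_i - d(m_i) h_i and multiples of elements
  of \<open>Kos\<close>.\<close>

lemma koszul_trivial_if_homotopy:
  assumes a: "\<And>i. i \<in> Ix n \<Longrightarrow> a i \<in> carrier Q" and syz: "(\<Sum>i\<in>Ix n. a i * rel n i) = 0"
    and h: "\<And>i. i \<in> Ix n \<Longrightarrow> h i \<in> K1 n" "\<And>i. i \<in> Ix n \<Longrightarrow> path_map (a i) = encK (a i, h i)"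
    and star: "(\<Sum>(y, e)\<in>Ix n. scaleK (a (y, e) + dK n (h (y, e))) (gamma_coeff (theta (j y)) e)) \<in> Kos n"
  shows "koszul_trivial (carrier Q) (rel n) (Ix n) a"
proof -
  define k where "k = (\<lambda>i. gamma_coeff (theta (j (fst i)) - j (fst i)) (snd i))"
  define m where "m = (\<lambda>i. gamma_coeff (theta (j (fst i))) (snd i))"
  have thj: "theta (j y) \<in> J" if "y \<in> Y" for y
    using J_add[OF theta_J[OF j_closed[OF that]] j_in_J[OF that]] by simp
  have k: "k i \<in> K1 n" and m: "m i \<in> K1 n" if "i \<in> Ix n" for i
    using that theta_J j_closed thj by (auto simp: k_def m_def intro!: gamma_coeff_closed)
  have mk: "m i - (k i + Poly_Mapping.single i 1) \<in> Kos n" if i: "i \<in> Ix n" for i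
  proof -
    obtain y e where ye: "i = (y, e)" "y \<in> Y" "e \<in> matrix_indices n" using i by auto
    note tj = theta_J[OF j_closed[OF ye(2)]]
    have "gamma (theta (j y) - j y + j y) e = gamma (theta (j y) - j y) e \<oplus>\<^bsub>C.dga\<^esub> gamma (j y) e"
      using gamma_add[OF tj j_in_J[OF ye(2)]] ye(3) by (simp del: diff_add_cancel)
    then have "encK (0, m i) = encK (0, k i) \<oplus>\<^bsub>C.dga\<^esub> encK (0, Poly_Mapping.single i 1)"
      using gamma_enc[OF tj ye(3)] gamma_enc[OF thj[OF ye(2)] ye(3)] gamma_j[OF ye(2)] ye
      by (simp add: yK_def m_def k_def)
    also have "\<dots> = encK (0, k i + Poly_Mapping.single i 1)"
      using k[OF i] single_K1[OF i] by (simp add: C.add_enc P_closed)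
    finally show ?thesis
      using encK_eq[of 0 "m i" "k i + Poly_Mapping.single i 1"] m[OF i] k[OF i] single_K1[OF i]
      by (simp add: P_closed K1_closed)
  qed
  have dm: "dK n (m i) = dK n (k i) + rel n i" if i: "i \<in> Ix n" for i
  proof -
    have "dK n (m i) - dK n (k i + Poly_Mapping.single i 1) = 0"
      using dK_Kos[OF mk[OF i]] C.d_diff[OF m[OF i] K1_closed(2)[OF k[OF i] single_K1[OF i]]] by (simp add: P_closed)
    then show ?thesis using dK_single[OF i] by (simp add: dK_simps)
  qed
  have kr: "path_map (rel n i) = encK (rel n i, k i)" if "i \<in> Ix n" for i
    using that path_map_rep j_closed by (auto simp: rel_def k_def)
  \<comment> \<open>The second part of the product in \<open>E\<close> of the paths of
    \<open>a i\<close> and \<open>rel n i\<close>.\<close>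
  let ?Z = "\<lambda>i. scaleK (a i) (k i) + scaleK (rel n i) (h i) + scaleK (dK n (k i)) (h i)"
  have Z: "?Z i \<in> K1 n" if i: "i \<in> Ix n" for i
    using a[OF i] h(1)[OF i] k[OF i] rel_closed[OF i] by (auto intro!: K1_closed scaleK_closed dK_closed)
  interpret Qr: k_algebra Q by (rule P_algebra)
  have arc: "a i * rel n i \<in> carrier Q" if "i \<in> Ix n" for i using a[OF that] rel_closed[OF that] by (rule P_closed)
  have "path_map (\<Sum>i\<in>Ix n. a i * rel n i) = finsum E.alg (\<lambda>i. path_map (a i * rel n i)) (Ix n)"
    using algebra_map_finsum[OF path_map_map Qr.ring_axioms Ec.ring_axioms, of "\<lambda>i. a i * rel n i" "Ix n"] arc
    by (simp add: finsum_P[OF arc])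
  also have "\<dots> = finsum E.alg (\<lambda>i. encK (a i * rel n i, ?Z i)) (Ix n)"
  proof (rule Ec.finsum_cong'[OF refl])
    show "(\<lambda>i. encK (a i * rel n i, ?Z i)) \<in> Ix n \<rightarrow> carrier E.alg" using arc Z E.enc_closed by blast
    fix i assume i: "i \<in> Ix n"
    have "path_map (a i * rel n i) = encK (a i, h i) \<otimes>\<^bsub>E.alg\<^esub> encK (rel n i, k i)"
      using algebra_map_mult[OF path_map_map a[OF i] rel_closed[OF i]] h(2)[OF i] kr[OF i] by simp
    then show "path_map (a i * rel n i) = encK (a i * rel n i, ?Z i)"
      using a[OF i] rel_closed[OF i] h(1)[OF i] k[OF i] by (simp add: E.mult_enc single_one scaleK_simps(4))
  qed
  also have "\<dots> = encK (0, sum ?Z (Ix n))"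
    using E.finsum_enc[OF finite_Ix arc Z] syz by simp
  finally have "encK (0, sum ?Z (Ix n)) = encK (0, 0)"
    using algebra_map_zero[OF path_map_map Qr.ring_axioms Ec.ring_axioms] syz by (simp add: E.zero_alg)
  then have Zs: "sum ?Z (Ix n) \<in> Kos n"
    using encK_eq[of 0 "sum ?Z (Ix n)" 0] sum_K1[of "Ix n" ?Z] Z by (simp add: P_closed K1_closed)
  have "(\<Sum>i\<in>Ix n. scaleK (a i + dK n (h i)) (m i)) \<in> Kos n"
    using star by (simp add: m_def case_prod_unfold)
  from Kos_closed(2)[OF this Kos_closed(3)[OF Zs]]
  have D: "(\<Sum>i\<in>Ix n. scaleK (a i + dK n (h i)) (m i)) - sum ?Z (Ix n) \<in> Kos n" by simp
  let ?R = "\<lambda>i. scaleK (dK n (h i)) (m i) - scaleK (dK n (m i)) (h i)"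
  let ?S = "\<lambda>i. scaleK (a i) (m i - (k i + Poly_Mapping.single i 1))"
  have "scaleK (a i + dK n (h i)) (m i) - ?Z i = scaleK (a i) (Poly_Mapping.single i 1) + (?R i + ?S i)" if "i \<in> Ix n" for i
    by (rule poly_mapping_eqI) (simp add: dm[OF that] lookup_add lookup_minus algebra_simps)
  then have "(\<Sum>i\<in>Ix n. scaleK (a i + dK n (h i)) (m i)) - sum ?Z (Ix n)
      = (\<Sum>i\<in>Ix n. scaleK (a i) (Poly_Mapping.single i 1)) + (\<Sum>i\<in>Ix n. ?R i + ?S i)"
    by (simp only: sum_subtractf[symmetric] sum.distrib[symmetric] cong: sum.cong)
  moreover have RS: "(\<Sum>i\<in>Ix n. ?R i + ?S i) \<in> Kos n"
    using crossing_Kos[OF m h(1)] Kos_closed(4)[OF a mk] by (intro sum_Kos Kos_closed(2)) auto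
  ultimately have "(\<Sum>i\<in>Ix n. scaleK (a i) (Poly_Mapping.single i 1)) \<in> Kos n"
    using Kos_closed(2)[OF D Kos_closed(3)[OF RS]] by simp
  then have "koszul_trivial (carrier Q) (rel n) (Ix n) (Poly_Mapping.lookup (\<Sum>i\<in>Ix n. scaleK (a i) (Poly_Mapping.single i 1)))"
    by (simp add: Kos_def)
  moreover have "Poly_Mapping.lookup (\<Sum>i\<in>Ix n. scaleK (a i) (Poly_Mapping.single i 1)) l = a l" if "l \<in> Ix n" for l
    using that finite_Ix by (simp add: lookup_sum lookup_single when_mult mult_when when_def if_distrib sum.delta cong: if_cong)
  ultimately show ?thesis unfolding koszul_trivial_def by simp
qed

end

end

section \<open>Acyclicity of the Koszul complex\<close>

context koszul_coding
begin

text \<open>Projectivity includes the bimodule axioms, and these include the axioms of the algebra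
  that acts.\<close>

lemma A_k_algebra: "k_algebra A"
  using ncci unfolding ncci_def projective_bimodule_def bimodule_def by blast

text \<open>\<open>psi\<close> from S to C classifies the lift followed by \<open>Psi\<close>;
  \<open>phi\<close> from Q to S comes from chosen preimages of generators. A syzygy gives a 1-cycle
  of S, which is a boundary from degree 2 and so vanishes under \<open>psi\<close>; this is the
  hypothesis \<open>star\<close> of \<open>koszul_trivial_if_homotopy\<close>.\<close>

lemma koszul_exact_rel:
  fixes R S :: "('k, 'u) dga" and encA :: "('x word \<Rightarrow>\<^sub>0 'k) \<times> ('x word \<Rightarrow>\<^sub>0 'k) \<Rightarrow> 'u"
  assumes R: "cofibrant_resolution A R q" and rep: "represents_dg_rep R n S \<pi>"
    and H1: "trivial_group (homology S 1)"
    and encA: "\<And>p q u v. p \<in> carrier F \<Longrightarrow> q \<in> carrier F \<Longrightarrow> u \<in> {0} \<Longrightarrow> v \<in> {0} \<Longrightarrow>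
      encA (p, u) = encA (q, v) \<longleftrightarrow> p - q \<in> J \<and> u - v \<in> {0}"
  shows "koszul_exact (carrier Q) (rel n) (Ix n)"
proof -
  interpret A: k_algebra A by (rule A_k_algebra)
  interpret S: comm_dg_algebra S using rep by (simp add: represents_dg_rep_def)
  have cof: "cofibrant R" and qi: "quasi_iso R (concentrated A) q"
    using R by (simp_all add: cofibrant_resolution_def)
  interpret R: dg_algebra R using cof by (simp add: cofibrant_def)
  interpret MR: k_algebra "matrix_algebra n S" by (rule S.k_algebra_matrix_algebra)
  interpret Qr: k_algebra Q by (rule P_algebra)
  obtain h where h: "h \<in> dga_hom R D.dga"
    and qh: "\<And>r f v. r \<in> carrier R \<Longrightarrow> f \<in> carrier F \<Longrightarrow> v \<in> J \<Longrightarrow> h r = encD (f, v) \<Longrightarrow> q r = J +>\<^bsub>F\<^esub> f"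
    using lift_resolution[of encA R q] encA R by blast
  have hm: "algebra_map R D.dga h" and hc: "\<And>i r. r \<in> comp R i \<Longrightarrow> h r \<in> comp D.dga i"
    and hd: "\<And>r. r \<in> carrier R \<Longrightarrow> h (diff R r) = diff D.dga (h r)"
    using h unfolding dga_hom_iff by blast+
  have q_hom: "q \<in> dga_hom R (concentrated A)" using qi unfolding quasi_iso_def by blast
  then have qm: "algebra_map R A q" unfolding dga_hom_iff algebra_map_to_concentrated by blast
  have pi: "\<pi> \<in> dga_hom R (matrix_dga n S)" using rep by (simp add: represents_dg_rep_def)
  then have pim: "algebra_map R (matrix_algebra n S) \<pi>" and pic: "\<And>i r. r \<in> comp R i \<Longrightarrow> \<pi> r \<in> matrix_indices n \<rightarrow>\<^sub>E comp S i"
    and pid: "\<And>r. r \<in> carrier R \<Longrightarrow> \<pi> (diff R r) = map_matrix n (diff S) (\<pi> r)"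
    unfolding dga_hom_iff algebra_map_matrix_dga by auto
  have "(\<lambda>r\<in>carrier R. Psi (h r)) \<in> dga_hom R (matrix_dga n C.dga)"
    by (rule dga_hom_comp[OF h Psi_hom R.dg_algebra_axioms])
  moreover have "bij_betw (\<lambda>\<psi>. \<lambda>x\<in>carrier R. map_matrix n \<psi> (\<pi> x)) (dga_hom S C.dga) (dga_hom R (matrix_dga n C.dga))"
    using rep Cd.comm_dg_algebra_axioms unfolding represents_dg_rep_def by blast
  ultimately have "(\<lambda>r\<in>carrier R. Psi (h r)) \<in> (\<lambda>\<psi>. \<lambda>x\<in>carrier R. map_matrix n \<psi> (\<pi> x)) ` dga_hom S C.dga"
    by (simp only: bij_betw_imp_surj_on)
  then obtain psi where psi: "psi \<in> dga_hom S C.dga"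
    and eq: "(\<lambda>x\<in>carrier R. map_matrix n psi (\<pi> x)) = (\<lambda>r\<in>carrier R. Psi (h r))"
    by (elim imageE) (rule that, assumption, rule sym)
  have psim: "algebra_map S C.dga psi" and psic: "\<And>i s. s \<in> comp S i \<Longrightarrow> psi s \<in> comp C.dga i"
    and psid: "\<And>s. s \<in> carrier S \<Longrightarrow> psi (diff S s) = diff C.dga (psi s)"
    using psi unfolding dga_hom_iff by blast+
  have psi_pi: "psi (\<pi> r e) = Psi (h r) e" if "r \<in> carrier R" "e \<in> matrix_indices n" for r e
    using fun_cong[OF fun_cong[OF eq, of r], of e] that by (simp add: map_matrix_def)

  \<comment> \<open>Preimages in degree 0 of R of the generators of A, together with their values in
    F under the lift.\<close>
  have "\<exists>r f. r \<in> comp R 0 \<and> q r = J +>\<^bsub>F\<^esub> gen x \<and> f \<in> carrier F \<and> h r = encD (f, 0)" if "x \<in> X" for x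
  proof -
    have "J +>\<^bsub>F\<^esub> gen x \<in> carrier A" using that by (auto simp: carrier_A)
    then obtain r where r: "r \<in> comp R 0" "q r = J +>\<^bsub>F\<^esub> gen x"
      using R.resolution_surj[OF qi A_k_algebra] by blast
    moreover have "h r \<in> comp D.dga 0" by (rule hc[OF r(1)])
    ultimately show ?thesis unfolding D.comp_dga by blast
  qed
  then obtain rx th where rx: "\<And>x. x \<in> X \<Longrightarrow> rx x \<in> comp R 0" "\<And>x. x \<in> X \<Longrightarrow> q (rx x) = J +>\<^bsub>F\<^esub> gen x"
    and th: "\<And>x. x \<in> X \<Longrightarrow> th x \<in> carrier F" and hrx: "\<And>x. x \<in> X \<Longrightarrow> h (rx x) = encD (th x, 0)"
    by metis
  have th': "th x - gen x \<in> J" if x: "x \<in> X" for x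
    using qh[OF R.comp_carrierD[OF rx(1)[OF x]] th[OF x] J_zero hrx[OF x]] rx(2)[OF x]
      coset_eq_iff[OF relation_ideal_ideal th[OF x] gen_closed[OF x]] by simp
  let ?th = "theta th" and ?ka = "path_map th"
  have theta_map: "algebra_map F F ?th" by (rule theta_map[of th]) (fact th th')+
  have theta_J: "?th f - f \<in> J" if "f \<in> carrier F" for f by (rule theta_J[of th, OF _ _ that]) (fact th th')+
  have theta_gen: "?th (gen x) = th x" if "x \<in> X" for x by (rule theta_gen[of th, OF _ _ that]) (fact th th')+
  have path_map_map: "algebra_map Q E.alg ?ka" by (rule path_map_map[of th]) (fact th th')+
  define evR where "evR = free_eval R rx"
  have evm: "algebra_map F R evR"
    unfolding evR_def using rx(1) R.comp_carrierD by (intro R.free_eval_algebra_map) auto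
  have evg: "evR (gen x) = rx x" if "x \<in> X" for x
    unfolding evR_def using rx(1)[OF that] R.comp_carrierD by (simp add: R.free_eval_gen)
  have ev0: "evR f \<in> comp R 0" if "f \<in> carrier F" for f
    unfolding evR_def using rx(1) that by (intro R.free_eval_comp_0) auto
  have qev: "q (evR f) = J +>\<^bsub>F\<^esub> f" if "f \<in> carrier F" for f
    by (rule algebra_map_free_algebra_eq[OF algebra_map_comp[OF evm qm] quotient_map _ that]) (simp add: evg rx)
  have inD: "algebra_map F D.dga (\<lambda>f. encD (f, 0))"
    by (rule algebra_mapI) (simp_all add: D.add_enc D.mult_enc D.smult_enc D.one_alg D.enc_closed F_closed J_zero)
  have hev: "h (evR f) = encD (?th f, 0)" if "f \<in> carrier F" for f
    by (rule algebra_map_free_algebra_eq[OF algebra_map_comp[OF evm hm] algebra_map_comp[OF theta_map inD] _ that])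
      (simp add: evg hrx theta_gen)

  \<comment> \<open>The relations become boundaries in R; preimages under the differential take the
    place of the Koszul generators.\<close>
  have "\<exists>s\<in>comp R 1. diff R s = evR (j y)" if y: "y \<in> Y" for y
  proof -
    have "q (evR (j y)) = \<zero>\<^bsub>A\<^esub>"
      using qev[OF j_closed[OF y]] F.a_rcos_zero[OF relation_ideal_ideal j_in_J[OF y]] by (simp add: A_fields)
    then show ?thesis using R.resolution_kernel[OF qi A_k_algebra ev0[OF j_closed[OF y]]] by blast
  qed
  then obtain sy where sy: "\<And>y. y \<in> Y \<Longrightarrow> sy y \<in> comp R 1" "\<And>y. y \<in> Y \<Longrightarrow> diff R (sy y) = evR (j y)" by metis
  note syc = R.comp_carrierD[OF sy(1)]
  have thj: "?th (j y) \<in> J" if "y \<in> Y" for y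
    using J_add[OF theta_J[OF j_closed[OF that]] j_in_J[OF that]] by simp
  have hsy: "h (sy y) = encD (0, ?th (j y))" if y: "y \<in> Y" for y
  proof -
    \<comment> \<open>The differential of \<open>D\<close> is injective on J, so the value of the
      lift on \<open>sy y\<close> is determined by its boundary.\<close>
    have "h (sy y) \<in> comp D.dga (Suc 0)" using hc[OF sy(1)[OF y]] by simp
    then obtain v where v: "h (sy y) = encD (0, v)" "v \<in> J" unfolding D.comp_dga by blast
    have "encD (?th (j y), 0) = encD (v, 0)"
      using hev[OF j_closed[OF y]] hd[OF syc[OF y]] sy(2)[OF y] v by (simp add: D.diff_enc F_closed)
    then have "?th (j y) = v" using encD[of "?th (j y)" v 0 0] thj[OF y] v(2) J_sub J_zero by simp
    then show ?thesis using v by simp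
  qed
  have G0: "G 0 = \<zero>\<^bsub>MC\<^esub>" using algebra_map_zero[OF G_map F.ring_axioms MC.ring_axioms] by (simp del: matrix_algebra_simps)
  have psi_sy: "psi (\<pi> (sy y) e) = encK (0, gamma_coeff (?th (j y)) e)" if y: "y \<in> Y" and e: "e \<in> matrix_indices n" for y e
  proof -
    have "Psi (h (sy y)) = gamma (?th (j y))"
      using thj[OF y] gamma_carrier[OF thj[OF y]] by (simp add: hsy[OF y] Psi_enc F_closed G0 del: matrix_algebra_simps)
    then show ?thesis using psi_pi[OF syc[OF y] e] gamma_enc[OF thj[OF y] e] by simp
  qed
  have psi_rx: "psi (\<pi> (rx x) e) = encK (generic_rep n (th x) e, 0)" if x: "x \<in> X" and e: "e \<in> matrix_indices n" for x e
  proof -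
    have "Psi (h (rx x)) = G (th x)"
      using th[OF x] algebra_map_closed[OF G_map th[OF x]] by (simp add: hrx[OF x] Psi_enc J_zero gamma_zero del: matrix_algebra_simps)
    then show ?thesis using psi_pi[OF R.comp_carrierD[OF rx(1)[OF x]] e] e by (simp add: G_def map_matrix_def)
  qed

  let ?S0 = "S\<lparr>carrier := comp S 0\<rparr>"
  note S0 = comm_k_algebra_comp_0[OF S.comm_dg_algebra_axioms]
  interpret S0: comm_k_algebra ?S0 by (rule S0(1))
  define phi where "phi = poly_eval ?S0 (\<lambda>(x, e). \<pi> (rx x) e)"
  have pirx: "\<pi> (rx x) e \<in> comp S 0" if "x \<in> X" "e \<in> matrix_indices n" for x e
    using pic[OF rx(1)[OF that(1)]] that(2) by (auto simp: PiE_iff)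
  have phi0: "algebra_map Q ?S0 phi"
    unfolding phi_def by (rule S0.poly_eval_algebra_map) (auto simp: rep_coordinates_def pirx)
  have phim: "algebra_map Q S phi" using algebra_map_comp[OF phi0 S0(2)] .
  have phic: "phi p \<in> comp S 0" if "p \<in> carrier Q" for p using algebra_map_closed[OF phi0 that] by simp
  have phiv: "phi (pvar (x, e)) = \<pi> (rx x) e" if "x \<in> X" "e \<in> matrix_indices n" for x e
    unfolding phi_def using pirx[OF that] by (subst S0.poly_eval_pvar) auto
  have phi_rep: "phi (generic_rep n f e) = \<pi> (evR f) e" if f: "f \<in> carrier F" and e: "e \<in> matrix_indices n" for f e
  proof -
    have "map_matrix n phi (generic_rep n f) = \<pi> (evR f)"
    proof (rule algebra_map_free_algebra_eq[OF _ algebra_map_comp[OF evm pim] _ f])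
      show "algebra_map F (matrix_algebra n S) (\<lambda>f. map_matrix n phi (generic_rep n f))"
        by (rule algebra_map_comp[OF generic_rep_map algebra_map_map_matrix[OF phim P_algebra S.k_algebra_axioms]])
      fix x assume x: "x \<in> X"
      have "\<pi> (rx x) \<in> extensional (matrix_indices n)" using pic[OF rx(1)[OF x]] by (auto simp: PiE_iff)
      then show "map_matrix n phi (generic_rep n (gen x)) = \<pi> (evR (gen x))"
        using x by (intro matrix_eqI[of _ n]) (auto simp: evg generic_rep_gen generic_matrix_def phiv)
    qed
    then show ?thesis using e by (metis map_matrix_def restrict_apply')
  qed
  \<comment> \<open>\<open>psi\<close> after \<open>phi\<close> is the second end point of the path:
    both are algebra maps on Q, and on coordinates both give the entries of the generic value of
    \<open>th x\<close>.\<close>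
  have psi_phi: "psi (phi p) = target (?ka p)" if p: "p \<in> carrier Q" for p
  proof (rule algebra_map_poly_algebra_eq[OF algebra_map_comp[OF phim psim] algebra_map_comp[OF path_map_map target_map] _ p])
    fix v assume "v \<in> Wn n"
    then obtain x e where v: "v = (x, e)" "x \<in> X" "e \<in> matrix_indices n" by (auto simp: rep_coordinates_def)
    note g = gen_closed[OF v(2)]
    have "pvar v = generic_rep n (gen x) e" using v by (simp add: generic_rep_gen generic_matrix_def)
    then have "target (?ka (pvar v)) = target (encK (generic_rep n (gen x) e, gamma_coeff (?th (gen x) - gen x) e))"
      using path_map_rep[of th, OF _ _ g v(3)] th th' by simp
    also have "\<dots> = encK (generic_rep n (gen x) e + generic_rep n (?th (gen x) - gen x) e, 0)"
      using target_enc[OF generic_rep_entry[OF g v(3)] gamma_coeff_closed[OF theta_J[OF g] v(3)]] dK_gamma_coeff[OF theta_J[OF g] v(3)] by simp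
    also have "generic_rep n (gen x) e + generic_rep n (?th (gen x) - gen x) e = generic_rep n (th x) e"
      using generic_rep_add[OF g J_sub[OF theta_J[OF g]] v(3)] by (simp add: theta_gen[OF v(2)])
    finally show "psi (phi (pvar v)) = target (?ka (pvar v))" using v phiv psi_rx by simp
  qed

  show ?thesis unfolding koszul_exact_def
  proof (intro allI impI)
    fix a assume a: "\<forall>i\<in>Ix n. a i \<in> carrier Q" and syz: "(\<Sum>i\<in>Ix n. a i * rel n i) = 0"
    then have "\<exists>u. u \<in> K1 n \<and> ?ka (a i) = encK (a i, u)" if "i \<in> Ix n" for i
      using path_map_enc[of th "a i"] th th' that by blast
    then obtain hh where hh: "\<And>i. i \<in> Ix n \<Longrightarrow> hh i \<in> K1 n" "\<And>i. i \<in> Ix n \<Longrightarrow> ?ka (a i) = encK (a i, hh i)"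
      by metis
    let ?s = "\<lambda>i. \<pi> (sy (fst i)) (snd i)"
    have s1: "?s i \<in> comp S 1" if "i \<in> Ix n" for i
      using pic[OF sy(1)] that by (auto simp: PiE_iff)
    note sc = S.comp_carrierD[OF s1] and ac = S.comp_carrierD[OF phic[OF bspec[OF a]]]
    \<comment> \<open>The element of degree 1 that the syzygy yields in S; its boundary is the image
      under \<open>phi\<close> of the zero sum.\<close>
    define z where "z = (\<Oplus>\<^bsub>S\<^esub>i\<in>Ix n. phi (a i) \<otimes>\<^bsub>S\<^esub> ?s i)"
    have z1: "z \<in> comp S 1" unfolding z_def
    proof (rule S.comp_finsum)
      fix i assume i: "i \<in> Ix n"
      show "phi (a i) \<otimes>\<^bsub>S\<^esub> ?s i \<in> comp S 1"
        using S.comp_mult[OF phic[OF bspec[OF a i]] s1[OF i]] by simp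
    qed
    have ds: "diff S (?s i) = phi (rel n i)" if i: "i \<in> Ix n" for i
    proof -
      obtain y e where ye: "i = (y, e)" "y \<in> Y" "e \<in> matrix_indices n" using i by auto
      then show ?thesis
        using fun_cong[OF pid[OF syc[OF ye(2)]], of e] phi_rep[OF j_closed[OF ye(2)] ye(3)] sy(2)[OF ye(2)]
        by (simp add: map_matrix_def rel_def)
    qed
    have arc: "a i * rel n i \<in> carrier Q" if "i \<in> Ix n" for i
      using bspec[OF a that] rel_closed[OF that] by (rule P_closed)
    have diff_term: "diff S (phi (a i) \<otimes>\<^bsub>S\<^esub> ?s i) = phi (a i * rel n i)" if i: "i \<in> Ix n" for i
    proof -
      have r: "phi (rel n i) \<in> carrier S" using algebra_map_closed[OF phim rel_closed[OF i]] .
      have "diff S (phi (a i) \<otimes>\<^bsub>S\<^esub> ?s i) = \<zero>\<^bsub>S\<^esub> \<otimes>\<^bsub>S\<^esub> ?s i \<oplus>\<^bsub>S\<^esub> (-1) ^ 0 \<odot>\<^bsub>S\<^esub> (phi (a i) \<otimes>\<^bsub>S\<^esub> phi (rel n i))"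
        using S.leibniz[OF phic[OF bspec[OF a i]] sc[OF i]] S.diff_comp_0[OF phic[OF bspec[OF a i]]] ds[OF i] by simp
      also have "\<dots> = phi (a i) \<otimes>\<^bsub>S\<^esub> phi (rel n i)"
        using sc[OF i] ac[OF i] r by (simp add: S.smult_one)
      finally show ?thesis using algebra_map_mult[OF phim bspec[OF a i] rel_closed[OF i]] by simp
    qed
    have "diff S z = (\<Oplus>\<^bsub>S\<^esub>i\<in>Ix n. diff S (phi (a i) \<otimes>\<^bsub>S\<^esub> ?s i))"
      unfolding z_def using sc ac by (intro S.diff_finsum) auto
    also have "\<dots> = (\<Oplus>\<^bsub>S\<^esub>i\<in>Ix n. phi (a i * rel n i))"
      using diff_term algebra_map_closed[OF phim arc] by (intro S.finsum_cong' refl) auto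
    also have "\<dots> = phi (finsum Q (\<lambda>i. a i * rel n i) (Ix n))"
      using arc by (intro algebra_map_finsum[OF phim Qr.ring_axioms S.ring_axioms, symmetric]) auto
    also have "\<dots> = \<zero>\<^bsub>S\<^esub>"
      using algebra_map_zero[OF phim Qr.ring_axioms S.ring_axioms] syz by (simp add: finsum_P[OF arc])
    finally have "diff S z = \<zero>\<^bsub>S\<^esub>" .
    then obtain b where b: "b \<in> comp S 2" "diff S b = z"
      using S.trivial_homology[OF H1 z1] by (auto simp: numeral_2_eq_2)
    let ?t = "\<lambda>i. scaleK (a i + dK n (hh i)) (gamma_coeff (?th (j (fst i))) (snd i))"
    have aK: "a i + dK n (hh i) \<in> carrier Q" and gK: "gamma_coeff (?th (j (fst i))) (snd i) \<in> K1 n" if i: "i \<in> Ix n" for i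
      using bspec[OF a i] dK_closed[OF hh(1)[OF i]] gamma_coeff_closed[OF thj] i by (auto intro: P_closed)
    have tK: "?t i \<in> K1 n" if i: "i \<in> Ix n" for i using aK[OF i] gK[OF i] by (rule scaleK_closed)
    \<comment> \<open>C contains only zero in degree 2.\<close>
    have "psi b = encK (0, 0)" using psic[OF b(1)] C.enc_comp_2[of 2] by simp
    then have "psi z = encK (0, 0)"
      using psid[OF S.comp_carrierD[OF b(1)]] b(2) by (simp add: C.diff_enc C.closed C.d_zero)
    moreover have "psi z = finsum C.dga (\<lambda>i. psi (phi (a i) \<otimes>\<^bsub>S\<^esub> ?s i)) (Ix n)"
      unfolding z_def using sc ac by (intro algebra_map_finsum[OF psim S.ring_axioms Cd.ring_axioms]) auto
    moreover have "finsum C.dga (\<lambda>i. psi (phi (a i) \<otimes>\<^bsub>S\<^esub> ?s i)) (Ix n) = finsum C.dga (\<lambda>i. encK (0, ?t i)) (Ix n)"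
    proof (rule Cd.finsum_cong'[OF refl])
      show "(\<lambda>i. encK (0, ?t i)) \<in> Ix n \<rightarrow> carrier C.dga" using tK C.enc_closed[of 0] by (auto simp: P_closed)
      fix i assume i: "i \<in> Ix n"
      have "psi (phi (a i)) = encK (a i + dK n (hh i), 0)"
        using psi_phi[OF bspec[OF a i]] hh(2)[OF i] target_enc[OF bspec[OF a i] hh(1)[OF i]] by simp
      moreover have "psi (?s i) = encK (0, gamma_coeff (?th (j (fst i))) (snd i))" using psi_sy i by auto
      ultimately show "psi (phi (a i) \<otimes>\<^bsub>S\<^esub> ?s i) = encK (0, ?t i)"
        using algebra_map_mult[OF psim ac[OF i] sc[OF i]] aK[OF i] gK[OF i]
        by (simp add: C.mult_enc C.closed C.lact_zero C.ract_zero)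
    qed
    moreover have "finsum C.dga (\<lambda>i. encK (0, ?t i)) (Ix n) = encK (0, sum ?t (Ix n))"
      unfolding C.finsum_dga using C.finsum_enc[of "Ix n" "\<lambda>_. 0" ?t] finite_Ix tK by (simp add: P_closed)
    ultimately have "encK (0, sum ?t (Ix n)) = encK (0, 0)" by simp
    then have "sum ?t (Ix n) \<in> Kos n"
      using encK_eq[of 0 "sum ?t (Ix n)" 0] sum_K1[of "Ix n" ?t] tK by (simp add: P_closed K1_closed)
    then show "koszul_trivial (carrier Q) (rel n) (Ix n) a"
      using th th' a syz hh by (intro koszul_trivial_if_homotopy[of th a hh]) (auto simp: case_prod_unfold)
  qed
qed

end

section \<open>Complete intersections\<close>

lemma minimal_relations:
  assumes "presentation_data X dx Y dy j"
  obtains Y' where "Y' \<subseteq> Y" "relation_ideal X Y' j = relation_ideal X Y j"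
    "\<And>y. y \<in> Y' \<Longrightarrow> j y \<notin> Idl\<^bsub>free_algebra X\<^esub> (j ` (Y' - {y}))"
proof -
  interpret F: k_algebra "free_algebra X" by (rule k_algebra_free_algebra)
  have Y: "finite Y" "j ` Y \<subseteq> carrier (free_algebra X)" using assms by (auto simp: presentation_data_def)
  obtain Y' where Y': "Y' \<subseteq> Y \<and> relation_ideal X Y' j = relation_ideal X Y j"
    and least: "\<And>Z. Z \<subseteq> Y \<and> relation_ideal X Z j = relation_ideal X Y j \<Longrightarrow> card Y' \<le> card Z"
    using ex_has_least_nat[of "\<lambda>Z. Z \<subseteq> Y \<and> relation_ideal X Z j = relation_ideal X Y j" Y card] by blast
  have "j y \<notin> Idl\<^bsub>free_algebra X\<^esub> (j ` (Y' - {y}))" if y: "y \<in> Y'" for y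
  proof
    let ?Z = "Y' - {y}"
    assume *: "j y \<in> Idl\<^bsub>free_algebra X\<^esub> (j ` ?Z)"
    have Z: "j ` ?Z \<subseteq> carrier (free_algebra X)" "j ` Y' \<subseteq> carrier (free_algebra X)" using Y(2) Y' by auto
    have "j ` Y' \<subseteq> Idl\<^bsub>free_algebra X\<^esub> (j ` ?Z)" using * F.genideal_self[OF Z(1)] by blast
    then have "relation_ideal X Y' j \<subseteq> relation_ideal X ?Z j"
      unfolding relation_ideal_def by (intro F.genideal_minimal F.genideal_ideal Z)
    moreover have "relation_ideal X ?Z j \<subseteq> relation_ideal X Y' j"
      unfolding relation_ideal_def using F.genideal_self[OF Z(2)] by (intro F.genideal_minimal F.genideal_ideal Z) auto
    ultimately have "card Y' \<le> card ?Z" using Y' by (intro least) auto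
    moreover have "finite Y'" using Y' Y(1) finite_subset by blast
    ultimately show False using card_Diff1_less[of Y' y] y by linarith
  qed
  then show ?thesis using that Y' by blast
qed

context graded_presentation
begin

text \<open>J has no nonzero constants, so \<open>q\<close> separates the scalar multiples of the
  unit of R. Hence \<open>'u\<close> has room for the coded objects, whose cardinality is at most
  that of the infinite field.\<close>

lemma lepoll_field:
  assumes R: "cofibrant_resolution A (R :: ('k, 'u) dga) q"
  shows "(UNIV :: 'k set) \<lesssim> (UNIV :: 'u set)"
proof -
  have qi: "quasi_iso R (concentrated A) q" using R by (simp add: cofibrant_resolution_def)
  interpret R: dg_algebra R using R by (simp add: cofibrant_resolution_def cofibrant_def)
  have qm: "algebra_map R A q"
    using qi unfolding quasi_iso_def dga_hom_iff algebra_map_to_concentrated by blast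
  have q: "q (c \<odot>\<^bsub>R\<^esub> \<one>\<^bsub>R\<^esub>) = J +>\<^bsub>F\<^esub> Poly_Mapping.single 0 c" for c
    using algebra_map_smult[OF qm R.one_closed, of c] algebra_map_one[OF qm] A_ops(3)[OF F_closed(6) F_closed(6), of c]
    by (simp add: A_fields)
  have "inj (\<lambda>c. c \<odot>\<^bsub>R\<^esub> \<one>\<^bsub>R\<^esub>)"
  proof (rule injI)
    fix c d :: 'k assume "c \<odot>\<^bsub>R\<^esub> \<one>\<^bsub>R\<^esub> = d \<odot>\<^bsub>R\<^esub> \<one>\<^bsub>R\<^esub>"
    from arg_cong[where f = q, OF this]
    have "J +>\<^bsub>F\<^esub> Poly_Mapping.single 0 c = J +>\<^bsub>F\<^esub> Poly_Mapping.single 0 d" unfolding q .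
    then have "Poly_Mapping.single 0 (c - d) \<in> J"
      using coset_eq_iff[OF relation_ideal_ideal single_word_closed single_word_closed, of 0 0 c d]
      by (simp add: single_diff)
    then have "0 < word_degree dx 0" if "c \<noteq> d" by (rule J_degree_pos) (use that in simp)
    then show "c = d" by (auto simp: word_degree_def zero_word_def)
  qed
  then show ?thesis unfolding lepoll_def by blast
qed

end

lemma (in minimal_ncci) generated_by_regular_sequence:
  fixes R S :: "('k, 'u) dga" and B :: "('k, 'u) module"
  assumes R: "cofibrant_resolution A R q" and rep: "represents_dg_rep R n S \<pi>"
    and H1: "trivial_group (homology S 1)" and B: "represents_rep A n B \<rho>"
  shows "generated_by_regular_sequence (P n) (rep_defining_ideal X J n B \<rho>)"
proof -
  have ku: "(UNIV :: 'k set) \<lesssim> (UNIV :: 'u set)" using lepoll_field[OF R] .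
  have inf: "infinite (UNIV :: 'u set)" by (rule lepoll_P(2)[OF ku])
  have lF: "carrier F \<lesssim> (UNIV :: 'u set)"
    unfolding free_algebra_eq by (rule lepoll_monoid_algebra[OF inf countable_words_over[OF finite_X] ku])
  have "J \<subseteq> carrier F" using J_sub by blast
  then have lJ: "J \<lesssim> (UNIV :: 'u set)" using lF by (meson subset_imp_lepoll lepoll_trans)
  have l0: "{0 :: 'x word \<Rightarrow>\<^sub>0 'k} \<lesssim> (UNIV :: 'u set)" by (simp add: lepoll_def)
  obtain encK where encK: "\<forall>p\<in>carrier (P n). \<forall>q\<in>carrier (P n). \<forall>u\<in>K1 n. \<forall>v\<in>K1 n.
      (encK (p, u) :: 'u) = encK (q, v) \<longleftrightarrow> p - q \<in> {0} \<and> u - v \<in> Kos n"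
    using two_term_encoding[OF lepoll_square[OF inf lepoll_P(1)[OF ku] lepoll_K1[OF ku]], of "{0}" "Kos n" n n]
    by (auto simp: Kos_closed)
  obtain encD where encD: "\<forall>p\<in>carrier F. \<forall>q\<in>carrier F. \<forall>u\<in>J. \<forall>v\<in>J.
      (encD (p, u) :: 'u) = encD (q, v) \<longleftrightarrow> p - q \<in> {0} \<and> u - v \<in> {0}"
    using two_term_encoding[OF lepoll_square[OF inf lF lJ], of "{0}" "{0}"] by auto
  obtain encA where encA: "\<forall>p\<in>carrier F. \<forall>q\<in>carrier F. \<forall>u\<in>{0 :: 'x word \<Rightarrow>\<^sub>0 'k}. \<forall>v\<in>{0}.
      (encA (p, u) :: 'u) = encA (q, v) \<longleftrightarrow> p - q \<in> J \<and> u - v \<in> {0}"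
    using two_term_encoding[OF lepoll_square[OF inf lF l0], of J "{0}"] J_zero J_add J_uminus by auto
  interpret koszul_coding X dx Y dy j n encK encD
    by unfold_locales (use encK encD in blast)+
  have ex: "koszul_exact (carrier (P n)) (rel n) (Ix n)"
    by (rule koszul_exact_rel[where encA = encA, OF R rep H1]) (use encA in blast)
  obtain xs where xs: "set xs = Ix n" "distinct xs" using finite_distinct_list[OF finite_Ix] by blast
  \<comment> \<open>The sequence lists the entries of all relation matrices; those of the matrix of
    y are homogeneous of the positive degree \<open>dy y\<close>.\<close>
  have "regular_sequence (P n) (map (rel n) xs)"
    using ex rel_closed keys_rel dy_pos unfolding xs(1)[symmetric]
    by (intro regular_sequence_if_koszul_exact[OF xs(2), where wt = wtP and e = "\<lambda>i. dy (fst i)"])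
      (auto simp: wtP_zero wtP_add xs(1))
  moreover have "rep_defining_ideal X J n B \<rho> = Idl\<^bsub>P n\<^esub> (set (map (rel n) xs))"
    using defining_ideal_eq[OF B ku] xs(1) by simp
  ultimately show ?thesis unfolding generated_by_regular_sequence_def by blast
qed

theorem theorem24:
  fixes X :: "'x set" and dx :: "'x \<Rightarrow> nat"
    and Y :: "'y set" and dy :: "'y \<Rightarrow> nat"
    and j :: "'y \<Rightarrow> 'x word \<Rightarrow>\<^sub>0 'k::field_char_0"
    and n :: nat
    and R :: "('k, 'u) dga" and q :: "'u \<Rightarrow> ('x word \<Rightarrow>\<^sub>0 'k) set"
    and S :: "('k, 'u) dga" and \<pi> :: "'u \<Rightarrow> nat \<times> nat \<Rightarrow> 'u"
    and B :: "('k, 'u) module" and \<rho> :: "('x word \<Rightarrow>\<^sub>0 'k) set \<Rightarrow> nat \<times> nat \<Rightarrow> 'u"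
  assumes "presentation_data X dx Y dy j"
    and "ncci X Y j"
    and "n \<ge> 1"
    and "cofibrant_resolution (presented_algebra X Y j) R q"
    and "represents_dg_rep R n S \<pi>"
    and "trivial_group (homology S 1)"
    and "represents_rep (presented_algebra X Y j) n B \<rho>"
  shows "generated_by_regular_sequence (poly_algebra (rep_coordinates X n))
           (rep_defining_ideal X (relation_ideal X Y j) n B \<rho>)"
proof -
  obtain Y' where Y': "Y' \<subseteq> Y" "relation_ideal X Y' j = relation_ideal X Y j"
    "\<And>y. y \<in> Y' \<Longrightarrow> j y \<notin> Idl\<^bsub>free_algebra X\<^esub> (j ` (Y' - {y}))"
    by (rule minimal_relations[OF assms(1)]) blast
  have "finite Y'" using Y'(1) assms(1) finite_subset by (auto simp: presentation_data_def)
  then have "presentation_data X dx Y' dy j" using assms(1) Y'(1) by (auto simp: presentation_data_def)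
  \<comment> \<open>\<open>ncci\<close> sees the relations only through the ideal that they
    generate.\<close>
  moreover have "ncci X Y' j" using assms(2) by (simp add: ncci_def presented_algebra_def Y'(2))
  ultimately interpret minimal_ncci X dx Y' dy j
    using Y'(3) by unfold_locales auto
  have "presented_algebra X Y' j = presented_algebra X Y j" by (simp add: presented_algebra_def Y'(2))
  then show ?thesis using generated_by_regular_sequence[of R q n S \<pi> B \<rho>] assms Y'(2) by simp
qed

end
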